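(* Let $m\ge0$ be an integer and let $(\Gamma,I)$ be the quiver with one node and $m$ loops. Let $a(q)=\sum_{d\ge0}a_d(q)x^d\in\mathbb{Q}(q)[[x]]$ be the generating function of the polynomials $a_d(q)$ counting isomorphism classes of absolutely irreducible $d$-dimensional representations of $\Gamma$ over finite fields $\mathbb{F}_q$ (with $a_0=0$). Then $$\operatorname{Exp}\left(\frac{a(q)-x}{1-q}\right)\bigg|_{q=1}=1-mx.$$
   Context: A $d$-dimensional representation of the quiver over a field $k$ is an $m$-tuple of endomorphisms of a $d$-dimensional $k$-vector space. It is absolutely irreducible if it is irreducible (nonzero without nonzero proper invariant subspaces) and remains so after every finite field extension of $k$. It is known that the number of isomorphism classes of absolutely irreducible $d$-dimensional representations over $\mathbb{F}_q$ is given by a polynomial $a_d(q)\in\mathbb{Z}[q]$, valid for all finite fields. Exp: on $\mathbb{Q}(q)[[x]]$ let $\psi_n(f(q,x))=f(q^n,x^n)$. For $f$ with zero constant term, $\operatorname{Exp}(f)=\exp\left(\sum_{k\ge1}\frac1k\psi_k(f)\right)$. The notation $|_{q=1}$ means coefficientwise evaluation at $q=1$; the coefficients of the power series $\operatorname{Exp}\left(\frac{a(q)-x}{1-q}\right)$ are rational functions of $q$ that are regular at $q=1$. *)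

theory Defs
  imports
    "Jordan_Normal_Form.Matrix"
    "HOL-Algebra.Embedded_Algebras"
    "HOL-Computational_Algebra.Computational_Algebra"
    "HOL-Computational_Algebra.Field_as_Ring"
begin

no_notation fps_nth (infixl \<open>$\<close> 75)
no_notation fls_nth (infixl \<open>$$\<close> 75)

section \<open>Representations of the quiver with one node and several loops\<close>

text \<open>
  Fields are records, because the statement ranges over all finite fields at once. A
  representation of dimension \<open>d\<close> is a list of matrices acting on the coordinate space \<open>K^d\<close>. The
  matrix operations of the vector and matrix theory need type classes, so the action is spelled out
  over the record.
\<close>

definition coord_space :: "('a, 'c) ring_scheme \<Rightarrow> nat \<Rightarrow> ('a, 'a vec) module" where
  "coord_space K d =
    \<lparr>carrier = {v. dim_vec v = d \<and> (\<forall>i<d. v $ i \<in> carrier K)},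
     mult = undefined, one = undefined,
     zero = vec d (\<lambda>_. \<zero>\<^bsub>K\<^esub>),
     add = (\<lambda>v w. vec d (\<lambda>i. v $ i \<oplus>\<^bsub>K\<^esub> w $ i)),
     module.smult = (\<lambda>c v. vec d (\<lambda>i. c \<otimes>\<^bsub>K\<^esub> v $ i))\<rparr>"

definition matrices :: "('a, 'c) ring_scheme \<Rightarrow> nat \<Rightarrow> 'a mat set" where
  "matrices K d = {A \<in> carrier_mat d d. \<forall>i<d. \<forall>j<d. A $$ (i, j) \<in> carrier K}"

definition mat_act :: "('a, 'c) ring_scheme \<Rightarrow> 'a mat \<Rightarrow> 'a vec \<Rightarrow> 'a vec" where
  "mat_act K A v =
    vec (dim_row A) (\<lambda>i. \<Oplus>\<^bsub>K\<^esub>j\<in>{..<dim_col A}. A $$ (i, j) \<otimes>\<^bsub>K\<^esub> v $ j)"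

definition reps :: "('a, 'c) ring_scheme \<Rightarrow> nat \<Rightarrow> nat \<Rightarrow> 'a mat list set" where
  "reps K m d = {As. length As = m \<and> set As \<subseteq> matrices K d}"

definition isomorphic_reps ::
  "('a, 'c) ring_scheme \<Rightarrow> nat \<Rightarrow> 'a mat list \<Rightarrow> 'a mat list \<Rightarrow> bool" where
  "isomorphic_reps K d As Bs \<longleftrightarrow>
    length As = length Bs \<and>
    (\<exists>P\<in>matrices K d.
      bij_betw (mat_act K P) (carrier (coord_space K d)) (carrier (coord_space K d)) \<and>
      (\<forall>i<length As. \<forall>v\<in>carrier (coord_space K d).
        mat_act K P (mat_act K (As ! i) v) = mat_act K (Bs ! i) (mat_act K P v)))"

definition irreducible_rep :: "('a, 'c) ring_scheme \<Rightarrow> nat \<Rightarrow> 'a mat list \<Rightarrow> bool" where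
  "irreducible_rep K d As \<longleftrightarrow>
    carrier (coord_space K d) \<noteq> {\<zero>\<^bsub>coord_space K d\<^esub>} \<and>
    (\<forall>U. submodule U K (coord_space K d) \<and> (\<forall>A\<in>set As. mat_act K A ` U \<subseteq> U) \<longrightarrow>
      U = {\<zero>\<^bsub>coord_space K d\<^esub>} \<or> U = carrier (coord_space K d))"

text \<open>
  A finite extension is given by an embedding \<open>h\<close>, and extension of scalars applies \<open>h\<close> to
  the matrix entries. Carriers inside \<^typ>\<open>nat\<close> lose nothing: every finite field, and every finite
  extension of a field with countable carrier, is countable and so has an isomorphic copy there.
\<close>

definition finite_extension :: "nat ring \<Rightarrow> nat ring \<Rightarrow> (nat \<Rightarrow> nat) \<Rightarrow> bool" where
  "finite_extension K L h \<longleftrightarrow>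
    field L \<and> h \<in> ring_hom K L \<and> ring.finite_dimension L (h ` carrier K) (carrier L)"

definition absolutely_irreducible_rep :: "nat ring \<Rightarrow> nat \<Rightarrow> nat mat list \<Rightarrow> bool" where
  "absolutely_irreducible_rep K d As \<longleftrightarrow>
    irreducible_rep K d As \<and>
    (\<forall>L h. finite_extension K L h \<longrightarrow> irreducible_rep L d (map (map_mat h) As))"

definition abs_irr_reps :: "nat ring \<Rightarrow> nat \<Rightarrow> nat \<Rightarrow> nat mat list set" where
  "abs_irr_reps K m d = {As \<in> reps K m d. absolutely_irreducible_rep K d As}"

definition abs_irr_classes :: "nat ring \<Rightarrow> nat \<Rightarrow> nat \<Rightarrow> nat mat list set set" where
  "abs_irr_classes K m d =
    abs_irr_reps K m d //
      {(As, Bs). As \<in> abs_irr_reps K m d \<and> Bs \<in> abs_irr_reps K m d \<and> isomorphic_reps K d As Bs}"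


section \<open>Power series over the field of rational functions\<close>

type_synonym ratfun = "rat poly fract"

definition q_var :: ratfun where
  "q_var = to_fract [:0, 1:]"

definition subst_q_power :: "nat \<Rightarrow> ratfun \<Rightarrow> ratfun" where
  "subst_q_power n r =
    Fract (fst (quot_of_fract r) \<circ>\<^sub>p monom 1 n) (snd (quot_of_fract r) \<circ>\<^sub>p monom 1 n)"

definition psi :: "nat \<Rightarrow> ratfun fps \<Rightarrow> ratfun fps" where
  "psi n f = fps_compose (Abs_fps (\<lambda>i. subst_q_power n (fps_nth f i))) (fps_X ^ n)"

text \<open>
  The infinite sum converges in the metric of formal power series (the \<open>x\<close>-adic one) when \<open>f\<close> has
  no constant term; see \<open>summable_psi\<close> below.
\<close>

definition Exp :: "ratfun fps \<Rightarrow> ratfun fps" where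
  "Exp f = fps_compose (fps_exp 1) (\<Sum>k. fps_const (1 / of_nat (Suc k)) * psi (Suc k) f)"

text \<open>\<^const>\<open>quot_of_fract\<close> yields a fraction in lowest terms.\<close>

definition regular_at_1 :: "ratfun \<Rightarrow> bool" where
  "regular_at_1 r \<longleftrightarrow> poly (snd (quot_of_fract r)) 1 \<noteq> 0"

definition eval_at_1 :: "ratfun \<Rightarrow> rat" where
  "eval_at_1 r = poly (fst (quot_of_fract r)) 1 / poly (snd (quot_of_fract r)) 1"

definition fps_eval_at_1 :: "ratfun fps \<Rightarrow> rat fps" where
  "fps_eval_at_1 f = Abs_fps (\<lambda>n. eval_at_1 (fps_nth f n))"

definition gen_fun :: "(nat \<Rightarrow> int poly) \<Rightarrow> ratfun fps" where
  "gen_fun a = Abs_fps (\<lambda>d. to_fract (map_poly of_int (a d)))"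

lemma subst_q_power_0 [simp]: "subst_q_power n 0 = 0"
  by (simp add: subst_q_power_def fract_collapse)

lemma psi_nth:
  assumes "n > 0"
  shows "fps_nth (psi n f) i = (if n dvd i then subst_q_power n (fps_nth f (i div n)) else 0)"
proof -
  have "fps_nth (psi n f) i =
      (\<Sum>j=0..i. subst_q_power n (fps_nth f j) * (if i = n * j then 1 else 0))"
    by (simp add: psi_def fps_compose_nth power_mult [symmetric] fps_X_power_nth)
  also have "\<dots> = (\<Sum>j=0..i. if n dvd i \<and> j = i div n then subst_q_power n (fps_nth f j) else 0)"
    using assms by (intro sum.cong) auto
  also have "\<dots> = (if n dvd i then subst_q_power n (fps_nth f (i div n)) else 0)"
    by (cases "n dvd i") auto
  finally show ?thesis .
qed

lemma summable_psi:
  assumes "fps_nth f 0 = 0"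
  shows "summable (\<lambda>k. fps_const (1 / of_nat (Suc k)) * psi (Suc k) f)"
proof -
  define u where "u = (\<lambda>k. fps_const (1 / of_nat (Suc k)) * psi (Suc k) f)"
  have z: "fps_nth (u k) i = 0" if "i < Suc k" for k i
    using that assms by (auto simp: u_def psi_nth dest: dvd_imp_le)
  have "u sums Abs_fps (\<lambda>i. \<Sum>k<i. fps_nth (u k) i)"
    unfolding sums_def
  proof (rule tendsto_fpsI)
    fix i
    show "\<forall>\<^sub>F n in sequentially. fps_nth (sum u {..<n}) i =
        fps_nth (Abs_fps (\<lambda>i. \<Sum>k<i. fps_nth (u k) i)) i"
      using eventually_ge_at_top[of i]
    proof eventually_elim
      case (elim n)
      have "(\<Sum>k<n. fps_nth (u k) i) = (\<Sum>k<i. fps_nth (u k) i)"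
        using elim by (intro sum.mono_neutral_right) (auto intro!: z)
      thus ?case by (simp add: fps_sum_nth)
    qed
  qed
  thus ?thesis unfolding u_def by (rule sums_summable)
qed

end

theory Submission
  imports Defs "HOL-Number_Theory.Number_Theory" "HOL-Library.Nat_Bijection"
    "HOL-Algebra.Weak_Morphisms"
begin

text \<open>
  Two numbers attached to each counting polynomial decide the claim: the value \<open>a_d(1)\<close>, which is
  one for \<open>d = 1\<close> and zero otherwise, and the derivative, for which \<open>d a_d'(1)\<close> is the number of
  primitive words of length \<open>d\<close> in \<open>m\<close> letters. Indeed the logarithm of the plethystic exponential
  evaluates at \<open>q = 1\<close> to minus the sum over \<open>n\<close> of \<open>(\<Sum>d | d dvd n. d a_d'(1)) x^n / n\<close>. Every word
  is a power of a unique primitive word, so the inner sum is \<open>m^n\<close>, and the result is the logarithm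
  of \<open>1 - m x\<close> (\<open>Exp_at_1_of_derivatives\<close>, \<open>sum_card_primitive_words\<close>).

  To find the two numbers, let \<open>N\<close> be the number of absolutely irreducible \<open>m\<close>-tuples of
  \<open>d \<times> d\<close> matrices over the field with \<open>q\<close> elements. By Schur's lemma
  (\<open>absolutely_irreducible_commutant\<close>) the stabilizers in \<open>GL_d\<close> are the scalars, hence
  \<open>(q - 1) N = a_d(q) |GL_d|\<close>, and \<open>|GL_d|\<close> is \<open>(q - 1)^d\<close> times a number congruent to \<open>d!\<close> modulo
  \<open>q - 1\<close>. So it suffices to know \<open>N\<close> modulo \<open>(q - 1)^(d + 1)\<close>. It is enough to know it modulo
  \<open>n^(d + 1)\<close> for primes \<open>q\<close> such that \<open>q - 1\<close> has an arbitrarily large unitary divisor \<open>n\<close> without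
  small factors.

  This is found by torus localization. Group the tuples by their support \<open>P\<close>, the set of
  positions of nonzero entries. Diagonal conjugation preserves absolute irreducibility, and so
  does rescaling whole blocks of the matrices for a suitable partition of the coordinates. For a
  well chosen partition the exponents modulo \<open>n\<close> act freely
  (\<open>exists_good_stable_partition\<close>, \<open>power_dvd_card_supported\<close>), so that the number of tuples with
  support \<open>P\<close> is divisible by \<open>n^(d - b + c)\<close>, where \<open>b\<close> is the number of blocks and \<open>c\<close> the number
  of arrows between blocks. As every block is left by an arrow, \<open>c \<ge> b\<close>. Divisibility by
  \<open>n^(d + 1)\<close> fails only for \<open>c = b\<close>, and then \<open>P\<close> is one cycle through all coordinates labelled by a
  primitive word (\<open>one_arrow_per_block_cycle\<close>), apart from the zero tuple for \<open>d = 1\<close>. For such a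
  cycle all \<open>(q - 1)^d\<close> tuples are absolutely irreducible
  (\<open>absolutely_irreducible_of_primitive_cycle\<close>), and there are \<open>(d - 1)!\<close> cycles for each primitive
  word. Thus \<open>N\<close> is congruent to \<open>(q - 1)^d (d - 1)!\<close> times the number of primitive words, plus one
  for \<open>d = 1\<close>, which yields both numbers (\<open>poly_first_order_from_congruences\<close>).
\<close>

section \<open>The plethystic exponential at q = 1\<close>

lemma log_Exp_nth:
  assumes "fps_nth f 0 = 0"
  shows "fps_nth (\<Sum>k. fps_const (1 / of_nat (Suc k)) * psi (Suc k) f) n =
    (\<Sum>k\<in>{1..n}. if k dvd n then subst_q_power k (fps_nth f (n div k)) / of_nat k else 0)"
proof -
  define u where "u = (\<lambda>k. fps_const (1 / of_nat (Suc k)) * psi (Suc k) f)"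
  have z: "fps_nth (u k) i = 0" if "i < Suc k" for k i
    using that assms by (auto simp: u_def psi_nth dest: dvd_imp_le)
  have "u sums Abs_fps (\<lambda>i. \<Sum>k<i. fps_nth (u k) i)"
    unfolding sums_def
  proof (rule tendsto_fpsI)
    fix i
    show "\<forall>\<^sub>F n in sequentially. fps_nth (sum u {..<n}) i =
        fps_nth (Abs_fps (\<lambda>i. \<Sum>k<i. fps_nth (u k) i)) i"
      using eventually_ge_at_top[of i]
    proof eventually_elim
      case (elim n)
      have "(\<Sum>k<n. fps_nth (u k) i) = (\<Sum>k<i. fps_nth (u k) i)"
        using elim by (intro sum.mono_neutral_right) (auto intro!: z)
      thus ?case by (simp add: fps_sum_nth)
    qed
  qed
  hence "fps_nth (suminf u) n = (\<Sum>k<n. fps_nth (u k) n)"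
    by (simp add: sums_iff)
  also have "\<dots> = (\<Sum>k\<in>{1..n}. if k dvd n then subst_q_power k (fps_nth f (n div k)) / of_nat k else 0)"
    by (rule sum.reindex_bij_witness[of _ "\<lambda>k. k - 1" Suc]) (auto simp: u_def psi_nth)
  finally show ?thesis by (simp add: u_def)
qed

lemma subst_q_power_to_fract:
  fixes b :: "rat poly"
  assumes "n > 0"
  shows "subst_q_power n (to_fract b) = to_fract (b \<circ>\<^sub>p monom 1 n)"
  by (simp add: subst_q_power_def Fract_conv_to_fract pcompose_1)

lemma poly_map_poly_of_int: "poly (map_poly of_int p) 1 = (of_int (poly p 1) :: rat)"
  by (induction p) (simp_all add: map_poly_pCons)

lemma pderiv_map_poly_of_int:
  "pderiv (map_poly of_int p) = (map_poly of_int (pderiv p) :: rat poly)"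
  by (rule poly_eqI) (simp add: coeff_pderiv coeff_map_poly)

definition fps_to_fract :: "rat poly fps \<Rightarrow> ratfun fps" where
  "fps_to_fract G = Abs_fps (\<lambda>n. to_fract (fps_nth G n))"

definition fps_poly_at_1 :: "rat poly fps \<Rightarrow> rat fps" where
  "fps_poly_at_1 G = Abs_fps (\<lambda>n. poly (fps_nth G n) 1)"

lemma fps_to_fract_nth [simp]: "fps_nth (fps_to_fract G) n = to_fract (fps_nth G n)"
  and fps_poly_at_1_nth [simp]: "fps_nth (fps_poly_at_1 G) n = poly (fps_nth G n) 1"
  by (simp_all add: fps_to_fract_def fps_poly_at_1_def)

lemma fps_to_fract_power: "fps_to_fract G ^ i = fps_to_fract (G ^ i)"
proof (induction i)
  case 0
  show ?case by (rule fps_ext) (simp add: fps_one_nth)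
next
  case (Suc i)
  then show ?case by (intro fps_ext) (simp add: fps_mult_nth)
qed

lemma fps_poly_at_1_power: "fps_poly_at_1 G ^ i = fps_poly_at_1 (G ^ i)"
proof (induction i)
  case 0
  show ?case by (rule fps_ext) (simp add: fps_one_nth)
next
  case (Suc i)
  then show ?case by (intro fps_ext) (simp add: fps_mult_nth poly_sum)
qed

lemma of_nat_conv_to_fract: "(of_nat k :: ratfun) = to_fract [:of_nat k:]"
  by (induction k) (simp_all add: one_pCons flip: to_fract_1 to_fract_add)

lemma to_fract_divide_of_nat:
  assumes "k > 0"
  shows "to_fract (p :: rat poly) / of_nat k = to_fract (smult (1 / of_nat k) p)"
proof -
  have "of_nat k * to_fract (smult (1 / of_nat k) p) = to_fract p"
    using assms by (simp add: of_nat_conv_to_fract flip: to_fract_mult)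
  thus ?thesis using assms by (simp add: field_simps)
qed

text \<open>
  Once the logarithm is known to have polynomial coefficients, so does its exponential; this is where
  regularity at \<open>q = 1\<close> comes from.
\<close>

lemma exp_fps_to_fract:
  "fps_nth (fps_exp 1 oo fps_to_fract G) n =
    to_fract (\<Sum>i=0..n. smult (1 / of_nat (fact i)) (fps_nth (G ^ i) n))"
proof -
  have "fps_nth (fps_exp 1 oo fps_to_fract G) n =
    (\<Sum>i=0..n. to_fract (fps_nth (G ^ i) n) / of_nat (fact i))"
    by (simp add: fps_compose_nth fps_to_fract_power)
  also have "\<dots> = (\<Sum>i=0..n. to_fract (smult (1 / of_nat (fact i)) (fps_nth (G ^ i) n)))"
    by (intro sum.cong refl to_fract_divide_of_nat) simp
  finally show ?thesis by (simp only: to_fract_sum)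
qed

lemma regular_to_fract [simp]: "regular_at_1 (to_fract p)"
  and eval_to_fract [simp]: "eval_at_1 (to_fract p) = poly p 1"
  by (simp_all add: regular_at_1_def eval_at_1_def)

text \<open>
  Both sides solve the differential equation \<open>y' = y H'\<close> with constant term one, because
  \<open>- m / (1 - m x)\<close> has the coefficients prescribed for \<open>H'\<close>.
\<close>

lemma exp_log_linear:
  fixes H :: "rat fps"
  assumes 0: "fps_nth H 0 = 0" and H: "\<And>n. n > 0 \<Longrightarrow> of_nat n * fps_nth H n = - (of_nat m ^ n)"
  shows "fps_exp 1 oo H = 1 - of_nat m * fps_X"
proof -
  define y where "y = fps_exp 1 oo H"
  define z :: "rat fps" where "z = 1 - of_nat m * fps_X"
  have dH: "fps_nth (fps_deriv H) n = - (of_nat m ^ Suc n)" for n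
    using H[of "Suc n"] by simp
  have y': "fps_deriv y = y * fps_deriv H"
    using 0 by (simp add: y_def fps_compose_deriv)
  have z': "fps_deriv z = z * fps_deriv H"
  proof (rule fps_ext)
    fix n
    have "fps_nth (z * fps_deriv H) n = (if n = 0 then - of_nat m else 0)"
      by (cases n) (simp_all add: z_def dH left_diff_distrib mult.assoc fps_of_nat[symmetric]
        del: fps_of_nat fps_deriv_nth)
    thus "fps_nth (fps_deriv z) n = fps_nth (z * fps_deriv H) n"
      by (simp add: z_def flip: fps_of_nat)
  qed
  have "fps_nth y n = fps_nth z n" for n
  proof (induction n rule: less_induct)
    case (less n)
    show ?case
    proof (cases n)
      case 0
      thus ?thesis by (simp add: y_def z_def flip: fps_of_nat)
    next
      case (Suc k)
      have "of_nat n * fps_nth y n = fps_nth (y * fps_deriv H) k"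
        by (simp add: Suc flip: y')
      also have "\<dots> = fps_nth (z * fps_deriv H) k"
        unfolding fps_mult_nth using Suc less by (intro sum.cong) auto
      also have "\<dots> = of_nat n * fps_nth z n"
        by (simp add: Suc flip: z')
      finally show ?thesis using Suc by (simp del: of_nat_Suc)
    qed
  qed
  thus ?thesis by (simp add: fps_eq_iff y_def z_def)
qed

text \<open>
  The value of \<open>a d\<close> at \<open>1\<close> makes \<open>1 - q\<close> divide the coefficients of \<open>a - x\<close>, with quotient \<open>- a_d'(1)\<close>
  at \<open>q = 1\<close>. There \<open>\<psi>_k\<close> only replaces \<open>x\<close> by \<open>x^k\<close>, so the logarithm evaluates to
  \<open>- (\<Sum>n. (\<Sum>d | d dvd n. d a_d'(1)) x^n / n)\<close>, which is the logarithm of \<open>1 - m x\<close>.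
\<close>

proposition Exp_at_1_of_derivatives:
  fixes m :: nat and a :: "nat \<Rightarrow> int poly"
  assumes a0: "a 0 = 0"
    and a1: "\<And>d. d > 0 \<Longrightarrow> poly (a d) 1 = (if d = 1 then 1 else 0)"
    and a': "\<And>n. n > 0 \<Longrightarrow> (\<Sum>d | d dvd n. int d * poly (pderiv (a d)) 1) = int m ^ n"
  shows "(\<forall>n. regular_at_1 (fps_nth (Exp ((gen_fun a - fps_X) / fps_const (1 - q_var))) n)) \<and>
    fps_eval_at_1 (Exp ((gen_fun a - fps_X) / fps_const (1 - q_var))) = 1 - of_nat m * fps_X"
proof -
  define r :: "int poly \<Rightarrow> rat poly" where "r = map_poly of_int"
  have ex: "\<exists>b. r (a d) - (if d = 1 then 1 else 0) = [:1, -1:] * b \<and>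
      poly b 1 = - of_int (poly (pderiv (a d)) 1)" for d
  proof -
    let ?p = "r (a d) - (if d = 1 then 1 else 0)"
    have v: "poly (r (a d)) 1 = of_int (poly (a d) 1)"
      by (simp add: r_def poly_map_poly_of_int)
    have "poly ?p 1 = 0"
    proof (cases "d = 0")
      case True
      thus ?thesis by (simp add: r_def a0)
    next
      case False
      thus ?thesis using a1[of d] by (simp add: v)
    qed
    hence "[:-1, 1:] dvd ?p" by (simp only: poly_eq_0_iff_dvd)
    then obtain c where c: "?p = [:-1, 1:] * c" by (rule dvdE)
    have "pderiv ?p = r (pderiv (a d))"
      by (simp add: r_def pderiv_diff pderiv_map_poly_of_int)
    hence "poly (pderiv ?p) 1 = of_int (poly (pderiv (a d)) 1)"
      by (simp add: r_def poly_map_poly_of_int)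
    moreover have "poly (pderiv ?p) 1 = poly c 1"
      unfolding c by (simp add: pderiv_diff pderiv_pCons)
    ultimately show ?thesis using c by (intro exI[of _ "- c"]) simp
  qed
  define b where "b = (\<lambda>d. SOME b. r (a d) - (if d = 1 then 1 else 0) = [:1, -1:] * b \<and>
      poly b 1 = - of_int (poly (pderiv (a d)) 1))"
  have b: "r (a d) - (if d = 1 then 1 else 0) = [:1, -1:] * b d"
      "poly (b d) 1 = - of_int (poly (pderiv (a d)) 1)" for d
    using someI_ex[OF ex[of d]] unfolding b_def by blast+
  define f where "f = (gen_fun a - fps_X) / fps_const (1 - q_var)"
  have q: "1 - q_var = to_fract [:1, -1:]"
    unfolding q_var_def by (simp add: one_pCons flip: to_fract_1 to_fract_diff)
  have f: "f = fps_to_fract (Abs_fps b)"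
  proof (rule fps_ext)
    fix d
    have "fps_nth (gen_fun a - fps_X) d = to_fract ([:1, -1:] * b d)"
      unfolding b(1)[symmetric] by (simp add: gen_fun_def r_def)
    moreover have "fps_nth f d = fps_nth (gen_fun a - fps_X) d / to_fract [:1, -1:]"
      unfolding f_def q by (simp add: fps_divide_nth_below divide_inverse mult.commute del: fps_sub_nth)
    ultimately show "fps_nth f d = fps_nth (fps_to_fract (Abs_fps b)) d"
      by (simp only: to_fract_mult) simp
  qed
  have b0: "b 0 = 0" using b(1)[of 0] by (simp add: a0 r_def del: mult_pCons_left)
  define G where "G = Abs_fps (\<lambda>n. \<Sum>k\<in>{1..n}. if k dvd n
    then smult (1 / of_nat k) (b (n div k) \<circ>\<^sub>p monom 1 k) else 0)"
  have G: "(\<Sum>k. fps_const (1 / of_nat (Suc k)) * psi (Suc k) f) = fps_to_fract G"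
    (is "?lhs = _")
  proof (rule fps_ext)
    fix n
    have "fps_nth ?lhs n =
      (\<Sum>k\<in>{1..n}. if k dvd n then subst_q_power k (fps_nth f (n div k)) / of_nat k else 0)"
      by (rule log_Exp_nth) (simp add: f b0)
    also have "\<dots> = (\<Sum>k\<in>{1..n}. to_fract (if k dvd n
        then smult (1 / of_nat k) (b (n div k) \<circ>\<^sub>p monom 1 k) else 0))"
      by (intro sum.cong) (auto simp: f subst_q_power_to_fract to_fract_divide_of_nat)
    finally show "fps_nth ?lhs n = fps_nth (fps_to_fract G) n"
      by (simp add: G_def)
  qed
  have E: "Exp f = fps_exp 1 oo fps_to_fract G" by (simp only: Exp_def G)
  define H where "H = fps_poly_at_1 G"
  have H0: "fps_nth H 0 = 0" by (simp add: H_def G_def)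
  have Hn: "of_nat n * fps_nth H n = - (of_nat m ^ n)" if n: "n > 0" for n
  proof -
    have "of_nat n * fps_nth H n =
      (\<Sum>k\<in>{1..n}. if k dvd n then of_nat (n div k) * poly (b (n div k)) 1 else 0)"
      unfolding H_def G_def sum_distrib_left fps_poly_at_1_nth poly_sum fps_nth_Abs_fps
    proof (intro sum.cong refl)
      fix k assume "k \<in> {1..n}"
      thus "of_nat n * poly (if k dvd n then smult (1 / of_nat k) (b (n div k) \<circ>\<^sub>p monom 1 k) else 0) 1 =
          (if k dvd n then of_nat (n div k) * poly (b (n div k)) 1 else 0)"
        by (auto simp: poly_pcompose poly_monom elim!: dvdE)
    qed
    also have "\<dots> = (\<Sum>k | k dvd n. of_nat (n div k) * poly (b (n div k)) 1)"
      using n by (intro sum.mono_neutral_cong_right) (auto dest: dvd_imp_le intro: Suc_leI dvd_pos_nat)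
    also have "\<dots> = (\<Sum>d | d dvd n. of_nat d * poly (b d) 1)"
      using n by (intro sum.reindex_bij_witness[of _ "\<lambda>d. n div d" "\<lambda>d. n div d"])
        (auto simp: dvd_div_iff_mult elim!: dvdE)
    also have "\<dots> = - of_int (\<Sum>d | d dvd n. int d * poly (pderiv (a d)) 1)"
      by (simp add: b(2) sum_negf)
    finally show ?thesis by (simp add: a'[OF n])
  qed
  have "fps_eval_at_1 (Exp f) = fps_exp 1 oo H"
  proof (rule fps_ext)
    fix n
    have "fps_nth (fps_eval_at_1 (Exp f)) n =
        poly (\<Sum>i=0..n. smult (1 / of_nat (fact i)) (fps_nth (G ^ i) n)) 1"
      by (simp only: fps_eval_at_1_def fps_nth_Abs_fps E exp_fps_to_fract eval_to_fract)
    thus "fps_nth (fps_eval_at_1 (Exp f)) n = fps_nth (fps_exp 1 oo H) n"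
      by (simp add: poly_sum fps_compose_nth H_def fps_poly_at_1_power)
  qed
  also have "\<dots> = 1 - of_nat m * fps_X" by (rule exp_log_linear[OF H0 Hn])
  finally show ?thesis
    unfolding f_def[symmetric] by (simp only: E exp_fps_to_fract regular_to_fract simp_thms)
qed

section \<open>Integer polynomials from congruences, and prime fields\<close>

text \<open>
  A prime factor \<open>p\<close> of \<open>2^l - 1\<close> with \<open>l\<close> prime satisfies \<open>l dvd p - 1\<close>, because \<open>2\<close> has order \<open>l\<close>
  modulo \<open>p\<close>. Take \<open>n\<close> to be the largest power of \<open>l\<close> in \<open>p - 1\<close>; this avoids Dirichlet's theorem.
\<close>

lemma exists_prime_with_rough_part:
  fixes B :: nat
  shows "\<exists>p n v. prime p \<and> p - 1 = n * v \<and> coprime n v \<and> B \<le> n \<and>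
    (\<forall>s. 0 < s \<and> s < B \<longrightarrow> coprime s n)"
proof -
  obtain l :: nat where l: "prime l" "l > max B 2" using bigger_prime by blast
  have "(2::nat) ^ l > 2 ^ 1" using l by (intro power_strict_increasing) auto
  hence "2 ^ l - 1 \<noteq> (1 :: nat)" by simp
  then obtain p :: nat where p: "prime p" "p dvd 2 ^ l - 1" using prime_factor_nat by blast
  have c: "[2 ^ l = 1] (mod p)"
    using p(2) by (metis cong_altdef_nat one_le_numeral one_le_power cong_sym)
  have "ord p 2 dvd l" using c ord_divides by blast
  moreover have "ord p 2 \<noteq> 1"
  proof
    assume "ord p 2 = 1"
    hence "[2 ^ 1 = 1] (mod p)" using ord_divides[of 2 1 p] by simp
    hence "p dvd 1" by (metis cong_altdef_nat cong_sym diff_add_inverse2 nat_1_add_1 one_le_numeral power_one_right)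
    thus False using p(1) by simp
  qed
  ultimately have o: "ord p 2 = l" using l(1) by (auto simp: prime_nat_iff)
  have "odd p"
  proof
    assume "even p"
    hence "even (2 ^ l - 1 :: nat)" using p(2) dvd_trans by blast
    thus False using l by simp
  qed
  hence "coprime p 2" by simp
  hence "ord p 2 dvd totient p" by (rule order_divides_totient)
  hence ld: "l dvd p - 1" using o p(1) by (simp add: totient_prime)
  have pos: "p - 1 \<noteq> 0" using p(1) prime_gt_1_nat by fastforce
  define k where "k = multiplicity l (p - 1)"
  obtain v where v: "p - 1 = l ^ k * v" "\<not> l dvd v"
    using multiplicity_decompose'[of "p - 1" l] pos l(1) unfolding k_def
    using not_prime_unit by blast
  have k: "k > 0" using ld pos l(1) by (simp add: k_def prime_multiplicity_gt_zero_iff)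
  have "coprime (l ^ k) v" using v(2) l(1) by (simp add: prime_imp_coprime)
  moreover have "B \<le> l ^ k"
    using l(2) k self_le_power[of l k] by simp
  moreover have "coprime s (l ^ k)" if "0 < s" "s < B" for s
  proof -
    have "\<not> l dvd s" using that l(2) nat_dvd_not_less by simp
    hence "coprime l s" using l(1) by (intro prime_imp_coprime)
    thus ?thesis by (simp add: coprime_commute)
  qed
  ultimately show ?thesis using p(1) v(1) by blast
qed

lemma poly_taylor_at_1:
  fixes a :: "int poly"
  obtains c where "\<And>q. poly a q = poly a 1 + poly (pderiv a) 1 * (q - 1) + (q - 1)\<^sup>2 * poly c q"
proof -
  have "poly (a - [:poly a 1:]) 1 = 0" by simp
  hence "[:-1, 1:] dvd a - [:poly a 1:]" by (simp only: poly_eq_0_iff_dvd)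
  then obtain b where b: "a - [:poly a 1:] = [:-1, 1:] * b" by (rule dvdE)
  have "poly (b - [:poly b 1:]) 1 = 0" by simp
  hence "[:-1, 1:] dvd b - [:poly b 1:]" by (simp only: poly_eq_0_iff_dvd)
  then obtain c where c: "b - [:poly b 1:] = [:-1, 1:] * c" by (rule dvdE)
  have "pderiv a = pderiv (a - [:poly a 1:])" by (simp add: pderiv_diff pderiv_pCons)
  hence d: "poly (pderiv a) 1 = poly b 1" unfolding b by (simp add: pderiv_diff pderiv_pCons)
  have "poly a q = poly a 1 + poly (pderiv a) 1 * (q - 1) + (q - 1)\<^sup>2 * poly c q" for q
  proof -
    have "poly a q = poly a 1 + (q - 1) * poly b q"
      using arg_cong[OF b, of "\<lambda>f. poly f q"] by (simp add: algebra_simps)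
    moreover have "poly b q = poly b 1 + (q - 1) * poly c q"
      using arg_cong[OF c, of "\<lambda>f. poly f q"] by (simp add: algebra_simps)
    ultimately show ?thesis by (simp add: d power2_eq_square algebra_simps)
  qed
  thus ?thesis by (rule that)
qed

lemma int_eq_0_of_large_divisor:
  fixes x n :: int
  assumes "n dvd x" "\<bar>x\<bar> < n"
  shows "x = 0"
proof (rule ccontr)
  assume "x \<noteq> 0"
  hence "\<bar>n\<bar> \<le> \<bar>x\<bar>" using assms(1) by (rule dvd_imp_le_int)
  thus False using assms(2) by linarith
qed

text \<open>
  After cancelling \<open>n^(d - 1)\<close>, the equation modulo \<open>n\<close> says that \<open>n\<close> divides \<open>(poly a 1 - \<delta>) D\<close>, as
  \<open>v\<close> is a unit and \<open>u\<close> is congruent to \<open>D\<close>. This integer does not depend on \<open>n\<close>, so it vanishes; the next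
  order in \<open>n\<close> then treats the derivative in the same way.
\<close>

lemma poly_first_order_from_congruences:
  fixes a :: "int poly" and d :: nat and c \<delta> D :: int
  assumes "d > 0" and D: "D \<noteq> 0"
    and H: "\<And>B. \<exists>n v u e :: int. B \<le> n \<and> coprime v n \<and> n dvd u - D \<and>
      (poly a (1 + n * v) - \<delta>) * (n * v) ^ (d - 1) * u = (n * v) ^ d * c + n ^ (d + 1) * e"
  shows "poly a 1 = \<delta> \<and> D * poly (pderiv a) 1 = c"
proof -
  obtain g where g: "\<And>q. poly a q = poly a 1 + poly (pderiv a) 1 * (q - 1) + (q - 1)\<^sup>2 * poly g q"
    using poly_taylor_at_1[of a] by blast
  define \<alpha> where "\<alpha> = poly a 1 - \<delta>"
  define \<beta> where "\<beta> = poly (pderiv a) 1"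
  obtain n v u e :: int where n: "1 + \<bar>\<alpha> * D\<bar> + \<bar>\<beta> * D - c\<bar> \<le> n" "coprime v n" "n dvd u - D"
    and eq: "(poly a (1 + n * v) - \<delta>) * (n * v) ^ (d - 1) * u = (n * v) ^ d * c + n ^ (d + 1) * e"
    using H by blast
  have n0: "n > 0" using n(1) by linarith
  define w where "w = poly g (1 + n * v)"
  obtain t where "u - D = n * t" using n(3) by (rule dvdE)
  hence t: "u = D + n * t" by simp
  obtain k where d: "d = Suc k" using \<open>d > 0\<close> by (cases d) auto
  have "(\<alpha> + \<beta> * (n * v) + (n * v)\<^sup>2 * w) * (n * v) ^ k * u = (n * v) ^ Suc k * c + n ^ (k + 2) * e"
    using eq by (simp add: g[of "1 + n * v"] \<alpha>_def \<beta>_def w_def d algebra_simps)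
  hence "n ^ k * ((\<alpha> + \<beta> * (n * v) + (n * v)\<^sup>2 * w) * v ^ k * u) = n ^ k * (n * v ^ Suc k * c + n ^ 2 * e)"
    by (simp add: power_mult_distrib power_add power2_eq_square algebra_simps)
  hence E: "(\<alpha> + \<beta> * (n * v) + (n * v)\<^sup>2 * w) * v ^ k * u = n * v ^ Suc k * c + n ^ 2 * e"
    using n0 by simp
  have cop: "coprime n (v ^ i)" for i using n(2) by (simp add: coprime_commute)
  have "v ^ k * (\<alpha> * D) = n * (v ^ Suc k * c + n * e
      - (\<beta> * v + n * v\<^sup>2 * w) * v ^ k * u - \<alpha> * v ^ k * t)"
    using E by (simp add: t power2_eq_square algebra_simps)
  hence "n dvd v ^ k * (\<alpha> * D)" by simp
  hence "n dvd \<alpha> * D" using cop coprime_dvd_mult_right_iff by blast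
  hence "\<alpha> * D = 0" using n(1) by (intro int_eq_0_of_large_divisor[of n]) auto
  hence \<alpha>0: "\<alpha> = 0" using D by simp
  have "n * (v ^ Suc k * (\<beta> * D - c)) = n * (n * (e - v\<^sup>2 * w * v ^ k * u - \<beta> * v * v ^ k * t))"
    using E by (simp add: t \<alpha>0 power2_eq_square algebra_simps)
  hence "n dvd v ^ Suc k * (\<beta> * D - c)" using n0 by simp
  hence "n dvd \<beta> * D - c" using cop coprime_dvd_mult_right_iff by blast
  hence "\<beta> * D - c = 0" using n(1) by (intro int_eq_0_of_large_divisor[of n]) auto
  thus ?thesis using \<alpha>0 by (simp add: \<alpha>_def \<beta>_def mult.commute)
qed

text \<open>
  The prime field, on the natural numbers because the representations counted have their entries there.
\<close>

definition residue_field :: "nat \<Rightarrow> nat ring" where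
  "residue_field p = \<lparr>carrier = {..<p}, mult = (\<lambda>x y. x * y mod p), one = 1, zero = 0,
     add = (\<lambda>x y. (x + y) mod p)\<rparr>"

lemma field_residue_field:
  assumes p: "prime p"
  shows "field (residue_field p)"
proof -
  have p1: "1 < p" using p by (rule prime_gt_1_nat)
  have neg: "\<exists>y<p. (y + x) mod p = 0" if "x < p" for x
  proof (cases "x = 0")
    case True
    thus ?thesis using p1 by (intro exI[of _ 0]) simp
  next
    case False
    thus ?thesis using that by (intro exI[of _ "p - x"]) simp
  qed
  have "abelian_group (residue_field p)"
  proof (rule abelian_groupI)
    fix x y z
    assume "x \<in> carrier (residue_field p)" "y \<in> carrier (residue_field p)"
      "z \<in> carrier (residue_field p)"
    show "x \<oplus>\<^bsub>residue_field p\<^esub> y \<oplus>\<^bsub>residue_field p\<^esub> z =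
        x \<oplus>\<^bsub>residue_field p\<^esub> (y \<oplus>\<^bsub>residue_field p\<^esub> z)"
      by (simp add: residue_field_def mod_add_left_eq mod_add_right_eq add.assoc)
    show "x \<oplus>\<^bsub>residue_field p\<^esub> y = y \<oplus>\<^bsub>residue_field p\<^esub> x"
      by (simp add: residue_field_def add.commute)
  next
    fix x assume "x \<in> carrier (residue_field p)"
    hence "x < p" by (simp add: residue_field_def)
    from neg[OF this] obtain y where "y < p \<and> (y + x) mod p = 0" by (rule exE)
    thus "\<exists>y\<in>carrier (residue_field p). y \<oplus>\<^bsub>residue_field p\<^esub> x = \<zero>\<^bsub>residue_field p\<^esub>"
      by (intro bexI[of _ y]) (simp_all add: residue_field_def)
  qed (use p1 in \<open>auto simp: residue_field_def\<close>)
  moreover have "comm_monoid (residue_field p)"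
  proof (rule comm_monoidI)
    fix x y z
    assume "x \<in> carrier (residue_field p)" "y \<in> carrier (residue_field p)"
      "z \<in> carrier (residue_field p)"
    show "x \<otimes>\<^bsub>residue_field p\<^esub> y \<otimes>\<^bsub>residue_field p\<^esub> z =
        x \<otimes>\<^bsub>residue_field p\<^esub> (y \<otimes>\<^bsub>residue_field p\<^esub> z)"
      by (simp add: residue_field_def mod_mult_left_eq mod_mult_right_eq mult.assoc)
    show "x \<otimes>\<^bsub>residue_field p\<^esub> y = y \<otimes>\<^bsub>residue_field p\<^esub> x"
      by (simp add: residue_field_def mult.commute)
  qed (use p1 in \<open>auto simp: residue_field_def\<close>)
  ultimately have "cring (residue_field p)"
    by (rule cringI) (simp add: residue_field_def mod_mult_left_eq mod_add_eq add_mult_distrib)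
  thus ?thesis
  proof (rule cring.cring_fieldI2)
    show "\<zero>\<^bsub>residue_field p\<^esub> \<noteq> \<one>\<^bsub>residue_field p\<^esub>" by (simp add: residue_field_def)
    fix x assume x: "x \<in> carrier (residue_field p)" "x \<noteq> \<zero>\<^bsub>residue_field p\<^esub>"
    hence "0 < x" "x < p" by (simp_all add: residue_field_def)
    hence "\<not> p dvd x" by (rule nat_dvd_not_less)
    with p have "coprime p x" by (rule prime_imp_coprime)
    hence "coprime x p" by (simp only: coprime_commute)
    from cong_solve_coprime_nat[OF this] obtain y where "[x * y = Suc 0] (mod p)" by (rule exE)
    thus "\<exists>y\<in>carrier (residue_field p). x \<otimes>\<^bsub>residue_field p\<^esub> y = \<one>\<^bsub>residue_field p\<^esub>"
      using p1 by (intro bexI[of _ "y mod p"]) (simp_all add: residue_field_def cong_def mod_mult_right_eq)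
  qed
qed

lemma card_residue_field: "card (carrier (residue_field p)) = p"
  and finite_residue_field: "finite (carrier (residue_field p))"
  by (simp_all add: residue_field_def)

section \<open>Coordinate spaces and matrices over a record\<close>

abbreviation kspace :: "('a, 'c) ring_scheme \<Rightarrow> nat \<Rightarrow> 'a vec set" where
  "kspace K d \<equiv> carrier (coord_space K d)"

definition vadd :: "('a, 'c) ring_scheme \<Rightarrow> nat \<Rightarrow> 'a vec \<Rightarrow> 'a vec \<Rightarrow> 'a vec" where
  "vadd K d v w = vec d (\<lambda>i. v $ i \<oplus>\<^bsub>K\<^esub> w $ i)"

definition vscale :: "('a, 'c) ring_scheme \<Rightarrow> nat \<Rightarrow> 'a \<Rightarrow> 'a vec \<Rightarrow> 'a vec" where
  "vscale K d c v = vec d (\<lambda>i. c \<otimes>\<^bsub>K\<^esub> v $ i)"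

definition vzero :: "('a, 'c) ring_scheme \<Rightarrow> nat \<Rightarrow> 'a vec" where
  "vzero K d = vec d (\<lambda>_. \<zero>\<^bsub>K\<^esub>)"

definition axis_vec :: "('a, 'c) ring_scheme \<Rightarrow> nat \<Rightarrow> 'a \<Rightarrow> nat \<Rightarrow> 'a vec" where
  "axis_vec K d c b = vec d (\<lambda>i. if i = b then c else \<zero>\<^bsub>K\<^esub>)"

definition coord_cut :: "('a, 'c) ring_scheme \<Rightarrow> nat \<Rightarrow> nat set \<Rightarrow> 'a vec \<Rightarrow> 'a vec" where
  "coord_cut K d S v = vec d (\<lambda>i. if i \<in> S then v $ i else \<zero>\<^bsub>K\<^esub>)"

lemma kspace_iff: "v \<in> kspace K d \<longleftrightarrow> dim_vec v = d \<and> (\<forall>i<d. v $ i \<in> carrier K)"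
  and coord_space_zero: "zero (coord_space K d) = vzero K d"
  and coord_space_add: "add (coord_space K d) = vadd K d"
  and coord_space_smult: "module.smult (coord_space K d) = vscale K d"
  by (auto simp: coord_space_def vzero_def vadd_def vscale_def fun_eq_iff)

lemma vec_ops_dim [simp]:
  "dim_vec (vadd K d v w) = d" "dim_vec (vscale K d c v) = d" "dim_vec (vzero K d) = d"
  "dim_vec (axis_vec K d c b) = d" "dim_vec (coord_cut K d S v) = d"
  by (simp_all add: vadd_def vscale_def vzero_def axis_vec_def coord_cut_def)

lemma vec_ops_nth [simp]:
  assumes "i < d"
  shows "vadd K d v w $ i = v $ i \<oplus>\<^bsub>K\<^esub> w $ i" "vscale K d c v $ i = c \<otimes>\<^bsub>K\<^esub> v $ i"
    "vzero K d $ i = \<zero>\<^bsub>K\<^esub>" "axis_vec K d c b $ i = (if i = b then c else \<zero>\<^bsub>K\<^esub>)"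
    "coord_cut K d S v $ i = (if i \<in> S then v $ i else \<zero>\<^bsub>K\<^esub>)"
  using assms by (simp_all add: vadd_def vscale_def vzero_def axis_vec_def coord_cut_def)

definition is_subspace :: "('a, 'c) ring_scheme \<Rightarrow> nat \<Rightarrow> 'a vec set \<Rightarrow> bool" where
  "is_subspace K d U \<longleftrightarrow> U \<subseteq> kspace K d \<and> vzero K d \<in> U \<and>
    (\<forall>u\<in>U. \<forall>v\<in>U. vadd K d u v \<in> U) \<and> (\<forall>c\<in>carrier K. \<forall>u\<in>U. vscale K d c u \<in> U)"

lemma is_subspaceD:
  assumes "is_subspace K d U"
  shows "u \<in> U \<Longrightarrow> u \<in> kspace K d" "vzero K d \<in> U" "u \<in> U \<Longrightarrow> v \<in> U \<Longrightarrow> vadd K d u v \<in> U"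
    "c \<in> carrier K \<Longrightarrow> u \<in> U \<Longrightarrow> vscale K d c u \<in> U"
  using assms unfolding is_subspace_def by blast+

lemma kspaceI:
  assumes "dim_vec v = d" "\<And>i. i < d \<Longrightarrow> v $ i \<in> carrier K"
  shows "v \<in> kspace K d"
  using assms by (simp add: kspace_iff)

lemma matricesI:
  assumes "dim_row A = d" "dim_col A = d"
    and "\<And>i j. i < d \<Longrightarrow> j < d \<Longrightarrow> A $$ (i, j) \<in> carrier K"
  shows "A \<in> matrices K d"
  using assms by (auto simp: matrices_def)

lemma kspace_nth [simp]: "v \<in> kspace K d \<Longrightarrow> i < d \<Longrightarrow> v $ i \<in> carrier K"
  and kspace_dim: "v \<in> kspace K d \<Longrightarrow> dim_vec v = d"
  by (simp_all add: coord_space_def)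

lemma matrices_dim: "A \<in> matrices K d \<Longrightarrow> dim_row A = d" "A \<in> matrices K d \<Longrightarrow> dim_col A = d"
  by (auto simp: matrices_def)

lemma matrices_nth [simp]:
  "A \<in> matrices K d \<Longrightarrow> i < d \<Longrightarrow> j < d \<Longrightarrow> A $$ (i, j) \<in> carrier K"
  by (simp add: matrices_def)

lemma kspace_eqI:
  assumes "v \<in> kspace K d" "w \<in> kspace K d" "\<And>i. i < d \<Longrightarrow> v $ i = w $ i"
  shows "v = w"
  using assms(3) kspace_dim[OF assms(1)] kspace_dim[OF assms(2)] by (intro eq_vecI) simp_all

context cring
begin

lemma vec_ops_closed [simp, intro]:
  "v \<in> kspace R d \<Longrightarrow> w \<in> kspace R d \<Longrightarrow> vadd R d v w \<in> kspace R d"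
  "c \<in> carrier R \<Longrightarrow> v \<in> kspace R d \<Longrightarrow> vscale R d c v \<in> kspace R d"
  "vzero R d \<in> kspace R d"
  "c \<in> carrier R \<Longrightarrow> axis_vec R d c b \<in> kspace R d"
  "v \<in> kspace R d \<Longrightarrow> coord_cut R d S v \<in> kspace R d"
  by (auto intro!: kspaceI simp: kspace_dim)

lemma abelian_group_coord_space: "abelian_group (coord_space R d)"
proof (rule abelian_groupI; (unfold coord_space_zero coord_space_add)?)
  fix x y z assume "x \<in> kspace R d" "y \<in> kspace R d" "z \<in> kspace R d"
  thus "vadd R d (vadd R d x y) z = vadd R d x (vadd R d y z)"
    by (intro eq_vecI) (simp_all add: a_assoc)
next
  fix x y assume "x \<in> kspace R d" "y \<in> kspace R d"
  thus "vadd R d x y = vadd R d y x" by (intro eq_vecI) (simp_all add: a_comm)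
next
  fix x assume x: "x \<in> kspace R d"
  show "vadd R d (vzero R d) x = x" using x by (intro eq_vecI) (simp_all add: kspace_dim)
  show "\<exists>y\<in>kspace R d. vadd R d y x = vzero R d"
  proof
    show "vec d (\<lambda>i. \<ominus> (x $ i)) \<in> kspace R d" using x by (intro kspaceI) simp_all
    show "vadd R d (vec d (\<lambda>i. \<ominus> (x $ i))) x = vzero R d"
      using x by (intro eq_vecI) (simp_all add: l_neg)
  qed
qed simp_all

lemma module_coord_space: "module R (coord_space R d)"
proof (rule moduleI; (unfold coord_space_smult coord_space_add)?)
  show "cring R" by (rule is_cring)
  show "abelian_group (coord_space R d)" by (rule abelian_group_coord_space)
qed (simp_all add: vec_eq_iff l_distr r_distr m_assoc kspace_dim)

lemma submodule_iff_subspace: "submodule U R (coord_space R d) \<longleftrightarrow> is_subspace R d U"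
proof
  assume U: "submodule U R (coord_space R d)"
  have "\<zero>\<^bsub>coord_space R d\<^esub> \<in> U"
    using subgroup.one_closed[OF submodule.axioms(1)[OF U]] by simp
  thus "is_subspace R d U"
    using module.submoduleE[OF module_coord_space U]
    by (simp add: is_subspace_def coord_space_zero coord_space_add coord_space_smult)
next
  assume U: "is_subspace R d U"
  note mod = module_coord_space
  have neg: "\<ominus>\<^bsub>coord_space R d\<^esub> u \<in> U" if u: "u \<in> U" for u
  proof -
    have "\<ominus>\<^bsub>coord_space R d\<^esub> u = vscale R d (\<ominus> \<one>) u"
      using module.smult_l_minus[OF mod one_closed is_subspaceD(1)[OF U u]]
        module.smult_one[OF mod is_subspaceD(1)[OF U u]]
      by (simp only: coord_space_smult)
    thus ?thesis using is_subspaceD(4)[OF U _ u] by simp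
  qed
  show "submodule U R (coord_space R d)"
  proof (rule module.submoduleI[OF mod]; (unfold coord_space_smult coord_space_add coord_space_zero)?)
    show "U \<subseteq> kspace R d" using is_subspaceD(1)[OF U] by blast
    show "vzero R d \<in> U" by (rule is_subspaceD(2)[OF U])
  qed (rule neg is_subspaceD[OF U]; assumption)+
qed

text \<open>
  Additive statements need only be checked on multiples of the axis vectors.
\<close>

lemma kspace_induct [consumes 1, case_names zero single add]:
  assumes v: "v \<in> kspace R d"
    and zero: "P (vzero R d)"
    and single: "\<And>c b. c \<in> carrier R \<Longrightarrow> b < d \<Longrightarrow> P (axis_vec R d c b)"
    and add: "\<And>u w. u \<in> kspace R d \<Longrightarrow> w \<in> kspace R d \<Longrightarrow> P u \<Longrightarrow> P w \<Longrightarrow> P (vadd R d u w)"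
  shows "P v"
proof -
  have "P (coord_cut R d {..<n} v)" if "n \<le> d" for n
    using that
  proof (induction n)
    case 0
    have "coord_cut R d {..<0} v = vzero R d" by (rule eq_vecI) auto
    thus ?case using zero by simp
  next
    case (Suc n)
    have "coord_cut R d {..<Suc n} v = vadd R d (coord_cut R d {..<n} v) (axis_vec R d (v $ n) n)"
      using v Suc.prems by (intro eq_vecI) (simp_all add: less_Suc_eq)
    moreover have "P (coord_cut R d {..<n} v)" using Suc by simp
    moreover have "P (axis_vec R d (v $ n) n)" using v Suc.prems by (intro single) auto
    ultimately show ?case using v Suc.prems by (simp add: add)
  qed
  hence "P (coord_cut R d {..<d} v)" by simp
  moreover have "coord_cut R d {..<d} v = v" using v by (intro eq_vecI) (auto simp: kspace_dim)
  ultimately show ?thesis by simp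
qed

lemma mat_act_nth:
  assumes "A \<in> matrices R d" "i < d"
  shows "mat_act R A v $ i = (\<Oplus>j\<in>{..<d}. A $$ (i, j) \<otimes> v $ j)"
  using assms(2) matrices_dim[OF assms(1)] by (simp add: mat_act_def)

lemma mat_act_dim: "A \<in> matrices R d \<Longrightarrow> dim_vec (mat_act R A v) = d"
  by (simp add: mat_act_def matrices_dim)

lemma mat_act_closed [simp, intro]:
  assumes "A \<in> matrices R d" "v \<in> kspace R d"
  shows "mat_act R A v \<in> kspace R d"
  using assms by (auto simp: mat_act_dim mat_act_nth intro!: kspaceI finsum_closed)

lemma mat_act_add:
  assumes "A \<in> matrices R d" "u \<in> kspace R d" "v \<in> kspace R d"
  shows "mat_act R A (vadd R d u v) = vadd R d (mat_act R A u) (mat_act R A v)"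
proof (rule eq_vecI)
  fix i assume "i < dim_vec (vadd R d (mat_act R A u) (mat_act R A v))"
  hence i: "i < d" by simp
  have "mat_act R A (vadd R d u v) $ i =
      (\<Oplus>j\<in>{..<d}. A $$ (i, j) \<otimes> u $ j \<oplus> A $$ (i, j) \<otimes> v $ j)"
    unfolding mat_act_nth[OF assms(1) i]
    using assms i by (intro finsum_cong') (simp_all add: r_distr)
  also have "\<dots> = vadd R d (mat_act R A u) (mat_act R A v) $ i"
    using assms i by (simp add: mat_act_nth finsum_addf Pi_def)
  finally show "mat_act R A (vadd R d u v) $ i = vadd R d (mat_act R A u) (mat_act R A v) $ i" .
qed (use assms in \<open>simp add: mat_act_dim\<close>)

lemma mat_act_scale:
  assumes "A \<in> matrices R d" "c \<in> carrier R" "v \<in> kspace R d"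
  shows "mat_act R A (vscale R d c v) = vscale R d c (mat_act R A v)"
proof (rule eq_vecI)
  fix i assume "i < dim_vec (vscale R d c (mat_act R A v))"
  hence i: "i < d" by simp
  have "mat_act R A (vscale R d c v) $ i = (\<Oplus>j\<in>{..<d}. c \<otimes> (A $$ (i, j) \<otimes> v $ j))"
    unfolding mat_act_nth[OF assms(1) i]
    using assms i by (intro finsum_cong') (simp_all add: m_lcomm)
  also have "\<dots> = vscale R d c (mat_act R A v) $ i"
    using assms i by (simp add: mat_act_nth finsum_rdistr Pi_def)
  finally show "mat_act R A (vscale R d c v) $ i = vscale R d c (mat_act R A v) $ i" .
qed (use assms in \<open>simp add: mat_act_dim\<close>)

lemma mat_act_zero: 
  assumes "A \<in> matrices R d"
  shows "mat_act R A (vzero R d) = vzero R d"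
  using assms
  by (intro eq_vecI) (auto simp: mat_act_dim mat_act_nth intro!: add.finprod_one_eqI)

lemma mat_act_axis:
  assumes "A \<in> matrices R d" "c \<in> carrier R" "b < d"
  shows "mat_act R A (axis_vec R d c b) = vec d (\<lambda>i. A $$ (i, b) \<otimes> c)"
proof (rule eq_vecI)
  fix i assume "i < dim_vec (vec d (\<lambda>i. A $$ (i, b) \<otimes> c))"
  hence i: "i < d" by simp
  have "mat_act R A (axis_vec R d c b) $ i = (\<Oplus>j\<in>{..<d}. if b = j then A $$ (i, j) \<otimes> c else \<zero>)"
    unfolding mat_act_nth[OF assms(1) i]
    using assms i by (intro finsum_cong') auto
  also have "\<dots> = A $$ (i, b) \<otimes> c"
    using finsum_singleton[of b "{..<d}" "\<lambda>j. A $$ (i, j) \<otimes> c"] assms i by simp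
  finally show "mat_act R A (axis_vec R d c b) $ i = vec d (\<lambda>i. A $$ (i, b) \<otimes> c) $ i"
    using i by simp
qed (use assms in \<open>simp add: mat_act_dim\<close>)

lemma axis_vec_scale:
  assumes "c \<in> carrier R" "e \<in> carrier R"
  shows "vscale R d c (axis_vec R d e b) = axis_vec R d (c \<otimes> e) b"
  using assms by (intro eq_vecI) auto

text \<open>A linear map is the action of the matrix whose columns are the images of the axis vectors.\<close>

lemma exists_matrix_of_linear:
  assumes cl: "\<And>v. v \<in> kspace R d \<Longrightarrow> f v \<in> kspace R d"
    and add: "\<And>u v. u \<in> kspace R d \<Longrightarrow> v \<in> kspace R d \<Longrightarrow> f (vadd R d u v) = vadd R d (f u) (f v)"
    and scale: "\<And>c v. c \<in> carrier R \<Longrightarrow> v \<in> kspace R d \<Longrightarrow> f (vscale R d c v) = vscale R d c (f v)"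
  shows "\<exists>A\<in>matrices R d. \<forall>v\<in>kspace R d. mat_act R A v = f v"
proof
  define A where "A = mat d d (\<lambda>(i, b). f (axis_vec R d \<one> b) $ i)"
  show A: "A \<in> matrices R d" using kspace_nth[OF cl] by (intro matricesI) (simp_all add: A_def)
  show "\<forall>v\<in>kspace R d. mat_act R A v = f v"
  proof
    fix v assume "v \<in> kspace R d"
    thus "mat_act R A v = f v"
    proof (induction v rule: kspace_induct)
      case zero
      have "f (vzero R d) = f (vscale R d \<zero> (vzero R d))"
        by (rule arg_cong[of _ _ f], rule eq_vecI) auto
      also have "\<dots> = vzero R d"
        using cl[of "vzero R d"] by (subst scale) (auto intro!: eq_vecI)
      finally show ?case using A by (simp add: mat_act_zero)
    next
      case (single c b)
      have "f (axis_vec R d c b) = vscale R d c (f (axis_vec R d \<one> b))"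
        using single by (simp add: axis_vec_scale flip: scale)
      thus ?case using single A cl[of "axis_vec R d \<one> b"] unfolding mat_act_axis[OF A single]
        by (intro eq_vecI) (auto simp: A_def m_comm)
    next
      case (add u w)
      thus ?case using A assms(2) by (simp add: mat_act_add)
    qed
  qed
qed

lemma matrices_eqI:
  assumes "A \<in> matrices R d" "B \<in> matrices R d"
    and "\<And>v. v \<in> kspace R d \<Longrightarrow> mat_act R A v = mat_act R B v"
  shows "A = B"
proof (rule eq_matI)
  fix i j assume "i < dim_row B" "j < dim_col B"
  hence ij: "i < d" "j < d" using matrices_dim[OF assms(2)] by simp_all
  have "mat_act R A (axis_vec R d \<one> j) $ i = mat_act R B (axis_vec R d \<one> j) $ i"
    using assms(3)[of "axis_vec R d \<one> j"] by simp
  thus "A $$ (i, j) = B $$ (i, j)"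
    using assms(1,2) ij by (simp add: mat_act_axis)
qed (use assms(1,2) in \<open>simp_all add: matrices_dim\<close>)

lemma eq_on_axes:
  assumes "A \<in> matrices R d" "B \<in> matrices R d" "C \<in> matrices R d" "D \<in> matrices R d"
    and "\<And>b. b < d \<Longrightarrow> mat_act R A (mat_act R B (axis_vec R d \<one> b)) =
      mat_act R C (mat_act R D (axis_vec R d \<one> b))"
    and "v \<in> kspace R d"
  shows "mat_act R A (mat_act R B v) = mat_act R C (mat_act R D v)"
  using assms(6)
proof (induction v rule: kspace_induct)
  case zero
  show ?case using assms(1-4) by (simp only: mat_act_zero)
next
  case (single c b)
  have eq: "axis_vec R d c b = vscale R d c (axis_vec R d \<one> b)"
    using single by (simp add: axis_vec_scale)
  show ?case unfolding eq using assms(1-4) assms(5)[OF single(2)] single(1)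
    by (simp add: mat_act_scale)
next
  case (add u w)
  have "mat_act R A (mat_act R B (vadd R d u w)) =
      vadd R d (mat_act R A (mat_act R B u)) (mat_act R A (mat_act R B w))"
    using assms(1-4) add(1,2) by (simp add: mat_act_add)
  also have "\<dots> = vadd R d (mat_act R C (mat_act R D u)) (mat_act R C (mat_act R D w))"
    by (simp only: add.IH)
  also have "\<dots> = mat_act R C (mat_act R D (vadd R d u w))"
    using assms(1-4) add(1,2) by (simp add: mat_act_add)
  finally show ?case .
qed

end

section \<open>Irreducibility relative to a partition of the coordinates\<close>

text \<open>
  The subrepresentations that are sums of pieces supported in the blocks, that is the fibres of \<open>\<pi>\<close>. For
  these graded subspaces it does not matter if the parts of a matrix between different pairs of blocks are
  rescaled independently.
\<close>

definition stable_subspace ::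
  "('a, 'c) ring_scheme \<Rightarrow> nat \<Rightarrow> (nat \<Rightarrow> nat) \<Rightarrow> 'a mat list \<Rightarrow> 'a vec set \<Rightarrow> bool" where
  "stable_subspace K d \<pi> As U \<longleftrightarrow> is_subspace K d U \<and>
    (\<forall>A\<in>set As. \<forall>u\<in>U. mat_act K A u \<in> U) \<and> (\<forall>g. \<forall>u\<in>U. coord_cut K d {a. \<pi> a = g} u \<in> U)"

definition block_irreducible ::
  "('a, 'c) ring_scheme \<Rightarrow> nat \<Rightarrow> (nat \<Rightarrow> nat) \<Rightarrow> 'a mat list \<Rightarrow> bool" where
  "block_irreducible K d \<pi> As \<longleftrightarrow> d > 0 \<and>
    (\<forall>U. stable_subspace K d \<pi> As U \<longrightarrow> U = {vzero K d} \<or> U = kspace K d)"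

definition support :: "('a, 'c) ring_scheme \<Rightarrow> nat \<Rightarrow> 'a mat list \<Rightarrow> (nat \<times> nat \<times> nat) set" where
  "support K d As = {(i, a, b). i < length As \<and> a < d \<and> b < d \<and> (As ! i) $$ (a, b) \<noteq> \<zero>\<^bsub>K\<^esub>}"

lemma supportI:
  "i < length As \<Longrightarrow> a < d \<Longrightarrow> b < d \<Longrightarrow> (As ! i) $$ (a, b) \<noteq> \<zero>\<^bsub>K\<^esub> \<Longrightarrow> (i, a, b) \<in> support K d As"
  by (simp add: support_def)

lemma reps_nth: "As \<in> reps K m d \<Longrightarrow> i < m \<Longrightarrow> As ! i \<in> matrices K d"
  and reps_length: "As \<in> reps K m d \<Longrightarrow> length As = m"
  and reps_set: "As \<in> reps K m d \<Longrightarrow> A \<in> set As \<Longrightarrow> A \<in> matrices K d"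
  by (auto simp: reps_def)

lemma stable_subspaceD:
  assumes "stable_subspace K d \<pi> As U"
  shows "is_subspace K d U" "A \<in> set As \<Longrightarrow> u \<in> U \<Longrightarrow> mat_act K A u \<in> U"
    "u \<in> U \<Longrightarrow> coord_cut K d {a. \<pi> a = g} u \<in> U"
  using assms by (simp_all add: stable_subspace_def)

context cring
begin

lemma cut_add:
  assumes "u \<in> kspace R d" "v \<in> kspace R d"
  shows "coord_cut R d S (vadd R d u v) = vadd R d (coord_cut R d S u) (coord_cut R d S v)"
  using assms by (intro eq_vecI) simp_all

lemma cut_scale:
  assumes "c \<in> carrier R" "v \<in> kspace R d"
  shows "coord_cut R d S (vscale R d c v) = vscale R d c (coord_cut R d S v)"
  using assms by (intro eq_vecI) simp_all

text \<open>A vector is the sum of its block components.\<close>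

lemma additive_mem_of_blocks:
  fixes \<pi> :: "nat \<Rightarrow> nat"
  assumes U: "is_subspace R d U" and v: "v \<in> kspace R d"
    and add: "\<And>u w. u \<in> kspace R d \<Longrightarrow> w \<in> kspace R d \<Longrightarrow> f (vadd R d u w) = vadd R d (f u) (f w)"
    and zero: "f (vzero R d) = vzero R d"
    and mem: "\<And>g. f (coord_cut R d {a. \<pi> a = g} v) \<in> U"
  shows "f v \<in> U"
proof -
  have "f (coord_cut R d {a. \<pi> a \<in> G} v) \<in> U" if "finite G" for G :: "nat set"
    using that
  proof (induction G rule: finite_induct)
    case empty
    have "coord_cut R d {a. \<pi> a \<in> {}} v = vzero R d" by (intro eq_vecI) simp_all
    thus ?case using is_subspaceD(2)[OF U] by (simp only: zero)
  next
    case (insert g G)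
    have "coord_cut R d {a. \<pi> a \<in> insert g G} v = vadd R d (coord_cut R d {a. \<pi> a = g} v) (coord_cut R d {a. \<pi> a \<in> G} v)"
      using insert.hyps(2) v by (intro eq_vecI) auto
    hence "f (coord_cut R d {a. \<pi> a \<in> insert g G} v) =
        vadd R d (f (coord_cut R d {a. \<pi> a = g} v)) (f (coord_cut R d {a. \<pi> a \<in> G} v))"
      using v by (simp add: add)
    thus ?case using is_subspaceD(3)[OF U mem insert.IH] by simp
  qed
  from this[of "\<pi> ` {..<d}"] have "f (coord_cut R d {a. \<pi> a \<in> \<pi> ` {..<d}} v) \<in> U" by simp
  moreover have "coord_cut R d {a. \<pi> a \<in> \<pi> ` {..<d}} v = v"
    using v by (intro eq_vecI) (simp_all add: kspace_dim)
  ultimately show ?thesis by simp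
qed

lemma mat_act_mem_of_blocks:
  fixes \<pi> :: "nat \<Rightarrow> nat"
  assumes U: "is_subspace R d U" and v: "v \<in> kspace R d" and A: "A \<in> matrices R d"
    and mem: "\<And>g h. coord_cut R d {a. \<pi> a = h} (mat_act R A (coord_cut R d {a. \<pi> a = g} v)) \<in> U"
  shows "mat_act R A v \<in> U"
proof (rule additive_mem_of_blocks[OF U v, where \<pi> = \<pi>])
  fix g
  have w: "mat_act R A (coord_cut R d {a. \<pi> a = g} v) \<in> kspace R d" using A v by simp
  show "mat_act R A (coord_cut R d {a. \<pi> a = g} v) \<in> U"
    by (rule additive_mem_of_blocks[OF U w, where \<pi> = \<pi> and f = "\<lambda>v. v"]) (simp_all add: mem)
qed (use A in \<open>simp_all add: mat_act_add mat_act_zero\<close>)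

text \<open>A block component of the image of a block component is computed by the entries of one block.\<close>

lemma block_entry_cong:
  assumes A: "A \<in> matrices R d" and u: "u \<in> kspace R d" and v: "v \<in> kspace R d" and i: "i < d"
    and eq: "\<And>b. b < d \<Longrightarrow> A $$ (i, b) \<noteq> \<zero> \<Longrightarrow> u $ b = v $ b"
  shows "mat_act R A u $ i = mat_act R A v $ i"
  unfolding mat_act_nth[OF A i]
proof (intro finsum_cong')
  show "(\<lambda>j. A $$ (i, j) \<otimes> v $ j) \<in> {..<d} \<rightarrow> carrier R" using A v i by simp
  fix b assume "b \<in> {..<d}"
  hence b: "b < d" by simp
  show "A $$ (i, b) \<otimes> u $ b = A $$ (i, b) \<otimes> v $ b"
  proof (cases "A $$ (i, b) = \<zero>")
    case True
    thus ?thesis using u v b by simp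
  next
    case False
    thus ?thesis using eq[OF b] by simp
  qed
qed simp

text \<open>
  The lowest weight forms of the vectors of a subspace span a graded subspace: \<open>v\<close> belongs to it
  when each weight component of \<open>v\<close> is the lowest weight component of some vector of \<open>U\<close>.
\<close>

definition initial_subspace :: "nat \<Rightarrow> (nat \<Rightarrow> int) \<Rightarrow> 'a vec set \<Rightarrow> 'a vec set" where
  "initial_subspace d W U = {v \<in> kspace R d. \<forall>k. \<exists>u\<in>U. (\<forall>a<d. W a < k \<longrightarrow> u $ a = \<zero>) \<and>
    (\<forall>a<d. W a = k \<longrightarrow> u $ a = v $ a)}"

lemma initial_subspaceI:
  assumes "v \<in> kspace R d"
    and "\<And>k. \<exists>u\<in>U. (\<forall>a<d. W a < k \<longrightarrow> u $ a = \<zero>) \<and> (\<forall>a<d. W a = k \<longrightarrow> u $ a = v $ a)"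
  shows "v \<in> initial_subspace d W U"
  using assms by (simp add: initial_subspace_def)

lemma initial_subspaceD:
  assumes "v \<in> initial_subspace d W U"
  shows "\<exists>u. u \<in> U \<and> (\<forall>a<d. W a < k \<longrightarrow> u $ a = \<zero>) \<and> (\<forall>a<d. W a = k \<longrightarrow> u $ a = v $ a)"
  using assms by (simp add: initial_subspace_def Bex_def)

lemma initial_subspace_subset: "v \<in> initial_subspace d W U \<Longrightarrow> v \<in> kspace R d"
  by (simp add: initial_subspace_def)

lemma is_subspace_initial_subspace:
  assumes U: "is_subspace R d U"
  shows "is_subspace R d (initial_subspace d W U)"
proof -
  have 1: "vzero R d \<in> initial_subspace d W U"
  proof (rule initial_subspaceI)
    fix k
    show "\<exists>u\<in>U. (\<forall>a<d. W a < k \<longrightarrow> u $ a = \<zero>) \<and> (\<forall>a<d. W a = k \<longrightarrow> u $ a = vzero R d $ a)"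
      using is_subspaceD(2)[OF U] by (rule bexI[rotated]) simp
  qed simp
  have 2: "vadd R d v w \<in> initial_subspace d W U"
    if v: "v \<in> initial_subspace d W U" and w: "w \<in> initial_subspace d W U" for v w
  proof (rule initial_subspaceI)
    fix k
    obtain x where x: "x \<in> U" "\<forall>a<d. W a < k \<longrightarrow> x $ a = \<zero>"
      "\<forall>a<d. W a = k \<longrightarrow> x $ a = v $ a" using initial_subspaceD[OF v, of k] by blast 
    obtain y where y: "y \<in> U" "\<forall>a<d. W a < k \<longrightarrow> y $ a = \<zero>"
      "\<forall>a<d. W a = k \<longrightarrow> y $ a = w $ a" using initial_subspaceD[OF w, of k] by blast
    show "\<exists>u\<in>U. (\<forall>a<d. W a < k \<longrightarrow> u $ a = \<zero>) \<and> (\<forall>a<d. W a = k \<longrightarrow> u $ a = vadd R d v w $ a)"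
      using is_subspaceD(3)[OF U x(1) y(1)] by (rule bexI[rotated]) (simp add: x y)
  qed (use initial_subspace_subset[OF v] initial_subspace_subset[OF w] in simp)
  have 3: "vscale R d c v \<in> initial_subspace d W U"
    if c: "c \<in> carrier R" and v: "v \<in> initial_subspace d W U" for c v
  proof (rule initial_subspaceI)
    fix k
    obtain x where x: "x \<in> U" "\<forall>a<d. W a < k \<longrightarrow> x $ a = \<zero>"
      "\<forall>a<d. W a = k \<longrightarrow> x $ a = v $ a" using initial_subspaceD[OF v, of k] by blast 
    show "\<exists>u\<in>U. (\<forall>a<d. W a < k \<longrightarrow> u $ a = \<zero>) \<and> (\<forall>a<d. W a = k \<longrightarrow> u $ a = vscale R d c v $ a)"
      using is_subspaceD(4)[OF U c x(1)] by (rule bexI[rotated]) (simp add: x c)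
  qed (use initial_subspace_subset[OF v] c in simp)
  show ?thesis
    unfolding is_subspace_def using 1 2 3 initial_subspace_subset by blast
qed

lemma initial_subspace_cut:
  assumes U: "is_subspace R d U"
    and cl: "\<And>u. u \<in> U \<Longrightarrow> coord_cut R d S u \<in> U" and v: "v \<in> initial_subspace d W U"
  shows "coord_cut R d S v \<in> initial_subspace d W U"
proof (rule initial_subspaceI)
  fix k
  obtain x where x: "x \<in> U" "\<forall>a<d. W a < k \<longrightarrow> x $ a = \<zero>"
      "\<forall>a<d. W a = k \<longrightarrow> x $ a = v $ a" using initial_subspaceD[OF v, of k] by blast 
  show "\<exists>u\<in>U. (\<forall>a<d. W a < k \<longrightarrow> u $ a = \<zero>) \<and> (\<forall>a<d. W a = k \<longrightarrow> u $ a = coord_cut R d S v $ a)"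
    using cl[OF x(1)] by (rule bexI[rotated]) (simp add: x)
qed (use initial_subspace_subset[OF v] in simp)

lemma initial_subspace_weight:
  assumes U: "is_subspace R d U" and v: "v \<in> initial_subspace d W U"
  shows "coord_cut R d {a. W a = l} v \<in> initial_subspace d W U"
proof (rule initial_subspaceI)
  fix k
  obtain x where x: "x \<in> U" "\<forall>a<d. W a < k \<longrightarrow> x $ a = \<zero>"
      "\<forall>a<d. W a = k \<longrightarrow> x $ a = v $ a" using initial_subspaceD[OF v, of k] by blast 
  show "\<exists>u\<in>U. (\<forall>a<d. W a < k \<longrightarrow> u $ a = \<zero>) \<and>
      (\<forall>a<d. W a = k \<longrightarrow> u $ a = coord_cut R d {a. W a = l} v $ a)"
  proof (cases "k = l")
    case True
    show ?thesis using x(1) by (rule bexI[rotated]) (simp add: x True)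
  next
    case False
    show ?thesis using is_subspaceD(2)[OF U] by (rule bexI[rotated]) (simp add: False)
  qed
qed (use initial_subspace_subset[OF v] in simp)

lemma initial_subspace_eq_zero:
  assumes U: "is_subspace R d U" and 0: "initial_subspace d W U = {vzero R d}"
  shows "U = {vzero R d}"
proof -
  have "u = vzero R d" if u: "u \<in> U" for u
  proof (rule ccontr)
    assume "u \<noteq> vzero R d"
    have uk: "u \<in> kspace R d" by (rule is_subspaceD(1)[OF U u])
    define T where "T = {a. a < d \<and> u $ a \<noteq> \<zero>}"
    have "T \<noteq> {}"
    proof
      assume "T = {}"
      hence "u = vzero R d" using uk by (intro eq_vecI) (auto simp: T_def kspace_dim)
      thus False using \<open>u \<noteq> vzero R d\<close> by contradiction
    qed
    moreover have fin: "finite T" by (simp add: T_def)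
    ultimately have "Min (W ` T) \<in> W ` T" by (intro Min_in) simp_all
    then obtain c where c: "c \<in> T" "W c = Min (W ` T)" by auto
    have low: "u $ a = \<zero>" if "a < d" "W a < W c" for a
    proof (rule ccontr)
      assume "u $ a \<noteq> \<zero>"
      hence "a \<in> T" using that by (simp add: T_def)
      hence "Min (W ` T) \<le> W a" using fin by simp
      thus False using that(2) c(2) by simp
    qed
    have "coord_cut R d {a. W a = W c} u \<in> initial_subspace d W U"
    proof (rule initial_subspaceI)
      fix k
      show "\<exists>x\<in>U. (\<forall>a<d. W a < k \<longrightarrow> x $ a = \<zero>) \<and>
          (\<forall>a<d. W a = k \<longrightarrow> x $ a = coord_cut R d {a. W a = W c} u $ a)"
      proof (cases "k = W c")
        case True
        show ?thesis using u by (rule bexI[rotated]) (simp add: True low)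
      next
        case False
        show ?thesis using is_subspaceD(2)[OF U] by (rule bexI[rotated]) (simp add: False)
      qed
    qed (use uk in simp)
    hence "coord_cut R d {a. W a = W c} u = vzero R d" using 0 by simp
    hence "coord_cut R d {a. W a = W c} u $ c = vzero R d $ c" by simp
    thus False using c(1) by (simp add: T_def)
  qed
  thus ?thesis using is_subspaceD(2)[OF U] by blast
qed

lemma initial_subspace_eq_kspace:
  assumes U: "is_subspace R d U" and full: "initial_subspace d W U = kspace R d"
  shows "U = kspace R d"
proof -
  define M where "M = (\<Sum>a<d. \<bar>W a\<bar>) + 1"
  have M: "\<bar>W a\<bar> < M" if "a < d" for a
    using member_le_sum[of a "{..<d}" "\<lambda>a. \<bar>W a\<bar>"] that by (simp add: M_def)
  have step: "v \<in> U" if "v \<in> kspace R d" "\<And>a. a < d \<Longrightarrow> W a < M - int n \<Longrightarrow> v $ a = \<zero>" for n v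
    using that
  proof (induction n arbitrary: v)
    case 0
    have "v = vzero R d"
    proof (rule eq_vecI)
      fix i assume "i < dim_vec (vzero R d)"
      hence "i < d" by simp
      thus "v $ i = vzero R d $ i" using 0(2)[of i] M[of i] by simp
    qed (use 0 in \<open>simp add: kspace_dim\<close>)
    thus ?case using is_subspaceD(2)[OF U] by simp
  next
    case (Suc n)
    have "v \<in> initial_subspace d W U" using Suc.prems(1) full by simp
    then obtain u where u: "u \<in> U" "\<forall>a<d. W a < M - int (Suc n) \<longrightarrow> u $ a = \<zero>"
      "\<forall>a<d. W a = M - int (Suc n) \<longrightarrow> u $ a = v $ a"
      using initial_subspaceD[of v d W U "M - int (Suc n)"] by blast
    have uk: "u \<in> kspace R d" by (rule is_subspaceD(1)[OF U u(1)])
    define w where "w = vadd R d v (vscale R d (\<ominus> \<one>) u)"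
    have "w \<in> U"
    proof (rule Suc.IH)
      show "w \<in> kspace R d" using uk Suc.prems(1) by (simp add: w_def)
      fix a assume a: "a < d" "W a < M - int n"
      have e: "u $ a = v $ a"
      proof (cases "W a = M - int (Suc n)")
        case True
        thus ?thesis using u(3) a by simp
      next
        case False
        hence "W a < M - int (Suc n)" using a by simp
        thus ?thesis using u(2) Suc.prems(2) a by simp
      qed
      show "w $ a = \<zero>" using a e Suc.prems(1) by (simp add: w_def r_neg l_minus)
    qed
    hence "vadd R d w u \<in> U" using u(1) by (rule is_subspaceD(3)[OF U])
    moreover have "vadd R d w u = v"
      using uk Suc.prems(1)
      by (intro eq_vecI) (simp_all add: w_def kspace_dim l_minus a_assoc l_neg)
    ultimately show ?case by simp
  qed
  have "v \<in> U" if v: "v \<in> kspace R d" for v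
  proof (rule step[OF v])
    fix a assume a: "a < d" "W a < M - int (nat (2 * M))"
    thus "v $ a = \<zero>" using M[OF a(1)] by simp
  qed
  thus ?thesis using is_subspaceD(1)[OF U] by blast
qed

text \<open>
  If integer weights \<open>W\<close> refine the partition and every nonzero part of a matrix between two blocks is
  homogeneous, then passing to lowest weight forms turns a subspace graded by \<open>\<pi>\<close> into one graded by
  \<open>(\<pi>, W)\<close>. It is stable again, and trivial only if the original subspace is.
\<close>

lemma block_irreducible_coarsen:
  assumes As: "As \<in> reps R m d"
    and irr: "block_irreducible R d \<pi>' As"
    and ref: "\<And>g. \<exists>h l. {a. \<pi>' a = g} = {a. \<pi> a = h} \<inter> {a. W a = (l :: int)} \<or> {a. \<pi>' a = g} = {}"
    and hom: "\<And>i a b. (i, a, b) \<in> support R d As \<Longrightarrow> W a - W b = \<omega> i (\<pi> a) (\<pi> b)"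
  shows "block_irreducible R d \<pi> As"
  unfolding block_irreducible_def
proof (intro conjI allI impI)
  show "d > 0" using irr by (simp add: block_irreducible_def)
  fix U assume st: "stable_subspace R d \<pi> As U"
  note U = stable_subspaceD(1)[OF st]
  let ?I = "initial_subspace d W U"
  note I = is_subspace_initial_subspace[OF U, of W]
  have cutI: "coord_cut R d {a. \<pi> a = g} v \<in> ?I" if "v \<in> ?I" for g v
    using initial_subspace_cut[OF U stable_subspaceD(3)[OF st] that] by simp
  have "stable_subspace R d \<pi>' As ?I"
    unfolding stable_subspace_def
  proof (intro conjI ballI allI)
    show "is_subspace R d ?I" by (rule I)
  next
    fix g v assume v: "v \<in> ?I"
    note vk = initial_subspace_subset[OF v]
    from ref[of g] obtain h l where
      "{a. \<pi>' a = g} = {a. \<pi> a = h} \<inter> {a. W a = l} \<or> {a. \<pi>' a = g} = {}" by (elim exE)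
    thus "coord_cut R d {a. \<pi>' a = g} v \<in> ?I"
    proof
      assume e: "{a. \<pi>' a = g} = {a. \<pi> a = h} \<inter> {a. W a = l}"
      have "coord_cut R d {a. \<pi>' a = g} v = coord_cut R d {a. W a = l} (coord_cut R d {a. \<pi> a = h} v)"
        unfolding e by (intro eq_vecI) simp_all
      thus ?thesis using initial_subspace_weight[OF U cutI[OF v]] by simp
    next
      assume e: "{a. \<pi>' a = g} = {}"
      have "coord_cut R d {a. \<pi>' a = g} v = vzero R d" unfolding e by (intro eq_vecI) simp_all
      thus ?thesis using is_subspaceD(2)[OF I] by simp
    qed
  next
    fix A v assume "A \<in> set As" and v: "v \<in> ?I"
    then obtain i where i: "i < m" "A = As ! i" using reps_length[OF As] by (auto simp: in_set_conv_nth)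
    have A: "A \<in> matrices R d" using reps_nth[OF As i(1)] i(2) by simp
    note vk = initial_subspace_subset[OF v]
    show "mat_act R A v \<in> ?I"
    proof (rule mat_act_mem_of_blocks[OF I vk A, where \<pi> = \<pi>])
      fix g h
      let ?v = "coord_cut R d {a. \<pi> a = g} v"
      show "coord_cut R d {a. \<pi> a = h} (mat_act R A ?v) \<in> ?I"
      proof (rule initial_subspaceI)
        fix k
        have "?v \<in> ?I" by (rule cutI[OF v])
        then obtain u where u: "u \<in> U" "\<forall>a<d. W a < k - \<omega> i h g \<longrightarrow> u $ a = \<zero>"
          "\<forall>a<d. W a = k - \<omega> i h g \<longrightarrow> u $ a = ?v $ a"
          using initial_subspaceD[of ?v d W U "k - \<omega> i h g"] by blast
        have uk: "u \<in> kspace R d" by (rule is_subspaceD(1)[OF U u(1)])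
        let ?u = "coord_cut R d {a. \<pi> a = g} u"
        have mem: "coord_cut R d {a. \<pi> a = h} (mat_act R A ?u) \<in> U"
          using stable_subspaceD(2)[OF st \<open>A \<in> set As\<close> stable_subspaceD(3)[OF st u(1)]]
          by (rule stable_subspaceD(3)[OF st])
        have wt: "W b = W a - \<omega> i h g" if "a < d" "\<pi> a = h" "b < d" "\<pi> b = g" "A $$ (a, b) \<noteq> \<zero>" for a b
        proof -
          have "(i, a, b) \<in> support R d As"
            using that i reps_length[OF As] by (intro supportI) simp_all
          thus ?thesis using hom[of i a b] that by simp
        qed
        have low: "mat_act R A ?u $ a = \<zero>" if a: "a < d" "W a < k" "\<pi> a = h" for a
        proof -
          have "mat_act R A ?u $ a = mat_act R A (vzero R d) $ a"
          proof (rule block_entry_cong[OF A _ _ a(1)])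
            fix b assume b: "b < d" "A $$ (a, b) \<noteq> \<zero>"
            show "?u $ b = vzero R d $ b"
              using wt[of a b] a b u(2) by simp
          qed (use uk in simp_all)
          thus ?thesis using a by (simp add: mat_act_zero[OF A])
        qed
        have top: "mat_act R A ?u $ a = mat_act R A ?v $ a" if a: "a < d" "W a = k" "\<pi> a = h" for a
        proof (rule block_entry_cong[OF A _ _ a(1)])
          fix b assume b: "b < d" "A $$ (a, b) \<noteq> \<zero>"
          show "?u $ b = ?v $ b"
            using wt[of a b] a b u(3) by simp
        qed (use uk vk in simp_all)
        show "\<exists>x\<in>U. (\<forall>a<d. W a < k \<longrightarrow> x $ a = \<zero>) \<and>
            (\<forall>a<d. W a = k \<longrightarrow> x $ a = coord_cut R d {a. \<pi> a = h} (mat_act R A ?v) $ a)"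
          using mem by (rule bexI[rotated]) (simp add: low top)
      qed (use A vk in simp)
    qed
  qed
  hence "?I = {vzero R d} \<or> ?I = kspace R d" using irr by (simp add: block_irreducible_def)
  thus "U = {vzero R d} \<or> U = kspace R d"
  proof
    assume "?I = {vzero R d}"
    thus ?thesis using initial_subspace_eq_zero[OF U] by simp
  next
    assume "?I = kspace R d"
    thus ?thesis using initial_subspace_eq_kspace[OF U] by simp
  qed
qed

end

lemma (in field) kspace_nontrivial_iff: "kspace R d \<noteq> {vzero R d} \<longleftrightarrow> d > 0"
proof (cases "d = 0")
  case True
  have "v = vzero R d" if "v \<in> kspace R d" for v
    using that True by (intro eq_vecI) (simp_all add: kspace_dim)
  thus ?thesis using True vec_ops_closed(3)[of d] by blast
next
  case False
  have "axis_vec R d \<one> 0 \<noteq> vzero R d"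
  proof
    assume "axis_vec R d \<one> 0 = vzero R d"
    hence "axis_vec R d \<one> 0 $ 0 = vzero R d $ 0" by simp
    thus False using False by simp
  qed
  moreover have "axis_vec R d \<one> 0 \<in> kspace R d" by simp
  ultimately show ?thesis using False by blast
qed

lemma (in field) irreducible_iff:
  "irreducible_rep R d As \<longleftrightarrow> d > 0 \<and> (\<forall>U. is_subspace R d U \<and>
    (\<forall>A\<in>set As. \<forall>u\<in>U. mat_act R A u \<in> U) \<longrightarrow> U = {vzero R d} \<or> U = kspace R d)"
  unfolding irreducible_rep_def submodule_iff_subspace coord_space_zero kspace_nontrivial_iff
    image_subset_iff by (rule refl)

lemma (in field) irreducible_iff_block_irreducible:
  assumes As: "As \<in> reps R m d"
  shows "irreducible_rep R d As \<longleftrightarrow> block_irreducible R d (\<lambda>_. 0) As"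
proof -
  have inv: "(submodule U R (coord_space R d) \<and> (\<forall>A\<in>set As. mat_act R A ` U \<subseteq> U)) \<longleftrightarrow>
      stable_subspace R d (\<lambda>_. 0) As U" for U
  proof -
    have "coord_cut R d {a. 0 = g} u \<in> U" if U: "is_subspace R d U" and u: "u \<in> U" for g :: nat and u
    proof (cases "g = 0")
      case True
      have "coord_cut R d {a. 0 = g} u = u"
        using is_subspaceD(1)[OF U u] True by (intro eq_vecI) (simp_all add: kspace_dim)
      thus ?thesis using u by simp
    next
      case False
      have "coord_cut R d {a. 0 = g} u = vzero R d"
        using False by (intro eq_vecI) simp_all
      thus ?thesis using is_subspaceD(2)[OF U] by simp
    qed
    thus ?thesis unfolding stable_subspace_def submodule_iff_subspace image_subset_iff by blast
  qed
  show ?thesis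
    unfolding irreducible_rep_def block_irreducible_def inv coord_space_zero kspace_nontrivial_iff
    by (rule refl)
qed

section \<open>Extension of scalars and rescaling of blocks\<close>

lemma map_mat_closed:
  assumes h: "h \<in> ring_hom K L" and A: "A \<in> matrices K d"
  shows "map_mat h A \<in> matrices L d"
  using matrices_dim[OF A] matrices_nth[OF A] ring_hom_closed[OF h] by (intro matricesI) simp_all

lemma map_reps_closed:
  assumes h: "h \<in> ring_hom K L" and As: "As \<in> reps K m d"
  shows "map (map_mat h) As \<in> reps L m d"
  using map_mat_closed[OF h] As by (auto simp: reps_def)

lemma field_hom_zero:
  assumes "field K" "field L" "h \<in> ring_hom K L"
  shows "h \<zero>\<^bsub>K\<^esub> = \<zero>\<^bsub>L\<^esub>"
  using assms ring_hom_zero[of h K L] by (simp add: field.is_ring cring.axioms(1) domain.axioms(1) field.axioms(1))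

lemma field_hom_eq_zero_iff:
  assumes K: "field K" and L: "field L" and h: "h \<in> ring_hom K L" and c: "c \<in> carrier K"
  shows "h c = \<zero>\<^bsub>L\<^esub> \<longleftrightarrow> c = \<zero>\<^bsub>K\<^esub>"
proof
  interpret K: field K by (rule K)
  interpret L: field L by (rule L)
  assume 0: "h c = \<zero>\<^bsub>L\<^esub>"
  show "c = \<zero>\<^bsub>K\<^esub>"
  proof (rule ccontr)
    assume "c \<noteq> \<zero>\<^bsub>K\<^esub>"
    hence u: "c \<in> Units K" using c by (simp add: K.field_Units)
    have "\<one>\<^bsub>L\<^esub> = h (c \<otimes>\<^bsub>K\<^esub> inv\<^bsub>K\<^esub> c)" using u ring_hom_one[OF h] by simp
    also have "\<dots> = h c \<otimes>\<^bsub>L\<^esub> h (inv\<^bsub>K\<^esub> c)" using u c by (intro ring_hom_mult[OF h]) simp_all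
    also have "\<dots> = \<zero>\<^bsub>L\<^esub>" using u ring_hom_closed[OF h] 0 by simp
    finally show False by simp
  qed
qed (simp add: field_hom_zero[OF K L h])

lemma map_vec_act:
  assumes K: "field K" and L: "field L" and h: "h \<in> ring_hom K L"
    and A: "A \<in> matrices K d" and v: "v \<in> kspace K d"
  shows "mat_act L (map_mat h A) (map_vec h v) = map_vec h (mat_act K A v)"
proof (rule eq_vecI)
  interpret K: field K by (rule K)
  interpret L: field L by (rule L)
  interpret ring_hom_cring K L h by (unfold_locales) (rule h)
  fix i assume "i < dim_vec (map_vec h (mat_act K A v))"
  hence i: "i < d" using K.mat_act_dim[OF A] by simp
  have "mat_act L (map_mat h A) (map_vec h v) $ i =
      (\<Oplus>\<^bsub>L\<^esub>j\<in>{..<d}. map_mat h A $$ (i, j) \<otimes>\<^bsub>L\<^esub> map_vec h v $ j)"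
    by (rule L.mat_act_nth[OF map_mat_closed[OF h A] i])
  also have "\<dots> = (\<Oplus>\<^bsub>L\<^esub>j\<in>{..<d}. h (A $$ (i, j) \<otimes>\<^bsub>K\<^esub> v $ j))"
    using A v i matrices_dim[OF A] kspace_dim[OF v] by (intro L.finsum_cong') simp_all
  also have "\<dots> = h (\<Oplus>\<^bsub>K\<^esub>j\<in>{..<d}. A $$ (i, j) \<otimes>\<^bsub>K\<^esub> v $ j)"
    using A v i by (subst hom_finsum) (simp_all add: o_def)
  finally show "mat_act L (map_mat h A) (map_vec h v) $ i = map_vec h (mat_act K A v) $ i"
    using i K.mat_act_dim[OF A] K.mat_act_nth[OF A i] by simp
next
  interpret K: field K by (rule K)
  interpret L: field L by (rule L)
  show "dim_vec (mat_act L (map_mat h A) (map_vec h v)) = dim_vec (map_vec h (mat_act K A v))"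
    using K.mat_act_dim[OF A] L.mat_act_dim[OF map_mat_closed[OF h A]] by simp
qed

lemma map_vec_axis:
  assumes "field K" "field L" "h \<in> ring_hom K L"
  shows "map_vec h (axis_vec K d \<one>\<^bsub>K\<^esub> b) = axis_vec L d \<one>\<^bsub>L\<^esub> b"
  using ring_hom_one[OF assms(3)] field_hom_zero[OF assms] by (intro eq_vecI) simp_all

lemma support_map:
  assumes "field K" "field L" "h \<in> ring_hom K L" and As: "As \<in> reps K m d"
  shows "support L d (map (map_mat h) As) = support K d As"
proof -
  have "map_mat h (As ! i) $$ (a, b) = \<zero>\<^bsub>L\<^esub> \<longleftrightarrow> (As ! i) $$ (a, b) = \<zero>\<^bsub>K\<^esub>"
    if "i < length As" "a < d" "b < d" for i a b
  proof -
    have A: "As ! i \<in> matrices K d" using reps_nth[OF As] reps_length[OF As] that by simp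
    show ?thesis
      using field_hom_eq_zero_iff[OF assms(1-3) matrices_nth[OF A that(2,3)]] that matrices_dim[OF A]
      by simp
  qed
  thus ?thesis by (auto simp: support_def)
qed

text \<open>
  The partition detects irreducibility for all tuples with support in \<open>P\<close>, over all fields: a tuple need only
  be tested against graded subspaces. Quantifying over all fields makes the notion apply to absolute
  irreducibility.
\<close>

definition good_partition :: "nat \<Rightarrow> nat \<Rightarrow> (nat \<times> nat \<times> nat) set \<Rightarrow> (nat \<Rightarrow> nat) \<Rightarrow> bool" where
  "good_partition m d P \<pi> \<longleftrightarrow> (\<forall>(L :: nat ring) Bs. field L \<longrightarrow> Bs \<in> reps L m d \<longrightarrow>
    support L d Bs \<subseteq> P \<longrightarrow> block_irreducible L d \<pi> Bs \<longrightarrow> irreducible_rep L d Bs)"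

lemma good_partition_trivial: "good_partition m d P (\<lambda>_. 0)"
  using field.irreducible_iff_block_irreducible by (auto simp: good_partition_def)

text \<open>
  Weights that are constant on each of the parts of \<open>P\<close> refine a good partition to a good one. The pair of
  labels is encoded as a number.
\<close>

lemma good_partition_refine:
  fixes W :: "nat \<Rightarrow> int"
  assumes good: "good_partition m d P \<pi>"
    and hom: "\<And>i a b. (i, a, b) \<in> P \<Longrightarrow> W a - W b = \<omega> i (\<pi> a) (\<pi> b)"
  shows "good_partition m d P (\<lambda>a. prod_encode (\<pi> a, int_encode (W a)))"
  unfolding good_partition_def
proof (intro allI impI)
  fix L :: "nat ring" and Bs
  assume L: "field L" and Bs: "Bs \<in> reps L m d" and P: "support L d Bs \<subseteq> P"
    and irr: "block_irreducible L d (\<lambda>a. prod_encode (\<pi> a, int_encode (W a))) Bs"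
  have cL: "cring L" using L by (simp add: field.axioms(1) domain.axioms(1))
  have "block_irreducible L d \<pi> Bs"
  proof (rule cring.block_irreducible_coarsen[OF cL Bs irr])
    fix g :: nat
    obtain h k where g: "g = prod_encode (h, k)" by (metis prod_decode_inverse surj_pair)
    have "{a. prod_encode (\<pi> a, int_encode (W a)) = g} = {a. \<pi> a = h} \<inter> {a. W a = int_decode k}"
      unfolding g by (auto simp: prod_encode_eq)
    thus "\<exists>h l. {a. prod_encode (\<pi> a, int_encode (W a)) = g} = {a. \<pi> a = h} \<inter> {a. W a = l} \<or>
        {a. prod_encode (\<pi> a, int_encode (W a)) = g} = {}" by blast
  next
    fix i a b assume "(i, a, b) \<in> support L d Bs"
    thus "W a - W b = \<omega> i (\<pi> a) (\<pi> b)" using P hom by blast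
  qed
  thus "irreducible_rep L d Bs" using good L Bs P by (simp add: good_partition_def)
qed

context field
begin

lemma irreducible_imp_block_irreducible:
  assumes "As \<in> reps R m d" "irreducible_rep R d As"
  shows "block_irreducible R d \<pi> As"
proof -
  have 1: "block_irreducible R d (\<lambda>_. 0) As"
    using assms irreducible_iff_block_irreducible by blast
  have "stable_subspace R d (\<lambda>_. 0) As U" if st: "stable_subspace R d \<pi> As U" for U
  proof -
    note U = stable_subspaceD(1)[OF st]
    have "coord_cut R d {a. 0 = g} u \<in> U" if u: "u \<in> U" for g :: nat and u
    proof (cases "g = 0")
      case True
      have "coord_cut R d {a. 0 = g} u = u"
        using is_subspaceD(1)[OF U u] True by (intro eq_vecI) (simp_all add: kspace_dim)
      thus ?thesis using u by simp
    next
      case False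
      have "coord_cut R d {a. 0 = g} u = vzero R d"
        using False by (intro eq_vecI) simp_all
      thus ?thesis using is_subspaceD(2)[OF U] by simp
    qed
    thus ?thesis using st by (simp add: stable_subspace_def)
  qed
  thus ?thesis using 1 by (simp add: block_irreducible_def)
qed

lemma nonzero_mult_cancel:
  assumes "a \<in> carrier R" "b \<in> carrier R" "a \<noteq> \<zero>"
  shows "inv a \<otimes> (a \<otimes> b) = b"
proof -
  have u: "a \<in> Units R" using assms by (simp add: field_Units)
  have "inv a \<otimes> (a \<otimes> b) = inv a \<otimes> a \<otimes> b" using u assms m_assoc[of "inv a" a b] by simp
  thus ?thesis using u assms by simp
qed

lemma inv_closed': "a \<in> carrier R \<Longrightarrow> a \<noteq> \<zero> \<Longrightarrow> inv a \<in> carrier R"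
  by (simp add: field_Units)

text \<open>
  A diagonal matrix \<open>t\<close> maps graded subspaces to graded subspaces, and so does multiplying the part of a
  matrix between two blocks by a nonzero scalar.
\<close>

lemma block_irreducible_twist:
  assumes As: "As \<in> reps R m d" and Bs: "Bs \<in> reps R m d"
    and irr: "block_irreducible R d \<pi> As"
    and t: "\<And>a. t a \<in> carrier R" "\<And>a. t a \<noteq> \<zero>"
    and z: "\<And>i g h. z i g h \<in> carrier R" "\<And>i g h. z i g h \<noteq> \<zero>"
    and eq: "\<And>i a b. i < m \<Longrightarrow> a < d \<Longrightarrow> b < d \<Longrightarrow>
      Bs ! i $$ (a, b) \<otimes> t b = t a \<otimes> (z i (\<pi> a) (\<pi> b) \<otimes> As ! i $$ (a, b))"
  shows "block_irreducible R d \<pi> Bs"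
  unfolding block_irreducible_def
proof (intro conjI allI impI)
  show "d > 0" using irr by (simp add: block_irreducible_def)
  fix U assume st: "stable_subspace R d \<pi> Bs U"
  note U = stable_subspaceD(1)[OF st]
  \<comment> \<open>the diagonal matrix, its inverse, and the transported subspace\<close>
  define D where "D = (\<lambda>v. vec d (\<lambda>a. t a \<otimes> v $ a))"
  define D' where "D' = (\<lambda>v. vec d (\<lambda>a. inv (t a) \<otimes> v $ a))"
  have D_nth: "D v $ a = t a \<otimes> v $ a" if "a < d" for v a using that by (simp add: D_def)
  have D'_nth: "D' v $ a = inv (t a) \<otimes> v $ a" if "a < d" for v a using that by (simp add: D'_def)
  have dims: "dim_vec (D v) = d" "dim_vec (D' v) = d" for v by (simp_all add: D_def D'_def)
  have Dc: "D v \<in> kspace R d" if "v \<in> kspace R d" for v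
    using that t by (intro kspaceI) (simp_all add: dims D_nth)
  have D'c: "D' v \<in> kspace R d" if "v \<in> kspace R d" for v
    using that t inv_closed' by (intro kspaceI) (simp_all add: dims D'_nth)
  have DD': "D (D' v) = v" if v: "v \<in> kspace R d" for v
  proof (rule kspace_eqI[OF Dc[OF D'c[OF v]] v])
    fix a assume a: "a < d"
    have "t a \<otimes> (inv (t a) \<otimes> v $ a) = inv (t a) \<otimes> (t a \<otimes> v $ a)"
      using t inv_closed' v a by (simp add: m_lcomm)
    thus "D (D' v) $ a = v $ a" using a v t by (simp add: D_nth D'_nth nonzero_mult_cancel)
  qed
  have D'D: "D' (D v) = v" if v: "v \<in> kspace R d" for v
    by (rule kspace_eqI[OF D'c[OF Dc[OF v]] v]) (use v t in \<open>simp add: D_nth D'_nth nonzero_mult_cancel\<close>)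
  define U' where "U' = {v \<in> kspace R d. D v \<in> U}"
  have U'I: "v \<in> U'" if "v \<in> kspace R d" "D v \<in> U" for v using that by (simp add: U'_def)
  have U'D: "v \<in> kspace R d" "D v \<in> U" if "v \<in> U'" for v using that by (simp_all add: U'_def)
  have D0: "D (vzero R d) = vzero R d" using t by (intro eq_vecI) (simp_all add: dims D_nth)
  have sub: "is_subspace R d U'"
    unfolding is_subspace_def
  proof (intro conjI ballI)
    show "U' \<subseteq> kspace R d" by (auto simp: U'_def)
    show "vzero R d \<in> U'" using is_subspaceD(2)[OF U] by (intro U'I) (simp_all add: D0)
  next
    fix u v assume uv: "u \<in> U'" "v \<in> U'"
    have "D (vadd R d u v) = vadd R d (D u) (D v)"
      using U'D(1)[OF uv(1)] U'D(1)[OF uv(2)] t by (intro eq_vecI) (simp_all add: dims D_nth r_distr)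
    thus "vadd R d u v \<in> U'"
      using is_subspaceD(3)[OF U U'D(2)[OF uv(1)] U'D(2)[OF uv(2)]] U'D(1)[OF uv(1)] U'D(1)[OF uv(2)]
      by (intro U'I) simp_all
  next
    fix c u assume c: "c \<in> carrier R" and u: "u \<in> U'"
    have "D (vscale R d c u) = vscale R d c (D u)"
      using U'D(1)[OF u] c t by (intro eq_vecI) (simp_all add: dims D_nth m_lcomm)
    thus "vscale R d c u \<in> U'"
      using is_subspaceD(4)[OF U c U'D(2)[OF u]] U'D(1)[OF u] c by (intro U'I) simp_all
  qed
  have D_cut: "D (coord_cut R d S v) = coord_cut R d S (D v)" for S v
    using t by (intro eq_vecI) (simp_all add: dims D_nth)
  have cutU': "coord_cut R d {a. \<pi> a = g} v \<in> U'" if v: "v \<in> U'" for g v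
    using stable_subspaceD(3)[OF st U'D(2)[OF v]] U'D(1)[OF v] by (intro U'I) (simp_all add: D_cut)
  have "stable_subspace R d \<pi> As U'"
    unfolding stable_subspace_def
  proof (intro conjI ballI allI)
    show "is_subspace R d U'" by (rule sub)
    show "coord_cut R d {a. \<pi> a = g} u \<in> U'" if "u \<in> U'" for g u by (rule cutU'[OF that])
  next
    fix A v assume "A \<in> set As" and v: "v \<in> U'"
    then obtain i where i: "i < m" "A = As ! i" using reps_length[OF As] by (auto simp: in_set_conv_nth)
    have A: "A \<in> matrices R d" using reps_nth[OF As i(1)] i(2) by simp
    have B: "Bs ! i \<in> matrices R d" using reps_nth[OF Bs i(1)] .
    have Bin: "Bs ! i \<in> set Bs" using i reps_length[OF Bs] by simp
    show "mat_act R A v \<in> U'"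
    proof (rule mat_act_mem_of_blocks[OF sub U'D(1)[OF v] A, where \<pi> = \<pi>])
      fix g h
      let ?v = "coord_cut R d {a. \<pi> a = g} v" and ?S = "{a. \<pi> a = h}"
      note vg = cutU'[OF v, of g]
      note vk = U'D(1)[OF vg] U'D(1)[OF v]
      have 1: "coord_cut R d ?S (mat_act R (Bs ! i) (D ?v)) \<in> U"
        by (rule stable_subspaceD(3)[OF st stable_subspaceD(2)[OF st Bin U'D(2)[OF vg]]])
      have 2: "mat_act R (Bs ! i) (D ?v) $ a = z i h g \<otimes> (t a \<otimes> mat_act R A ?v $ a)"
        if a: "a < d" "\<pi> a = h" for a
      proof -
        have "mat_act R (Bs ! i) (D ?v) $ a =
            (\<Oplus>b\<in>{..<d}. (z i h g \<otimes> t a) \<otimes> (A $$ (a, b) \<otimes> ?v $ b))"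
          unfolding mat_act_nth[OF B a(1)]
        proof (intro finsum_cong')
          show "(\<lambda>b. (z i h g \<otimes> t a) \<otimes> (A $$ (a, b) \<otimes> ?v $ b)) \<in> {..<d} \<rightarrow> carrier R"
            using vk A a t z by simp
          fix b assume "b \<in> {..<d}"
          hence b: "b < d" by simp
          have vb: "v $ b \<in> carrier R" using U'D(1)[OF v] b by simp
          have ab: "A $$ (a, b) \<in> carrier R" "Bs ! i $$ (a, b) \<in> carrier R" using A B a b by simp_all
          show "Bs ! i $$ (a, b) \<otimes> D ?v $ b = (z i h g \<otimes> t a) \<otimes> (A $$ (a, b) \<otimes> ?v $ b)"
          proof (cases "\<pi> b = g")
            case True
            have "Bs ! i $$ (a, b) \<otimes> (t b \<otimes> v $ b) = (Bs ! i $$ (a, b) \<otimes> t b) \<otimes> v $ b"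
              using ab t vb by (simp add: m_assoc)
            also have "\<dots> = (z i h g \<otimes> t a) \<otimes> (A $$ (a, b) \<otimes> v $ b)"
              using eq[OF i(1) a(1) b] ab t z vb a True i(2) by (simp add: m_ac)
            finally show ?thesis using b True by (simp add: D_nth)
          next
            case False
            thus ?thesis using b ab t z by (simp add: D_nth)
          qed
        qed simp
        also have "\<dots> = (z i h g \<otimes> t a) \<otimes> mat_act R A ?v $ a"
          unfolding mat_act_nth[OF A a(1)] using vk A a t z by (subst finsum_rdistr) simp_all
        finally show ?thesis using kspace_nth[OF mat_act_closed[OF A vk(1)] a(1)] t z by (simp add: m_assoc)
      qed
      have "vscale R d (inv (z i h g)) (coord_cut R d ?S (mat_act R (Bs ! i) (D ?v))) =
          D (coord_cut R d ?S (mat_act R A ?v))"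
      proof (rule eq_vecI)
        fix a assume "a < dim_vec (D (coord_cut R d ?S (mat_act R A ?v)))"
        hence a: "a < d" by (simp add: dims)
        have "t a \<otimes> mat_act R A ?v $ a \<in> carrier R"
          using kspace_nth[OF mat_act_closed[OF A vk(1)] a] t by simp
        thus "vscale R d (inv (z i h g)) (coord_cut R d ?S (mat_act R (Bs ! i) (D ?v))) $ a =
            D (coord_cut R d ?S (mat_act R A ?v)) $ a"
          using a z t inv_closed' by (simp add: D_nth 2 nonzero_mult_cancel)
      qed (simp add: dims)
      moreover have "vscale R d (inv (z i h g)) (coord_cut R d ?S (mat_act R (Bs ! i) (D ?v))) \<in> U"
        using inv_closed' z 1 by (intro is_subspaceD(4)[OF U]) simp_all
      ultimately show "coord_cut R d ?S (mat_act R A ?v) \<in> U'"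
        using vk A by (intro U'I) simp_all
    qed
  qed
  hence "U' = {vzero R d} \<or> U' = kspace R d" using irr by (simp add: block_irreducible_def)
  thus "U = {vzero R d} \<or> U = kspace R d"
  proof
    assume U': "U' = {vzero R d}"
    have "u = vzero R d" if u: "u \<in> U" for u
    proof -
      note uk = is_subspaceD(1)[OF U u]
      have "D' u \<in> U'" using D'c[OF uk] DD'[OF uk] u by (intro U'I) simp_all
      hence "D' u = vzero R d" using U' by simp
      hence "D (D' u) = vzero R d" using D0 by simp
      thus ?thesis using DD'[OF uk] by simp
    qed
    thus ?thesis using is_subspaceD(2)[OF U] by blast
  next
    assume U': "U' = kspace R d"
    have "u \<in> U" if u: "u \<in> kspace R d" for u
    proof -
      have "D' u \<in> U'" using D'c[OF u] U' by simp
      thus ?thesis using U'D(2) DD'[OF u] by fastforce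
    qed
    thus ?thesis using is_subspaceD(1)[OF U] by blast
  qed
qed

end

lemma map_mat_map_nth:
  assumes "As \<in> reps K m d" "i < m" "a < d" "b < d"
  shows "(map (map_mat h) As ! i) $$ (a, b) = h (As ! i $$ (a, b))"
  using reps_length[OF assms(1)] matrices_dim[OF reps_nth[OF assms(1,2)]] assms by simp

lemma absolutely_irreducible_twist:
  fixes K :: "nat ring"
  assumes K: "field K" and As: "As \<in> reps K m d" and Bs: "Bs \<in> reps K m d"
    and irr: "absolutely_irreducible_rep K d As"
    and good: "good_partition m d (support K d As) \<pi>"
    and t: "\<And>a. t a \<in> carrier K" "\<And>a. t a \<noteq> \<zero>\<^bsub>K\<^esub>"
    and z: "\<And>i g h. z i g h \<in> carrier K" "\<And>i g h. z i g h \<noteq> \<zero>\<^bsub>K\<^esub>"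
    and eq: "\<And>i a b. i < m \<Longrightarrow> a < d \<Longrightarrow> b < d \<Longrightarrow>
      Bs ! i $$ (a, b) \<otimes>\<^bsub>K\<^esub> t b = t a \<otimes>\<^bsub>K\<^esub> (z i (\<pi> a) (\<pi> b) \<otimes>\<^bsub>K\<^esub> As ! i $$ (a, b))"
  shows "absolutely_irreducible_rep K d Bs"
proof -
  interpret K: field K by (rule K)
  have supp: "support K d Bs \<subseteq> support K d As"
  proof
    fix x assume "x \<in> support K d Bs"
    then obtain i a b where x: "x = (i, a, b)" "i < m" "a < d" "b < d" "Bs ! i $$ (a, b) \<noteq> \<zero>\<^bsub>K\<^esub>"
      using reps_length[OF Bs] by (auto simp: support_def)
    have "Bs ! i $$ (a, b) \<otimes>\<^bsub>K\<^esub> t b \<noteq> \<zero>\<^bsub>K\<^esub>"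
      using x t matrices_nth[OF reps_nth[OF Bs x(2)] x(3,4)] by (simp add: K.integral_iff)
    hence "As ! i $$ (a, b) \<noteq> \<zero>\<^bsub>K\<^esub>"
      using eq[OF x(2-4)] t z by auto
    thus "x \<in> support K d As" using x reps_length[OF As] by (simp add: support_def)
  qed
  have main: "irreducible_rep L d (map (map_mat h) Bs)"
    if L: "field L" and h: "h \<in> ring_hom K L" and irrL: "irreducible_rep L d (map (map_mat h) As)"
    for L :: "nat ring" and h
  proof -
    interpret L: field L by (rule L)
    have AL: "map (map_mat h) As \<in> reps L m d" and BL: "map (map_mat h) Bs \<in> reps L m d"
      using map_reps_closed[OF h] As Bs by blast+
    have nz: "h c \<noteq> \<zero>\<^bsub>L\<^esub>" if "c \<in> carrier K" "c \<noteq> \<zero>\<^bsub>K\<^esub>" for c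
      using field_hom_eq_zero_iff[OF K L h that(1)] that(2) by simp
    have "block_irreducible L d \<pi> (map (map_mat h) Bs)"
    proof (rule L.block_irreducible_twist[OF AL BL L.irreducible_imp_block_irreducible[OF AL irrL],
          where t = "\<lambda>a. h (t a)" and z = "\<lambda>i g k. h (z i g k)"])
      fix i a b assume i: "i < m" "a < d" "b < d"
      have A: "As ! i $$ (a, b) \<in> carrier K" "Bs ! i $$ (a, b) \<in> carrier K"
        using matrices_nth[OF reps_nth[OF As i(1)] i(2,3)] matrices_nth[OF reps_nth[OF Bs i(1)] i(2,3)]
        by blast+
      show "map (map_mat h) Bs ! i $$ (a, b) \<otimes>\<^bsub>L\<^esub> h (t b) =
          h (t a) \<otimes>\<^bsub>L\<^esub> (h (z i (\<pi> a) (\<pi> b)) \<otimes>\<^bsub>L\<^esub> map (map_mat h) As ! i $$ (a, b))"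
        unfolding map_mat_map_nth[OF As i] map_mat_map_nth[OF Bs i]
        using arg_cong[OF eq[OF i], of h] A t(1) z(1) by (simp add: ring_hom_mult[OF h])
    qed (use t z nz ring_hom_closed[OF h] in simp_all)
    moreover have "support L d (map (map_mat h) Bs) \<subseteq> support K d As"
      using support_map[OF K L h Bs] supp by simp
    ultimately show ?thesis using good L BL by (simp add: good_partition_def)
  qed
  have 1: "irreducible_rep K d As" and 2: "\<And>L h. finite_extension K L h \<Longrightarrow> irreducible_rep L d (map (map_mat h) As)"
    using irr by (simp_all add: absolutely_irreducible_rep_def)
  have idm: "map (map_mat (\<lambda>x. x)) Cs = Cs" if "Cs \<in> reps K m d" for Cs
    by (rule map_idI) (auto intro!: eq_matI)
  have "irreducible_rep K d (map (map_mat (\<lambda>x. x)) Bs)"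
    by (rule main[OF K]) (use 1 idm[OF As] in \<open>auto simp: ring_hom_def\<close>)
  moreover have "irreducible_rep L d (map (map_mat h) Bs)" if fe: "finite_extension K L h" for L h
    using fe by (intro main 2[OF fe]) (simp_all add: finite_extension_def)
  ultimately show ?thesis using idm[OF Bs] by (simp add: absolutely_irreducible_rep_def)
qed

section \<open>Commutants\<close>

definition matrix_of :: "('a, 'c) ring_scheme \<Rightarrow> nat \<Rightarrow> ('a vec \<Rightarrow> 'a vec) \<Rightarrow> 'a mat" where
  "matrix_of K d f = mat d d (\<lambda>(i, b). f (axis_vec K d \<one>\<^bsub>K\<^esub> b) $ i)"

definition commuting :: "('a, 'c) ring_scheme \<Rightarrow> nat \<Rightarrow> 'a mat \<Rightarrow> 'a mat \<Rightarrow> bool" where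
  "commuting K d A B \<longleftrightarrow> (\<forall>v\<in>kspace K d. mat_act K A (mat_act K B v) = mat_act K B (mat_act K A v))"

definition commutant :: "('a, 'c) ring_scheme \<Rightarrow> nat \<Rightarrow> 'a mat set \<Rightarrow> 'a mat set" where
  "commutant K d S = {X \<in> matrices K d. \<forall>Y\<in>S. commuting K d X Y}"

text \<open>
  Products are formed by composing the actions, so that the ring laws are those of maps.
\<close>

definition commutant_ring :: "('a, 'c) ring_scheme \<Rightarrow> nat \<Rightarrow> 'a mat set \<Rightarrow> 'a mat ring" where
  "commutant_ring K d S = \<lparr>carrier = commutant K d S,
     mult = (\<lambda>A B. matrix_of K d (\<lambda>v. mat_act K A (mat_act K B v))),
     one = matrix_of K d (\<lambda>v. v), zero = matrix_of K d (\<lambda>v. vzero K d),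
     add = (\<lambda>A B. matrix_of K d (\<lambda>v. vadd K d (mat_act K A v) (mat_act K B v)))\<rparr>"

lemma finite_kspace: "finite (carrier K) \<Longrightarrow> finite (kspace K d)"
  and card_kspace: "card (kspace K d) = card (carrier K) ^ d"
proof -
  let ?L = "{xs. set xs \<subseteq> carrier K \<and> length xs = d}"
  have b: "bij_betw vec_of_list ?L (kspace K d)"
  proof (rule bij_betw_byWitness[where f' = list_of_vec])
    show "vec_of_list ` ?L \<subseteq> kspace K d"
      by (auto intro!: kspaceI simp: vec_of_list_index subset_iff)
    show "list_of_vec ` kspace K d \<subseteq> ?L"
    proof
      fix xs assume "xs \<in> list_of_vec ` kspace K d"
      then obtain v where v: "v \<in> kspace K d" "xs = list_of_vec v" by blast
      thus "xs \<in> ?L" using kspace_dim[OF v(1)] kspace_nth[OF v(1)]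
        by (auto simp: set_list_of_vec vec_set_def)
    qed
  qed (simp_all add: list_vec vec_list)
  show "card (kspace K d) = card (carrier K) ^ d"
  proof (cases "finite (carrier K)")
    case True
    thus ?thesis using bij_betw_same_card[OF b] card_lists_length_eq[OF True, of d] by simp
  next
    case False
    show ?thesis
    proof (cases "d = 0")
      case True
      hence "kspace K d = {vzero K d}" by (auto intro!: kspaceI eq_vecI simp: kspace_dim)
      thus ?thesis using True by simp
    next
      case d: False
      have "infinite (kspace K d)"
      proof
        assume fin: "finite (kspace K d)"
        have "carrier K \<subseteq> (\<lambda>v. v $ 0) ` kspace K d"
        proof
          fix c assume "c \<in> carrier K"
          hence "vec d (\<lambda>_. c) \<in> kspace K d" by (intro kspaceI) simp_all
          moreover have "vec d (\<lambda>_. c) $ 0 = c" using d by simp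
          ultimately show "c \<in> (\<lambda>v. v $ 0) ` kspace K d" by (metis imageI)
        qed
        thus False using fin \<open>infinite (carrier K)\<close> finite_surj by blast
      qed
      thus ?thesis using False d by simp
    qed
  qed
  show "finite (carrier K) \<Longrightarrow> finite (kspace K d)"
    using bij_betw_finite[OF b] finite_lists_length_eq by blast
qed

lemma finite_matrices:
  assumes "finite (carrier K)"
  shows "finite (matrices K d)"
proof -
  have "inj_on (\<lambda>A. map (\<lambda>i. map (\<lambda>j. A $$ (i, j)) [0..<d]) [0..<d]) (matrices K d)"
  proof (rule inj_onI)
    fix A B assume A: "A \<in> matrices K d" and B: "B \<in> matrices K d"
      and "map (\<lambda>i. map (\<lambda>j. A $$ (i, j)) [0..<d]) [0..<d] = map (\<lambda>i. map (\<lambda>j. B $$ (i, j)) [0..<d]) [0..<d]"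
    hence "A $$ (i, j) = B $$ (i, j)" if "i < d" "j < d" for i j using that by (simp add: map_eq_conv)
    thus "A = B" using matrices_dim[OF A] matrices_dim[OF B] by (intro eq_matI) simp_all
  qed
  moreover have "(\<lambda>A. map (\<lambda>i. map (\<lambda>j. A $$ (i, j)) [0..<d]) [0..<d]) ` matrices K d \<subseteq>
      {xss. set xss \<subseteq> {xs. set xs \<subseteq> carrier K \<and> length xs = d} \<and> length xss = d}"
    by auto
  moreover have "finite {xss. set xss \<subseteq> {xs. set xs \<subseteq> carrier K \<and> length xs = d} \<and> length xss = d}"
    by (intro finite_lists_length_eq assms)
  ultimately show ?thesis by (rule inj_on_finite)
qed

context cring
begin

definition linear_map :: "nat \<Rightarrow> ('a vec \<Rightarrow> 'a vec) \<Rightarrow> bool" where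
  "linear_map d f \<longleftrightarrow> (\<forall>v\<in>kspace R d. f v \<in> kspace R d) \<and>
    (\<forall>u\<in>kspace R d. \<forall>v\<in>kspace R d. f (vadd R d u v) = vadd R d (f u) (f v)) \<and>
    (\<forall>c\<in>carrier R. \<forall>v\<in>kspace R d. f (vscale R d c v) = vscale R d c (f v))"

lemma linear_mapI:
  assumes "\<And>v. v \<in> kspace R d \<Longrightarrow> f v \<in> kspace R d"
    and "\<And>u v. u \<in> kspace R d \<Longrightarrow> v \<in> kspace R d \<Longrightarrow> f (vadd R d u v) = vadd R d (f u) (f v)"
    and "\<And>c v. c \<in> carrier R \<Longrightarrow> v \<in> kspace R d \<Longrightarrow> f (vscale R d c v) = vscale R d c (f v)"
  shows "linear_map d f"
  using assms by (simp add: linear_map_def)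

lemma matrix_of:
  assumes f: "linear_map d f"
  shows "matrix_of R d f \<in> matrices R d"
    and "v \<in> kspace R d \<Longrightarrow> mat_act R (matrix_of R d f) v = f v"
proof -
  have "\<exists>A\<in>matrices R d. \<forall>v\<in>kspace R d. mat_act R A v = f v"
    using f unfolding linear_map_def by (intro exists_matrix_of_linear) blast+
  then obtain A where A: "A \<in> matrices R d" "\<forall>v\<in>kspace R d. mat_act R A v = f v" by blast
  have "matrix_of R d f = A"
  proof (rule eq_matI)
    fix i j assume "i < dim_row A" "j < dim_col A"
    hence ij: "i < d" "j < d" using matrices_dim[OF A(1)] by simp_all
    have e: "f (axis_vec R d \<one> j) = mat_act R A (axis_vec R d \<one> j)" using A(2) by simp
    show "matrix_of R d f $$ (i, j) = A $$ (i, j)"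
      using ij A(1) by (simp add: matrix_of_def e mat_act_axis)
  qed (simp_all add: matrix_of_def matrices_dim[OF A(1)])
  thus "matrix_of R d f \<in> matrices R d" "v \<in> kspace R d \<Longrightarrow> mat_act R (matrix_of R d f) v = f v"
    using A by simp_all
qed

lemma vadd_assoc:
  "u \<in> kspace R d \<Longrightarrow> v \<in> kspace R d \<Longrightarrow> w \<in> kspace R d \<Longrightarrow>
    vadd R d (vadd R d u v) w = vadd R d u (vadd R d v w)"
  by (intro eq_vecI) (simp_all add: a_assoc)

lemma vadd_comm: "u \<in> kspace R d \<Longrightarrow> v \<in> kspace R d \<Longrightarrow> vadd R d u v = vadd R d v u"
  by (intro eq_vecI) (simp_all add: a_comm)

lemma vadd_zero: "v \<in> kspace R d \<Longrightarrow> vadd R d (vzero R d) v = v"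
  by (intro eq_vecI) (simp_all add: kspace_dim)

lemma vadd_interchange:
  "u \<in> kspace R d \<Longrightarrow> v \<in> kspace R d \<Longrightarrow> w \<in> kspace R d \<Longrightarrow> x \<in> kspace R d \<Longrightarrow>
    vadd R d (vadd R d u v) (vadd R d w x) = vadd R d (vadd R d u w) (vadd R d v x)"
  by (intro eq_vecI) (simp_all add: a_ac)

lemma vscale_add:
  "c \<in> carrier R \<Longrightarrow> u \<in> kspace R d \<Longrightarrow> v \<in> kspace R d \<Longrightarrow>
    vscale R d c (vadd R d u v) = vadd R d (vscale R d c u) (vscale R d c v)"
  by (intro eq_vecI) (simp_all add: r_distr)

lemma vscale_scale:
  "c \<in> carrier R \<Longrightarrow> e \<in> carrier R \<Longrightarrow> v \<in> kspace R d \<Longrightarrow>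
    vscale R d c (vscale R d e v) = vscale R d e (vscale R d c v)"
  by (intro eq_vecI) (simp_all add: m_lcomm)

lemma linear_map_comp:
  "A \<in> matrices R d \<Longrightarrow> B \<in> matrices R d \<Longrightarrow> linear_map d (\<lambda>v. mat_act R A (mat_act R B v))"
  by (intro linear_mapI) (simp_all add: mat_act_add mat_act_scale)

lemma linear_map_add:
  "A \<in> matrices R d \<Longrightarrow> B \<in> matrices R d \<Longrightarrow> linear_map d (\<lambda>v. vadd R d (mat_act R A v) (mat_act R B v))"
  by (intro linear_mapI) (simp_all add: mat_act_add mat_act_scale vadd_interchange vscale_add)

lemma linear_map_id: "linear_map d (\<lambda>v. v)"
  by (intro linear_mapI) simp_all

lemma linear_map_zero: "linear_map d (\<lambda>v. vzero R d)"
  by (intro linear_mapI) (auto intro!: eq_vecI)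

lemma linear_map_scale: "c \<in> carrier R \<Longrightarrow> linear_map d (vscale R d c)"
  by (intro linear_mapI) (simp_all add: vscale_add vscale_scale)

lemma commutantD:
  "X \<in> commutant R d S \<Longrightarrow> X \<in> matrices R d"
  "X \<in> commutant R d S \<Longrightarrow> Y \<in> S \<Longrightarrow> v \<in> kspace R d \<Longrightarrow>
    mat_act R X (mat_act R Y v) = mat_act R Y (mat_act R X v)"
  by (simp_all add: commutant_def commuting_def)

lemma commutantI:
  assumes f: "linear_map d f" and S: "S \<subseteq> matrices R d"
    and "\<And>Y v. Y \<in> S \<Longrightarrow> v \<in> kspace R d \<Longrightarrow> f (mat_act R Y v) = mat_act R Y (f v)"
  shows "matrix_of R d f \<in> commutant R d S"
proof -
  have "mat_act R (matrix_of R d f) (mat_act R Y v) = mat_act R Y (mat_act R (matrix_of R d f) v)"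
    if "Y \<in> S" "v \<in> kspace R d" for Y v
  proof -
    have Y: "Y \<in> matrices R d" using that(1) S by blast
    show ?thesis using that Y by (simp add: matrix_of(2)[OF f] assms(3))
  qed
  thus ?thesis using matrix_of(1)[OF f] by (simp add: commutant_def commuting_def)
qed

lemma commutant_closed:
  assumes S: "S \<subseteq> matrices R d" and A: "A \<in> commutant R d S" and B: "B \<in> commutant R d S"
  shows "matrix_of R d (\<lambda>v. mat_act R A (mat_act R B v)) \<in> commutant R d S"
    and "matrix_of R d (\<lambda>v. vadd R d (mat_act R A v) (mat_act R B v)) \<in> commutant R d S"
proof -
  note AB = commutantD(1)[OF A] commutantD(1)[OF B]
  show "matrix_of R d (\<lambda>v. mat_act R A (mat_act R B v)) \<in> commutant R d S"
  proof (rule commutantI[OF linear_map_comp[OF AB] S])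
    fix Y v assume Y: "Y \<in> S" and v: "v \<in> kspace R d"
    have "mat_act R A (mat_act R B (mat_act R Y v)) = mat_act R A (mat_act R Y (mat_act R B v))"
      by (simp only: commutantD(2)[OF B Y v])
    also have "\<dots> = mat_act R Y (mat_act R A (mat_act R B v))"
      using AB v by (intro commutantD(2)[OF A Y]) simp
    finally show "mat_act R A (mat_act R B (mat_act R Y v)) = mat_act R Y (mat_act R A (mat_act R B v))" .
  qed
  show "matrix_of R d (\<lambda>v. vadd R d (mat_act R A v) (mat_act R B v)) \<in> commutant R d S"
  proof (rule commutantI[OF linear_map_add[OF AB] S])
    fix Y v assume Y: "Y \<in> S" and v: "v \<in> kspace R d"
    have "Y \<in> matrices R d" using Y S by blast
    thus "vadd R d (mat_act R A (mat_act R Y v)) (mat_act R B (mat_act R Y v)) =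
        mat_act R Y (vadd R d (mat_act R A v) (mat_act R B v))"
      using AB v by (simp add: commutantD(2)[OF A Y v] commutantD(2)[OF B Y v] mat_act_add)
  qed
qed

lemma scalar_in_commutant:
  assumes "S \<subseteq> matrices R d" "c \<in> carrier R"
  shows "matrix_of R d (vscale R d c) \<in> commutant R d S"
  using assms by (intro commutantI linear_map_scale) (auto simp: mat_act_scale)

lemma vscale_minus_one:
  assumes "v \<in> kspace R d"
  shows "vadd R d (vscale R d (\<ominus> \<one>) v) v = vzero R d"
  using assms by (intro eq_vecI) (simp_all add: l_minus l_neg)

lemma ring_commutant_ring:
  assumes S: "S \<subseteq> matrices R d"
  shows "ring (commutant_ring R d S)"
proof -
  let ?C = "commutant R d S"
  let ?mul = "\<lambda>A B. matrix_of R d (\<lambda>v. mat_act R A (mat_act R B v))"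
  let ?add = "\<lambda>A B. matrix_of R d (\<lambda>v. vadd R d (mat_act R A v) (mat_act R B v))"
  let ?one = "matrix_of R d (\<lambda>v. v)" and ?zero = "matrix_of R d (\<lambda>v. vzero R d)"
  have one: "?one \<in> ?C" by (rule commutantI[OF linear_map_id S]) simp
  have zero: "?zero \<in> ?C"
    by (rule commutantI[OF linear_map_zero S]) (use S in \<open>auto simp: mat_act_zero\<close>)
  note M = commutantD(1)
  have act_mul: "mat_act R (?mul A B) v = mat_act R A (mat_act R B v)"
    and act_add: "mat_act R (?add A B) v = vadd R d (mat_act R A v) (mat_act R B v)"
    if "A \<in> ?C" "B \<in> ?C" "v \<in> kspace R d" for A B v
    using matrix_of(2)[OF linear_map_comp[OF M[OF that(1)] M[OF that(2)]] that(3)]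
      matrix_of(2)[OF linear_map_add[OF M[OF that(1)] M[OF that(2)]] that(3)] by simp_all
  have act_one: "mat_act R ?one v = v" and act_zero: "mat_act R ?zero v = vzero R d"
    if "v \<in> kspace R d" for v
    using matrix_of(2)[OF linear_map_id that] matrix_of(2)[OF linear_map_zero that] by simp_all
  have act_in: "mat_act R A v \<in> kspace R d" if "A \<in> ?C" "v \<in> kspace R d" for A v
    using M[OF that(1)] that(2) by simp
  note cl = commutant_closed[OF S]
  have eqI: "A = B" if "A \<in> ?C" "B \<in> ?C" "\<And>v. v \<in> kspace R d \<Longrightarrow> mat_act R A v = mat_act R B v" for A B
    using that by (intro matrices_eqI[OF M M])
  have eqs: "?add (?add A B) C = ?add A (?add B C)" "?add A B = ?add B A" "?add ?zero A = A"
      "?mul (?mul A B) C = ?mul A (?mul B C)" "?mul ?one A = A" "?mul A ?one = A"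
      "?mul (?add A B) C = ?add (?mul A C) (?mul B C)" "?mul C (?add A B) = ?add (?mul C A) (?mul C B)"
    if ABC: "A \<in> ?C" "B \<in> ?C" "C \<in> ?C" for A B C
  proof -
    note c = cl one zero ABC
    note r = act_mul act_add act_one act_zero act_in vadd_assoc vadd_zero
    show "?add (?add A B) C = ?add A (?add B C)" by (rule eqI) (simp_all only: c r)
    show "?add A B = ?add B A"
      by (rule eqI) (simp_all only: c r vadd_comm[OF act_in[OF ABC(1)] act_in[OF ABC(2)]])
    show "?add ?zero A = A" "?mul (?mul A B) C = ?mul A (?mul B C)" "?mul ?one A = A" "?mul A ?one = A"
      "?mul (?add A B) C = ?add (?mul A C) (?mul B C)"
      by (rule eqI, simp_all only: c r)+
    show "?mul C (?add A B) = ?add (?mul C A) (?mul C B)"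
      by (rule eqI) (simp_all only: c r mat_act_add[OF M[OF ABC(3)]])
  qed
  have neg: "\<exists>B\<in>?C. ?add B A = ?zero" if A: "A \<in> ?C" for A
  proof
    let ?n = "matrix_of R d (vscale R d (\<ominus> \<one>))"
    have n: "?n \<in> ?C" by (rule scalar_in_commutant[OF S]) simp
    have act_n: "mat_act R ?n v = vscale R d (\<ominus> \<one>) v" if "v \<in> kspace R d" for v
      using that by (intro matrix_of(2) linear_map_scale) simp_all
    show "?mul ?n A \<in> ?C" by (rule cl(1)[OF n A])
    show "?add (?mul ?n A) A = ?zero"
    proof (rule eqI)
      fix v assume v: "v \<in> kspace R d"
      show "mat_act R (?add (?mul ?n A) A) v = mat_act R ?zero v"
        using vscale_minus_one[OF act_in[OF A v]]
        by (simp only: act_add[OF cl(1)[OF n A] A v] act_mul[OF n A v] act_n[OF act_in[OF A v]] act_zero[OF v])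
    qed (rule cl(2)[OF cl(1)[OF n A] A] zero)+
  qed
  show ?thesis
  proof (rule ringI)
    show "abelian_group (commutant_ring R d S)"
      by (rule abelian_groupI; simp only: commutant_ring_def ring.simps monoid.simps partial_object.simps)
        (rule cl zero eqs neg; assumption)+
    show "monoid (commutant_ring R d S)"
      by (rule monoidI; simp only: commutant_ring_def ring.simps monoid.simps partial_object.simps)
        (rule cl one eqs; assumption)+
  qed (simp only: commutant_ring_def ring.simps monoid.simps partial_object.simps; rule eqs; assumption)+
qed

end

section \<open>Schur's lemma\<close>

text \<open>
  A finite field is spanned by its finitely many elements over any subfield.
\<close>

lemma finite_field_extension:
  fixes K L :: "nat ring"
  assumes K: "field K" and L: "field L" and h: "h \<in> ring_hom K L" and fin: "finite (carrier L)"
  shows "finite_extension K L h"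
proof -
  interpret K: field K by (rule K)
  interpret L: field L by (rule L)
  interpret hom: ring_hom_ring K L h by (rule ring_hom_ringI2[OF K.is_ring L.is_ring h])
  have sub: "subfield (h ` carrier K) L"
    using hom.img_is_subfield(2)[OF K.carrier_is_subfield] L.one_not_zero by simp
  obtain Us where Us: "set Us = carrier L" using finite_list[OF fin] by blast
  have "L.Span (h ` carrier K) Us \<subseteq> carrier L"
    using L.Span_in_carrier[OF subfieldE(3)[OF sub]] Us by simp
  moreover have "carrier L \<subseteq> L.Span (h ` carrier K) Us"
    by (rule L.Span_base_incl[OF sub, of Us, unfolded Us, OF order_refl])
  ultimately have "L.Span (h ` carrier K) Us = carrier L" by blast
  hence "L.finite_dimension (h ` carrier K) (carrier L)"
    using L.Span_finite_dimension[OF sub, of Us] Us by simp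
  thus ?thesis using L h by (simp add: finite_extension_def)
qed

context field
begin

text \<open>
  The kernel of an element of the commutant is a subrepresentation, hence zero, and the space is finite.
\<close>

lemma commutant_nonzero_bij:
  assumes fin: "finite (carrier R)" and As: "As \<in> reps R m d" and irr: "irreducible_rep R d As"
    and S: "set As \<subseteq> S" "S \<subseteq> matrices R d" and X: "X \<in> commutant R d S"
    and nz: "X \<noteq> matrix_of R d (\<lambda>v. vzero R d)"
  shows "bij_betw (mat_act R X) (kspace R d) (kspace R d)"
proof -
  note XM = commutantD(1)[OF X]
  have birr: "block_irreducible R d (\<lambda>_. 0) As"
    using irreducible_imp_block_irreducible[OF As irr] .
  define U where "U = {v \<in> kspace R d. mat_act R X v = vzero R d}"
  have "is_subspace R d U"
    unfolding is_subspace_def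
  proof (intro conjI ballI)
    show "U \<subseteq> kspace R d" "vzero R d \<in> U" by (auto simp: U_def mat_act_zero[OF XM])
    show "vadd R d u v \<in> U" if "u \<in> U" "v \<in> U" for u v
      using that by (simp add: U_def mat_act_add[OF XM] vadd_zero)
    show "vscale R d c u \<in> U" if "c \<in> carrier R" "u \<in> U" for c u
      using that by (auto simp: U_def mat_act_scale[OF XM] intro!: eq_vecI)
  qed
  moreover have "mat_act R A u \<in> U" if A: "A \<in> set As" and u: "u \<in> U" for A u
  proof -
    have "A \<in> matrices R d" "A \<in> S" using A S by blast+
    thus ?thesis using u commutantD(2)[OF X \<open>A \<in> S\<close>, of u] by (simp add: U_def mat_act_zero)
  qed
  moreover have "coord_cut R d {a. 0 = g} u \<in> U" if u: "u \<in> U" for u and g :: nat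
  proof (cases "g = 0")
    have uk: "u \<in> kspace R d" using u by (simp add: U_def)
    case True
    have "coord_cut R d {a. 0 = g} u = u"
      using uk True by (intro eq_vecI) (simp_all add: kspace_dim)
    thus ?thesis using u by simp
  next
    case False
    have "coord_cut R d {a. 0 = g} u = vzero R d"
      using False by (intro eq_vecI) simp_all
    thus ?thesis by (simp add: U_def mat_act_zero[OF XM])
  qed
  ultimately have "stable_subspace R d (\<lambda>_. 0) As U" by (simp add: stable_subspace_def)
  hence alt: "U = {vzero R d} \<or> U = kspace R d" using birr by (simp add: block_irreducible_def)
  have "U \<noteq> kspace R d"
  proof
    assume U: "U = kspace R d"
    have "X = matrix_of R d (\<lambda>v. vzero R d)"
    proof (rule matrices_eqI[OF XM matrix_of(1)[OF linear_map_zero]])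
      fix v assume v: "v \<in> kspace R d"
      hence "v \<in> U" using U by simp
      thus "mat_act R X v = mat_act R (matrix_of R d (\<lambda>v. vzero R d)) v"
        using v by (simp add: matrix_of(2)[OF linear_map_zero] U_def)
    qed
    thus False using nz by contradiction
  qed
  hence U0: "U = {vzero R d}" using alt by blast
  have inj: "inj_on (mat_act R X) (kspace R d)"
  proof (rule inj_onI)
    fix u v assume u: "u \<in> kspace R d" and v: "v \<in> kspace R d" and e: "mat_act R X u = mat_act R X v"
    define w where "w = vadd R d (vscale R d (\<ominus> \<one>) v) u"
    have w: "w \<in> kspace R d" using u v by (simp add: w_def)
    have "mat_act R X w = vadd R d (vscale R d (\<ominus> \<one>) (mat_act R X v)) (mat_act R X v)"
      using u v by (simp add: w_def mat_act_add[OF XM] mat_act_scale[OF XM] e)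
    also have "\<dots> = vzero R d" using XM v by (intro vscale_minus_one) simp
    finally have "w \<in> U" using w by (simp add: U_def)
    hence w0: "w = vzero R d" using U0 by simp
    show "u = v"
    proof (rule kspace_eqI[OF u v])
      fix i assume i: "i < d"
      have "\<ominus> (v $ i) \<oplus> u $ i = \<zero>"
        using arg_cong[OF w0, of "\<lambda>x. x $ i"] i u v by (simp add: w_def l_minus)
      thus "u $ i = v $ i"
        using i u v minus_equality[of "u $ i" "\<ominus> (v $ i)"] by (simp add: a_comm)
    qed
  qed
  moreover have "mat_act R X ` kspace R d \<subseteq> kspace R d" using XM by auto
  ultimately show ?thesis
    using endo_inj_surj[OF finite_kspace[OF fin]] by (simp add: bij_betw_def)
qed

lemma commutant_inverse:
  assumes X: "X \<in> commutant R d S" and S: "S \<subseteq> matrices R d"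
    and bij: "bij_betw (mat_act R X) (kspace R d) (kspace R d)"
  shows "\<exists>Y\<in>commutant R d S. (\<forall>v\<in>kspace R d. mat_act R X (mat_act R Y v) = v) \<and>
    (\<forall>v\<in>kspace R d. mat_act R Y (mat_act R X v) = v)"
proof -
  note XM = commutantD(1)[OF X]
  define f where "f = inv_into (kspace R d) (mat_act R X)"
  have fX: "f (mat_act R X v) = v" if "v \<in> kspace R d" for v
    using bij_betw_inv_into_left[OF bij that] by (simp add: f_def)
  have Xf: "mat_act R X (f v) = v" if "v \<in> kspace R d" for v
    using bij_betw_inv_into_right[OF bij that] by (simp add: f_def)
  have fc: "f v \<in> kspace R d" if "v \<in> kspace R d" for v
    using bij_betw_inv_into[OF bij] that by (auto simp: f_def bij_betw_def)
  have lin: "linear_map d f"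
  proof (rule linear_mapI)
    show "f v \<in> kspace R d" if "v \<in> kspace R d" for v by (rule fc[OF that])
    fix u v assume u: "u \<in> kspace R d" and v: "v \<in> kspace R d"
    have "f (vadd R d u v) = f (mat_act R X (vadd R d (f u) (f v)))"
      using u v fc by (simp add: mat_act_add[OF XM] Xf)
    thus "f (vadd R d u v) = vadd R d (f u) (f v)" using u v fc by (simp add: fX)
  next
    fix c v assume c: "c \<in> carrier R" and v: "v \<in> kspace R d"
    have "f (vscale R d c v) = f (mat_act R X (vscale R d c (f v)))"
      using c v fc by (simp add: mat_act_scale[OF XM] Xf)
    thus "f (vscale R d c v) = vscale R d c (f v)" using c v fc by (simp add: fX)
  qed
  have "matrix_of R d f \<in> commutant R d S"
  proof (rule commutantI[OF lin S])
    fix Y v assume Y: "Y \<in> S" and v: "v \<in> kspace R d"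
    have YM: "Y \<in> matrices R d" using Y S by blast
    have "mat_act R X (mat_act R Y (f v)) = mat_act R Y v"
      using commutantD(2)[OF X Y fc[OF v]] Xf[OF v] by simp
    hence "f (mat_act R Y v) = f (mat_act R X (mat_act R Y (f v)))" by simp
    also have "\<dots> = mat_act R Y (f v)" using YM fc[OF v] by (intro fX) simp
    finally show "f (mat_act R Y v) = mat_act R Y (f v)" .
  qed
  moreover have "mat_act R X (mat_act R (matrix_of R d f) v) = v" if "v \<in> kspace R d" for v
    using that by (simp add: matrix_of(2)[OF lin] Xf)
  moreover have "mat_act R (matrix_of R d f) (mat_act R X v) = v" if "v \<in> kspace R d" for v
    using that XM by (simp add: matrix_of(2)[OF lin] fX)
  ultimately show ?thesis by (intro bexI[of _ "matrix_of R d f"] conjI ballI)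
qed

text \<open>
  The matrices commuting with \<open>S\<close> and with its commutant form the centre of the commutant, and by Schur's
  lemma the nonzero ones are invertible.
\<close>

lemma field_bicommutant:
  assumes fin: "finite (carrier R)" and As: "As \<in> reps R m d" and irr: "irreducible_rep R d As"
    and S: "set As \<subseteq> S" "S \<subseteq> matrices R d"
  shows "field (commutant_ring R d (S \<union> commutant R d S))"
proof -
  let ?T = "S \<union> commutant R d S"
  let ?Z = "commutant R d ?T"
  have T: "?T \<subseteq> matrices R d" using S(2) by (auto dest: commutantD(1))
  have TA: "set As \<subseteq> ?T" using S(1) by blast
  have ZS: "X \<in> commutant R d S" if "X \<in> ?Z" for X
    using that by (simp add: commutant_def)
  have comm: "mat_act R X (mat_act R Y v) = mat_act R Y (mat_act R X v)"
    if "X \<in> ?Z" "Y \<in> ?Z" "v \<in> kspace R d" for X Y v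
    using commutantD(2)[OF that(1) _ that(3), of Y] ZS[OF that(2)] by simp
  note simps = commutant_ring_def ring.simps monoid.simps partial_object.simps
  have ring: "ring (commutant_ring R d ?T)" by (rule ring_commutant_ring[OF T])
  have "comm_monoid (commutant_ring R d ?T)"
  proof (rule monoid.monoid_comm_monoidI)
    show "monoid (commutant_ring R d ?T)" using ring by (simp add: ring.axioms(2))
    fix X Y assume "X \<in> carrier (commutant_ring R d ?T)" "Y \<in> carrier (commutant_ring R d ?T)"
    hence X: "X \<in> ?Z" and Y: "Y \<in> ?Z" by (simp_all only: simps)
    have "matrix_of R d (\<lambda>v. mat_act R X (mat_act R Y v)) = matrix_of R d (\<lambda>v. mat_act R Y (mat_act R X v))"
      by (rule matrices_eqI[where d = d]; (intro matrix_of(1) linear_map_comp commutantD(1)[OF X] commutantD(1)[OF Y])?)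
        (simp add: matrix_of(2) linear_map_comp commutantD(1)[OF X] commutantD(1)[OF Y] comm[OF X Y])
    thus "X \<otimes>\<^bsub>commutant_ring R d ?T\<^esub> Y = Y \<otimes>\<^bsub>commutant_ring R d ?T\<^esub> X"
      by (simp only: simps)
  qed
  hence cr: "cring (commutant_ring R d ?T)" using ring by (simp add: cring_def)
  have d: "d > 0"
    using irreducible_imp_block_irreducible[OF As irr, of "\<lambda>_. 0"] by (simp add: block_irreducible_def)
  show ?thesis
  proof (rule cring.cring_fieldI2[OF cr]; (simp only: simps)?)
    show "matrix_of R d (\<lambda>v. vzero R d) \<noteq> matrix_of R d (\<lambda>v. v)"
    proof
      assume e: "matrix_of R d (\<lambda>v. vzero R d) = matrix_of R d (\<lambda>v. v)"
      have "vzero R d = axis_vec R d \<one> 0"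
        using arg_cong[OF e, of "\<lambda>A. mat_act R A (axis_vec R d \<one> 0)"]
        by (simp add: matrix_of(2)[OF linear_map_zero] matrix_of(2)[OF linear_map_id])
      hence "vzero R d $ 0 = axis_vec R d \<one> 0 $ 0" by simp
      thus False using d by simp
    qed
    fix X assume X: "X \<in> ?Z" and nz: "X \<noteq> matrix_of R d (\<lambda>v. vzero R d)"
    from commutant_inverse[OF X T commutant_nonzero_bij[OF fin As irr TA T X nz]]
    obtain Y where Y: "Y \<in> ?Z" "(\<forall>v\<in>kspace R d. mat_act R X (mat_act R Y v) = v) \<and>
        (\<forall>v\<in>kspace R d. mat_act R Y (mat_act R X v) = v)" by (rule bexE)
    have "matrix_of R d (\<lambda>v. mat_act R X (mat_act R Y v)) = matrix_of R d (\<lambda>v. v)"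
      by (rule matrices_eqI[where d = d]; (intro matrix_of(1) linear_map_comp linear_map_id commutantD(1)[OF X] commutantD(1)[OF Y(1)])?)
        (simp add: matrix_of(2) linear_map_comp linear_map_id commutantD(1)[OF X] commutantD(1)[OF Y(1)] Y(2))
    thus "\<exists>Y\<in>?Z. matrix_of R d (\<lambda>v. mat_act R X (mat_act R Y v)) = matrix_of R d (\<lambda>v. v)"
      using Y(1) by (rule bexI)
  qed
qed

end

lemma (in cring) entry_eq_act_axis:
  "X \<in> matrices R d \<Longrightarrow> i < d \<Longrightarrow> b < d \<Longrightarrow> X $$ (i, b) = mat_act R X (axis_vec R d \<one> b) $ i"
  by (simp add: mat_act_axis)

text \<open>
  Let \<open>Z\<close> be the field of matrices that commute with the tuple, with \<open>\<Phi>\<close> and with everything commuting with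
  these. It contains \<open>\<Phi>\<close> and the scalars. Over the extension \<open>Z\<close> of \<open>K\<close> the multiplication map from \<open>Z^d\<close> to
  \<open>K^d\<close> has a subrepresentation as its kernel, which is proper since the map is not zero. Absolute
  irreducibility makes the map injective, and counting elements gives \<open>|Z| \<le> |K|\<close>.
\<close>

theorem absolutely_irreducible_commutant:
  fixes K :: "nat ring"
  assumes K: "field K" and fin: "finite (carrier K)" and As: "As \<in> reps K m d"
    and irr: "absolutely_irreducible_rep K d As" and \<Phi>: "\<Phi> \<in> commutant K d (set As)"
  shows "\<exists>c\<in>carrier K. \<forall>v\<in>kspace K d. mat_act K \<Phi> v = vscale K d c v"
proof -
  interpret K: field K by (rule K)
  have irrK: "irreducible_rep K d As"
    and irrL: "\<And>L h. finite_extension K L h \<Longrightarrow> irreducible_rep L d (map (map_mat h) As)"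
    using irr by (simp_all add: absolutely_irreducible_rep_def)
  have d: "d > 0"
    using K.irreducible_imp_block_irreducible[OF As irrK, of "\<lambda>_. 0"] by (simp add: block_irreducible_def)
  \<comment> \<open>adjoining \<open>\<Phi>\<close> puts it into \<open>Z\<close>, as it then commutes with all that commutes with \<open>S\<close>\<close>
  define S where "S = insert \<Phi> (set As)"
  have S: "set As \<subseteq> S" "S \<subseteq> matrices K d"
    using K.commutantD(1)[OF \<Phi>] reps_set[OF As] by (auto simp: S_def)
  define T where "T = S \<union> commutant K d S"
  have TM: "T \<subseteq> matrices K d" using S(2) by (auto simp: T_def dest: K.commutantD(1))
  define Z where "Z = commutant K d T"
  have ZM: "X \<in> matrices K d" if "X \<in> Z" for X using that by (simp add: Z_def K.commutantD(1))
  have \<Phi>Z: "\<Phi> \<in> Z"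
  proof -
    have "commuting K d \<Phi> Y" if "Y \<in> T" for Y
      using that \<Phi> by (auto simp: T_def S_def commutant_def commuting_def)
    thus ?thesis using K.commutantD(1)[OF \<Phi>] by (simp add: Z_def commutant_def)
  qed
  define Zr where "Zr = commutant_ring K d T"
  have Zf: "field Zr"
    using K.field_bicommutant[OF fin As irrK S] by (simp add: Zr_def T_def)
  have Zc: "carrier Zr = Z" by (simp add: Zr_def Z_def commutant_ring_def)
  have finZ: "finite Z" using finite_subset[OF _ finite_matrices[OF fin]] ZM by blast
  then obtain enc :: "nat mat \<Rightarrow> nat" and n where "enc ` Z = {i. i < n}" and encZ: "inj_on enc Z"
    using finite_imp_inj_to_nat_seg by blast
  hence inj: "inj_on enc (carrier Zr)" by (simp add: Zc)
  \<comment> \<open>a copy of \<open>Z\<close> on the natural numbers, as the extensions are fields there\<close>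
  define L :: "nat ring" where "L = image_ring enc Zr"
  have Lf: "field L" unfolding L_def by (rule field.inj_imp_image_ring_is_field[OF Zf inj])
  interpret L: field L by (rule Lf)
  have Lc: "carrier L = enc ` Z" by (simp add: L_def image_ring_carrier Zc)
  have enc: "enc \<in> ring_hom Zr L"
    using inj_imp_image_ring_iso[OF inj] by (simp add: L_def ring_iso_def)
  define dec where "dec = inv_into Z enc"
  have dec_enc: "dec (enc X) = X" if "X \<in> Z" for X
    using that encZ by (simp add: dec_def)
  have decZ: "dec x \<in> Z" and enc_dec: "enc (dec x) = x" if "x \<in> carrier L" for x
    using that by (simp_all add: dec_def Lc inv_into_into f_inv_into_f)
  \<comment> \<open>the scalar matrices embed \<open>K\<close> into \<open>Z\<close>\<close>
  define sc where "sc = (\<lambda>c. matrix_of K d (vscale K d c))"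
  have scZ: "sc c \<in> Z" if "c \<in> carrier K" for c
    unfolding sc_def Z_def by (rule K.scalar_in_commutant[OF TM that])
  have act_sc: "mat_act K (sc c) v = vscale K d c v" if "c \<in> carrier K" "v \<in> kspace K d" for c v
    unfolding sc_def by (rule K.matrix_of(2)[OF K.linear_map_scale[OF that(1)] that(2)])
  have Zmul: "X \<otimes>\<^bsub>Zr\<^esub> Y = matrix_of K d (\<lambda>v. mat_act K X (mat_act K Y v))"
    and Zadd: "X \<oplus>\<^bsub>Zr\<^esub> Y = matrix_of K d (\<lambda>v. vadd K d (mat_act K X v) (mat_act K Y v))"
    and Zone: "\<one>\<^bsub>Zr\<^esub> = matrix_of K d (\<lambda>v. v)" and Zzero: "\<zero>\<^bsub>Zr\<^esub> = matrix_of K d (\<lambda>v. vzero K d)" for X Y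
    by (simp_all add: Zr_def commutant_ring_def)
  have act_mul: "mat_act K (X \<otimes>\<^bsub>Zr\<^esub> Y) v = mat_act K X (mat_act K Y v)"
    and act_add: "mat_act K (X \<oplus>\<^bsub>Zr\<^esub> Y) v = vadd K d (mat_act K X v) (mat_act K Y v)"
    if "X \<in> Z" "Y \<in> Z" "v \<in> kspace K d" for X Y v
    unfolding Zmul Zadd
    using K.matrix_of(2)[OF K.linear_map_comp[OF ZM[OF that(1)] ZM[OF that(2)]] that(3)]
      K.matrix_of(2)[OF K.linear_map_add[OF ZM[OF that(1)] ZM[OF that(2)]] that(3)] by simp_all
  have act_one: "mat_act K \<one>\<^bsub>Zr\<^esub> v = v" and act_zero: "mat_act K \<zero>\<^bsub>Zr\<^esub> v = vzero K d"
    if "v \<in> kspace K d" for v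
    unfolding Zone Zzero
    using K.matrix_of(2)[OF K.linear_map_id that] K.matrix_of(2)[OF K.linear_map_zero that] by simp_all
  interpret Z: field Zr by (rule Zf)
  have mulZ: "X \<otimes>\<^bsub>Zr\<^esub> Y \<in> Z" and addZ: "X \<oplus>\<^bsub>Zr\<^esub> Y \<in> Z" if "X \<in> Z" "Y \<in> Z" for X Y
    using Z.m_closed[of X Y] Z.a_closed[of X Y] that by (simp_all add: Zc)
  have oneZ: "\<one>\<^bsub>Zr\<^esub> \<in> Z" and zeroZ: "\<zero>\<^bsub>Zr\<^esub> \<in> Z" using Z.one_closed Z.zero_closed by (simp_all add: Zc)
  have eqI: "X = Y" if "X \<in> Z" "Y \<in> Z" "\<And>v. v \<in> kspace K d \<Longrightarrow> mat_act K X v = mat_act K Y v" for X Y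
    using that by (intro K.matrices_eqI[OF ZM ZM])
  have sc: "sc \<in> ring_hom K Zr"
  proof (rule ring_hom_memI)
    fix c e assume c: "c \<in> carrier K" and e: "e \<in> carrier K"
    show "sc (c \<otimes>\<^bsub>K\<^esub> e) = sc c \<otimes>\<^bsub>Zr\<^esub> sc e"
    proof (rule eqI[OF scZ mulZ[OF scZ[OF c] scZ[OF e]]])
      fix v assume v: "v \<in> kspace K d"
      have "vscale K d (c \<otimes>\<^bsub>K\<^esub> e) v = vscale K d c (vscale K d e v)"
        using c e v by (intro eq_vecI) (simp_all add: K.m_assoc)
      thus "mat_act K (sc (c \<otimes>\<^bsub>K\<^esub> e)) v = mat_act K (sc c \<otimes>\<^bsub>Zr\<^esub> sc e) v"
        using c e v by (simp add: act_sc act_mul scZ)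
    qed (use c e in simp)
    show "sc (c \<oplus>\<^bsub>K\<^esub> e) = sc c \<oplus>\<^bsub>Zr\<^esub> sc e"
    proof (rule eqI[OF scZ addZ[OF scZ[OF c] scZ[OF e]]])
      fix v assume v: "v \<in> kspace K d"
      have "vscale K d (c \<oplus>\<^bsub>K\<^esub> e) v = vadd K d (vscale K d c v) (vscale K d e v)"
        using c e v by (intro eq_vecI) (simp_all add: K.l_distr)
      thus "mat_act K (sc (c \<oplus>\<^bsub>K\<^esub> e)) v = mat_act K (sc c \<oplus>\<^bsub>Zr\<^esub> sc e) v"
        using c e v by (simp add: act_sc act_add scZ)
    qed (use c e in simp)
  next
    show "sc \<one>\<^bsub>K\<^esub> = \<one>\<^bsub>Zr\<^esub>"
    proof (rule eqI[OF scZ oneZ])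
      fix v assume v: "v \<in> kspace K d"
      have "vscale K d \<one>\<^bsub>K\<^esub> v = v" using v by (intro eq_vecI) (simp_all add: kspace_dim)
      thus "mat_act K (sc \<one>\<^bsub>K\<^esub>) v = mat_act K \<one>\<^bsub>Zr\<^esub> v" using v by (simp add: act_sc act_one)
    qed simp
  qed (simp add: scZ Zc)
  define h where "h = (\<lambda>c. enc (sc c))"
  have h: "h \<in> ring_hom K L" using ring_hom_trans[OF sc enc] by (simp add: h_def comp_def)
  have fe: "finite_extension K L h"
    using finite_field_extension[OF K Lf h] finZ by (simp add: Lc)
  have irr': "irreducible_rep L d (map (map_mat h) As)" by (rule irrL[OF fe])
  have AL: "map (map_mat h) As \<in> reps L m d" by (rule map_reps_closed[OF h As])
  have dec_add: "dec (x \<oplus>\<^bsub>L\<^esub> y) = dec x \<oplus>\<^bsub>Zr\<^esub> dec y"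
    and dec_mul: "dec (x \<otimes>\<^bsub>L\<^esub> y) = dec x \<otimes>\<^bsub>Zr\<^esub> dec y" if x: "x \<in> carrier L" and y: "y \<in> carrier L" for x y
  proof -
    have "x \<oplus>\<^bsub>L\<^esub> y = enc (dec x \<oplus>\<^bsub>Zr\<^esub> dec y)" "x \<otimes>\<^bsub>L\<^esub> y = enc (dec x \<otimes>\<^bsub>Zr\<^esub> dec y)"
      using ring_hom_add[OF enc, of "dec x" "dec y"] ring_hom_mult[OF enc, of "dec x" "dec y"] decZ[OF x] decZ[OF y]
      by (simp_all add: Zc enc_dec x y)
    thus "dec (x \<oplus>\<^bsub>L\<^esub> y) = dec x \<oplus>\<^bsub>Zr\<^esub> dec y" "dec (x \<otimes>\<^bsub>L\<^esub> y) = dec x \<otimes>\<^bsub>Zr\<^esub> dec y"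
      using decZ[OF x] decZ[OF y] by (simp_all add: dec_enc mulZ addZ)
  qed
  have dec_zero: "dec \<zero>\<^bsub>L\<^esub> = \<zero>\<^bsub>Zr\<^esub>" and dec_one: "dec \<one>\<^bsub>L\<^esub> = \<one>\<^bsub>Zr\<^esub>"
    using dec_enc[OF zeroZ] dec_enc[OF oneZ] by (simp_all add: L_def image_ring_zero image_ring_one)
  have dec_h: "dec (h c) = sc c" if "c \<in> carrier K" for c using that by (simp add: h_def dec_enc scZ)
  let ?e = "axis_vec K d \<one>\<^bsub>K\<^esub>"
  \<comment> \<open>multiplication: the sum of the \<open>b\<close>-th columns of the matrices \<open>u b\<close>\<close>
  define \<mu> where "\<mu> = (\<lambda>u. vec d (\<lambda>i. \<Oplus>\<^bsub>K\<^esub>b\<in>{..<d}. dec (u $ b) $$ (i, b)))"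
  have \<mu>_dim: "dim_vec (\<mu> u) = d" for u by (simp add: \<mu>_def)
  have \<mu>_nth: "\<mu> u $ i = (\<Oplus>\<^bsub>K\<^esub>b\<in>{..<d}. dec (u $ b) $$ (i, b))" if "i < d" for u i
    using that by (simp add: \<mu>_def)
  have ent: "dec x $$ (i, b) \<in> carrier K" if "x \<in> carrier L" "i < d" "b < d" for x i b
    using matrices_nth[OF ZM[OF decZ]] that by simp
  have entu: "dec (u $ b) $$ (i, b) \<in> carrier K" if "u \<in> kspace L d" "i < d" "b < d" for u i b
    using ent[OF kspace_nth[OF that(1,3)] that(2,3)] .
  have \<mu>c: "\<mu> u \<in> kspace K d" if u: "u \<in> kspace L d" for u
    using entu[OF u] by (intro kspaceI) (simp_all add: \<mu>_dim \<mu>_nth)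
  have \<mu>_add: "\<mu> (vadd L d u w) = vadd K d (\<mu> u) (\<mu> w)" if u: "u \<in> kspace L d" and w: "w \<in> kspace L d" for u w
  proof (rule eq_vecI)
    fix i assume "i < dim_vec (vadd K d (\<mu> u) (\<mu> w))"
    hence i: "i < d" by simp
    have "dec (vadd L d u w $ b) $$ (i, b) = dec (u $ b) $$ (i, b) \<oplus>\<^bsub>K\<^esub> dec (w $ b) $$ (i, b)"
      if b: "b < d" for b
    proof -
      have c: "u $ b \<in> carrier L" "w $ b \<in> carrier L" using u w b by simp_all
      note z = decZ[OF c(1)] decZ[OF c(2)]
      show ?thesis
        using i b by (simp add: dec_add[OF c] K.entry_eq_act_axis[OF ZM[OF addZ[OF z]]] act_add[OF z]
          K.entry_eq_act_axis[OF ZM[OF z(1)]] K.entry_eq_act_axis[OF ZM[OF z(2)]])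
    qed
    hence "\<mu> (vadd L d u w) $ i =
        (\<Oplus>\<^bsub>K\<^esub>b\<in>{..<d}. dec (u $ b) $$ (i, b) \<oplus>\<^bsub>K\<^esub> dec (w $ b) $$ (i, b))"
      unfolding \<mu>_nth[OF i] using entu[OF u i] entu[OF w i] by (intro K.finsum_cong') simp_all
    also have "\<dots> = \<mu> u $ i \<oplus>\<^bsub>K\<^esub> \<mu> w $ i"
      unfolding \<mu>_nth[OF i] using entu[OF u i] entu[OF w i] by (intro K.finsum_addf) simp_all
    finally show "\<mu> (vadd L d u w) $ i = vadd K d (\<mu> u) (\<mu> w) $ i" using i by simp
  qed (simp add: \<mu>_dim)
  have \<mu>_axis: "\<mu> (axis_vec L d c b) = mat_act K (dec c) (?e b)" if c: "c \<in> carrier L" and b: "b < d" for c b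
  proof (rule eq_vecI)
    note cz = ZM[OF decZ[OF c]]
    fix i assume "i < dim_vec (mat_act K (dec c) (?e b))"
    hence i: "i < d" using K.mat_act_dim[OF cz] by simp
    have "\<mu> (axis_vec L d c b) $ i = (\<Oplus>\<^bsub>K\<^esub>a\<in>{..<d}. if b = a then dec c $$ (i, a) else \<zero>\<^bsub>K\<^esub>)"
      unfolding \<mu>_nth[OF i]
    proof (intro K.finsum_cong')
      show "(\<lambda>a. if b = a then dec c $$ (i, a) else \<zero>\<^bsub>K\<^esub>) \<in> {..<d} \<rightarrow> carrier K"
        using ent[OF c i] by simp
      fix a assume "a \<in> {..<d}"
      hence a: "a < d" by simp
      have "\<zero>\<^bsub>Zr\<^esub> $$ (i, a) = \<zero>\<^bsub>K\<^esub>"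
        using i a by (simp add: K.entry_eq_act_axis[OF ZM[OF zeroZ]] act_zero)
      thus "dec (axis_vec L d c b $ a) $$ (i, a) = (if b = a then dec c $$ (i, a) else \<zero>\<^bsub>K\<^esub>)"
        using a by (simp add: dec_zero)
    qed simp
    also have "\<dots> = dec c $$ (i, b)"
      using K.finsum_singleton[of b "{..<d}" "\<lambda>a. dec c $$ (i, a)"] b ent[OF c i] by simp
    also have "\<dots> = mat_act K (dec c) (?e b) $ i" by (rule K.entry_eq_act_axis[OF cz i b])
    finally show "\<mu> (axis_vec L d c b) $ i = mat_act K (dec c) (?e b) $ i" .
  qed (simp add: \<mu>_dim K.mat_act_dim[OF ZM[OF decZ[OF c]]])
  have \<mu>_zero: "\<mu> (vzero L d) = vzero K d"
  proof -
    have "vzero L d = axis_vec L d \<zero>\<^bsub>L\<^esub> 0" by (intro eq_vecI) simp_all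
    hence "\<mu> (vzero L d) = mat_act K (dec \<zero>\<^bsub>L\<^esub>) (?e 0)" using \<mu>_axis[of "\<zero>\<^bsub>L\<^esub>" 0] d by simp
    thus ?thesis by (simp add: dec_zero act_zero)
  qed
  have \<mu>_scale: "\<mu> (vscale L d x u) = mat_act K (dec x) (\<mu> u)" if x: "x \<in> carrier L" and u: "u \<in> kspace L d" for x u
    using u
  proof (induction u rule: L.kspace_induct)
    case zero
    have "vscale L d x (vzero L d) = vzero L d" using x by (intro eq_vecI) simp_all
    thus ?case by (simp add: \<mu>_zero K.mat_act_zero[OF ZM[OF decZ[OF x]]])
  next
    case (single c b)
    have "\<mu> (vscale L d x (axis_vec L d c b)) = mat_act K (dec (x \<otimes>\<^bsub>L\<^esub> c)) (?e b)"
      using x single by (simp add: L.axis_vec_scale \<mu>_axis)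
    also have "\<dots> = mat_act K (dec x) (mat_act K (dec c) (?e b))"
      by (simp add: dec_mul[OF x single(1)] act_mul[OF decZ[OF x] decZ[OF single(1)]])
    finally show ?case using single by (simp add: \<mu>_axis)
  next
    case (add u w)
    have "\<mu> (vscale L d x (vadd L d u w)) = vadd K d (\<mu> (vscale L d x u)) (\<mu> (vscale L d x w))"
      using x add(1,2) by (simp add: L.vscale_add \<mu>_add)
    also have "\<dots> = mat_act K (dec x) (vadd K d (\<mu> u) (\<mu> w))"
      using K.mat_act_add[OF ZM[OF decZ[OF x]] \<mu>c[OF add(1)] \<mu>c[OF add(2)]] by (simp add: add.IH)
    finally show ?case using add(1,2) by (simp add: \<mu>_add)
  qed
  have \<mu>_rep: "\<mu> (mat_act L (map_mat h A) u) = mat_act K A (\<mu> u)"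
    if A: "A \<in> set As" and u: "u \<in> kspace L d" for A u
    using u
  proof (induction u rule: L.kspace_induct)
    case zero
    show ?case using reps_set[OF As A] map_mat_closed[OF h reps_set[OF As A]]
      by (simp add: L.mat_act_zero K.mat_act_zero \<mu>_zero)
  next
    case (add u w)
    note AM = reps_set[OF As A]
    note hA = map_mat_closed[OF h AM]
    have "\<mu> (mat_act L (map_mat h A) (vadd L d u w)) =
        vadd K d (\<mu> (mat_act L (map_mat h A) u)) (\<mu> (mat_act L (map_mat h A) w))"
      using add(1,2) hA by (simp add: L.mat_act_add \<mu>_add)
    also have "\<dots> = mat_act K A (vadd K d (\<mu> u) (\<mu> w))"
      using K.mat_act_add[OF AM \<mu>c[OF add(1)] \<mu>c[OF add(2)]] by (simp add: add.IH)
    finally show ?case using add(1,2) by (simp add: \<mu>_add)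
  next
    case (single c b)
    note AM = reps_set[OF As A]
    note hA = map_mat_closed[OF h AM]
    note cz = decZ[OF single(1)]
    have AT: "A \<in> T" using A by (simp add: T_def S_def)
    show ?case
    proof (rule kspace_eqI)
      show "\<mu> (mat_act L (map_mat h A) (axis_vec L d c b)) \<in> kspace K d"
        using hA single by (intro \<mu>c) simp
      show "mat_act K A (\<mu> (axis_vec L d c b)) \<in> kspace K d"
        using AM single by (intro K.mat_act_closed \<mu>c) simp_all
      fix i assume i: "i < d"
      have "\<mu> (mat_act L (map_mat h A) (axis_vec L d c b)) $ i =
          (\<Oplus>\<^bsub>K\<^esub>a\<in>{..<d}. dec c $$ (i, a) \<otimes>\<^bsub>K\<^esub> mat_act K A (?e b) $ a)"
        unfolding \<mu>_nth[OF i]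
      proof (intro K.finsum_cong')
        show "(\<lambda>a. dec c $$ (i, a) \<otimes>\<^bsub>K\<^esub> mat_act K A (?e b) $ a) \<in> {..<d} \<rightarrow> carrier K"
          using ent[OF single(1) i] kspace_nth[OF K.mat_act_closed[OF AM, of "?e b"]] by simp
        fix a assume "a \<in> {..<d}"
        hence a: "a < d" by simp
        have ab: "A $$ (a, b) \<in> carrier K" using AM a single(2) by simp
        have "mat_act L (map_mat h A) (axis_vec L d c b) $ a = h (A $$ (a, b)) \<otimes>\<^bsub>L\<^esub> c"
          using L.mat_act_axis[OF hA single] a single(2) matrices_dim[OF AM] by simp
        hence "dec (mat_act L (map_mat h A) (axis_vec L d c b) $ a) = sc (A $$ (a, b)) \<otimes>\<^bsub>Zr\<^esub> dec c"
          using ring_hom_closed[OF h ab] single(1) by (simp add: dec_mul dec_h ab)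
        moreover have "(sc (A $$ (a, b)) \<otimes>\<^bsub>Zr\<^esub> dec c) $$ (i, a) = A $$ (a, b) \<otimes>\<^bsub>K\<^esub> dec c $$ (i, a)"
          using i a ab ZM[OF cz]
          by (simp add: K.entry_eq_act_axis[OF ZM[OF mulZ[OF scZ[OF ab] cz]]] act_mul[OF scZ[OF ab] cz]
            act_sc K.entry_eq_act_axis[OF ZM[OF cz]])
        moreover have "mat_act K A (?e b) $ a = A $$ (a, b)"
          using AM a single(2) by (simp add: K.mat_act_axis)
        ultimately show "dec (mat_act L (map_mat h A) (axis_vec L d c b) $ a) $$ (i, a) =
            dec c $$ (i, a) \<otimes>\<^bsub>K\<^esub> mat_act K A (?e b) $ a"
          using ab ent[OF single(1) i a] by (simp add: K.m_comm)
      qed simp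
      also have "\<dots> = mat_act K (dec c) (mat_act K A (?e b)) $ i"
        using K.mat_act_nth[OF ZM[OF cz] i] by simp
      also have "mat_act K (dec c) (mat_act K A (?e b)) = mat_act K A (mat_act K (dec c) (?e b))"
        by (rule K.commutantD(2)[OF cz[unfolded Z_def] AT K.vec_ops_closed(4)[OF K.one_closed]])
      finally show "\<mu> (mat_act L (map_mat h A) (axis_vec L d c b)) $ i = mat_act K A (\<mu> (axis_vec L d c b)) $ i"
        using single by (simp add: \<mu>_axis)
    qed
  qed
  define U where "U = {u \<in> kspace L d. \<mu> u = vzero K d}"
  have subU: "is_subspace L d U"
    unfolding is_subspace_def
  proof (intro conjI ballI)
    show "U \<subseteq> kspace L d" "vzero L d \<in> U" by (auto simp: U_def \<mu>_zero)
    show "vadd L d u v \<in> U" if "u \<in> U" "v \<in> U" for u v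
      using that by (simp add: U_def \<mu>_add K.vadd_zero)
    show "vscale L d x u \<in> U" if "x \<in> carrier L" "u \<in> U" for x u
      using that by (simp add: U_def \<mu>_scale K.mat_act_zero[OF ZM[OF decZ]])
  qed
  have "mat_act L A u \<in> U" if A: "A \<in> set (map (map_mat h) As)" and u: "u \<in> U" for A u
  proof -
    obtain B where B: "B \<in> set As" "A = map_mat h B" using A by auto
    show ?thesis
      using u map_mat_closed[OF h reps_set[OF As B(1)]]
      by (simp add: U_def B(2) \<mu>_rep[OF B(1)] K.mat_act_zero[OF reps_set[OF As B(1)]])
  qed
  hence "U = {\<zero>\<^bsub>coord_space L d\<^esub>} \<or> U = kspace L d"
    using irr' subU unfolding irreducible_rep_def L.submodule_iff_subspace image_subset_iff by blast
  moreover have "U \<noteq> kspace L d"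
  proof
    assume "U = kspace L d"
    hence "axis_vec L d \<one>\<^bsub>L\<^esub> 0 \<in> U" by simp
    hence "?e 0 = vzero K d" using d by (simp add: U_def \<mu>_axis dec_one act_one)
    hence "?e 0 $ 0 = vzero K d $ 0" by simp
    thus False using d by simp
  qed
  ultimately have U0: "U = {vzero L d}" by (simp add: coord_space_zero)
  have "inj_on \<mu> (kspace L d)"
  proof (rule inj_onI)
    fix u v assume u: "u \<in> kspace L d" and v: "v \<in> kspace L d" and e: "\<mu> u = \<mu> v"
    define w where "w = vadd L d (vscale L d (\<ominus>\<^bsub>L\<^esub> \<one>\<^bsub>L\<^esub>) v) u"
    have w: "w \<in> kspace L d" using u v by (simp add: w_def)
    have "\<mu> w = vadd K d (\<mu> (vscale L d (\<ominus>\<^bsub>L\<^esub> \<one>\<^bsub>L\<^esub>) v)) (\<mu> v)"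
      using u v by (simp add: w_def \<mu>_add e)
    also have "\<dots> = \<mu> (vadd L d (vscale L d (\<ominus>\<^bsub>L\<^esub> \<one>\<^bsub>L\<^esub>) v) v)" using v by (simp add: \<mu>_add)
    also have "\<dots> = vzero K d" using v by (simp add: L.vscale_minus_one \<mu>_zero)
    finally have "w \<in> U" using w by (simp add: U_def)
    hence w0: "w = vzero L d" using U0 by simp
    show "u = v"
    proof (rule kspace_eqI[OF u v])
      fix i assume i: "i < d"
      have "\<ominus>\<^bsub>L\<^esub> (v $ i) \<oplus>\<^bsub>L\<^esub> u $ i = \<zero>\<^bsub>L\<^esub>"
        using arg_cong[OF w0, of "\<lambda>x. x $ i"] i u v by (simp add: w_def L.l_minus)
      thus "u $ i = v $ i"
        using i u v L.minus_equality[of "u $ i" "\<ominus>\<^bsub>L\<^esub> (v $ i)"] by (simp add: L.a_comm)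
    qed
  qed
  hence "card (kspace L d) \<le> card (kspace K d)"
    using \<mu>c finite_kspace[OF fin] by (intro card_inj_on_le) auto
  hence "card (carrier L) ^ d \<le> card (carrier K) ^ d" by (simp add: card_kspace)
  hence le: "card (carrier L) \<le> card (carrier K)" using d by (simp add: power_mono_iff)
  have cardL: "card (carrier L) = card Z" by (simp add: Lc card_image[OF encZ])
  have "inj_on sc (carrier K)"
  proof (rule inj_onI)
    fix c e assume c: "c \<in> carrier K" and e: "e \<in> carrier K" and s: "sc c = sc e"
    have "vscale K d c (?e 0) = vscale K d e (?e 0)" using act_sc[OF c] act_sc[OF e] s by simp
    hence "vscale K d c (?e 0) $ 0 = vscale K d e (?e 0) $ 0" by simp
    thus "c = e" using c e d by simp
  qed
  hence "card (sc ` carrier K) = card (carrier K)" by (rule card_image)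
  hence "sc ` carrier K = Z"
    using card_seteq[OF finZ, of "sc ` carrier K"] scZ le cardL by auto
  then obtain c where "c \<in> carrier K" "\<Phi> = sc c" using \<Phi>Z by auto
  thus ?thesis using act_sc by auto
qed

section \<open>The order of the general linear group\<close>

definition general_linear :: "('a, 'c) ring_scheme \<Rightarrow> nat \<Rightarrow> 'a mat set" where
  "general_linear K d = {P \<in> matrices K d. bij_betw (mat_act K P) (kspace K d) (kspace K d)}"

definition initial_vecs :: "('a, 'c) ring_scheme \<Rightarrow> nat \<Rightarrow> nat \<Rightarrow> 'a vec set" where
  "initial_vecs K d k = {v \<in> kspace K d. \<forall>i<d. k \<le> i \<longrightarrow> v $ i = \<zero>\<^bsub>K\<^esub>}"

text \<open>
  Matrices whose first \<open>k\<close> columns are linearly independent while the others vanish; padding with zero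
  columns keeps all of them square.
\<close>

definition injective_frames :: "('a, 'c) ring_scheme \<Rightarrow> nat \<Rightarrow> nat \<Rightarrow> 'a mat set" where
  "injective_frames K d k = {P \<in> matrices K d. (\<forall>i<d. \<forall>j<d. k \<le> j \<longrightarrow> P $$ (i, j) = \<zero>\<^bsub>K\<^esub>) \<and>
    (\<forall>v\<in>initial_vecs K d k. mat_act K P v = vzero K d \<longrightarrow> v = vzero K d)}"

definition set_column :: "nat \<Rightarrow> 'a mat \<Rightarrow> nat \<Rightarrow> 'a vec \<Rightarrow> 'a mat" where
  "set_column d P k w = mat d d (\<lambda>(i, j). if j = k then w $ i else P $$ (i, j))"

context field
begin

lemma matrix_inj_iff:
  assumes P: "P \<in> matrices R d"
  shows "inj_on (mat_act R P) (kspace R d) \<longleftrightarrow>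
    (\<forall>v\<in>kspace R d. mat_act R P v = vzero R d \<longrightarrow> v = vzero R d)"
proof (intro iffI ballI impI)
  fix v assume inj: "inj_on (mat_act R P) (kspace R d)" and v: "v \<in> kspace R d" "mat_act R P v = vzero R d"
  hence "mat_act R P v = mat_act R P (vzero R d)" by (simp add: mat_act_zero[OF P])
  thus "v = vzero R d" using inj_onD[OF inj] v(1) vec_ops_closed(3) by blast
next
  assume ker: "\<forall>v\<in>kspace R d. mat_act R P v = vzero R d \<longrightarrow> v = vzero R d"
  show "inj_on (mat_act R P) (kspace R d)"
  proof (rule inj_onI)
    fix u v assume u: "u \<in> kspace R d" and v: "v \<in> kspace R d" and e: "mat_act R P u = mat_act R P v"
    define w where "w = vadd R d (vscale R d (\<ominus> \<one>) v) u"
    have w: "w \<in> kspace R d" using u v by (simp add: w_def)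
    have "mat_act R P w = vadd R d (vscale R d (\<ominus> \<one>) (mat_act R P v)) (mat_act R P v)"
      using u v P by (simp add: w_def mat_act_add mat_act_scale e)
    also have "\<dots> = vzero R d" using v P by (intro vscale_minus_one) simp
    finally have w0: "w = vzero R d" using ker w by blast
    show "u = v"
    proof (rule kspace_eqI[OF u v])
      fix i assume i: "i < d"
      have "\<ominus> (v $ i) \<oplus> u $ i = \<zero>"
        using arg_cong[OF w0, of "\<lambda>x. x $ i"] i u v by (simp add: w_def l_minus)
      thus "u $ i = v $ i"
        using i u v minus_equality[of "u $ i" "\<ominus> (v $ i)"] by (simp add: a_comm)
    qed
  qed
qed

lemma general_linear_eq_frames:
  assumes fin: "finite (carrier R)"
  shows "general_linear R d = injective_frames R d d"
proof -
  have V: "initial_vecs R d d = kspace R d" by (auto simp: initial_vecs_def)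
  have "bij_betw (mat_act R P) (kspace R d) (kspace R d) \<longleftrightarrow> inj_on (mat_act R P) (kspace R d)"
    if P: "P \<in> matrices R d" for P
  proof
    assume "inj_on (mat_act R P) (kspace R d)"
    moreover have "mat_act R P ` kspace R d \<subseteq> kspace R d" using P by auto
    ultimately show "bij_betw (mat_act R P) (kspace R d) (kspace R d)"
      using endo_inj_surj[OF finite_kspace[OF fin]] by (simp add: bij_betw_def)
  qed (simp add: bij_betw_def)
  thus ?thesis unfolding general_linear_def injective_frames_def V
    using matrix_inj_iff by auto
qed

lemma card_initial_vecs:
  assumes k: "k \<le> d"
  shows "card (initial_vecs R d k) = card (carrier R) ^ k"
proof -
  have "bij_betw (\<lambda>v. vec d (\<lambda>i. if i < k then v $ i else \<zero>)) (kspace R k) (initial_vecs R d k)"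
  proof (rule bij_betw_byWitness[where f' = "\<lambda>v. vec k (\<lambda>i. v $ i)"])
    show "\<forall>v\<in>kspace R k. vec k (($) (vec d (\<lambda>i. if i < k then v $ i else \<zero>))) = v"
      using k by (auto intro!: eq_vecI simp: kspace_dim)
    show "\<forall>v\<in>initial_vecs R d k. vec d (\<lambda>i. if i < k then vec k (($) v) $ i else \<zero>) = v"
      by (auto intro!: eq_vecI simp: initial_vecs_def kspace_dim)
    show "(\<lambda>v. vec d (\<lambda>i. if i < k then v $ i else \<zero>)) ` kspace R k \<subseteq> initial_vecs R d k"
      by (auto intro!: kspaceI simp: initial_vecs_def)
    show "(\<lambda>v. vec k (($) v)) ` initial_vecs R d k \<subseteq> kspace R k"
      using k by (auto intro!: kspaceI simp: initial_vecs_def)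
  qed
  from bij_betw_same_card[OF this] show ?thesis by (simp only: card_kspace)
qed

lemma set_column_closed:
  assumes "P \<in> matrices R d" "w \<in> kspace R d"
  shows "set_column d P k w \<in> matrices R d"
  using assms by (intro matricesI) (simp_all add: set_column_def)

lemma set_column_act:
  assumes P: "P \<in> matrices R d" and w: "w \<in> kspace R d" and k: "k < d"
    and z: "\<And>i. i < d \<Longrightarrow> P $$ (i, k) = \<zero>" and v: "v \<in> kspace R d"
  shows "mat_act R (set_column d P k w) v = vadd R d (mat_act R P v) (vscale R d (v $ k) w)"
  using v
proof (induction v rule: kspace_induct)
  note C = set_column_closed[OF P w, of k]
  case zero
  show ?case using k w by (simp add: mat_act_zero[OF P] mat_act_zero[OF C]) (auto intro!: eq_vecI)
next
  note C = set_column_closed[OF P w, of k]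
  case (single c b)
  show ?case
  proof (rule eq_vecI)
    fix i assume "i < dim_vec (vadd R d (mat_act R P (axis_vec R d c b)) (vscale R d (axis_vec R d c b $ k) w))"
    hence i: "i < d" by simp
    have set_column_nth: "set_column d P k w $$ (i, b) = (if b = k then w $ i else P $$ (i, b))"
      using i single(2) by (simp add: set_column_def)
    show "mat_act R (set_column d P k w) (axis_vec R d c b) $ i =
        vadd R d (mat_act R P (axis_vec R d c b)) (vscale R d (axis_vec R d c b $ k) w) $ i"
      using i single P w k z[OF i] set_column_nth
      by (simp add: mat_act_axis[OF P single] mat_act_axis[OF C single] m_comm)
  qed (simp add: mat_act_dim[OF C])
next
  note C = set_column_closed[OF P w, of k]
  case (add u x)
  have "vscale R d ((vadd R d u x) $ k) w = vadd R d (vscale R d (u $ k) w) (vscale R d (x $ k) w)"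
    using add k w by (intro eq_vecI) (simp_all add: l_distr)
  moreover have "vscale R d (u $ k) w \<in> kspace R d" "vscale R d (x $ k) w \<in> kspace R d"
    using add k w by simp_all
  ultimately show ?case
    using add P by (simp add: mat_act_add[OF P] mat_act_add[OF C] vadd_interchange)
qed

lemma set_column_frame_iff:
  assumes P: "P \<in> matrices R d" and w: "w \<in> kspace R d" and k: "k < d"
    and z: "\<And>i j. i < d \<Longrightarrow> j < d \<Longrightarrow> k \<le> j \<Longrightarrow> P $$ (i, j) = \<zero>"
  shows "set_column d P k w \<in> injective_frames R d (Suc k) \<longleftrightarrow>
    P \<in> injective_frames R d k \<and> w \<notin> mat_act R P ` kspace R d"
proof -
  note C = set_column_closed[OF P w, of k]
  have act: "mat_act R (set_column d P k w) v = vadd R d (mat_act R P v) (vscale R d (v $ k) w)"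
    if "v \<in> kspace R d" for v
    using z k that by (intro set_column_act[OF P w k]) simp_all
  have cols: "set_column d P k w $$ (i, j) = \<zero>" if "i < d" "j < d" "Suc k \<le> j" for i j
    using that z[of i j] by (simp add: set_column_def)
  show ?thesis
  proof
    assume F: "set_column d P k w \<in> injective_frames R d (Suc k)"
    have ker: "v = vzero R d"
      if "v \<in> initial_vecs R d (Suc k)" "vadd R d (mat_act R P v) (vscale R d (v $ k) w) = vzero R d" for v
    proof -
      have "v \<in> kspace R d" using that(1) by (simp add: initial_vecs_def)
      thus ?thesis using F that act[of v] by (simp add: injective_frames_def)
    qed
    have "P \<in> injective_frames R d k"
      unfolding injective_frames_def
    proof (intro CollectI conjI allI ballI impI)
      fix v assume v: "v \<in> initial_vecs R d k" "mat_act R P v = vzero R d"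
      have vk: "v \<in> kspace R d" "v $ k = \<zero>" using v(1) k by (simp_all add: initial_vecs_def)
      have "v \<in> initial_vecs R d (Suc k)" using v(1) by (simp add: initial_vecs_def)
      moreover have "vadd R d (mat_act R P v) (vscale R d (v $ k) w) = vzero R d"
        using vk w v(2) by (intro eq_vecI) simp_all
      ultimately show "v = vzero R d" by (rule ker)
    qed (use P z in simp_all)
    moreover have "w \<notin> mat_act R P ` kspace R d"
    proof
      assume "w \<in> mat_act R P ` kspace R d"
      then obtain x where x: "x \<in> kspace R d" "w = mat_act R P x" by blast
      define v where "v = vec d (\<lambda>i. if i < k then x $ i else if i = k then \<ominus> \<one> else \<zero>)"
      have vk: "v \<in> kspace R d" using x(1) by (intro kspaceI) (simp_all add: v_def)
      have "v \<in> initial_vecs R d (Suc k)" using vk by (simp add: initial_vecs_def v_def)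
      moreover have "vadd R d (mat_act R P v) (vscale R d (v $ k) w) = vzero R d"
      proof (rule eq_vecI)
        fix i assume "i < dim_vec (vzero R d)"
        hence i: "i < d" by simp
        have "mat_act R P v $ i = mat_act R P x $ i"
        proof (rule block_entry_cong[OF P vk x(1) i])
          fix b assume b: "b < d" "P $$ (i, b) \<noteq> \<zero>"
          hence "b < k" using z[OF i b(1)] by (cases "k \<le> b") simp_all
          thus "v $ b = x $ b" using b by (simp add: v_def)
        qed
        moreover have "w $ i \<in> carrier R" using w i by simp
        ultimately show "vadd R d (mat_act R P v) (vscale R d (v $ k) w) $ i = vzero R d $ i"
          using i k by (simp add: v_def flip: x(2)) (simp add: l_minus r_neg)
      qed simp
      ultimately have "v = vzero R d" by (rule ker)
      hence "v $ k = vzero R d $ k" by simp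
      hence "\<ominus> \<one> = \<zero>" using k by (simp add: v_def)
      hence "\<ominus> (\<ominus> \<one>) = \<ominus> \<zero>" by (rule arg_cong)
      thus False by simp
    qed
    ultimately show "P \<in> injective_frames R d k \<and> w \<notin> mat_act R P ` kspace R d" by blast
  next
    assume F: "P \<in> injective_frames R d k \<and> w \<notin> mat_act R P ` kspace R d"
    show "set_column d P k w \<in> injective_frames R d (Suc k)"
      unfolding injective_frames_def
    proof (intro CollectI conjI allI ballI impI)
      fix v assume v: "v \<in> initial_vecs R d (Suc k)" "mat_act R (set_column d P k w) v = vzero R d"
      have vk: "v \<in> kspace R d" using v(1) by (simp add: initial_vecs_def)
      have vkk: "v $ k \<in> carrier R" using vk k by simp
      have e: "vadd R d (mat_act R P v) (vscale R d (v $ k) w) = vzero R d"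
        using v(2) act[OF vk] by simp
      have ei: "mat_act R P v $ i \<oplus> v $ k \<otimes> w $ i = \<zero>" if "i < d" for i
        using arg_cong[OF e, of "\<lambda>x. x $ i"] that by simp
      have ci: "mat_act R P v $ i \<in> carrier R" if "i < d" for i
        by (rule kspace_nth[OF mat_act_closed[OF P vk] that])
      have v0: "v $ k = \<zero>"
      proof (rule ccontr)
        assume nz: "v $ k \<noteq> \<zero>"
        have ic: "inv (v $ k) \<in> carrier R" by (rule inv_closed'[OF vkk nz])
        have "mat_act R P (vscale R d (\<ominus> (inv (v $ k))) v) = w"
        proof (rule kspace_eqI[OF _ w])
          show "mat_act R P (vscale R d (\<ominus> (inv (v $ k))) v) \<in> kspace R d"
            using P vk ic by simp
          fix i assume i: "i < d"
          have wi: "w $ i \<in> carrier R" using w i by simp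
          have "\<ominus> (mat_act R P v $ i) = v $ k \<otimes> w $ i"
            using minus_equality[of "v $ k \<otimes> w $ i" "mat_act R P v $ i"] ei[OF i] ci[OF i] vkk wi
            by (simp add: a_comm)
          hence "inv (v $ k) \<otimes> (\<ominus> (mat_act R P v $ i)) = w $ i"
            using nonzero_mult_cancel[OF vkk wi nz] by simp
          thus "mat_act R P (vscale R d (\<ominus> (inv (v $ k))) v) $ i = w $ i"
            using ic vk i ci[OF i] by (simp add: mat_act_scale[OF P] l_minus r_minus)
        qed
        moreover have "vscale R d (\<ominus> (inv (v $ k))) v \<in> kspace R d" using ic vk by simp
        ultimately show False using F by blast
      qed
      have "v $ i = \<zero>" if "i < d" "Suc k \<le> i" for i
        using v(1) that by (simp add: initial_vecs_def)
      hence "v $ i = \<zero>" if "i < d" "k \<le> i" for i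
        using that v0 by (cases "i = k") simp_all
      hence "v \<in> initial_vecs R d k" using vk by (simp add: initial_vecs_def)
      moreover have "mat_act R P v = vzero R d"
      proof (rule kspace_eqI[where K = R and d = d])
        fix i assume i: "i < d"
        have "w $ i \<in> carrier R" using w i by simp
        thus "mat_act R P v $ i = vzero R d $ i" using ei[OF i] ci[OF i] v0 i by simp
      qed (use P vk in simp_all)
      ultimately show "v = vzero R d" using F by (simp add: injective_frames_def)
    qed (use C cols in simp_all)
  qed
qed

text \<open>
  The next column is any vector outside the span of the previous ones, which has \<open>q^k\<close> elements.
\<close>

lemma card_injective_frames:
  assumes fin: "finite (carrier R)" and k: "k \<le> d"
  shows "int (card (injective_frames R d k)) =
    (\<Prod>i<k. int (card (carrier R)) ^ d - int (card (carrier R)) ^ i)"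
  using k
proof (induction k)
  case 0
  have "injective_frames R d 0 = {mat d d (\<lambda>_. \<zero>)}"
  proof (intro equalityI subsetI)
    fix P assume "P \<in> injective_frames R d 0"
    hence P: "P \<in> matrices R d" "\<And>i j. i < d \<Longrightarrow> j < d \<Longrightarrow> P $$ (i, j) = \<zero>"
      by (simp_all add: injective_frames_def)
    have "P = mat d d (\<lambda>_. \<zero>)" using P matrices_dim[OF P(1)] by (intro eq_matI) simp_all
    thus "P \<in> {mat d d (\<lambda>_. \<zero>)}" by simp
  next
    fix P assume "P \<in> {mat d d (\<lambda>_. \<zero>)}"
    hence P: "P = mat d d (\<lambda>_. \<zero>)" by simp
    have "v = vzero R d" if "v \<in> initial_vecs R d 0" for v
    proof (rule kspace_eqI[where K = R and d = d])
      show "v \<in> kspace R d" using that by (simp add: initial_vecs_def)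
    qed (use that in \<open>simp_all add: initial_vecs_def\<close>)
    moreover have "P \<in> matrices R d" unfolding P by (intro matricesI) simp_all
    ultimately show "P \<in> injective_frames R d 0" by (simp add: injective_frames_def P)
  qed
  thus ?case by simp
next
  case (Suc k)
  have k: "k < d" using Suc.prems by simp
  define q where "q = card (carrier R)"
  define X where "X = Sigma (injective_frames R d k) (\<lambda>P. kspace R d - mat_act R P ` kspace R d)"
  have zc: "P $$ (i, j) = \<zero>" if "P \<in> injective_frames R d k" "i < d" "j < d" "k \<le> j" for P i j
    using that by (simp add: injective_frames_def)
  have PM: "P \<in> matrices R d" if "P \<in> injective_frames R d l" for P l
    using that by (simp add: injective_frames_def)
  have "bij_betw (\<lambda>(P, w). set_column d P k w) X (injective_frames R d (Suc k))"
  proof (rule bij_betw_byWitness[where f' = "\<lambda>P. (set_column d P k (vzero R d), vec d (\<lambda>i. P $$ (i, k)))"])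
    show "\<forall>x\<in>X. (set_column d (case x of (P, w) \<Rightarrow> set_column d P k w) k (vzero R d),
        vec d (\<lambda>i. (case x of (P, w) \<Rightarrow> set_column d P k w) $$ (i, k))) = x"
    proof
      fix x assume x: "x \<in> X"
      obtain P w where Pw: "x = (P, w)" "P \<in> injective_frames R d k" "w \<in> kspace R d"
        using x by (auto simp: X_def)
      have "set_column d (set_column d P k w) k (vzero R d) = P"
        using zc[OF Pw(2)] k matrices_dim[OF PM[OF Pw(2)]] by (intro eq_matI) (auto simp: set_column_def)
      moreover have "vec d (\<lambda>i. set_column d P k w $$ (i, k)) = w"
        using k Pw(3) by (intro eq_vecI) (simp_all add: set_column_def kspace_dim)
      ultimately show "(set_column d (case x of (P, w) \<Rightarrow> set_column d P k w) k (vzero R d),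
        vec d (\<lambda>i. (case x of (P, w) \<Rightarrow> set_column d P k w) $$ (i, k))) = x" by (simp add: Pw(1))
    qed
    have dec: "set_column d (set_column d P k (vzero R d)) k (vec d (\<lambda>i. P $$ (i, k))) = P"
      if "P \<in> injective_frames R d (Suc k)" for P
      using matrices_dim[OF PM[OF that]] by (intro eq_matI) (auto simp: set_column_def)
    show "\<forall>P\<in>injective_frames R d (Suc k). (case (set_column d P k (vzero R d), vec d (\<lambda>i. P $$ (i, k)))
        of (P, w) \<Rightarrow> set_column d P k w) = P" using dec by simp
    show "(\<lambda>(P, w). set_column d P k w) ` X \<subseteq> injective_frames R d (Suc k)"
    proof (rule image_subsetI)
      fix x assume x: "x \<in> X"
      obtain P w where Pw: "x = (P, w)" "P \<in> injective_frames R d k" "w \<in> kspace R d"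
        "w \<notin> mat_act R P ` kspace R d"
        using x by (auto simp: X_def)
      thus "(case x of (P, w) \<Rightarrow> set_column d P k w) \<in> injective_frames R d (Suc k)"
        using set_column_frame_iff[OF PM[OF Pw(2)] Pw(3) k zc[OF Pw(2)]] by simp
    qed
    show "(\<lambda>P. (set_column d P k (vzero R d), vec d (\<lambda>i. P $$ (i, k)))) ` injective_frames R d (Suc k) \<subseteq> X"
    proof (rule image_subsetI)
      fix P assume P: "P \<in> injective_frames R d (Suc k)"
      let ?P = "set_column d P k (vzero R d)" and ?w = "vec d (\<lambda>i. P $$ (i, k))"
      have M: "?P \<in> matrices R d" by (rule set_column_closed[OF PM[OF P]]) simp
      have w: "?w \<in> kspace R d" using PM[OF P] k by (intro kspaceI) simp_all
      have z: "?P $$ (i, j) = \<zero>" if "i < d" "j < d" "k \<le> j" for i j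
        using P that by (auto simp: set_column_def injective_frames_def Suc_le_eq dest: le_imp_less_or_eq)
      have "set_column d ?P k ?w \<in> injective_frames R d (Suc k)" using P dec[OF P] by simp
      thus "(?P, ?w) \<in> X" using set_column_frame_iff[OF M w k z] w by (simp add: X_def)
    qed
  qed
  hence "card (injective_frames R d (Suc k)) = card X" by (rule bij_betw_same_card[symmetric])
  also have "\<dots> = (\<Sum>P\<in>injective_frames R d k. card (kspace R d - mat_act R P ` kspace R d))"
    unfolding X_def using finite_matrices[OF fin] finite_kspace[OF fin]
    by (intro card_SigmaI) (auto simp: injective_frames_def intro: finite_subset)
  also have "int \<dots> = (\<Sum>P\<in>injective_frames R d k. int q ^ d - int q ^ k)"
    unfolding of_nat_sum
  proof (rule sum.cong[OF refl])
    fix P assume P: "P \<in> injective_frames R d k"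
    have "mat_act R P ` kspace R d = mat_act R P ` initial_vecs R d k"
    proof (intro equalityI subsetI)
      fix w assume "w \<in> mat_act R P ` kspace R d"
      then obtain x where x: "x \<in> kspace R d" "w = mat_act R P x" by blast
      have c: "coord_cut R d {..<k} x \<in> kspace R d" using x(1) by simp
      have "mat_act R P (coord_cut R d {..<k} x) = mat_act R P x"
      proof (rule kspace_eqI[where K = R and d = d])
        fix i assume i: "i < d"
        show "mat_act R P (coord_cut R d {..<k} x) $ i = mat_act R P x $ i"
        proof (rule block_entry_cong[OF PM[OF P] c x(1) i])
          fix b assume b: "b < d" "P $$ (i, b) \<noteq> \<zero>"
          hence "b < k" using zc[OF P i b(1)] by (cases "k \<le> b") simp_all
          thus "coord_cut R d {..<k} x $ b = x $ b" using b by simp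
        qed
      qed (use PM[OF P] x(1) in simp_all)
      moreover have "coord_cut R d {..<k} x \<in> initial_vecs R d k" using c by (simp add: initial_vecs_def)
      ultimately show "w \<in> mat_act R P ` initial_vecs R d k" using x(2) by (metis imageI)
    qed (auto simp: initial_vecs_def)
    moreover have "inj_on (mat_act R P) (initial_vecs R d k)"
    proof (rule inj_onI)
      fix u v assume u: "u \<in> initial_vecs R d k" and v: "v \<in> initial_vecs R d k"
        and e: "mat_act R P u = mat_act R P v"
      have uk: "u \<in> kspace R d" "v \<in> kspace R d" using u v by (simp_all add: initial_vecs_def)
      define w where "w = vadd R d (vscale R d (\<ominus> \<one>) v) u"
      have "w \<in> initial_vecs R d k" using u v by (simp add: initial_vecs_def w_def)
      moreover have "mat_act R P w = vadd R d (vscale R d (\<ominus> \<one>) (mat_act R P v)) (mat_act R P v)"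
        using uk by (simp add: w_def mat_act_add[OF PM[OF P]] mat_act_scale[OF PM[OF P]] e)
      moreover have "\<dots> = vzero R d" using uk PM[OF P] by (intro vscale_minus_one) simp
      ultimately have w0: "w = vzero R d" using P by (simp add: injective_frames_def)
      show "u = v"
      proof (rule kspace_eqI[OF uk])
        fix i assume i: "i < d"
        have "\<ominus> (v $ i) \<oplus> u $ i = \<zero>"
          using arg_cong[OF w0, of "\<lambda>x. x $ i"] i uk by (simp add: w_def l_minus)
        thus "u $ i = v $ i"
          using i uk minus_equality[of "u $ i" "\<ominus> (v $ i)"] by (simp add: a_comm)
      qed
    qed
    ultimately have c: "card (mat_act R P ` kspace R d) = q ^ k"
      using card_initial_vecs[of k d] k by (simp add: card_image q_def)
    have sub: "mat_act R P ` kspace R d \<subseteq> kspace R d" using PM[OF P] by auto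
    have "card (kspace R d - mat_act R P ` kspace R d) = q ^ d - q ^ k"
      using card_Diff_subset[OF finite_subset[OF sub finite_kspace[OF fin]] sub] c card_kspace[of R d]
      by (simp add: q_def)
    moreover have "q ^ k \<le> q ^ d" using card_mono[OF finite_kspace[OF fin] sub] c card_kspace[of R d]
      by (simp add: q_def)
    ultimately show "int (card (kspace R d - mat_act R P ` kspace R d)) = int q ^ d - int q ^ k"
      by (simp add: of_nat_diff)
  qed
  also have "\<dots> = (\<Prod>i<Suc k. int q ^ d - int q ^ i)"
    using Suc by (simp add: q_def)
  finally show ?case by (simp add: q_def)
qed

end

text \<open>
  The quotient of \<open>q^d - q^i\<close> by \<open>q - 1\<close> is congruent to \<open>d - i\<close> modulo \<open>q - 1\<close>.
\<close>

lemma general_linear_order_expansion: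
  fixes q :: int
  shows "\<exists>u. (\<Prod>i<d. q ^ d - q ^ i) = (q - 1) ^ d * u \<and> q - 1 dvd u - fact d"
proof -
  define s where "s = (\<lambda>i. q ^ i * (\<Sum>j<d - i. q ^ j))"
  have f: "q ^ d - q ^ i = (q - 1) * s i" if "i < d" for i
  proof -
    have g: "(q - 1) * (\<Sum>j<d - i. q ^ j) = q ^ (d - i) - 1" by (simp add: power_diff_1_eq)
    have "q ^ d = q ^ i * q ^ (d - i)" using that by (simp flip: power_add)
    hence "q ^ d - q ^ i = q ^ i * (q ^ (d - i) - 1)" by (simp add: right_diff_distrib)
    hence "q ^ d - q ^ i = q ^ i * ((q - 1) * (\<Sum>j<d - i. q ^ j))" by (simp only: g)
    thus ?thesis by (simp only: s_def mult.left_commute)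
  qed
  have "(\<Prod>i<d. q ^ d - q ^ i) = (\<Prod>i<d. (q - 1) * s i)" by (intro prod.cong) (simp_all add: f)
  hence 1: "(\<Prod>i<d. q ^ d - q ^ i) = (q - 1) ^ d * (\<Prod>i<d. s i)" by (simp add: prod.distrib)
  have q: "[q = 1] (mod (q - 1))" by (simp add: cong_iff_dvd_diff)
  have "[s i = int (d - i)] (mod (q - 1))" for i
  proof -
    have "[s i = 1 ^ i * (\<Sum>j<d - i. 1 ^ j)] (mod (q - 1))"
      unfolding s_def by (intro cong_mult cong_sum cong_pow q)
    thus ?thesis by simp
  qed
  hence "[(\<Prod>i<d. s i) = (\<Prod>i<d. int (d - i))] (mod (q - 1))" by (intro cong_prod)
  moreover have "(\<Prod>i<d. int (d - i)) = fact d"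
    unfolding fact_prod_rev atLeast0LessThan of_nat_prod by (rule refl)
  ultimately show ?thesis using 1 by (auto simp: cong_iff_dvd_diff)
qed

lemma (in field) card_general_linear:
  assumes "finite (carrier R)"
  shows "int (card (general_linear R d)) =
    (\<Prod>i<d. int (card (carrier R)) ^ d - int (card (carrier R)) ^ i)"
  using card_injective_frames[OF assms, of d d] general_linear_eq_frames[OF assms] by simp

section \<open>Counting isomorphism classes\<close>

definition inverse_matrices :: "('a, 'c) ring_scheme \<Rightarrow> nat \<Rightarrow> 'a mat \<Rightarrow> 'a mat \<Rightarrow> bool" where
  "inverse_matrices K d P Q \<longleftrightarrow> P \<in> matrices K d \<and> Q \<in> matrices K d \<and>
    (\<forall>v\<in>kspace K d. mat_act K P (mat_act K Q v) = v) \<and> (\<forall>v\<in>kspace K d. mat_act K Q (mat_act K P v) = v)"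

definition intertwines :: "('a, 'c) ring_scheme \<Rightarrow> nat \<Rightarrow> 'a mat \<Rightarrow> 'a mat list \<Rightarrow> 'a mat list \<Rightarrow> bool" where
  "intertwines K d P As Bs \<longleftrightarrow> length As = length Bs \<and> (\<forall>i<length As. \<forall>v\<in>kspace K d.
    mat_act K P (mat_act K (As ! i) v) = mat_act K (Bs ! i) (mat_act K P v))"

lemma isomorphic_reps_iff:
  "isomorphic_reps K d As Bs \<longleftrightarrow> (\<exists>P\<in>general_linear K d. intertwines K d P As Bs)"
  by (auto simp: isomorphic_reps_def general_linear_def intertwines_def)

lemma inverse_matricesD:
  assumes "inverse_matrices K d P Q"
  shows "P \<in> matrices K d" "Q \<in> matrices K d"
    "v \<in> kspace K d \<Longrightarrow> mat_act K P (mat_act K Q v) = v" "v \<in> kspace K d \<Longrightarrow> mat_act K Q (mat_act K P v) = v"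
  using assms by (simp_all add: inverse_matrices_def)

lemma inverse_matrices_sym: "inverse_matrices K d P Q \<Longrightarrow> inverse_matrices K d Q P"
  by (simp add: inverse_matrices_def)

lemma intertwinesD:
  "intertwines K d P As Bs \<Longrightarrow> i < length As \<Longrightarrow> v \<in> kspace K d \<Longrightarrow>
    mat_act K P (mat_act K (As ! i) v) = mat_act K (Bs ! i) (mat_act K P v)"
  by (simp add: intertwines_def)

lemma reps_eqI:
  assumes As: "As \<in> reps K m d" and Bs: "Bs \<in> reps K m d" and "cring K"
    and "\<And>i v. i < m \<Longrightarrow> v \<in> kspace K d \<Longrightarrow> mat_act K (As ! i) v = mat_act K (Bs ! i) v"
  shows "As = Bs"
proof (rule nth_equalityI)
  fix i assume "i < length As"
  hence i: "i < m" using reps_length[OF As] by simp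
  show "As ! i = Bs ! i"
    by (rule cring.matrices_eqI[OF assms(3) reps_nth[OF As i] reps_nth[OF Bs i] assms(4)[OF i]])
qed (use reps_length[OF As] reps_length[OF Bs] in simp)

lemma finite_reps: "finite (carrier K) \<Longrightarrow> finite (reps K m d)"
  using finite_lists_length_eq[OF finite_matrices[of K d], of m]
  by (rule rev_finite_subset) (auto simp: reps_def)

context field
begin

lemma general_linear_iff_inverse:
  "P \<in> general_linear R d \<longleftrightarrow> (\<exists>Q. inverse_matrices R d P Q)"
proof
  assume P: "P \<in> general_linear R d"
  hence "P \<in> commutant R d {}" by (simp add: general_linear_def commutant_def)
  from commutant_inverse[OF this] P show "\<exists>Q. inverse_matrices R d P Q"
    by (auto simp: general_linear_def inverse_matrices_def dest: commutantD(1))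
next
  assume "\<exists>Q. inverse_matrices R d P Q"
  then obtain Q where Q: "inverse_matrices R d P Q" by blast
  note PQ = inverse_matricesD[OF Q]
  have "bij_betw (mat_act R P) (kspace R d) (kspace R d)"
    by (rule bij_betw_byWitness[where f' = "mat_act R Q"]) (use PQ in auto)
  thus "P \<in> general_linear R d" using PQ(1) by (simp add: general_linear_def)
qed

lemma intertwines_inverse:
  assumes As: "As \<in> reps R m d" and Bs: "Bs \<in> reps R m d" and PQ: "inverse_matrices R d P Q"
    and int: "intertwines R d P As Bs"
  shows "intertwines R d Q Bs As"
proof -
  note I = inverse_matricesD[OF PQ]
  have "mat_act R Q (mat_act R (Bs ! i) v) = mat_act R (As ! i) (mat_act R Q v)"
    if i: "i < m" and v: "v \<in> kspace R d" for i v
  proof -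
    have Qv: "mat_act R Q v \<in> kspace R d" using I(2) v by simp
    have "mat_act R P (mat_act R (As ! i) (mat_act R Q v)) = mat_act R (Bs ! i) (mat_act R P (mat_act R Q v))"
      using i reps_length[OF As] by (intro intertwinesD[OF int _ Qv]) simp
    hence "mat_act R Q (mat_act R P (mat_act R (As ! i) (mat_act R Q v))) = mat_act R Q (mat_act R (Bs ! i) v)"
      by (simp add: I(3)[OF v])
    thus ?thesis using I(4)[of "mat_act R (As ! i) (mat_act R Q v)"] reps_nth[OF As i] Qv by simp
  qed
  thus ?thesis using reps_length[OF As] reps_length[OF Bs] by (simp add: intertwines_def)
qed

lemma irreducible_intertwined:
  assumes As: "As \<in> reps R m d" and Bs: "Bs \<in> reps R m d" and PQ: "inverse_matrices R d P Q"
    and int: "intertwines R d P As Bs" and irr: "irreducible_rep R d As"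
  shows "irreducible_rep R d Bs"
  unfolding irreducible_iff
proof (intro conjI allI impI)
  show "d > 0" using irr by (simp add: irreducible_iff)
  fix U assume "is_subspace R d U \<and> (\<forall>A\<in>set Bs. \<forall>u\<in>U. mat_act R A u \<in> U)"
  hence U: "is_subspace R d U" and inv: "\<And>A u. A \<in> set Bs \<Longrightarrow> u \<in> U \<Longrightarrow> mat_act R A u \<in> U" by simp_all
  note I = inverse_matricesD[OF PQ]
  define U' where "U' = {v \<in> kspace R d. mat_act R P v \<in> U}"
  have "is_subspace R d U'"
    unfolding is_subspace_def
  proof (intro conjI ballI)
    show "U' \<subseteq> kspace R d" by (auto simp: U'_def)
    show "vzero R d \<in> U'" using is_subspaceD(2)[OF U] by (simp add: U'_def mat_act_zero[OF I(1)])
    show "vadd R d u v \<in> U'" if "u \<in> U'" "v \<in> U'" for u v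
      using that is_subspaceD(3)[OF U] by (simp add: U'_def mat_act_add[OF I(1)])
    show "vscale R d c u \<in> U'" if "c \<in> carrier R" "u \<in> U'" for c u
      using that is_subspaceD(4)[OF U] by (simp add: U'_def mat_act_scale[OF I(1)])
  qed
  moreover have "mat_act R A u \<in> U'" if A: "A \<in> set As" and u: "u \<in> U'" for A u
  proof -
    obtain i where i: "i < m" "A = As ! i" using A reps_length[OF As] by (auto simp: in_set_conv_nth)
    have uk: "u \<in> kspace R d" "mat_act R P u \<in> U" using u by (simp_all add: U'_def)
    have "mat_act R P (mat_act R A u) = mat_act R (Bs ! i) (mat_act R P u)"
      using i reps_length[OF As] intertwinesD[OF int _ uk(1), of i] by simp
    moreover have "mat_act R (Bs ! i) (mat_act R P u) \<in> U"
      using i reps_length[OF Bs] by (intro inv[OF _ uk(2)]) simp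
    ultimately show ?thesis using uk(1) reps_set[OF As A] by (simp add: U'_def)
  qed
  ultimately have alt: "U' = {vzero R d} \<or> U' = kspace R d" using irr by (simp add: irreducible_iff)
  have pull: "mat_act R Q u \<in> U'" if "u \<in> U" for u
    using is_subspaceD(1)[OF U that] that I by (simp add: U'_def)
  from alt show "U = {vzero R d} \<or> U = kspace R d"
  proof
    assume U': "U' = {vzero R d}"
    have "u = vzero R d" if u: "u \<in> U" for u
    proof -
      have "mat_act R Q u = vzero R d" using pull[OF u] U' by simp
      hence "mat_act R P (mat_act R Q u) = vzero R d" by (simp add: mat_act_zero[OF I(1)])
      thus ?thesis using I(3)[OF is_subspaceD(1)[OF U u]] by simp
    qed
    thus ?thesis using is_subspaceD(2)[OF U] by blast
  next
    assume U': "U' = kspace R d"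
    have "u \<in> U" if u: "u \<in> kspace R d" for u
    proof -
      have "mat_act R Q u \<in> U'" using u U' I(2) by simp
      hence "mat_act R P (mat_act R Q u) \<in> U" by (simp add: U'_def)
      thus ?thesis using I(3)[OF u] by simp
    qed
    thus ?thesis using is_subspaceD(1)[OF U] by blast
  qed
qed

lemma linear_map_comp3:
  "A \<in> matrices R d \<Longrightarrow> B \<in> matrices R d \<Longrightarrow> C \<in> matrices R d \<Longrightarrow>
    linear_map d (\<lambda>v. mat_act R A (mat_act R B (mat_act R C v)))"
  by (intro linear_mapI) (simp_all add: mat_act_add mat_act_scale)

lemma identity_inverse: "inverse_matrices R d (matrix_of R d (\<lambda>v. v)) (matrix_of R d (\<lambda>v. v))"
  using matrix_of[OF linear_map_id] by (simp add: inverse_matrices_def)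

end

lemma inverse_matrices_map:
  assumes K: "field K" and L: "field L" and h: "h \<in> ring_hom K L" and PQ: "inverse_matrices K d P Q"
  shows "inverse_matrices L d (map_mat h P) (map_mat h Q)"
proof -
  interpret K: field K by (rule K)
  interpret L: field L by (rule L)
  define I where "I = matrix_of L d (\<lambda>v. v)"
  have IM: "I \<in> matrices L d" and Iact: "\<And>v. v \<in> kspace L d \<Longrightarrow> mat_act L I v = v"
    using L.matrix_of[OF L.linear_map_id] by (simp_all add: I_def)
  have main: "mat_act L (map_mat h P) (mat_act L (map_mat h Q) v) = v"
    if PQ: "inverse_matrices K d P Q" and v: "v \<in> kspace L d" for P Q v
  proof -
    note D = inverse_matricesD[OF PQ]
    have "mat_act L (map_mat h P) (mat_act L (map_mat h Q) v) = mat_act L I (mat_act L I v)"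
    proof (rule L.eq_on_axes[OF map_mat_closed[OF h D(1)] map_mat_closed[OF h D(2)] IM IM _ v])
      fix b assume b: "b < d"
      have e: "axis_vec K d \<one>\<^bsub>K\<^esub> b \<in> kspace K d" by simp
      have "mat_act L (map_mat h P) (mat_act L (map_mat h Q) (axis_vec L d \<one>\<^bsub>L\<^esub> b)) = axis_vec L d \<one>\<^bsub>L\<^esub> b"
        using e D by (simp add: map_vec_act[OF K L h] flip: map_vec_axis[OF K L h])
      thus "mat_act L (map_mat h P) (mat_act L (map_mat h Q) (axis_vec L d \<one>\<^bsub>L\<^esub> b)) =
          mat_act L I (mat_act L I (axis_vec L d \<one>\<^bsub>L\<^esub> b))" by (simp add: Iact)
    qed
    thus ?thesis by (simp add: Iact v)
  qed
  show ?thesis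
    using main[OF PQ] main[OF inverse_matrices_sym[OF PQ]] inverse_matricesD(1,2)[OF PQ]
    by (simp add: inverse_matrices_def map_mat_closed[OF h])
qed

lemma intertwines_map:
  assumes K: "field K" and L: "field L" and h: "h \<in> ring_hom K L" and P: "P \<in> matrices K d"
    and As: "As \<in> reps K m d" and Bs: "Bs \<in> reps K m d" and int: "intertwines K d P As Bs"
  shows "intertwines L d (map_mat h P) (map (map_mat h) As) (map (map_mat h) Bs)"
proof -
  interpret K: field K by (rule K)
  interpret L: field L by (rule L)
  have "mat_act L (map_mat h P) (mat_act L (map_mat h (As ! i)) v) =
      mat_act L (map_mat h (Bs ! i)) (mat_act L (map_mat h P) v)" if i: "i < m" and v: "v \<in> kspace L d" for i v
  proof (rule L.eq_on_axes[OF _ _ _ _ _ v])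
    fix b assume b: "b < d"
    have e: "axis_vec K d \<one>\<^bsub>K\<^esub> b \<in> kspace K d" by simp
    have "mat_act K P (mat_act K (As ! i) (axis_vec K d \<one>\<^bsub>K\<^esub> b)) =
        mat_act K (Bs ! i) (mat_act K P (axis_vec K d \<one>\<^bsub>K\<^esub> b))"
      using i reps_length[OF As] by (intro intertwinesD[OF int _ e]) simp
    thus "mat_act L (map_mat h P) (mat_act L (map_mat h (As ! i)) (axis_vec L d \<one>\<^bsub>L\<^esub> b)) =
        mat_act L (map_mat h (Bs ! i)) (mat_act L (map_mat h P) (axis_vec L d \<one>\<^bsub>L\<^esub> b))"
      using e P reps_nth[OF As i] reps_nth[OF Bs i]
      by (simp add: map_vec_act[OF K L h] flip: map_vec_axis[OF K L h])
  qed (use map_mat_closed[OF h P] map_mat_closed[OF h reps_nth[OF As i]] map_mat_closed[OF h reps_nth[OF Bs i]] in simp_all)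
  thus ?thesis using reps_length[OF As] reps_length[OF Bs] by (simp add: intertwines_def)
qed

text \<open>
  An invertible intertwiner stays one after extension of scalars.
\<close>

lemma absolutely_irreducible_intertwined:
  fixes K :: "nat ring"
  assumes K: "field K" and As: "As \<in> reps K m d" and Bs: "Bs \<in> reps K m d"
    and PQ: "inverse_matrices K d P Q" and int: "intertwines K d P As Bs"
    and irr: "absolutely_irreducible_rep K d As"
  shows "absolutely_irreducible_rep K d Bs"
proof -
  have "irreducible_rep L d (map (map_mat h) Bs)" if fe: "finite_extension K L h" for L h
  proof -
    have L: "field L" and h: "h \<in> ring_hom K L" using fe by (simp_all add: finite_extension_def)
    show ?thesis
      by (rule field.irreducible_intertwined[OF L map_reps_closed[OF h As] map_reps_closed[OF h Bs]
        inverse_matrices_map[OF K L h PQ] intertwines_map[OF K L h inverse_matricesD(1)[OF PQ] As Bs int]])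
        (use irr fe in \<open>simp add: absolutely_irreducible_rep_def\<close>)
  qed
  moreover have "irreducible_rep K d Bs"
    by (rule field.irreducible_intertwined[OF K As Bs PQ int]) (use irr in \<open>simp add: absolutely_irreducible_rep_def\<close>)
  ultimately show ?thesis by (simp add: absolutely_irreducible_rep_def)
qed

text \<open>
  The general linear group acts on the absolutely irreducible tuples with orbits the isomorphism
  classes, and by Schur's lemma all stabilizers are the nonzero scalars.
\<close>

lemma card_class:
  fixes K :: "nat ring"
  assumes K: "field K" and fin: "finite (carrier K)" and As: "As \<in> abs_irr_reps K m d"
  shows "card {Bs \<in> abs_irr_reps K m d. isomorphic_reps K d As Bs} * (card (carrier K) - 1) =
    card (general_linear K d)"
proof -
  interpret K: field K by (rule K)
  have AR: "As \<in> reps K m d" and irr: "absolutely_irreducible_rep K d As"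
    using As by (simp_all add: abs_irr_reps_def)
  have d: "d > 0" using irr by (simp add: absolutely_irreducible_rep_def K.irreducible_iff)
  define C where "C = {Bs \<in> abs_irr_reps K m d. isomorphic_reps K d As Bs}"
  \<comment> \<open>the invertible matrices from \<open>As\<close> to \<open>Bs\<close>; each such set is a torsor under the nonzero scalars\<close>
  define F where "F = (\<lambda>Bs. {P \<in> general_linear K d. intertwines K d P As Bs})"
  have finGL: "finite (general_linear K d)"
    using finite_matrices[OF fin, of d] by (rule rev_finite_subset) (auto simp: general_linear_def)
  have CR: "Bs \<in> reps K m d" if "Bs \<in> C" for Bs using that by (simp add: C_def abs_irr_reps_def)
  have finC: "finite C"
    using finite_reps[OF fin, of m d] by (rule rev_finite_subset) (auto dest: CR)
  have cover: "general_linear K d = (\<Union>Bs\<in>C. F Bs)"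
  proof (intro equalityI subsetI)
    fix P assume P: "P \<in> general_linear K d"
    then obtain Q where PQ: "inverse_matrices K d P Q" using K.general_linear_iff_inverse by blast
    note I = inverse_matricesD[OF PQ]
    define Bs where "Bs = map (\<lambda>A. matrix_of K d (\<lambda>v. mat_act K P (mat_act K A (mat_act K Q v)))) As"
    note lin = K.linear_map_comp3[OF I(1) _ I(2)]
    have BR: "Bs \<in> reps K m d"
      using K.matrix_of(1)[OF lin] reps_length[OF AR] reps_set[OF AR] by (auto simp: reps_def Bs_def)
    have "mat_act K P (mat_act K (As ! i) v) = mat_act K (Bs ! i) (mat_act K P v)"
      if i: "i < length As" and v: "v \<in> kspace K d" for i v
    proof -
      have A: "As ! i \<in> matrices K d" using reps_set[OF AR] i by simp
      have Pv: "mat_act K P v \<in> kspace K d" using I(1) v by simp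
      have "mat_act K (Bs ! i) (mat_act K P v) = mat_act K P (mat_act K (As ! i) (mat_act K Q (mat_act K P v)))"
        using i by (simp add: Bs_def K.matrix_of(2)[OF lin[OF A] Pv])
      thus ?thesis by (simp add: I(4)[OF v])
    qed
    hence int: "intertwines K d P As Bs" by (simp add: intertwines_def Bs_def)
    have "absolutely_irreducible_rep K d Bs"
      by (rule absolutely_irreducible_intertwined[OF K AR BR PQ int irr])
    hence "Bs \<in> C" using BR P int by (auto simp: C_def abs_irr_reps_def isomorphic_reps_iff)
    thus "P \<in> (\<Union>Bs\<in>C. F Bs)" using P int by (auto simp: F_def)
  qed (auto simp: F_def)
  have disj: "F Bs \<inter> F Cs = {}" if B: "Bs \<in> C" and C: "Cs \<in> C" and ne: "Bs \<noteq> Cs" for Bs Cs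
  proof (rule ccontr)
    assume "F Bs \<inter> F Cs \<noteq> {}"
    then obtain P where P: "P \<in> general_linear K d" "intertwines K d P As Bs" "intertwines K d P As Cs"
      by (auto simp: F_def)
    then obtain Q where PQ: "inverse_matrices K d P Q" using K.general_linear_iff_inverse by blast
    note I = inverse_matricesD[OF PQ]
    have "Bs = Cs"
    proof (rule reps_eqI[OF CR[OF B] CR[OF C] K.is_cring])
      fix i v assume i: "i < m" and v: "v \<in> kspace K d"
      have Qv: "mat_act K Q v \<in> kspace K d" using I(2) v by simp
      show "mat_act K (Bs ! i) v = mat_act K (Cs ! i) v"
        using intertwinesD[OF P(2) _ Qv, of i] intertwinesD[OF P(3) _ Qv, of i] i reps_length[OF AR] I(3)[OF v] by simp
    qed
    thus False using ne by contradiction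
  qed
  have fib: "card (F Bs) = card (carrier K) - 1" if B: "Bs \<in> C" for Bs
  proof -
    from B obtain P where P: "P \<in> general_linear K d" "intertwines K d P As Bs"
      by (auto simp: C_def isomorphic_reps_iff)
    then obtain Q where PQ: "inverse_matrices K d P Q" using K.general_linear_iff_inverse by blast
    note I = inverse_matricesD[OF PQ]
    define f where "f = (\<lambda>c v. vscale K d c (mat_act K P v))"
    have lin: "K.linear_map d (f c)" if c: "c \<in> carrier K" for c
      using c I(1) unfolding f_def
      by (intro K.linear_mapI) (simp_all add: K.mat_act_add K.mat_act_scale K.vscale_add K.vscale_scale)
    note Mf = K.matrix_of[OF lin]
    have act_f: "mat_act K (matrix_of K d (f c)) v = vscale K d c (mat_act K P v)"
      if "c \<in> carrier K" "v \<in> kspace K d" for c v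
      using Mf(2)[OF that] by (simp add: f_def)
    have sub: "matrix_of K d (f c) \<in> F Bs" if c: "c \<in> carrier K" "c \<noteq> \<zero>\<^bsub>K\<^esub>" for c
    proof -
      have ic: "inv\<^bsub>K\<^esub> c \<in> carrier K" by (rule K.inv_closed'[OF c])
      let ?Q = "matrix_of K d (\<lambda>v. vscale K d (inv\<^bsub>K\<^esub> c) (mat_act K Q v))"
      have linQ: "K.linear_map d (\<lambda>v. vscale K d (inv\<^bsub>K\<^esub> c) (mat_act K Q v))"
        using ic I(2)
        by (intro K.linear_mapI) (simp_all add: K.mat_act_add K.mat_act_scale K.vscale_add K.vscale_scale)
      note MQ = K.matrix_of[OF linQ]
      have canc: "vscale K d c (vscale K d (inv\<^bsub>K\<^esub> c) v) = v" "vscale K d (inv\<^bsub>K\<^esub> c) (vscale K d c v) = v"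
        if v: "v \<in> kspace K d" for v
      proof -
        show 1: "vscale K d (inv\<^bsub>K\<^esub> c) (vscale K d c v) = v"
          using K.nonzero_mult_cancel[OF c(1) kspace_nth[OF v] c(2)] by (intro eq_vecI) (simp_all add: kspace_dim[OF v])
        show "vscale K d c (vscale K d (inv\<^bsub>K\<^esub> c) v) = v"
          using 1 K.vscale_scale[OF c(1) ic v] by simp
      qed
      have "inverse_matrices K d (matrix_of K d (f c)) ?Q"
        unfolding inverse_matrices_def
      proof (intro conjI ballI)
        fix v assume v: "v \<in> kspace K d"
        have Qv: "mat_act K Q v \<in> kspace K d" and Pv: "mat_act K P v \<in> kspace K d" using I v by simp_all
        show "mat_act K (matrix_of K d (f c)) (mat_act K ?Q v) = v"
          using c(1) ic Qv I v by (simp add: MQ(2)[OF v] act_f K.mat_act_scale canc)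
        show "mat_act K ?Q (mat_act K (matrix_of K d (f c)) v) = v"
          using c Pv I v by (simp add: MQ(2) act_f K.mat_act_scale canc)
      qed (rule Mf(1)[OF c(1)] MQ(1))+
      moreover have "intertwines K d (matrix_of K d (f c)) As Bs"
        unfolding intertwines_def
      proof (intro conjI allI impI ballI)
        show "length As = length Bs" using reps_length[OF AR] reps_length[OF CR[OF B]] by simp
        fix i v assume i: "i < length As" and v: "v \<in> kspace K d"
        have im: "i < m" using i reps_length[OF AR] by simp
        have A: "As ! i \<in> matrices K d" "Bs ! i \<in> matrices K d"
          using reps_nth[OF AR im] reps_nth[OF CR[OF B] im] by simp_all
        show "mat_act K (matrix_of K d (f c)) (mat_act K (As ! i) v) = mat_act K (Bs ! i) (mat_act K (matrix_of K d (f c)) v)"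
          using A v c(1) I(1) intertwinesD[OF P(2) i v] by (simp add: act_f K.mat_act_scale)
      qed
      ultimately show ?thesis using K.general_linear_iff_inverse by (auto simp: F_def)
    qed
    have "F Bs \<subseteq> (\<lambda>c. matrix_of K d (f c)) ` (carrier K - {\<zero>\<^bsub>K\<^esub>})"
    proof
      fix P' assume P': "P' \<in> F Bs"
      hence GL': "P' \<in> matrices K d" "bij_betw (mat_act K P') (kspace K d) (kspace K d)"
        and int': "intertwines K d P' As Bs"
        by (simp_all add: F_def general_linear_def)
      let ?X = "matrix_of K d (\<lambda>v. mat_act K Q (mat_act K P' v))"
      note linX = K.linear_map_comp[OF I(2) GL'(1)]
      have "?X \<in> commutant K d (set As)"
      proof (rule K.commutantI[OF linX])
        show "set As \<subseteq> matrices K d" using reps_set[OF AR] by blast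
        fix A v assume A: "A \<in> set As" and v: "v \<in> kspace K d"
        then obtain i where i: "i < m" "A = As ! i" using reps_length[OF AR] by (auto simp: in_set_conv_nth)
        have P'v: "mat_act K P' v \<in> kspace K d" using GL'(1) v by simp
        have "mat_act K P' (mat_act K A v) = mat_act K (Bs ! i) (mat_act K P' v)"
          using i reps_length[OF AR] intertwinesD[OF int' _ v, of i] by simp
        moreover have "mat_act K Q (mat_act K (Bs ! i) (mat_act K P' v)) = mat_act K A (mat_act K Q (mat_act K P' v))"
          using intertwinesD[OF K.intertwines_inverse[OF AR CR[OF B] PQ P(2)] _ P'v, of i] i reps_length[OF CR[OF B]]
          by simp
        ultimately show "mat_act K Q (mat_act K P' (mat_act K A v)) = mat_act K A (mat_act K Q (mat_act K P' v))"
          by simp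
      qed
      from absolutely_irreducible_commutant[OF K fin AR irr this]
      obtain c where c: "c \<in> carrier K" "\<forall>v\<in>kspace K d. mat_act K ?X v = vscale K d c v" by blast
      have act: "mat_act K P' v = f c v" if v: "v \<in> kspace K d" for v
      proof -
        have P'v: "mat_act K P' v \<in> kspace K d" using GL'(1) v by simp
        have "mat_act K Q (mat_act K P' v) = vscale K d c v" using c(2) v K.matrix_of(2)[OF linX v] by simp
        hence "mat_act K P (mat_act K Q (mat_act K P' v)) = mat_act K P (vscale K d c v)" by simp
        thus ?thesis using I(3)[OF P'v] I(1) c(1) v by (simp add: f_def K.mat_act_scale)
      qed
      have "P' = matrix_of K d (f c)"
        by (rule K.matrices_eqI[OF GL'(1) Mf(1)[OF c(1)]]) (simp add: act Mf(2)[OF c(1)])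
      moreover have "c \<noteq> \<zero>\<^bsub>K\<^esub>"
      proof
        assume c0: "c = \<zero>\<^bsub>K\<^esub>"
        have "mat_act K P' v = vzero K d" if v: "v \<in> kspace K d" for v
          using act[OF v] I(1) v kspace_nth[OF K.mat_act_closed[OF I(1) v]]
          by (simp add: f_def c0) (auto intro!: eq_vecI)
        hence "mat_act K P' (axis_vec K d \<one>\<^bsub>K\<^esub> 0) = mat_act K P' (vzero K d)" by simp
        hence "axis_vec K d \<one>\<^bsub>K\<^esub> 0 = vzero K d"
          using inj_onD[OF bij_betw_imp_inj_on[OF GL'(2)]] by simp
        hence "axis_vec K d \<one>\<^bsub>K\<^esub> 0 $ 0 = vzero K d $ 0" by simp
        thus False using d by simp
      qed
      ultimately show "P' \<in> (\<lambda>c. matrix_of K d (f c)) ` (carrier K - {\<zero>\<^bsub>K\<^esub>})" using c(1) by blast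
    qed
    hence eq: "F Bs = (\<lambda>c. matrix_of K d (f c)) ` (carrier K - {\<zero>\<^bsub>K\<^esub>})" using sub by blast
    have "inj_on (\<lambda>c. matrix_of K d (f c)) (carrier K - {\<zero>\<^bsub>K\<^esub>})"
    proof (rule inj_onI)
      fix c e assume "c \<in> carrier K - {\<zero>\<^bsub>K\<^esub>}" "e \<in> carrier K - {\<zero>\<^bsub>K\<^esub>}" and s: "matrix_of K d (f c) = matrix_of K d (f e)"
      hence c: "c \<in> carrier K" and e: "e \<in> carrier K" by simp_all
      define v where "v = mat_act K Q (axis_vec K d \<one>\<^bsub>K\<^esub> 0)"
      have v: "v \<in> kspace K d" using I(2) by (simp add: v_def)
      have "f c v = f e v" using Mf(2)[OF c v] Mf(2)[OF e v] s by simp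
      hence "vscale K d c (axis_vec K d \<one>\<^bsub>K\<^esub> 0) = vscale K d e (axis_vec K d \<one>\<^bsub>K\<^esub> 0)"
        by (simp add: f_def v_def I(3))
      hence "vscale K d c (axis_vec K d \<one>\<^bsub>K\<^esub> 0) $ 0 = vscale K d e (axis_vec K d \<one>\<^bsub>K\<^esub> 0) $ 0" by simp
      thus "c = e" using c e d by simp
    qed
    hence "card (F Bs) = card (carrier K - {\<zero>\<^bsub>K\<^esub>})" unfolding eq by (rule card_image)
    thus ?thesis using fin by simp
  qed
  have "card (general_linear K d) = (\<Sum>Bs\<in>C. card (F Bs))"
    unfolding cover using finC finGL disj
    by (intro card_UN_disjoint) (auto simp: F_def)
  also have "\<dots> = card C * (card (carrier K) - 1)" by (simp add: fib)
  finally show ?thesis by (simp add: C_def)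
qed

lemma card_abs_irr_reps:
  fixes K :: "nat ring"
  assumes K: "field K" and fin: "finite (carrier K)"
  shows "card (abs_irr_reps K m d) * (card (carrier K) - 1) =
    card (abs_irr_classes K m d) * card (general_linear K d)"
proof -
  interpret K: field K by (rule K)
  let ?X = "abs_irr_reps K m d"
  let ?r = "{(As, Bs). As \<in> ?X \<and> Bs \<in> ?X \<and> isomorphic_reps K d As Bs}"
  have XR: "As \<in> reps K m d" if "As \<in> ?X" for As using that by (simp add: abs_irr_reps_def)
  have refl: "isomorphic_reps K d As As" if "As \<in> ?X" for As
  proof -
    have "matrix_of K d (\<lambda>v. v) \<in> general_linear K d"
      using K.general_linear_iff_inverse K.identity_inverse by blast
    moreover have "intertwines K d (matrix_of K d (\<lambda>v. v)) As As"
      using reps_set[OF XR[OF that]] by (simp add: intertwines_def K.matrix_of(2)[OF K.linear_map_id])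
    ultimately show ?thesis by (auto simp: isomorphic_reps_iff)
  qed
  have sym: "isomorphic_reps K d Bs As" if "As \<in> ?X" "Bs \<in> ?X" "isomorphic_reps K d As Bs" for As Bs
  proof -
    from that(3) obtain P where P: "P \<in> general_linear K d" "intertwines K d P As Bs"
      by (auto simp: isomorphic_reps_iff)
    then obtain Q where PQ: "inverse_matrices K d P Q" using K.general_linear_iff_inverse by blast
    have "intertwines K d Q Bs As" by (rule K.intertwines_inverse[OF XR[OF that(1)] XR[OF that(2)] PQ P(2)])
    moreover have "Q \<in> general_linear K d" using inverse_matrices_sym[OF PQ] K.general_linear_iff_inverse by blast
    ultimately show ?thesis by (auto simp: isomorphic_reps_iff)
  qed
  have trans: "isomorphic_reps K d As Cs"
    if X: "As \<in> ?X" "Bs \<in> ?X" "Cs \<in> ?X" and iso: "isomorphic_reps K d As Bs" "isomorphic_reps K d Bs Cs" for As Bs Cs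
  proof -
    from iso obtain P Q where P: "P \<in> general_linear K d" "intertwines K d P As Bs"
      and Q: "Q \<in> general_linear K d" "intertwines K d Q Bs Cs"
      by (auto simp: isomorphic_reps_iff)
    have M: "P \<in> matrices K d" "Q \<in> matrices K d" using P Q by (simp_all add: general_linear_def)
    let ?QP = "matrix_of K d (\<lambda>v. mat_act K Q (mat_act K P v))"
    note QP = K.matrix_of[OF K.linear_map_comp[OF M(2,1)]]
    have "bij_betw (mat_act K Q \<circ> mat_act K P) (kspace K d) (kspace K d)"
      using P(1) Q(1) by (intro bij_betw_trans[of _ _ "kspace K d"]) (simp_all add: general_linear_def)
    hence "bij_betw (mat_act K ?QP) (kspace K d) (kspace K d)"
      by (subst bij_betw_cong[where g = "mat_act K Q \<circ> mat_act K P"]) (simp_all add: QP(2))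
    hence "?QP \<in> general_linear K d" using QP(1) by (simp add: general_linear_def)
    moreover have "intertwines K d ?QP As Cs"
      unfolding intertwines_def
    proof (intro conjI allI impI ballI)
      show "length As = length Cs" using P(2) Q(2) by (simp add: intertwines_def)
      fix i v assume i: "i < length As" and v: "v \<in> kspace K d"
      have i': "i < m" "i < length Bs" using i reps_length[OF XR[OF X(1)]] reps_length[OF XR[OF X(2)]] by simp_all
      have A: "As ! i \<in> matrices K d" using reps_nth[OF XR[OF X(1)] i'(1)] .
      have Pv: "mat_act K P v \<in> kspace K d" using M v by simp
      show "mat_act K ?QP (mat_act K (As ! i) v) = mat_act K (Cs ! i) (mat_act K ?QP v)"
        using A v M intertwinesD[OF P(2) i v] intertwinesD[OF Q(2) i'(2) Pv] by (simp add: QP(2))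
    qed
    ultimately show ?thesis by (auto simp: isomorphic_reps_iff)
  qed
  have eq: "equiv ?X ?r"
  proof (rule equivI)
    show "?r \<subseteq> ?X \<times> ?X" by auto
    show "refl_on ?X ?r" using refl by (auto simp: refl_on_def)
    show "sym ?r" using sym by (auto simp: sym_def)
    show "trans ?r" using trans unfolding trans_def by blast
  qed
  have finX: "finite ?X"
    using finite_reps[OF fin, of m d] by (rule rev_finite_subset) (auto dest: XR)
  define k where "k = card (general_linear K d) div (card (carrier K) - 1)"
  have "{\<zero>\<^bsub>K\<^esub>, \<one>\<^bsub>K\<^esub>} \<subseteq> carrier K" by simp
  hence "card {\<zero>\<^bsub>K\<^esub>, \<one>\<^bsub>K\<^esub>} \<le> card (carrier K)" using fin by (intro card_mono)
  hence q: "card (carrier K) - 1 > 0" by simp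
  have ck: "card c * (card (carrier K) - 1) = card (general_linear K d)" if c: "c \<in> ?X // ?r" for c
  proof -
    obtain As where As: "As \<in> ?X" "c = ?r `` {As}" using c by (rule quotientE)
    have "c = {Bs \<in> ?X. isomorphic_reps K d As Bs}" using As by auto
    thus ?thesis using card_class[OF K fin As(1)] by simp
  qed
  have "k * card (?X // ?r) = card (\<Union>(?X // ?r))"
  proof (rule card_partition)
    show "finite (?X // ?r)" using finX by (rule finite_quotient) auto
    show "finite (\<Union>(?X // ?r))" using finX by (simp only: Union_quotient[OF eq])
    show "card c = k" if "c \<in> ?X // ?r" for c
      using ck[OF that] q unfolding k_def by (metis nonzero_mult_div_cancel_right less_numeral_extra(3))
    show "c1 \<inter> c2 = {}" if "c1 \<in> ?X // ?r" "c2 \<in> ?X // ?r" "c1 \<noteq> c2" for c1 c2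
      using quotient_disj[OF eq that(1,2)] that(3) by blast
  qed
  hence kX: "k * card (abs_irr_classes K m d) = card ?X"
    by (simp only: Union_quotient[OF eq] abs_irr_classes_def)
  show ?thesis
  proof (cases "\<exists>c. c \<in> ?X // ?r")
    case False
    hence "?X // ?r = {}" by (simp only: ex_in_conv not_not)
    hence "abs_irr_classes K m d = {}" by (simp only: abs_irr_classes_def)
    thus ?thesis using kX by simp
  next
    case True
    then obtain c where "c \<in> ?X // ?r" by (rule exE)
    hence "(card (carrier K) - 1) dvd card (general_linear K d)" using ck[of c] by (metis dvd_triv_right)
    hence "k * (card (carrier K) - 1) = card (general_linear K d)" by (simp add: k_def)
    thus ?thesis using kX by (metis mult.assoc mult.commute)
  qed
qed

section \<open>A torus acting on the tuples with a given support\<close>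

text \<open>
  Pigeonhole: among \<open>B\<close> multiples of \<open>x\<close> two have all their residues modulo \<open>n\<close> in the same fifths of the
  interval, and their difference is small.
\<close>

lemma simultaneous_small_multiple:
  fixes x :: "nat \<Rightarrow> int" and n :: int and B d :: nat
  assumes n: "n > 0" and B: "5 ^ d < B"
  shows "\<exists>s W. 0 < s \<and> s < B \<and> (\<forall>a<d. n dvd W a - int s * x a) \<and> (\<forall>a<d. 5 * \<bar>W a\<bar> < n)"
proof -
  define r where "r = (\<lambda>s a. (int s * x a) mod n)"
  have r: "0 \<le> r s a" "r s a < n" for s a using n by (simp_all add: r_def)
  \<comment> \<open>the vector of the fifths of the interval that contain the residues\<close>
  define F where "F = (\<lambda>s. restrict (\<lambda>a. (5 * r s a) div n) {..<d})"
  have box: "(5 * r s a) div n \<in> {0..4}" for s a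
  proof -
    have "(5 * r s a) div n * n \<le> 5 * r s a"
      using n div_mult_mod_eq[of "5 * r s a" n] pos_mod_sign[of n "5 * r s a"] by linarith
    also have "\<dots> < 5 * n" using r(2)[of s a] by simp
    finally have "(5 * r s a) div n < 5" using n by simp
    moreover have "0 \<le> (5 * r s a) div n" using n r(1)[of s a] by (simp add: pos_imp_zdiv_nonneg_iff)
    ultimately show ?thesis by simp
  qed
  have "F ` {..<B} \<subseteq> {..<d} \<rightarrow>\<^sub>E {0..4}" by (intro image_subsetI) (simp only: F_def restrict_PiE_iff box ball_triv simp_thms)
  moreover have fin: "finite ({..<d} \<rightarrow>\<^sub>E {0..4::int})" by (intro finite_PiE) simp_all
  ultimately have "card (F ` {..<B}) \<le> card ({..<d} \<rightarrow>\<^sub>E {0..4::int})" by (intro card_mono)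
  also have "\<dots> = 5 ^ d" by (simp add: card_PiE)
  also have "\<dots> < card {..<B}" using B by simp
  finally have "\<not> inj_on F {..<B}" by (rule pigeonhole)
  then obtain s1 s2 where s: "s1 < B" "s2 < B" "F s1 = F s2" "s1 \<noteq> s2" by (auto simp: inj_on_def)
  have main: ?thesis if s: "s1 < s2" "s2 < B" "F s1 = F s2" for s1 s2
  proof -
    define W where "W = (\<lambda>a. r s2 a - r s1 a)"
    have "n dvd W a - int (s2 - s1) * x a" for a
    proof -
      have "n dvd r s2 a - int s2 * x a" "n dvd r s1 a - int s1 * x a"
        unfolding r_def mod_eq_dvd_iff[symmetric] by simp_all
      hence "n dvd (r s2 a - int s2 * x a) - (r s1 a - int s1 * x a)" by (rule dvd_diff)
      thus ?thesis using s(1) by (simp add: W_def of_nat_diff algebra_simps)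
    qed
    moreover have "5 * \<bar>W a\<bar> < n" if a: "a < d" for a
    proof -
      define k where "k = (5 * r s1 a) div n"
      have "F s1 a = F s2 a" using s(3) by simp
      hence k2: "(5 * r s2 a) div n = k" using a by (simp add: F_def k_def)
      have "k * n \<le> 5 * r s1 a" "5 * r s1 a < k * n + n"
        using n div_mult_mod_eq[of "5 * r s1 a" n] pos_mod_bound[of n "5 * r s1 a"] pos_mod_sign[of n "5 * r s1 a"]
        unfolding k_def by linarith+
      moreover have "k * n \<le> 5 * r s2 a" "5 * r s2 a < k * n + n"
        using n div_mult_mod_eq[of "5 * r s2 a" n] pos_mod_bound[of n "5 * r s2 a"] pos_mod_sign[of n "5 * r s2 a"]
        unfolding k2 by linarith+
      ultimately have "5 * W a < n \<and> 5 * (- W a) < n" unfolding W_def by (intro conjI; simp)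
      thus ?thesis by (simp add: abs_if)
    qed
    moreover have "0 < s2 - s1" "s2 - s1 < B" using s by simp_all
    ultimately show ?thesis by blast
  qed
  show ?thesis
  proof (cases "s1 < s2")
    case True
    thus ?thesis using main[of s1 s2] s by simp
  next
    case False
    thus ?thesis using main[of s2 s1] s by simp
  qed
qed

text \<open>
  An infinitesimal form of freeness of the torus action: diagonal exponents \<open>x\<close> and block exponents \<open>y\<close> that
  fix all tuples with support \<open>P\<close> are trivial on each block, up to a constant.
\<close>

definition stable_partition :: "nat \<Rightarrow> int \<Rightarrow> (nat \<times> nat \<times> nat) set \<Rightarrow> (nat \<Rightarrow> nat) \<Rightarrow> bool" where
  "stable_partition d n P \<pi> \<longleftrightarrow> (\<forall>x y. (\<forall>(i, a, b)\<in>P. n dvd x a + y (i, \<pi> a, \<pi> b) - x b) \<longrightarrow>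
    (\<forall>a<d. \<forall>b<d. \<pi> a = \<pi> b \<longrightarrow> n dvd x a - x b))"

lemma stable_partitionD:
  assumes "stable_partition d n P \<pi>"
    and "\<And>i a b. (i, a, b) \<in> P \<Longrightarrow> n dvd x a + y (i, \<pi> a, \<pi> b) - x b"
    and "a < d" "b < d" "\<pi> a = \<pi> b"
  shows "n dvd x a - x b"
proof -
  have "(\<forall>(i, a, b)\<in>P. n dvd x a + y (i, \<pi> a, \<pi> b) - x b) \<longrightarrow>
      (\<forall>a<d. \<forall>b<d. \<pi> a = \<pi> b \<longrightarrow> n dvd x a - x b)"
    by (rule spec[OF spec[OF assms(1)[unfolded stable_partition_def]]])
  moreover have "\<forall>(i, a, b)\<in>P. n dvd x a + y (i, \<pi> a, \<pi> b) - x b"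
    using assms(2) by (intro ballI) (simp only: split_paired_all prod.case)
  ultimately have "\<forall>a<d. \<forall>b<d. \<pi> a = \<pi> b \<longrightarrow> n dvd x a - x b" by (rule mp)
  thus ?thesis using assms(3-5) by simp
qed

text \<open>
  A good partition with as many blocks as possible is stable. Exponents violating stability have a small
  multiple \<open>W\<close>, and then the congruences between differences of \<open>W\<close> are equalities of integers. So \<open>W\<close>
  refines the partition to a good one with more blocks, as the multiplier is prime to \<open>n\<close>.
  The bound \<open>5\<close> leaves room for the four terms in \<open>W a - W b - (W a' - W b')\<close>.
\<close>

lemma exists_good_stable_partition:
  fixes n :: int
  assumes n: "n > 0" and B: "5 ^ d < B" and rough: "\<And>s. 0 < s \<Longrightarrow> s < B \<Longrightarrow> coprime (int s) n"
    and P: "P \<subseteq> {..<m} \<times> {..<d} \<times> {..<d}"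
  shows "\<exists>\<pi>. good_partition m d P \<pi> \<and> stable_partition d n P \<pi>"
proof -
  have "\<exists>\<pi>. good_partition m d P \<pi> \<and>
      (\<forall>\<pi>'. good_partition m d P \<pi>' \<longrightarrow> card (\<pi>' ` {..<d}) \<le> card (\<pi> ` {..<d}))"
  proof (rule ex_has_greatest_nat)
    show "good_partition m d P (\<lambda>_. 0)" by (rule good_partition_trivial)
    show "\<forall>\<pi>. good_partition m d P \<pi> \<longrightarrow> card (\<pi> ` {..<d}) < Suc d"
      using card_image_le[of "{..<d}"] by (auto simp: less_Suc_eq_le)
  qed
  then obtain \<pi> where good: "good_partition m d P \<pi>"
    and max: "\<And>\<pi>'. good_partition m d P \<pi>' \<Longrightarrow> card (\<pi>' ` {..<d}) \<le> card (\<pi> ` {..<d})"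
    by blast
  have "stable_partition d n P \<pi>"
    unfolding stable_partition_def
  proof (intro allI impI)
    fix x y a0 b0
    assume xy: "\<forall>(i, a, b)\<in>P. n dvd x a + y (i, \<pi> a, \<pi> b) - x b"
      and a0: "a0 < d" and b0: "b0 < d" and eq: "\<pi> a0 = \<pi> b0"
    show "n dvd x a0 - x b0"
    proof (rule ccontr)
      assume nd: "\<not> n dvd x a0 - x b0"
      obtain s W where s: "0 < s" "s < B" and W: "\<forall>a<d. n dvd W a - int s * x a" "\<forall>a<d. 5 * \<bar>W a\<bar> < n"
        using simultaneous_small_multiple[OF n B, of x] by blast
      define Q where "Q = (\<lambda>i g h w. \<exists>a b. (i, a, b) \<in> P \<and> \<pi> a = g \<and> \<pi> b = h \<and> w = W a - W b)"
      \<comment> \<open>the common difference of weights on one part of the pattern\<close>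
      define \<omega> where "\<omega> = (\<lambda>i g h. SOME w. Q i g h w)"
      have diff: "n dvd (W a - W b) + int s * y (i, \<pi> a, \<pi> b)" if "(i, a, b) \<in> P" for i a b
      proof -
        have ab: "a < d" "b < d" using that P by auto
        have "n dvd (W a - int s * x a) - (W b - int s * x b)"
          by (rule dvd_diff) (use W(1) ab in simp_all)
        moreover have "n dvd x a + y (i, \<pi> a, \<pi> b) - x b" using bspec[OF xy that] by simp
        ultimately have "n dvd (W a - int s * x a) - (W b - int s * x b) + int s * (x a + y (i, \<pi> a, \<pi> b) - x b)"
          by (intro dvd_add dvd_mult)
        thus ?thesis by (simp add: algebra_simps)
      qed
      have hom: "W a - W b = \<omega> i (\<pi> a) (\<pi> b)" if p: "(i, a, b) \<in> P" for i a b
      proof -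
        have "Q i (\<pi> a) (\<pi> b) (W a - W b)" using p unfolding Q_def by blast
        hence "Q i (\<pi> a) (\<pi> b) (\<omega> i (\<pi> a) (\<pi> b))" unfolding \<omega>_def by (rule someI)
        then obtain a' b' where p': "(i, a', b') \<in> P" "\<pi> a' = \<pi> a" "\<pi> b' = \<pi> b"
          and w: "\<omega> i (\<pi> a) (\<pi> b) = W a' - W b'" unfolding Q_def by blast
        have ab: "a < d" "b < d" "a' < d" "b' < d" using p p'(1) P by auto
        have "n dvd ((W a - W b) + int s * y (i, \<pi> a, \<pi> b)) - ((W a' - W b') + int s * y (i, \<pi> a', \<pi> b'))"
          by (intro dvd_diff diff p p'(1))
        hence "n dvd (W a - W b) - (W a' - W b')" by (simp add: p'(2,3))
        moreover have "\<bar>(W a - W b) - (W a' - W b')\<bar> < n"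
        proof -
          have "5 * \<bar>W a\<bar> < n" "5 * \<bar>W b\<bar> < n" "5 * \<bar>W a'\<bar> < n" "5 * \<bar>W b'\<bar> < n"
            using W(2) ab by simp_all
          thus ?thesis by linarith
        qed
        ultimately have "(W a - W b) - (W a' - W b') = 0" by (rule int_eq_0_of_large_divisor)
        thus ?thesis using w by simp
      qed
      \<comment> \<open>the partition refined by \<open>W\<close>\<close>
      define \<pi>' where "\<pi>' = (\<lambda>a. prod_encode (\<pi> a, int_encode (W a)))"
      have "good_partition m d P \<pi>'"
        unfolding \<pi>'_def using good hom by (rule good_partition_refine)
      hence le: "card (\<pi>' ` {..<d}) \<le> card (\<pi> ` {..<d})" by (rule max)
      let ?f = "\<lambda>g. fst (prod_decode g)"
      have im: "\<pi> ` {..<d} = ?f ` (\<pi>' ` {..<d})" by (simp add: \<pi>'_def image_image)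
      have "card (?f ` (\<pi>' ` {..<d})) = card (\<pi>' ` {..<d})"
        using card_image_le[of "\<pi>' ` {..<d}" ?f] le unfolding im by simp
      hence inj: "inj_on ?f (\<pi>' ` {..<d})" by (intro eq_card_imp_inj_on) simp_all
      have "\<pi>' a0 = \<pi>' b0"
        by (rule inj_onD[OF inj _ imageI[of a0] imageI[of b0]])
          (use a0 b0 eq in \<open>simp_all add: \<pi>'_def\<close>)
      hence Weq: "W a0 = W b0" by (simp add: \<pi>'_def prod_encode_eq int_encode_eq)
      have "n dvd (W b0 - int s * x b0) - (W a0 - int s * x a0)"
        by (rule dvd_diff) (use W(1) a0 b0 in simp_all)
      hence "n dvd int s * (x a0 - x b0)" by (simp add: Weq algebra_simps)
      moreover have "coprime n (int s)" using rough[OF s] by (simp add: coprime_commute)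
      ultimately show False using nd coprime_dvd_mult_right_iff by blast
    qed
  qed
  thus ?thesis using good by blast
qed

text \<open>
  Tuples of exponents act on the tuples of matrices with a given support: \<open>e\<close> conjugates by a
  diagonal matrix, \<open>f\<close> rescales every block of every matrix. The factor \<open>n - 1\<close> plays the role of
  \<open>-1\<close>, as the base \<open>\<gamma>\<close> has order \<open>n\<close>.
\<close>

definition twist_exponent :: "nat \<Rightarrow> (nat \<Rightarrow> nat) \<Rightarrow> (nat \<Rightarrow> nat) \<Rightarrow> (nat \<times> nat \<times> nat \<Rightarrow> nat) \<Rightarrow>
    nat \<Rightarrow> nat \<Rightarrow> nat \<Rightarrow> nat" where
  "twist_exponent n \<pi> e f i a b = e a + f (i, \<pi> a, \<pi> b) + (n - 1) * e b"

definition twist :: "nat ring \<Rightarrow> nat \<Rightarrow> nat \<Rightarrow> nat \<Rightarrow> nat \<Rightarrow> (nat \<Rightarrow> nat) \<Rightarrow>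
    (nat \<Rightarrow> nat) \<Rightarrow> (nat \<times> nat \<times> nat \<Rightarrow> nat) \<Rightarrow> nat mat list \<Rightarrow> nat mat list" where
  "twist K m d n \<gamma> \<pi> e f As = map (\<lambda>i. mat d d (\<lambda>(a, b).
     \<gamma> [^]\<^bsub>K\<^esub> twist_exponent n \<pi> e f i a b \<otimes>\<^bsub>K\<^esub> (As ! i) $$ (a, b))) [0..<m]"

definition supported_abs_irr :: "nat ring \<Rightarrow> nat \<Rightarrow> nat \<Rightarrow> (nat \<times> nat \<times> nat) set \<Rightarrow> nat mat list set" where
  "supported_abs_irr K m d P = {As \<in> abs_irr_reps K m d. support K d As = P}"

lemma reps_entries_eqI:
  assumes "As \<in> reps K m d" "Bs \<in> reps K m d"
    and "\<And>i a b. i < m \<Longrightarrow> a < d \<Longrightarrow> b < d \<Longrightarrow> As ! i $$ (a, b) = Bs ! i $$ (a, b)"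
  shows "As = Bs"
proof (rule nth_equalityI)
  fix i assume "i < length As"
  hence i: "i < m" using reps_length[OF assms(1)] by simp
  show "As ! i = Bs ! i"
    using matrices_dim[OF reps_nth[OF assms(1) i]] matrices_dim[OF reps_nth[OF assms(2) i]] assms(3)[OF i]
    by (intro eq_matI) simp_all
qed (use reps_length[OF assms(1)] reps_length[OF assms(2)] in simp)

locale finite_field_with_root =
  fixes K :: "nat ring" and \<gamma> n :: nat
  assumes K: "field K" and fin: "finite (carrier K)"
    and \<gamma>: "\<gamma> \<in> carrier K" "\<gamma> \<noteq> \<zero>\<^bsub>K\<^esub>" and n: "n > 0"
    and order: "\<And>x y. \<gamma> [^]\<^bsub>K\<^esub> (x :: nat) = \<gamma> [^]\<^bsub>K\<^esub> (y :: nat) \<longleftrightarrow> [x = y] (mod n)"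
begin

sublocale K: field K by (rule K)

lemma pow_closed: "\<gamma> [^]\<^bsub>K\<^esub> (x :: nat) \<in> carrier K" "\<gamma> [^]\<^bsub>K\<^esub> (x :: nat) \<noteq> \<zero>\<^bsub>K\<^esub>"
  using \<gamma> by (simp, induction x) (simp_all add: K.integral_iff)

lemma pow_add: "\<gamma> [^]\<^bsub>K\<^esub> (x + y :: nat) = \<gamma> [^]\<^bsub>K\<^esub> x \<otimes>\<^bsub>K\<^esub> \<gamma> [^]\<^bsub>K\<^esub> y"
  using \<gamma> by (simp add: K.nat_pow_mult)

lemma pow_eq_one: "[x = 0] (mod n) \<Longrightarrow> \<gamma> [^]\<^bsub>K\<^esub> (x :: nat) = \<one>\<^bsub>K\<^esub>"
  using order[of x 0] by simp

lemma twist_nth: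
  assumes "i < m" "a < d" "b < d"
  shows "twist K m d n \<gamma> \<pi> e f As ! i $$ (a, b) =
    \<gamma> [^]\<^bsub>K\<^esub> twist_exponent n \<pi> e f i a b \<otimes>\<^bsub>K\<^esub> (As ! i) $$ (a, b)"
  using assms by (simp add: twist_def)

lemma twist_reps:
  assumes "As \<in> reps K m d"
  shows "twist K m d n \<gamma> \<pi> e f As \<in> reps K m d"
proof -
  have "mat d d (\<lambda>(a, b). \<gamma> [^]\<^bsub>K\<^esub> twist_exponent n \<pi> e f i a b \<otimes>\<^bsub>K\<^esub> (As ! i) $$ (a, b)) \<in> matrices K d"
    if "i < m" for i
    using matrices_nth[OF reps_nth[OF assms that]] pow_closed by (intro matricesI) simp_all
  thus ?thesis by (auto simp: reps_def twist_def)
qed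

lemma support_twist:
  assumes As: "As \<in> reps K m d"
  shows "support K d (twist K m d n \<gamma> \<pi> e f As) = support K d As"
proof -
  have "twist K m d n \<gamma> \<pi> e f As ! i $$ (a, b) = \<zero>\<^bsub>K\<^esub> \<longleftrightarrow> As ! i $$ (a, b) = \<zero>\<^bsub>K\<^esub>"
    if "i < m" "a < d" "b < d" for i a b
    using that pow_closed matrices_nth[OF reps_nth[OF As that(1)] that(2,3)]
    by (simp add: twist_nth K.integral_iff)
  thus ?thesis using reps_length[OF As] reps_length[OF twist_reps[OF As]] by (auto simp: support_def)
qed

lemma twist_supported:
  assumes good: "good_partition m d P \<pi>" and As: "As \<in> supported_abs_irr K m d P"
  shows "twist K m d n \<gamma> \<pi> e f As \<in> supported_abs_irr K m d P"
proof -
  have AR: "As \<in> reps K m d" and irr: "absolutely_irreducible_rep K d As" and P: "support K d As = P"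
    using As by (simp_all add: supported_abs_irr_def abs_irr_reps_def)
  have "absolutely_irreducible_rep K d (twist K m d n \<gamma> \<pi> e f As)"
  proof (rule absolutely_irreducible_twist[OF K AR twist_reps[OF AR] irr, where \<pi> = \<pi>
      and t = "\<lambda>a. \<gamma> [^]\<^bsub>K\<^esub> e a" and z = "\<lambda>i g h. \<gamma> [^]\<^bsub>K\<^esub> f (i, g, h)"])
    show "good_partition m d (support K d As) \<pi>" using good P by simp
    fix i a b assume i: "i < m" "a < d" "b < d"
    have A: "As ! i $$ (a, b) \<in> carrier K" using matrices_nth[OF reps_nth[OF AR i(1)] i(2,3)] .
    have "\<gamma> [^]\<^bsub>K\<^esub> (twist_exponent n \<pi> e f i a b + e b) = \<gamma> [^]\<^bsub>K\<^esub> (e a + f (i, \<pi> a, \<pi> b))"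
    proof -
      have "twist_exponent n \<pi> e f i a b + e b = e a + f (i, \<pi> a, \<pi> b) + n * e b"
        using n by (cases n) (simp_all add: twist_exponent_def)
      thus ?thesis unfolding order by (simp add: cong_def)
    qed
    hence ex: "\<gamma> [^]\<^bsub>K\<^esub> twist_exponent n \<pi> e f i a b \<otimes>\<^bsub>K\<^esub> \<gamma> [^]\<^bsub>K\<^esub> e b =
        \<gamma> [^]\<^bsub>K\<^esub> e a \<otimes>\<^bsub>K\<^esub> \<gamma> [^]\<^bsub>K\<^esub> f (i, \<pi> a, \<pi> b)" by (simp only: pow_add)
    have "twist K m d n \<gamma> \<pi> e f As ! i $$ (a, b) \<otimes>\<^bsub>K\<^esub> \<gamma> [^]\<^bsub>K\<^esub> e b =
        (\<gamma> [^]\<^bsub>K\<^esub> twist_exponent n \<pi> e f i a b \<otimes>\<^bsub>K\<^esub> \<gamma> [^]\<^bsub>K\<^esub> e b) \<otimes>\<^bsub>K\<^esub> As ! i $$ (a, b)"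
      unfolding twist_nth[OF i] using pow_closed A by (simp add: K.m_ac)
    thus "twist K m d n \<gamma> \<pi> e f As ! i $$ (a, b) \<otimes>\<^bsub>K\<^esub> \<gamma> [^]\<^bsub>K\<^esub> e b =
        \<gamma> [^]\<^bsub>K\<^esub> e a \<otimes>\<^bsub>K\<^esub> (\<gamma> [^]\<^bsub>K\<^esub> f (i, \<pi> a, \<pi> b) \<otimes>\<^bsub>K\<^esub> As ! i $$ (a, b))"
      using pow_closed A by (simp add: ex K.m_assoc)
  qed (use pow_closed in simp_all)
  thus ?thesis using twist_reps[OF AR] support_twist[OF AR] P
    by (simp add: supported_abs_irr_def abs_irr_reps_def)
qed

lemma twist_eq_iff:
  assumes As: "As \<in> reps K m d" and P: "support K d As = P"
  shows "twist K m d n \<gamma> \<pi> e f As = twist K m d n \<gamma> \<pi> e' f' As \<longleftrightarrow>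
    (\<forall>(i, a, b)\<in>P. [twist_exponent n \<pi> e f i a b = twist_exponent n \<pi> e' f' i a b] (mod n))"
proof
  assume eq: "twist K m d n \<gamma> \<pi> e f As = twist K m d n \<gamma> \<pi> e' f' As"
  show "\<forall>(i, a, b)\<in>P. [twist_exponent n \<pi> e f i a b = twist_exponent n \<pi> e' f' i a b] (mod n)"
  proof (intro ballI, clarify)
    fix i a b assume "(i, a, b) \<in> P"
    hence i: "i < m" "a < d" "b < d" and nz: "As ! i $$ (a, b) \<noteq> \<zero>\<^bsub>K\<^esub>"
      using P reps_length[OF As] by (auto simp: support_def)
    have A: "As ! i $$ (a, b) \<in> carrier K" using matrices_nth[OF reps_nth[OF As i(1)] i(2,3)] .
    have "\<gamma> [^]\<^bsub>K\<^esub> twist_exponent n \<pi> e f i a b \<otimes>\<^bsub>K\<^esub> As ! i $$ (a, b) =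
        \<gamma> [^]\<^bsub>K\<^esub> twist_exponent n \<pi> e' f' i a b \<otimes>\<^bsub>K\<^esub> As ! i $$ (a, b)"
      using arg_cong[OF eq, of "\<lambda>Bs. Bs ! i $$ (a, b)"] by (simp only: twist_nth[OF i])
    hence "\<gamma> [^]\<^bsub>K\<^esub> twist_exponent n \<pi> e f i a b = \<gamma> [^]\<^bsub>K\<^esub> twist_exponent n \<pi> e' f' i a b"
      using K.m_rcancel[OF nz A pow_closed(1) pow_closed(1)] by simp
    thus "[twist_exponent n \<pi> e f i a b = twist_exponent n \<pi> e' f' i a b] (mod n)" by (simp only: order)
  qed
next
  assume cong: "\<forall>(i, a, b)\<in>P. [twist_exponent n \<pi> e f i a b = twist_exponent n \<pi> e' f' i a b] (mod n)"
  show "twist K m d n \<gamma> \<pi> e f As = twist K m d n \<gamma> \<pi> e' f' As"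
  proof (rule reps_entries_eqI[OF twist_reps[OF As] twist_reps[OF As]])
    fix i a b assume i: "i < m" "a < d" "b < d"
    show "twist K m d n \<gamma> \<pi> e f As ! i $$ (a, b) = twist K m d n \<gamma> \<pi> e' f' As ! i $$ (a, b)"
    proof (cases "As ! i $$ (a, b) = \<zero>\<^bsub>K\<^esub>")
      case True
      thus ?thesis using pow_closed by (simp add: twist_nth[OF i])
    next
      case False
      hence "(i, a, b) \<in> P" using i P reps_length[OF As] by (auto simp: support_def)
      hence "[twist_exponent n \<pi> e f i a b = twist_exponent n \<pi> e' f' i a b] (mod n)"
        using cong by blast
      hence "\<gamma> [^]\<^bsub>K\<^esub> twist_exponent n \<pi> e f i a b = \<gamma> [^]\<^bsub>K\<^esub> twist_exponent n \<pi> e' f' i a b"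
        by (simp only: order)
      thus ?thesis by (simp only: twist_nth[OF i])
    qed
  qed
qed

lemma twist_exponent_add:
  "twist_exponent n \<pi> (\<lambda>a. e a + e' a) (\<lambda>c. f c + f' c) i a b =
    twist_exponent n \<pi> e f i a b + twist_exponent n \<pi> e' f' i a b"
  by (simp add: twist_exponent_def algebra_simps)

lemma twist_twist:
  assumes "As \<in> reps K m d"
  shows "twist K m d n \<gamma> \<pi> e f (twist K m d n \<gamma> \<pi> e' f' As) =
    twist K m d n \<gamma> \<pi> (\<lambda>a. e a + e' a) (\<lambda>c. f c + f' c) As"
proof (rule reps_entries_eqI[OF twist_reps[OF twist_reps[OF assms]] twist_reps[OF assms]])
  fix i a b assume i: "i < m" "a < d" "b < d"
  thus "twist K m d n \<gamma> \<pi> e f (twist K m d n \<gamma> \<pi> e' f' As) ! i $$ (a, b) =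
      twist K m d n \<gamma> \<pi> (\<lambda>a. e a + e' a) (\<lambda>c. f c + f' c) As ! i $$ (a, b)"
    using pow_closed matrices_nth[OF reps_nth[OF assms i(1)] i(2,3)]
    by (simp add: twist_nth twist_exponent_add pow_add K.m_assoc)
qed

lemma twist_trivial:
  assumes As: "As \<in> reps K m d"
    and "\<And>i a b. i < m \<Longrightarrow> a < d \<Longrightarrow> b < d \<Longrightarrow> [twist_exponent n \<pi> e f i a b = 0] (mod n)"
  shows "twist K m d n \<gamma> \<pi> e f As = As"
proof (rule reps_entries_eqI[OF twist_reps[OF As] As])
  fix i a b assume i: "i < m" "a < d" "b < d"
  show "twist K m d n \<gamma> \<pi> e f As ! i $$ (a, b) = As ! i $$ (a, b)"
    using matrices_nth[OF reps_nth[OF As i(1)] i(2,3)] pow_eq_one[OF assms(2)[OF i]]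
    by (simp add: twist_nth[OF i])
qed

lemma twist_exponent_cong:
  assumes "\<And>a. [e a = e' a] (mod n)" "\<And>c. [f c = f' c] (mod n)"
  shows "[twist_exponent n \<pi> e f i a b = twist_exponent n \<pi> e' f' i a b] (mod n)"
  unfolding twist_exponent_def by (intro cong_add cong_mult assms cong_refl)

text \<open>
  Normalizing \<open>e\<close> to vanish at one representative of each block makes the action free, so that all
  orbits have the same size.
\<close>

lemma power_dvd_card_supported:
  assumes good: "good_partition m d P \<pi>" and stable: "stable_partition d (int n) P \<pi>"
    and P: "P \<subseteq> {..<m} \<times> {..<d} \<times> {..<d}"
  shows "n ^ (d - card (\<pi> ` {..<d}) + card ((\<lambda>(i, a, b). (i, \<pi> a, \<pi> b)) ` P)) dvd
    card (supported_abs_irr K m d P)"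
proof -
  define X where "X = supported_abs_irr K m d P"
  define C where "C = (\<lambda>(i, a, b). (i, \<pi> a, \<pi> b)) ` P"
  define \<rho> where "\<rho> = (\<lambda>a. SOME b. b < d \<and> \<pi> b = \<pi> a)"
  have \<rho>: "\<rho> a < d" "\<pi> (\<rho> a) = \<pi> a" if "a < d" for a
    using someI[of "\<lambda>b. b < d \<and> \<pi> b = \<pi> a" a] that by (simp_all add: \<rho>_def)
  have \<rho>_cong: "\<rho> a = \<rho> b" if "\<pi> a = \<pi> b" for a b using that by (simp add: \<rho>_def)
  \<comment> \<open>one representative of each block\<close>
  define Rp where "Rp = \<rho> ` {..<d}"
  have Rp: "Rp \<subseteq> {..<d}" unfolding Rp_def by (intro image_subsetI) (simp add: \<rho>(1))
  have "\<pi> ` Rp = (\<lambda>a. \<pi> (\<rho> a)) ` {..<d}" by (simp only: Rp_def image_image)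
  also have "\<dots> = \<pi> ` {..<d}" by (intro image_cong refl) (simp add: \<rho>(2))
  finally have im: "\<pi> ` Rp = \<pi> ` {..<d}" .
  have "inj_on \<pi> Rp"
    unfolding Rp_def
  proof (intro inj_onI, elim imageE)
    fix a b a' b' assume a: "a = \<rho> a'" "a' \<in> {..<d}" and b: "b = \<rho> b'" "b' \<in> {..<d}" and e: "\<pi> a = \<pi> b"
    have "\<pi> a' = \<pi> b'" using e \<rho>(2)[of a'] \<rho>(2)[of b'] a b by simp
    thus "a = b" unfolding a(1) b(1) by (rule \<rho>_cong)
  qed
  hence card_Rp: "card Rp = card (\<pi> ` {..<d})" unfolding im[symmetric] by (rule card_image[symmetric])
  define D where "D = {..<d} - Rp"
  have card_D: "card D = d - card (\<pi> ` {..<d})"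
    using card_Diff_subset[OF finite_subset[OF Rp] Rp] card_Rp by (simp add: D_def)
  have finC: "finite C" unfolding C_def using P by (intro finite_imageI) (rule finite_subset, auto)
  have XR: "As \<in> reps K m d" "support K d As = P" if "As \<in> X" for As
    using that by (simp_all add: X_def supported_abs_irr_def abs_irr_reps_def)
  \<comment> \<open>exponents of the diagonal part, normalized at the representatives\<close>
  define ex where "ex = (\<lambda>(e :: nat \<Rightarrow> nat) a. if a \<in> D then e a else 0)"
  define T where "T = (\<lambda>p As. twist K m d n \<gamma> \<pi> (ex (fst p)) (snd p) As)"
  have ex_add: "ex (\<lambda>a. e a + e' a) = (\<lambda>a. ex e a + ex e' a)" for e e'
    by (rule ext) (simp add: ex_def)
  define r where "r = {(As, Bs). As \<in> X \<and> Bs \<in> X \<and> (\<exists>p. Bs = T p As)}"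
  have TX: "T p As \<in> X" if "As \<in> X" for p As
    using twist_supported[OF good, of As] that by (simp add: X_def T_def)
  have rI: "(As, T p As) \<in> r" if "As \<in> X" for As p
    unfolding r_def using that TX[OF that, of p] by blast
  have rE: "As \<in> X \<and> Bs \<in> X \<and> (\<exists>p. Bs = T p As)" if "(As, Bs) \<in> r" for As Bs
    using that by (simp only: r_def mem_Collect_eq prod.case)
  have TT: "T p (T p' As) = T (\<lambda>a. fst p a + fst p' a, \<lambda>c. snd p c + snd p' c) As" if "As \<in> X" for p p' As
    unfolding T_def twist_twist[OF XR(1)[OF that]] by (simp add: ex_add)
  have eq: "equiv X r"
  proof (rule equivI)
    show "r \<subseteq> X \<times> X" using rE by (intro subrelI) blast
    show "refl_on X r"
    proof (rule refl_onI)
      fix As assume As: "As \<in> X"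
      have "T (\<lambda>_. 0, \<lambda>_. 0) As = As"
        unfolding T_def by (rule twist_trivial[OF XR(1)[OF As]]) (simp add: twist_exponent_def ex_def)
      thus "(As, As) \<in> r" using rI[OF As, of "(\<lambda>_. 0, \<lambda>_. 0)"] by simp
    qed
    show "sym r"
    proof (rule symI)
      fix As Bs assume "(As, Bs) \<in> r"
      from rE[OF this] obtain p where As: "As \<in> X" and Bs: "Bs \<in> X" "Bs = T p As" by blast
      \<comment> \<open>inverse exponents\<close>
      define p' where "p' = (\<lambda>a. (n - 1) * fst p a, \<lambda>c. (n - 1) * snd p c)"
      have m: "n dvd (n - Suc 0) * x + x" for x :: nat
      proof -
        have "(n - Suc 0) * x + x = n * x" using n by (cases n) simp_all
        thus ?thesis by (simp only: dvd_triv_left)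
      qed
      have "T p' Bs = As"
        unfolding Bs(2) TT[OF As] unfolding T_def
      proof (rule twist_trivial[OF XR(1)[OF As]])
        fix i a b
        let ?e = "ex (fst (\<lambda>a. fst p' a + fst p a, \<lambda>c. snd p' c + snd p c))"
        let ?f = "snd (\<lambda>a. fst p' a + fst p a, \<lambda>c. snd p' c + snd p c)"
        have "[?e a = 0] (mod n)" for a by (simp add: ex_def p'_def m cong_0_iff)
        moreover have "[?f c = 0] (mod n)" for c by (simp add: p'_def m cong_0_iff)
        ultimately have "[twist_exponent n \<pi> ?e ?f i a b = twist_exponent n \<pi> (\<lambda>_. 0) (\<lambda>_. 0) i a b] (mod n)"
          by (rule twist_exponent_cong)
        thus "[twist_exponent n \<pi> ?e ?f i a b = 0] (mod n)" by (simp add: twist_exponent_def)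
      qed
      thus "(Bs, As) \<in> r" using rI[OF Bs(1), of p'] by simp
    qed
    show "trans r"
    proof (rule transI)
      fix As Bs Cs assume AB: "(As, Bs) \<in> r" and BC: "(Bs, Cs) \<in> r"
      from rE[OF AB] obtain p where As: "As \<in> X" and Bs: "Bs = T p As" by blast
      from rE[OF BC] obtain p' where Cs: "Cs = T p' Bs" by blast
      show "(As, Cs) \<in> r" unfolding Cs Bs TT[OF As] by (rule rI[OF As])
    qed
  qed
  have finX: "finite X"
    using finite_reps[OF fin, of m d] by (rule rev_finite_subset) (auto dest: XR(1))
  have "n ^ (card D + card C) dvd card c" if c: "c \<in> X // r" for c
  proof -
    obtain As where As: "As \<in> X" "c = r `` {As}" using c by (rule quotientE)
    define E where "E = (D \<rightarrow>\<^sub>E {..<n}) \<times> (C \<rightarrow>\<^sub>E {..<n})"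
    have Tcong: "T p As = T p' As \<longleftrightarrow> (\<forall>(i, a, b)\<in>P. [twist_exponent n \<pi> (ex (fst p)) (snd p) i a b =
        twist_exponent n \<pi> (ex (fst p')) (snd p') i a b] (mod n))" for p p'
      unfolding T_def by (rule twist_eq_iff[OF XR[OF As(1)]])
    have inj: "inj_on (\<lambda>p. T p As) E"
    proof (rule inj_onI)
      fix p p' assume p: "p \<in> E" and p': "p' \<in> E" and eqT: "T p As = T p' As"
      define x where "x = (\<lambda>a. int (ex (fst p) a) - int (ex (fst p') a))"
      define y where "y = (\<lambda>c. int (snd p c) - int (snd p' c))"
      have xy: "int n dvd x a + y (i, \<pi> a, \<pi> b) - x b" if "(i, a, b) \<in> P" for i a b
      proof -
        have "\<forall>(i, a, b)\<in>P. [twist_exponent n \<pi> (ex (fst p)) (snd p) i a b =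
            twist_exponent n \<pi> (ex (fst p')) (snd p') i a b] (mod n)" by (rule iffD1[OF Tcong eqT])
        from bspec[OF this that]
        have "[twist_exponent n \<pi> (ex (fst p)) (snd p) i a b = twist_exponent n \<pi> (ex (fst p')) (snd p') i a b] (mod n)"
          by (simp only: prod.case)
        hence "[int (twist_exponent n \<pi> (ex (fst p)) (snd p) i a b) =
            int (twist_exponent n \<pi> (ex (fst p')) (snd p') i a b)] (mod int n)" by (simp only: cong_int_iff)
        hence "int n dvd int (twist_exponent n \<pi> (ex (fst p)) (snd p) i a b) -
            int (twist_exponent n \<pi> (ex (fst p')) (snd p') i a b)" by (simp only: cong_iff_dvd_diff)
        moreover obtain k where k: "n = Suc k" using n by (cases n) simp_all
        have "int (twist_exponent n \<pi> (ex (fst p)) (snd p) i a b) -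
            int (twist_exponent n \<pi> (ex (fst p')) (snd p') i a b) =
            x a + y (i, \<pi> a, \<pi> b) - x b + int n * x b"
          by (simp add: twist_exponent_def x_def y_def k algebra_simps)
        ultimately have "int n dvd x a + y (i, \<pi> a, \<pi> b) - x b + int n * x b" by (simp only:)
        from dvd_diff[OF this dvd_triv_left[of "int n" "x b"]] show ?thesis by simp
      qed
      have xb: "int n dvd x a" if a: "a < d" for a
      proof -
        have "int n dvd x a - x (\<rho> a)"
          by (rule stable_partitionD[where x = x and y = y, OF stable xy a \<rho>(1)[OF a] \<rho>(2)[OF a, symmetric]])
        moreover have "x (\<rho> a) = 0" using a by (simp add: x_def ex_def D_def Rp_def)
        ultimately show ?thesis by simp
      qed
      have E1: "fst p \<in> D \<rightarrow>\<^sub>E {..<n}" "fst p' \<in> D \<rightarrow>\<^sub>E {..<n}"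
        and E2: "snd p \<in> C \<rightarrow>\<^sub>E {..<n}" "snd p' \<in> C \<rightarrow>\<^sub>E {..<n}"
        using p p' by (simp_all only: E_def mem_Times_iff)
      have eq1: "fst p a = fst p' a" if a: "a \<in> D" for a
      proof -
        have "fst p a < n" "fst p' a < n"
          using PiE_mem[OF E1(1) a] PiE_mem[OF E1(2) a] by simp_all
        hence "\<bar>x a\<bar> < int n" using a by (simp add: x_def ex_def)
        with xb[of a] have "x a = 0" using a by (intro int_eq_0_of_large_divisor[of "int n"]) (simp_all only: D_def Diff_iff lessThan_iff)
        thus ?thesis using a by (simp add: x_def ex_def)
      qed
      have 1: "fst p = fst p'" by (rule PiE_ext[OF E1 eq1])
      have eq2: "snd p c = snd p' c" if c: "c \<in> C" for c
      proof -
        have "\<exists>q. q \<in> P \<and> c = (\<lambda>(i, a, b). (i, \<pi> a, \<pi> b)) q"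
          using c by (simp only: C_def image_iff Bex_def)
        then obtain q where q: "q \<in> P \<and> c = (\<lambda>(i, a, b). (i, \<pi> a, \<pi> b)) q" by (rule exE)
        obtain i a b where "q = (i, a, b)" by (rule prod_cases3)
        hence iab: "(i, a, b) \<in> P" "c = (i, \<pi> a, \<pi> b)" using q by simp_all
        have "snd p c < n" "snd p' c < n"
          using PiE_mem[OF E2(1) c] PiE_mem[OF E2(2) c] by simp_all
        hence "\<bar>y c\<bar> < int n" by (simp add: y_def)
        moreover have "int n dvd y c" using xy[OF iab(1)] by (simp add: x_def 1 iab(2))
        ultimately have "y c = 0" by (rule int_eq_0_of_large_divisor[rotated])
        thus ?thesis by (simp add: y_def)
      qed
      have "snd p = snd p'" by (rule PiE_ext[OF E2 eq2])
      with 1 show "p = p'" by (rule prod_eqI)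
    qed
    have cE: "c = (\<lambda>p. T p As) ` E"
    proof (intro equalityI subsetI)
      fix Bs assume "Bs \<in> c"
      hence "(As, Bs) \<in> r" unfolding As(2) by (simp only: Image_singleton_iff)
      from conjunct2[OF conjunct2[OF rE[OF this]]] obtain p where p: "Bs = T p As" by (rule exE)
      define p' where "p' = (restrict (\<lambda>a. fst p a mod n) D, restrict (\<lambda>c. snd p c mod n) C)"
      have "p' \<in> E"
        unfolding E_def p'_def mem_Times_iff fst_conv snd_conv restrict_PiE_iff using n by simp
      moreover have "T p As = T p' As"
        unfolding Tcong
      proof (intro ballI, clarify)
        fix i a b assume iab: "(i, a, b) \<in> P"
        have e: "[ex (fst p) a = ex (fst p') a] (mod n)" for a by (simp add: ex_def p'_def cong_def)
        have "(i, \<pi> a, \<pi> b) \<in> C"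
          unfolding C_def by (rule image_eqI[OF _ iab]) simp
        hence "[snd p (i, \<pi> a, \<pi> b) = snd p' (i, \<pi> a, \<pi> b)] (mod n)" by (simp add: p'_def cong_def)
        thus "[twist_exponent n \<pi> (ex (fst p)) (snd p) i a b = twist_exponent n \<pi> (ex (fst p')) (snd p') i a b] (mod n)"
          unfolding twist_exponent_def by (intro cong_add cong_mult e cong_refl)
      qed
      ultimately show "Bs \<in> (\<lambda>p. T p As) ` E" unfolding p by (intro image_eqI[of _ _ p'])
    next
      fix Bs assume "Bs \<in> (\<lambda>p. T p As) ` E"
      then obtain p where p: "Bs = T p As" by (rule imageE)
      show "Bs \<in> c" unfolding As(2) p by (simp only: Image_singleton_iff rI[OF As(1)])
    qed
    have "card c = card E" unfolding cE by (rule card_image[OF inj])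
    moreover have "card E = n ^ (card D + card C)"
    proof -
      have "card (D \<rightarrow>\<^sub>E {..<n}) = n ^ card D" by (simp add: card_PiE D_def)
      moreover have "card (C \<rightarrow>\<^sub>E {..<n}) = n ^ card C" using finC by (simp add: card_PiE)
      ultimately show ?thesis by (simp only: E_def card_cartesian_product power_add)
    qed
    ultimately show ?thesis by (simp only: dvd_refl)
  qed
  hence "n ^ (card D + card C) dvd card (\<Union>(X // r))"
  proof (intro dvd_partition)
    show "finite (\<Union>(X // r))" using finX by (simp only: Union_quotient[OF eq])
    show "\<forall>c1\<in>X // r. \<forall>c2\<in>X // r. c1 \<noteq> c2 \<longrightarrow> c1 \<inter> c2 = {}"
      using quotient_disj[OF eq] by (intro ballI impI) metis
  qed simp_all
  thus ?thesis by (simp only: Union_quotient[OF eq] card_D flip: C_def X_def)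
qed

end

section \<open>Tuples with one arrow per block\<close>

text \<open>
  Suppose that every block is left by one kind of arrow only: column \<open>b\<close> is supported in the matrix
  \<open>\<iota> (\<pi> b)\<close> and in the block \<open>\<sigma> (\<pi> b)\<close>. Then all matrices are restrictions of the single matrix
  below.
\<close>

definition merged_matrix :: "nat \<Rightarrow> (nat \<Rightarrow> nat) \<Rightarrow> (nat \<Rightarrow> nat) \<Rightarrow> 'a mat list \<Rightarrow> 'a mat" where
  "merged_matrix d \<pi> \<iota> As = mat d d (\<lambda>(a, b). (As ! \<iota> (\<pi> b)) $$ (a, b))"

definition one_arrow_per_block ::
  "('a, 'c) ring_scheme \<Rightarrow> nat \<Rightarrow> nat \<Rightarrow> (nat \<Rightarrow> nat) \<Rightarrow> (nat \<Rightarrow> nat) \<Rightarrow> (nat \<Rightarrow> nat) \<Rightarrow> 'a mat list \<Rightarrow> bool" where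
  "one_arrow_per_block K m d \<pi> \<iota> \<sigma> As \<longleftrightarrow> As \<in> reps K m d \<and> (\<forall>b<d. \<iota> (\<pi> b) < m) \<and>
    (\<forall>i a b. (i, a, b) \<in> support K d As \<longrightarrow> i = \<iota> (\<pi> b) \<and> \<pi> a = \<sigma> (\<pi> b))"

lemma one_arrow_per_blockD:
  assumes "one_arrow_per_block K m d \<pi> \<iota> \<sigma> As"
  shows "As \<in> reps K m d" "b < d \<Longrightarrow> \<iota> (\<pi> b) < m"
    "(i, a, b) \<in> support K d As \<Longrightarrow> i = \<iota> (\<pi> b)" "(i, a, b) \<in> support K d As \<Longrightarrow> \<pi> a = \<sigma> (\<pi> b)"
  using assms unfolding one_arrow_per_block_def by blast+

context cring
begin

lemma merged_matrix_closed:
  assumes "one_arrow_per_block R m d \<pi> \<iota> \<sigma> As"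
  shows "merged_matrix d \<pi> \<iota> As \<in> matrices R d"
  using matrices_nth[OF reps_nth[OF one_arrow_per_blockD(1,2)[OF assms]]]
  by (intro matricesI) (simp_all add: merged_matrix_def)

lemma merged_matrix_support:
  assumes o: "one_arrow_per_block R m d \<pi> \<iota> \<sigma> As" and ab: "a < d" "b < d"
    and nz: "merged_matrix d \<pi> \<iota> As $$ (a, b) \<noteq> \<zero>"
  shows "(\<iota> (\<pi> b), a, b) \<in> support R d As"
  using nz ab one_arrow_per_blockD(2)[OF o ab(2)] reps_length[OF one_arrow_per_blockD(1)[OF o]]
  by (intro supportI) (simp_all add: merged_matrix_def)

lemma act_eq_merged:
  assumes o: "one_arrow_per_block R m d \<pi> \<iota> \<sigma> As" and i: "i < m" and v: "v \<in> kspace R d"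
  shows "mat_act R (As ! i) v = mat_act R (merged_matrix d \<pi> \<iota> As) (coord_cut R d {b. \<iota> (\<pi> b) = i} v)"
proof -
  note A = reps_nth[OF one_arrow_per_blockD(1)[OF o] i]
  note F = merged_matrix_closed[OF o]
  show ?thesis
  proof (rule kspace_eqI[where K = R and d = d])
    fix a assume a: "a < d"
    show "mat_act R (As ! i) v $ a = mat_act R (merged_matrix d \<pi> \<iota> As) (coord_cut R d {b. \<iota> (\<pi> b) = i} v) $ a"
      unfolding mat_act_nth[OF A a] mat_act_nth[OF F a]
    proof (rule finsum_cong')
      show "(\<lambda>b. merged_matrix d \<pi> \<iota> As $$ (a, b) \<otimes> coord_cut R d {b. \<iota> (\<pi> b) = i} v $ b) \<in> {..<d} \<rightarrow> carrier R"
        using v F a by simp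
      fix b assume "b \<in> {..<d}"
      hence b: "b < d" by simp
      show "As ! i $$ (a, b) \<otimes> v $ b =
          merged_matrix d \<pi> \<iota> As $$ (a, b) \<otimes> coord_cut R d {b. \<iota> (\<pi> b) = i} v $ b"
      proof (cases "\<iota> (\<pi> b) = i")
        case True
        thus ?thesis using a b by (simp add: merged_matrix_def)
      next
        case False
        have "As ! i $$ (a, b) = \<zero>"
        proof (rule ccontr)
          assume "As ! i $$ (a, b) \<noteq> \<zero>"
          hence "(i, a, b) \<in> support R d As"
            using i a b reps_length[OF one_arrow_per_blockD(1)[OF o]] by (intro supportI) simp_all
          thus False using one_arrow_per_blockD(3)[OF o] False by simp
        qed
        thus ?thesis using False v F a b by simp
      qed
    qed simp
  qed (use A F v in simp_all)
qed

text \<open>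
  The merged matrix moves the block \<open>h\<close> into the block \<open>\<sigma> h\<close>.
\<close>

lemma cut_merged:
  assumes o: "one_arrow_per_block R m d \<pi> \<iota> \<sigma> As" and v: "v \<in> kspace R d"
  shows "coord_cut R d {a. \<pi> a \<in> T} (mat_act R (merged_matrix d \<pi> \<iota> As) v) =
    mat_act R (merged_matrix d \<pi> \<iota> As) (coord_cut R d {b. \<sigma> (\<pi> b) \<in> T} v)"
proof -
  note F = merged_matrix_closed[OF o]
  have c: "coord_cut R d {b. \<sigma> (\<pi> b) \<in> T} v \<in> kspace R d" using v by simp
  show ?thesis
  proof (rule kspace_eqI[where K = R and d = d])
    fix a assume a: "a < d"
    have w: "\<pi> a = \<sigma> (\<pi> b)" if "b < d" "merged_matrix d \<pi> \<iota> As $$ (a, b) \<noteq> \<zero>" for b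
      using one_arrow_per_blockD(4)[OF o merged_matrix_support[OF o a that]] .
    show "coord_cut R d {a. \<pi> a \<in> T} (mat_act R (merged_matrix d \<pi> \<iota> As) v) $ a =
        mat_act R (merged_matrix d \<pi> \<iota> As) (coord_cut R d {b. \<sigma> (\<pi> b) \<in> T} v) $ a"
    proof (cases "\<pi> a \<in> T")
      case True
      have "mat_act R (merged_matrix d \<pi> \<iota> As) v $ a =
          mat_act R (merged_matrix d \<pi> \<iota> As) (coord_cut R d {b. \<sigma> (\<pi> b) \<in> T} v) $ a"
        by (rule block_entry_cong[OF F v c a]) (use w True in simp)
      thus ?thesis using a True by simp
    next
      case False
      have "mat_act R (merged_matrix d \<pi> \<iota> As) (coord_cut R d {b. \<sigma> (\<pi> b) \<in> T} v) $ a =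
          mat_act R (merged_matrix d \<pi> \<iota> As) (vzero R d) $ a"
        by (rule block_entry_cong[OF F c vec_ops_closed(3) a]) (use w False in auto)
      thus ?thesis using a False by (simp add: mat_act_zero[OF F])
    qed
  qed (use F v in simp_all)
qed

lemma funpow_act_closed:
  assumes "F \<in> matrices R d" "v \<in> kspace R d"
  shows "(mat_act R F ^^ k) v \<in> kspace R d"
  using assms by (induction k) simp_all

lemma cut_funpow_merged:
  assumes o: "one_arrow_per_block R m d \<pi> \<iota> \<sigma> As" and v: "v \<in> kspace R d"
  shows "coord_cut R d {a. \<pi> a \<in> T} ((mat_act R (merged_matrix d \<pi> \<iota> As) ^^ k) v) =
    (mat_act R (merged_matrix d \<pi> \<iota> As) ^^ k) (coord_cut R d {b. (\<sigma> ^^ k) (\<pi> b) \<in> T} v)"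
proof (induction k arbitrary: T)
  case (Suc k)
  note F = merged_matrix_closed[OF o]
  have "coord_cut R d {a. \<pi> a \<in> T} ((mat_act R (merged_matrix d \<pi> \<iota> As) ^^ Suc k) v) =
      mat_act R (merged_matrix d \<pi> \<iota> As)
        (coord_cut R d {a. \<pi> a \<in> {h. \<sigma> h \<in> T}} ((mat_act R (merged_matrix d \<pi> \<iota> As) ^^ k) v))"
    using cut_merged[OF o funpow_act_closed[OF F v]] by simp
  also have "\<dots> = (mat_act R (merged_matrix d \<pi> \<iota> As) ^^ Suc k) (coord_cut R d {b. (\<sigma> ^^ k) (\<pi> b) \<in> {h. \<sigma> h \<in> T}} v)"
    by (simp only: Suc.IH funpow.simps comp_apply)
  finally show ?case by simp
qed simp

lemma linear_map_funpow:
  assumes F: "F \<in> matrices R d"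
  shows "linear_map d (mat_act R F ^^ k)"
proof (induction k)
  case 0
  show ?case by (intro linear_mapI) simp_all
next
  case (Suc k)
  thus ?case using F unfolding linear_map_def by (simp add: mat_act_add mat_act_scale)
qed

text \<open>A power of the merged matrix commutes with the tuple if it respects the labels of the blocks.\<close>

lemma funpow_merged_in_commutant:
  assumes o: "one_arrow_per_block R m d \<pi> \<iota> \<sigma> As"
    and per: "\<And>b. b < d \<Longrightarrow> \<iota> ((\<sigma> ^^ k) (\<pi> b)) = \<iota> (\<pi> b)"
  shows "matrix_of R d (mat_act R (merged_matrix d \<pi> \<iota> As) ^^ k) \<in> commutant R d (set As)"
proof -
  note F = merged_matrix_closed[OF o]
  note AR = one_arrow_per_blockD(1)[OF o]
  let ?F = "mat_act R (merged_matrix d \<pi> \<iota> As)"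
  show ?thesis
  proof (rule commutantI[OF linear_map_funpow[OF F]])
    show "set As \<subseteq> matrices R d" using reps_set[OF AR] by blast
    fix A v assume A: "A \<in> set As" and v: "v \<in> kspace R d"
    obtain i where i: "i < m" "A = As ! i"
      using A unfolding in_set_conv_nth reps_length[OF AR] by blast
    have Fv: "(?F ^^ k) v \<in> kspace R d" by (rule funpow_act_closed[OF F v])
    have cv: "coord_cut R d {b. \<iota> (\<pi> b) = i} v \<in> kspace R d" using v by simp
    have "coord_cut R d {b. (\<sigma> ^^ k) (\<pi> b) \<in> {h. \<iota> h = i}} v = coord_cut R d {b. \<iota> (\<pi> b) = i} v"
      using per by (intro eq_vecI) simp_all
    hence "coord_cut R d {b. \<iota> (\<pi> b) = i} ((?F ^^ k) v) = (?F ^^ k) (coord_cut R d {b. \<iota> (\<pi> b) = i} v)"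
      using cut_funpow_merged[OF o v, of "{h. \<iota> h = i}" k] by simp
    hence "mat_act R A ((?F ^^ k) v) = ?F ((?F ^^ k) (coord_cut R d {b. \<iota> (\<pi> b) = i} v))"
      unfolding i(2) act_eq_merged[OF o i(1) Fv] by simp
    also have "\<dots> = (?F ^^ k) (mat_act R A v)"
      unfolding i(2) act_eq_merged[OF o i(1) v] by (simp only: funpow_swap1)
    finally show "(?F ^^ k) (mat_act R A v) = mat_act R A ((?F ^^ k) v)" by (rule sym)
  qed
qed

end

context field
begin

lemma axis_nonzero: "b < d \<Longrightarrow> axis_vec R d \<one> b \<noteq> vzero R d"
  by (auto simp: vec_eq_iff)

text \<open>
  If a column vanishes in all matrices, then its axis spans a subrepresentation.
\<close>

lemma column_nonzero_or_trivial:
  assumes As: "As \<in> reps R m d" and irr: "irreducible_rep R d As" and b: "b < d"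
  shows "(\<exists>i a. (i, a, b) \<in> support R d As) \<or> (d = 1 \<and> support R d As = {})"
proof (cases "\<exists>i a. (i, a, b) \<in> support R d As")
  case False
  have col: "As ! i $$ (a, b) = \<zero>" if "i < m" "a < d" for i a
  proof (rule ccontr)
    assume "As ! i $$ (a, b) \<noteq> \<zero>"
    hence "(i, a, b) \<in> support R d As" using that b reps_length[OF As] by (intro supportI) simp_all
    thus False using False by blast
  qed
  let ?e = "axis_vec R d"
  define U where "U = (\<lambda>c. ?e c b) ` carrier R"
  have "is_subspace R d U"
    unfolding is_subspace_def
  proof (intro conjI ballI)
    show "U \<subseteq> kspace R d" by (auto simp: U_def)
    have "?e \<zero> b = vzero R d" by (intro eq_vecI) simp_all
    thus "vzero R d \<in> U" unfolding U_def using zero_closed by (intro image_eqI[of _ _ \<zero>]) simp_all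
  next
    fix u v assume "u \<in> U" "v \<in> U"
    then obtain c e where c: "c \<in> carrier R" "u = ?e c b" and e: "e \<in> carrier R" "v = ?e e b"
      by (auto simp: U_def)
    have "vadd R d u v = ?e (c \<oplus> e) b" using c e by (intro eq_vecI) simp_all
    thus "vadd R d u v \<in> U" using c e by (simp add: U_def)
  next
    fix x u assume x: "x \<in> carrier R" and "u \<in> U"
    then obtain c where c: "c \<in> carrier R" "u = ?e c b" by (auto simp: U_def)
    thus "vscale R d x u \<in> U" using x by (simp add: axis_vec_scale U_def)
  qed
  moreover have "mat_act R A u \<in> U" if A: "A \<in> set As" and u: "u \<in> U" for A u
  proof -
    obtain i where i: "i < m" "A = As ! i" using A unfolding in_set_conv_nth reps_length[OF As] by blast
    obtain c where c: "c \<in> carrier R" "u = ?e c b" using u by (auto simp: U_def)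
    have "mat_act R A u = ?e \<zero> b"
      using c i col b mat_act_axis[OF reps_nth[OF As i(1)] c(1) b] by (auto intro!: eq_vecI)
    thus ?thesis using zero_closed by (simp add: U_def)
  qed
  ultimately have alt: "U = {vzero R d} \<or> U = kspace R d" using irr by (simp add: irreducible_iff)
  have "?e \<one> b \<in> U" by (simp add: U_def)
  moreover have "?e \<one> b \<noteq> vzero R d" by (rule axis_nonzero[OF b])
  ultimately have full: "U = kspace R d" using alt by blast
  have only: "a = b" if a: "a < d" for a
  proof (rule ccontr)
    assume "a \<noteq> b"
    have "?e \<one> a \<in> U" using full by simp
    then obtain c where "?e \<one> a = ?e c b" by (auto simp: U_def)
    hence "?e \<one> a $ a = ?e c b $ a" by simp
    thus False using a \<open>a \<noteq> b\<close> by simp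
  qed
  have "d = 1" using only[of 0] only[of "d - 1"] b by simp
  moreover have "support R d As = {}"
  proof (rule ccontr)
    assume "support R d As \<noteq> {}"
    then obtain i a c where "(i, a, c) \<in> support R d As" by (metis all_not_in_conv prod_cases3)
    moreover from this have "c < d" by (simp add: support_def)
    ultimately show False using only[of c] False by blast
  qed
  ultimately show ?thesis by blast
qed blast

text \<open>
  An absolutely irreducible tuple with one arrow per block is a cyclic quiver representation. The
  power of the merged matrix that goes once around the cycle is a scalar by Schur's lemma, hence
  the vectors obtained by moving one axis vector around span a subrepresentation, and every block
  has dimension one.
\<close>

lemma one_arrow_per_block_cycle:
  assumes o: "one_arrow_per_block R m d \<pi> \<iota> \<sigma> As" and irr: "irreducible_rep R d As"
    and scalar: "\<forall>\<Phi>\<in>commutant R d (set As).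
      \<exists>c\<in>carrier R. \<forall>v\<in>kspace R d. mat_act R \<Phi> v = vscale R d c v"
    and cols: "\<forall>b<d. \<exists>i a. (i, a, b) \<in> support R d As" and a: "a < d"
  shows "\<exists>k>0. (\<sigma> ^^ k) (\<pi> a) = \<pi> a \<and> inj_on (\<lambda>j. (\<sigma> ^^ j) (\<pi> a)) {..<k} \<and>
      \<pi> ` {..<d} = (\<lambda>j. (\<sigma> ^^ j) (\<pi> a)) ` {..<k}"
    and "a' < d \<Longrightarrow> \<pi> a' = \<pi> a \<Longrightarrow> a' = a"
proof -
  note AR = one_arrow_per_blockD(1)[OF o]
  note FM = merged_matrix_closed[OF o]
  let ?F = "mat_act R (merged_matrix d \<pi> \<iota> As)" and ?e = "axis_vec R d \<one>"
  have \<sigma>_block: "\<exists>a<d. \<pi> a = \<sigma> (\<pi> b)" if b: "b < d" for b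
  proof -
    obtain i c where "(i, c, b) \<in> support R d As" using cols[rule_format, OF b] by blast
    moreover from this have "c < d" by (simp add: support_def)
    ultimately show ?thesis using one_arrow_per_blockD(4)[OF o] by blast
  qed
  have orbit: "\<exists>j. \<pi> c = (\<sigma> ^^ j) (\<pi> b)" if b: "b < d" and c: "c < d" for b c
  proof -
    define Orb where "Orb = range (\<lambda>j. (\<sigma> ^^ j) (\<pi> b))"
    have Orb\<sigma>: "\<sigma> h \<in> Orb" if h: "h \<in> Orb" for h
    proof -
      obtain j where "h = (\<sigma> ^^ j) (\<pi> b)" using h by (auto simp: Orb_def)
      hence "\<sigma> h = (\<sigma> ^^ Suc j) (\<pi> b)" by simp
      thus ?thesis unfolding Orb_def by (rule range_eqI)
    qed
    define U where "U = {v \<in> kspace R d. \<forall>x<d. \<pi> x \<notin> Orb \<longrightarrow> v $ x = \<zero>}"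
    have "is_subspace R d U"
      unfolding is_subspace_def by (intro conjI ballI) (auto simp: U_def)
    moreover have "mat_act R A u \<in> U" if A: "A \<in> set As" and u: "u \<in> U" for A u
    proof -
      obtain i where i: "i < m" "A = As ! i" using A unfolding in_set_conv_nth reps_length[OF AR] by blast
      have uk: "u \<in> kspace R d" using u by (simp add: U_def)
      note AM = reps_nth[OF AR i(1)]
      have "mat_act R A u $ x = \<zero>" if x: "x < d" "\<pi> x \<notin> Orb" for x
      proof -
        have "mat_act R (As ! i) u $ x = mat_act R (As ! i) (vzero R d) $ x"
        proof (rule block_entry_cong[OF AM uk vec_ops_closed(3) x(1)])
          fix y assume y: "y < d" "As ! i $$ (x, y) \<noteq> \<zero>"
          hence "(i, x, y) \<in> support R d As" using i x reps_length[OF AR] by (intro supportI) simp_all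
          hence "\<pi> x = \<sigma> (\<pi> y)" by (rule one_arrow_per_blockD(4)[OF o])
          hence "\<pi> y \<notin> Orb" using Orb\<sigma>[of "\<pi> y"] x(2) by auto
          thus "u $ y = vzero R d $ y" using u y by (simp add: U_def)
        qed
        thus ?thesis using x by (simp add: i(2) mat_act_zero[OF AM])
      qed
      thus ?thesis using uk AM by (simp add: U_def i(2))
    qed
    ultimately have alt: "U = {vzero R d} \<or> U = kspace R d" using irr by (simp add: irreducible_iff)
    have "\<pi> b \<in> Orb" unfolding Orb_def by (rule range_eqI[of _ _ 0]) simp
    hence "?e b \<in> U" using b by (auto simp: U_def)
    moreover have "?e b \<noteq> vzero R d" by (rule axis_nonzero[OF b])
    ultimately have "U = kspace R d" using alt by blast
    hence "?e c \<in> U" by simp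
    hence "\<pi> c \<in> Orb" using c by (auto simp: U_def)
    thus ?thesis by (auto simp: Orb_def)
  qed
  have per: "\<exists>k>0. (\<sigma> ^^ k) (\<pi> a) = \<pi> a"
  proof -
    obtain b where b: "b < d" "\<pi> b = \<sigma> (\<pi> a)" using \<sigma>_block[OF a] by blast
    obtain j where "\<pi> a = (\<sigma> ^^ j) (\<pi> b)" using orbit[OF b(1) a] by blast
    hence "(\<sigma> ^^ Suc j) (\<pi> a) = \<pi> a" using b(2) by (simp add: funpow_swap1)
    thus ?thesis by (intro exI[of _ "Suc j"]) simp
  qed
  \<comment> \<open>the length of the cycle of blocks\<close>
  define k where "k = (LEAST k. k > 0 \<and> (\<sigma> ^^ k) (\<pi> a) = \<pi> a)"
  define h where "h = (\<lambda>j. (\<sigma> ^^ j) (\<pi> a))"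
  have k: "k > 0" "h k = h 0"
    using LeastI_ex[OF per] by (simp_all add: k_def h_def)
  have kmin: "h j \<noteq> h 0" if "0 < j" "j < k" for j
    using not_less_Least[of j "\<lambda>k. k > 0 \<and> (\<sigma> ^^ k) (\<pi> a) = \<pi> a"] that by (auto simp: k_def h_def)
  have h_add: "h (i + j) = (\<sigma> ^^ i) (h j)" for i j by (simp add: h_def funpow_add)
  have h_mod: "h j = h (j mod k)" for j
    unfolding h_def using k(2) by (intro funpow_mod_eq[symmetric]) (simp add: h_def)
  have inj: "inj_on h {..<k}"
  proof (rule linorder_inj_onI)
    fix i j assume ij: "i < j" "i \<in> {..<k}" "j \<in> {..<k}"
    show "h i \<noteq> h j"
    proof
      assume "h i = h j"
      hence "h ((k - j) + i) = h ((k - j) + j)" by (simp only: h_add)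
      moreover have "k - j + j = k" using ij by simp
      ultimately have "h (k - j + i) = h 0" using k(2) by simp
      moreover have "0 < k - j + i" "k - j + i < k" using ij by simp_all
      ultimately show False using kmin[of "k - j + i"] by (simp only: simp_thms)
    qed
  qed (rule linear)
  have all: "\<exists>j<k. \<pi> c = h j" if c: "c < d" for c
  proof -
    obtain j where "\<pi> c = h j" using orbit[OF a c] by (auto simp: h_def)
    hence "\<pi> c = h (j mod k)" using h_mod by simp
    thus ?thesis using k(1) by (intro exI[of _ "j mod k"]) simp
  qed
  have h_block: "\<exists>c<d. \<pi> c = h j" for j
  proof (induction j)
    case 0
    show ?case using a by (intro exI[of _ a]) (simp add: h_def)
  next
    case (Suc j)
    then obtain c where c: "c < d" "\<pi> c = h j" by blast
    thus ?case using \<sigma>_block[OF c(1)] by (simp add: h_def)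
  qed
  have "\<pi> ` {..<d} = h ` {..<k}"
  proof (intro equalityI subsetI)
    fix x assume "x \<in> \<pi> ` {..<d}"
    then obtain c where "c < d" "x = \<pi> c" by auto
    then obtain j where "j < k" "x = h j" using all[of c] by blast
    thus "x \<in> h ` {..<k}" by (intro image_eqI[of _ _ j]) simp_all
  next
    fix x assume "x \<in> h ` {..<k}"
    then obtain j where "x = h j" by auto
    moreover obtain c where "c < d" "\<pi> c = h j" using h_block[of j] by blast
    ultimately show "x \<in> \<pi> ` {..<d}" by (intro image_eqI[of _ _ c]) simp_all
  qed
  thus "\<exists>k>0. (\<sigma> ^^ k) (\<pi> a) = \<pi> a \<and> inj_on (\<lambda>j. (\<sigma> ^^ j) (\<pi> a)) {..<k} \<and>
      \<pi> ` {..<d} = (\<lambda>j. (\<sigma> ^^ j) (\<pi> a)) ` {..<k}"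
    using k inj by (intro exI[of _ k]) (simp add: h_def)
  have \<sigma>k: "(\<sigma> ^^ k) (\<pi> b) = \<pi> b" if b: "b < d" for b
  proof -
    obtain j where "\<pi> b = h j" using all[OF b] by blast
    moreover have "(\<sigma> ^^ k) (h j) = h (k + j)" by (simp only: h_add)
    moreover have "h (k + j) = h j" using h_mod[of "k + j"] h_mod[of j] by simp
    ultimately show ?thesis by simp
  qed
  have "matrix_of R d (?F ^^ k) \<in> commutant R d (set As)"
    by (rule funpow_merged_in_commutant[OF o]) (simp add: \<sigma>k)
  from bspec[OF scalar this] obtain c0 where c0: "c0 \<in> carrier R"
    "\<forall>v\<in>kspace R d. mat_act R (matrix_of R d (?F ^^ k)) v = vscale R d c0 v" by blast
  have Fk: "(?F ^^ k) v = vscale R d c0 v" if v: "v \<in> kspace R d" for v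
    using c0(2) v matrix_of(2)[OF linear_map_funpow[OF FM, where k = k] v] by simp
  \<comment> \<open>one axis vector moved around the cycle, and the space spanned by its positions\<close>
  define u where "u = (\<lambda>j. (?F ^^ j) (?e a))"
  have uk: "u j \<in> kspace R d" for j unfolding u_def by (rule funpow_act_closed[OF FM]) simp
  define blk where "blk = (\<lambda>j v. coord_cut R d {b. \<pi> b = h j} v)"
  define U where "U = {v \<in> kspace R d. \<forall>j<k. \<exists>c\<in>carrier R. blk j v = vscale R d c (u j)}"
  have zero_u: "vscale R d \<zero> (u j) = vzero R d" for j
    using uk[of j] by (intro eq_vecI) simp_all
  have "is_subspace R d U"
    unfolding is_subspace_def
  proof (intro conjI ballI)
    show "U \<subseteq> kspace R d" by (auto simp: U_def)
    have "blk j (vzero R d) = vscale R d \<zero> (u j)" for j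
      unfolding zero_u by (intro eq_vecI) (simp_all add: blk_def)
    thus "vzero R d \<in> U" using zero_closed by (simp add: U_def) blast
  next
    fix x y assume x: "x \<in> U" and y: "y \<in> U"
    have xy: "x \<in> kspace R d" "y \<in> kspace R d" using x y by (simp_all add: U_def)
    have "\<exists>c\<in>carrier R. blk j (vadd R d x y) = vscale R d c (u j)" if j: "j < k" for j
    proof -
      obtain c e where c: "c \<in> carrier R" "blk j x = vscale R d c (u j)"
        and e: "e \<in> carrier R" "blk j y = vscale R d e (u j)" using x y j unfolding U_def by blast
      have "blk j (vadd R d x y) = vadd R d (blk j x) (blk j y)" using xy by (simp add: blk_def cut_add)
      also have "\<dots> = vscale R d (c \<oplus> e) (u j)"
        using c e uk[of j] by (intro eq_vecI) (simp_all add: l_distr)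
      finally show ?thesis using c e by (intro bexI[of _ "c \<oplus> e"]) simp_all
    qed
    thus "vadd R d x y \<in> U" using xy by (simp add: U_def)
  next
    fix s x assume s: "s \<in> carrier R" and x: "x \<in> U"
    have xk: "x \<in> kspace R d" using x by (simp add: U_def)
    have "\<exists>c\<in>carrier R. blk j (vscale R d s x) = vscale R d c (u j)" if j: "j < k" for j
    proof -
      obtain c where c: "c \<in> carrier R" "blk j x = vscale R d c (u j)" using x j unfolding U_def by blast
      have "blk j (vscale R d s x) = vscale R d s (blk j x)" using xk s by (simp add: blk_def cut_scale)
      also have "\<dots> = vscale R d (s \<otimes> c) (u j)"
        using c s uk[of j] by (intro eq_vecI) (simp_all add: m_assoc)
      finally show ?thesis using c s by (intro bexI[of _ "s \<otimes> c"]) simp_all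
    qed
    thus "vscale R d s x \<in> U" using xk s by (simp add: U_def)
  qed
  moreover have "mat_act R A x \<in> U" if A: "A \<in> set As" and x: "x \<in> U" for A x
  proof -
    obtain i where i: "i < m" "A = As ! i" using A unfolding in_set_conv_nth reps_length[OF AR] by blast
    have xk: "x \<in> kspace R d" using x by (simp add: U_def)
    let ?x = "coord_cut R d {b. \<iota> (\<pi> b) = i} x"
    have x'k: "?x \<in> kspace R d" using xk by simp
    have "\<exists>c\<in>carrier R. blk j (?F ?x) = vscale R d c (u j)" if j: "j < k" for j
    proof -
      \<comment> \<open>the predecessor of \<open>j\<close> on the cycle\<close>
      define p where "p = (if j = 0 then k - 1 else j - 1)"
      have p: "p < k" "h (Suc p) = h j" using j k by (auto simp: p_def)
      have set_eq: "\<sigma> (\<pi> b) = h j \<longleftrightarrow> \<pi> b = h p" if b: "b < d" for b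
      proof
        assume "\<pi> b = h p"
        thus "\<sigma> (\<pi> b) = h j" using p(2) by (simp add: h_def)
      next
        assume e: "\<sigma> (\<pi> b) = h j"
        obtain l where l: "l < k" "\<pi> b = h l" using all[OF b] by blast
        have "h (Suc l) = h (Suc p)" using e l p(2) by (simp add: h_def)
        hence "(\<sigma> ^^ (k - 1)) (h (Suc l)) = (\<sigma> ^^ (k - 1)) (h (Suc p))" by simp
        hence "h (k - 1 + Suc l) = h (k - 1 + Suc p)" by (simp only: h_add)
        hence "h (l + k) = h (p + k)" using k(1) by (simp add: add.commute)
        hence "h l = h p" using h_mod[of "l + k"] h_mod[of l] h_mod[of "p + k"] h_mod[of p] by simp
        thus "\<pi> b = h p" using l(2) by simp
      qed
      obtain c where c: "c \<in> carrier R" "blk p x = vscale R d c (u p)" using x p(1) unfolding U_def by blast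
      have "blk j (?F ?x) = ?F (coord_cut R d {b. \<sigma> (\<pi> b) = h j} ?x)"
        using cut_merged[OF o x'k, of "{h j}"] by (simp add: blk_def)
      also have "coord_cut R d {b. \<sigma> (\<pi> b) = h j} ?x = coord_cut R d {b. \<iota> (\<pi> b) = i} (blk p x)"
        using set_eq by (intro eq_vecI) (simp_all add: blk_def)
      also have "\<dots> = vscale R d (if \<iota> (h p) = i then c else \<zero>) (u p)"
      proof (rule eq_vecI)
        fix b assume "b < dim_vec (vscale R d (if \<iota> (h p) = i then c else \<zero>) (u p))"
        hence b: "b < d" by simp
        have bl: "blk p x $ b = c \<otimes> u p $ b" using c(2) b by simp
        have bp: "blk p x $ b = \<zero>" if "\<pi> b \<noteq> h p" using that b by (simp add: blk_def)
        have up: "u p $ b \<in> carrier R" using kspace_nth[OF uk b] .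
        show "coord_cut R d {b. \<iota> (\<pi> b) = i} (blk p x) $ b =
            vscale R d (if \<iota> (h p) = i then c else \<zero>) (u p) $ b"
        proof (cases "\<pi> b = h p")
          case True
          thus ?thesis using b bl up by simp
        next
          case False
          have z: "c \<otimes> u p $ b = \<zero>" using bl bp[OF False] by simp
          show ?thesis using b bp[OF False] z up by simp
        qed
      qed simp
      finally have e: "blk j (?F ?x) = ?F (vscale R d (if \<iota> (h p) = i then c else \<zero>) (u p))" .
      define c' where "c' = (if \<iota> (h p) = i then c else \<zero>)"
      have c': "c' \<in> carrier R" using c(1) by (simp add: c'_def)
      have e2: "blk j (?F ?x) = vscale R d c' (?F (u p))"
        using e c' uk[of p] FM by (simp add: mat_act_scale c'_def)
      show ?thesis
      proof (cases "j = 0")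
        case False
        hence "?F (u p) = u j" by (cases j) (simp_all add: u_def p_def)
        thus ?thesis using e2 c' by auto
      next
        case True
        have "?F (u p) = (?F ^^ Suc p) (?e a)" by (simp add: u_def)
        also have "Suc p = k" using True k(1) by (simp add: p_def)
        also have "(?F ^^ k) (?e a) = vscale R d c0 (u 0)" using Fk[of "?e a"] by (simp add: u_def)
        finally have "blk j (?F ?x) = vscale R d c' (vscale R d c0 (u 0))" using e2 by simp
        also have "\<dots> = vscale R d (c' \<otimes> c0) (u j)"
          using c' c0(1) uk[of 0] True by (intro eq_vecI) (simp_all add: m_assoc)
        finally show ?thesis using c' c0(1) by (intro bexI[of _ "c' \<otimes> c0"]) simp_all
      qed
    qed
    thus ?thesis
      unfolding i(2) act_eq_merged[OF o i(1) xk] using FM x'k by (simp add: U_def)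
  qed
  ultimately have alt: "U = {vzero R d} \<or> U = kspace R d" using irr by (simp add: irreducible_iff)
  have "?e a \<in> U"
  proof -
    have "\<exists>c\<in>carrier R. blk j (?e a) = vscale R d c (u j)" if j: "j < k" for j
    proof (cases "j = 0")
      case True
      have "blk j (?e a) = vscale R d \<one> (u j)"
        using True a by (intro eq_vecI) (auto simp: blk_def u_def h_def)
      thus ?thesis by (intro bexI[of _ \<one>]) simp_all
    next
      case False
      have "\<pi> a \<noteq> h j" using kmin[of j] False j by (simp add: h_def)
      hence "blk j (?e a) = vscale R d \<zero> (u j)"
        unfolding zero_u by (intro eq_vecI) (auto simp: blk_def)
      thus ?thesis by (intro bexI[of _ \<zero>]) simp_all
    qed
    thus ?thesis by (simp add: U_def)
  qed
  moreover have "?e a \<noteq> vzero R d" by (rule axis_nonzero[OF a])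
  ultimately have full: "U = kspace R d" using alt by blast
  assume a': "a' < d" "\<pi> a' = \<pi> a"
  show "a' = a"
  proof (rule ccontr)
    assume ne: "a' \<noteq> a"
    have "?e a' \<in> U" using full by simp
    then obtain c where c: "c \<in> carrier R" "blk 0 (?e a') = vscale R d c (u 0)"
      using k(1) unfolding U_def by blast
    have "blk 0 (?e a') $ a' = vscale R d c (u 0) $ a'" using c(2) by simp
    thus False using a' ne c(1) by (simp add: blk_def u_def h_def)
  qed
qed

end

section \<open>Primitive words and cycle patterns\<close>

text \<open>
  Words of length \<open>n\<close> are represented by functions of period \<open>n\<close>, so that rotations are shifts and a word and
  its powers are equal.
\<close>

definition periodic_words :: "nat \<Rightarrow> nat \<Rightarrow> (nat \<Rightarrow> nat) set" where
  "periodic_words m n = {w. \<forall>j. w j < m \<and> w (j + n) = w j}"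

definition primitive_words :: "nat \<Rightarrow> nat \<Rightarrow> (nat \<Rightarrow> nat) set" where
  "primitive_words m n = {w \<in> periodic_words m n. \<forall>e. 0 < e \<and> e < n \<longrightarrow> w \<notin> periodic_words m e}"

lemma periodic_wordsD:
  assumes "w \<in> periodic_words m n"
  shows "w j < m" "w (j + n) = w j"
  using assms by (simp_all add: periodic_words_def)

lemma periodic_words_add_mult: "w \<in> periodic_words m n \<Longrightarrow> w (j + k * n) = w j"
  by (induction k) (simp_all add: periodic_wordsD(2) add.assoc[symmetric] add.commute[of n])

lemma periodic_words_mod: "w \<in> periodic_words m n \<Longrightarrow> w (j mod n) = w j"
  using periodic_words_add_mult[of w m n "j mod n" "j div n"] by simp

lemma periodic_words_period_mod:
  assumes e: "w \<in> periodic_words m e" and n: "w \<in> periodic_words m n"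
  shows "w \<in> periodic_words m (n mod e)"
proof -
  have "w (j + n mod e) = w j" for j
  proof -
    have "w (j + n mod e) = w ((j + n mod e) + (n div e) * e)"
      by (rule periodic_words_add_mult[OF e, symmetric])
    also have "(j + n mod e) + (n div e) * e = j + n" by simp
    finally show ?thesis using periodic_wordsD(2)[OF n] by simp
  qed
  thus ?thesis using periodic_wordsD(1)[OF n] by (simp add: periodic_words_def)
qed

lemma periodic_words_dvd:
  assumes "w \<in> periodic_words m e" "e dvd n"
  shows "w \<in> periodic_words m n"
proof -
  obtain k where k: "n = k * e" using assms(2) by (metis dvd_def mult.commute)
  show ?thesis
    unfolding periodic_words_def k
    using periodic_words_add_mult[OF assms(1)] periodic_wordsD(1)[OF assms(1)] by simp
qed

lemma exists_primitive_period:
  assumes w: "w \<in> periodic_words m n" and n: "n > 0"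
  shows "\<exists>e>0. e dvd n \<and> w \<in> primitive_words m e"
proof -
  let ?Q = "\<lambda>e. e > 0 \<and> w \<in> periodic_words m e"
  define e where "e = (LEAST e. ?Q e)"
  have Q: "?Q n" using w n by simp
  have e: "e > 0" "w \<in> periodic_words m e" using LeastI[of ?Q n, OF Q] by (simp_all add: e_def)
  have min: "w \<notin> periodic_words m k" if "0 < k" "k < e" for k
    using not_less_Least[of k ?Q] that by (simp add: e_def)
  have "n mod e = 0"
    using min[of "n mod e"] periodic_words_period_mod[OF e(2) w] e(1) by auto
  moreover have "w \<in> primitive_words m e" using e min by (simp add: primitive_words_def)
  ultimately show ?thesis using e(1) by (intro exI[of _ e]) (simp add: mod_eq_0_iff_dvd)
qed

lemma primitive_words_unique:
  assumes "w \<in> primitive_words m n" "w \<in> primitive_words m n'" "n > 0" "n' > 0"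
  shows "n = n'"
  using assms unfolding primitive_words_def by (metis (no_types, lifting) linorder_neqE_nat mem_Collect_eq)

lemma card_periodic_words:
  assumes n: "n > 0"
  shows "card (periodic_words m n) = m ^ n" "finite (periodic_words m n)"
proof -
  have "bij_betw (\<lambda>w. restrict w {..<n}) (periodic_words m n) ({..<n} \<rightarrow>\<^sub>E {..<m})"
  proof (rule bij_betw_byWitness[where f' = "\<lambda>f j. f (j mod n)"])
    show "\<forall>w\<in>periodic_words m n. (\<lambda>j. restrict w {..<n} (j mod n)) = w"
      using n periodic_words_mod by (intro ballI ext) simp
    show "\<forall>f\<in>{..<n} \<rightarrow>\<^sub>E {..<m}. restrict (\<lambda>j. f (j mod n)) {..<n} = f"
    proof (intro ballI ext)
      fix f j assume f: "f \<in> {..<n} \<rightarrow>\<^sub>E {..<m}"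
      show "restrict (\<lambda>j. f (j mod n)) {..<n} j = f j"
        using PiE_arb[OF f, of j] by (cases "j < n") simp_all
    qed
    show "(\<lambda>w. restrict w {..<n}) ` periodic_words m n \<subseteq> {..<n} \<rightarrow>\<^sub>E {..<m}"
      using periodic_wordsD(1) by (intro image_subsetI) (simp add: restrict_PiE_iff)
    show "(\<lambda>f j. f (j mod n)) ` ({..<n} \<rightarrow>\<^sub>E {..<m}) \<subseteq> periodic_words m n"
    proof (rule image_subsetI)
      fix f assume f: "f \<in> {..<n} \<rightarrow>\<^sub>E {..<m}"
      have "f (j mod n) < m" for j using PiE_mem[OF f, of "j mod n"] n by simp
      thus "(\<lambda>j. f (j mod n)) \<in> periodic_words m n" by (simp add: periodic_words_def)
    qed
  qed
  note b = this
  show "card (periodic_words m n) = m ^ n" using bij_betw_same_card[OF b] by (simp add: card_PiE)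
  show "finite (periodic_words m n)" using bij_betw_finite[OF b] by (simp add: finite_PiE)
qed

lemma finite_primitive_words: "n > 0 \<Longrightarrow> finite (primitive_words m n)"
  using card_periodic_words(2) by (rule rev_finite_subset) (auto simp: primitive_words_def)

text \<open>
  Every periodic word is primitive for its least period, and the least period divides all others.
\<close>

lemma sum_card_primitive_words:
  assumes n: "n > 0"
  shows "(\<Sum>d | d dvd n. card (primitive_words m d)) = m ^ n"
proof -
  have pos: "d > 0" if "d dvd n" for d using that n by (simp add: dvd_pos_nat)
  have "periodic_words m n = (\<Union>d\<in>{d. d dvd n}. primitive_words m d)"
  proof (intro equalityI subsetI)
    fix w assume "w \<in> periodic_words m n"
    from exists_primitive_period[OF this n] obtain e where "e dvd n" "w \<in> primitive_words m e" by blast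
    thus "w \<in> (\<Union>d\<in>{d. d dvd n}. primitive_words m d)" by (intro UN_I[of e]) simp_all
  next
    fix w assume "w \<in> (\<Union>d\<in>{d. d dvd n}. primitive_words m d)"
    then obtain d where d: "d \<in> {d. d dvd n}" "w \<in> primitive_words m d" by (rule UN_E)
    have "w \<in> periodic_words m d" using d(2) by (simp add: primitive_words_def)
    thus "w \<in> periodic_words m n" by (rule periodic_words_dvd) (use d(1) in simp)
  qed
  also have "card \<dots> = (\<Sum>d\<in>{d. d dvd n}. card (primitive_words m d))"
  proof (rule card_UN_disjoint)
    show "finite {d. d dvd n}" using n by (rule finite_divisors_nat)
    show "\<forall>d\<in>{d. d dvd n}. finite (primitive_words m d)"
      by (intro ballI finite_primitive_words pos) simp
    show "\<forall>d\<in>{d. d dvd n}. \<forall>e\<in>{d. d dvd n}. d \<noteq> e \<longrightarrow> primitive_words m d \<inter> primitive_words m e = {}"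
    proof (intro ballI impI equals0I)
      fix d e w assume "d \<in> {d. d dvd n}" "e \<in> {d. d dvd n}" "d \<noteq> e"
        and "w \<in> primitive_words m d \<inter> primitive_words m e"
      thus False using primitive_words_unique[of w m d e] pos[of d] pos[of e] by simp
    qed
  qed
  finally show ?thesis using card_periodic_words(1)[OF n] by simp
qed

text \<open>
  A cyclic walk through all coordinates, starting at \<open>\<rho> 0\<close>, whose arrows are labelled by the letters of \<open>w\<close>.
  Requiring \<open>\<rho>\<close> to fix \<open>0\<close> makes the pair \<open>(\<rho>, w)\<close> unique.
\<close>

definition cycle_pattern :: "nat \<Rightarrow> (nat \<Rightarrow> nat) \<Rightarrow> (nat \<Rightarrow> nat) \<Rightarrow> (nat \<times> nat \<times> nat) set" where
  "cycle_pattern d \<rho> w = (\<lambda>j. (w j, \<rho> (Suc j mod d), \<rho> j)) ` {..<d}"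

lemma permutes_fixing_0:
  fixes d :: nat
  assumes "\<rho> permutes {1..<d}" and d: "d > 0"
  shows "\<rho> 0 = 0" "inj \<rho>" "\<rho> ` {..<d} = {..<d}"
proof -
  have p: "\<rho> permutes {..<d}" using assms(1) by (rule permutes_subset) auto
  show "\<rho> 0 = 0" using permutes_not_in[OF assms(1), of 0] by simp
  show "inj \<rho>" using assms(1) by (rule permutes_inj)
  show "\<rho> ` {..<d} = {..<d}" using p by (rule permutes_image)
qed

lemma cycle_pattern_iff:
  assumes \<rho>: "\<rho> permutes {1..<d}" and j: "j < d"
  shows "(i, a, \<rho> j) \<in> cycle_pattern d \<rho> w \<longleftrightarrow> i = w j \<and> a = \<rho> (Suc j mod d)"
proof -
  have "inj \<rho>" using permutes_fixing_0[OF \<rho>] j by simp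
  thus ?thesis using j unfolding cycle_pattern_def image_iff by (auto simp: inj_eq)
qed

lemma cycle_patternE:
  assumes "(i, a, b) \<in> cycle_pattern d \<rho> w"
  obtains j where "j < d" "i = w j" "a = \<rho> (Suc j mod d)" "b = \<rho> j"
  using assms by (auto simp: cycle_pattern_def)

lemma card_cycle_pattern:
  assumes "\<rho> permutes {1..<d}" and d: "d > 0"
  shows "card (cycle_pattern d \<rho> w) = d"
proof -
  have "inj_on (\<lambda>j. (w j, \<rho> (Suc j mod d), \<rho> j)) {..<d}"
    using permutes_fixing_0(2)[OF assms] by (intro inj_onI) (simp add: inj_eq)
  thus ?thesis unfolding cycle_pattern_def by (subst card_image) simp_all
qed

lemma cycle_pattern_subset:
  assumes \<rho>: "\<rho> permutes {1..<d}" and d: "d > 0" and w: "w \<in> periodic_words m d"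
  shows "cycle_pattern d \<rho> w \<subseteq> {..<m} \<times> {..<d} \<times> {..<d}"
proof -
  have "\<rho> j < d" if "j < d" for j
    using imageI[of j "{..<d}" \<rho>] that unfolding permutes_fixing_0(3)[OF \<rho> d] by simp
  thus ?thesis
    unfolding cycle_pattern_def using d periodic_wordsD(1)[OF w] by (intro image_subsetI) simp
qed

lemma cycle_pattern_inj:
  assumes \<rho>: "\<rho> permutes {1..<d}" "\<rho>' permutes {1..<d}" and d: "d > 0"
    and w: "w \<in> periodic_words m d" "w' \<in> periodic_words m d"
    and eq: "cycle_pattern d \<rho> w = cycle_pattern d \<rho>' w'"
  shows "\<rho> = \<rho>'" "w = w'"
proof -
  have step: "w j = w' j \<and> \<rho> (Suc j mod d) = \<rho>' (Suc j mod d)" if j: "j < d" "\<rho> j = \<rho>' j" for j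
  proof -
    have "(w j, \<rho> (Suc j mod d), \<rho> j) \<in> cycle_pattern d \<rho> w"
      unfolding cycle_pattern_iff[OF \<rho>(1) j(1)] by (intro conjI refl)
    hence "(w j, \<rho> (Suc j mod d), \<rho>' j) \<in> cycle_pattern d \<rho>' w'" by (simp only: eq j(2))
    thus ?thesis by (rule iffD1[OF cycle_pattern_iff[OF \<rho>(2) j(1)]])
  qed
  have r: "\<rho> j = \<rho>' j" if "j < d" for j
    using that
  proof (induction j)
    case 0
    show ?case using permutes_fixing_0(1)[OF \<rho>(1) d] permutes_fixing_0(1)[OF \<rho>(2) d] by simp
  next
    case (Suc j)
    hence "j < d" "\<rho> j = \<rho>' j" by simp_all
    from conjunct2[OF step[OF this]] show ?case unfolding mod_less[OF Suc.prems] .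
  qed
  show "\<rho> = \<rho>'"
  proof
    fix j show "\<rho> j = \<rho>' j"
    proof (cases "j < d")
      case False
      hence j: "j \<notin> {1..<d}" by simp
      show ?thesis by (simp only: permutes_not_in[OF \<rho>(1) j] permutes_not_in[OF \<rho>(2) j])
    qed (rule r)
  qed
  show "w = w'"
  proof
    fix j
    have j: "j mod d < d" using d by simp
    have "w (j mod d) = w' (j mod d)" using step[OF j r[OF j]] by (rule conjunct1)
    thus "w j = w' j" unfolding periodic_words_mod[OF w(1)] periodic_words_mod[OF w(2)] .
  qed
qed

lemma Suc_mod_inj:
  assumes "j < d" "j' < d" "Suc j mod d = Suc j' mod d"
  shows "j = j'"
proof -
  have "[Suc j = Suc j'] (mod d)" using assms(3) by (simp only: cong_def)
  hence "[j + 1 = j' + 1] (mod d)" by simp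
  hence "[j = j'] (mod d)" by (simp only: cong_add_rcancel_nat)
  thus ?thesis using assms(1,2) by (simp add: cong_def)
qed

lemma primitive_words_shift:
  assumes w: "w \<in> primitive_words m d" and j: "j < d" "k < d"
    and eq: "\<And>t. t < d \<Longrightarrow> w (j + t) = w (k + t)"
  shows "j = k"
proof -
  have main: False if jk: "j < k" "k < d" and eq: "\<And>t. t < d \<Longrightarrow> w (j + t) = w (k + t)" for j k
  proof -
    have p: "w \<in> periodic_words m d" using w by (simp add: primitive_words_def)
    have "w (x + (k - j)) = w x" for x
    proof -
      \<comment> \<open>the number of steps from position \<open>j\<close> to position \<open>x\<close>\<close>
      define t where "t = (x + (d - j)) mod d"
      have "(j + t) mod d = (j + (x + (d - j))) mod d" unfolding t_def by (rule mod_add_right_eq)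
      also have "j + (x + (d - j)) = x + d" using jk by simp
      finally have 1: "(j + t) mod d = x mod d" by simp
      have "(x + (k - j)) mod d = (x mod d + (k - j)) mod d" by (simp only: mod_add_left_eq)
      also have "\<dots> = (j + t + (k - j)) mod d" by (simp only: 1[symmetric] mod_add_left_eq)
      also have "j + t + (k - j) = k + t" using jk by simp
      finally have 2: "(x + (k - j)) mod d = (k + t) mod d" .
      have "w (x + (k - j)) = w (k + t)"
        unfolding periodic_words_mod[OF p, of "x + (k - j)", symmetric] 2 by (rule periodic_words_mod[OF p])
      also have "\<dots> = w (j + t)" using eq[of t] jk by (simp add: t_def)
      also have "\<dots> = w x"
        unfolding periodic_words_mod[OF p, of "j + t", symmetric] 1 by (rule periodic_words_mod[OF p])
      finally show ?thesis .
    qed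
    hence "w \<in> periodic_words m (k - j)" using periodic_wordsD(1)[OF p] by (simp add: periodic_words_def)
    moreover have "0 < k - j" "k - j < d" using jk by simp_all
    ultimately show False using w unfolding primitive_words_def by blast
  qed
  show ?thesis
  proof (rule linorder_cases[of j k])
    assume "j < k"
    from main[OF this j(2) eq] show ?thesis by simp
  next
    assume "k < j"
    from main[OF this j(1) eq[symmetric]] show ?thesis by simp
  qed
qed

context field
begin

lemma cycle_entry:
  assumes As: "As \<in> reps R m d" and P: "support R d As = cycle_pattern d \<rho> w"
    and \<rho>: "\<rho> permutes {1..<d}" and i: "i < m" and j: "j < d" "k < d"
  shows "As ! i $$ (\<rho> k, \<rho> j) \<noteq> \<zero> \<longleftrightarrow> i = w j \<and> k = Suc j mod d"
proof -
  have d: "d > 0" using j by simp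
  have \<rho>d: "\<rho> x < d" if "x < d" for x
    using imageI[of x "{..<d}" \<rho>] that unfolding permutes_fixing_0(3)[OF \<rho> d] by simp
  have "As ! i $$ (\<rho> k, \<rho> j) \<noteq> \<zero> \<longleftrightarrow> (i, \<rho> k, \<rho> j) \<in> support R d As"
    using i \<rho>d[OF j(1)] \<rho>d[OF j(2)] reps_length[OF As] by (simp add: support_def)
  also have "\<dots> \<longleftrightarrow> i = w j \<and> \<rho> k = \<rho> (Suc j mod d)"
    unfolding P by (rule cycle_pattern_iff[OF \<rho> j(1)])
  finally show ?thesis by (simp only: inj_eq[OF permutes_fixing_0(2)[OF \<rho> d]])
qed

lemma cycle_act:
  assumes As: "As \<in> reps R m d" and P: "support R d As = cycle_pattern d \<rho> w"
    and \<rho>: "\<rho> permutes {1..<d}" and i: "i < m" and j: "j < d" and v: "v \<in> kspace R d"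
  shows "mat_act R (As ! i) v $ \<rho> (Suc j mod d) = As ! i $$ (\<rho> (Suc j mod d), \<rho> j) \<otimes> v $ \<rho> j"
proof -
  have d: "d > 0" using j by simp
  have \<rho>d: "\<rho> x < d" if "x < d" for x
    using imageI[of x "{..<d}" \<rho>] that unfolding permutes_fixing_0(3)[OF \<rho> d] by simp
  have s: "Suc j mod d < d" using d by simp
  note A = reps_nth[OF As i]
  have vj: "v $ \<rho> j \<in> carrier R" by (rule kspace_nth[OF v \<rho>d[OF j]])
  have ax: "axis_vec R d (v $ \<rho> j) (\<rho> j) \<in> kspace R d" by (rule vec_ops_closed(4)[OF vj])
  have "mat_act R (As ! i) v $ \<rho> (Suc j mod d) =
      mat_act R (As ! i) (axis_vec R d (v $ \<rho> j) (\<rho> j)) $ \<rho> (Suc j mod d)"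
  proof (rule block_entry_cong[OF A v ax \<rho>d[OF s]])
    fix b assume b: "b < d" "As ! i $$ (\<rho> (Suc j mod d), b) \<noteq> \<zero>"
    have "b \<in> \<rho> ` {..<d}" unfolding permutes_fixing_0(3)[OF \<rho> d] using b by simp
    then obtain k where k: "b = \<rho> k" "k < d" by (elim imageE) simp
    from b(2) have "Suc j mod d = Suc k mod d"
      unfolding k(1) cycle_entry[OF As P \<rho> i k(2) s] by (rule conjunct2)
    hence "j = k" by (rule Suc_mod_inj[OF j k(2)])
    thus "v $ b = axis_vec R d (v $ \<rho> j) (\<rho> j) $ b" using b k by simp
  qed
  also have "\<dots> = As ! i $$ (\<rho> (Suc j mod d), \<rho> j) \<otimes> v $ \<rho> j"
    unfolding mat_act_axis[OF A vj \<rho>d[OF j]] using \<rho>d[OF s] by simp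
  finally show ?thesis .
qed

text \<open>
  Reading the word once, starting at the position \<open>k\<close>, kills all axis vectors but the one
  at \<open>\<rho> k\<close>, because a primitive word differs from its proper rotations.
\<close>

lemma irreducible_of_primitive_cycle:
  assumes As: "As \<in> reps R m d" and P: "support R d As = cycle_pattern d \<rho> w"
    and \<rho>: "\<rho> permutes {1..<d}" and w: "w \<in> primitive_words m d" and d: "d > 0"
  shows "irreducible_rep R d As"
  unfolding irreducible_iff
proof (intro conjI allI impI d)
  fix U assume UA: "is_subspace R d U \<and> (\<forall>A\<in>set As. \<forall>u\<in>U. mat_act R A u \<in> U)"
  note U = UA[THEN conjunct1]
  have p: "w \<in> periodic_words m d" using w by (simp add: primitive_words_def)
  have inv: "mat_act R (As ! w x) u \<in> U" if "u \<in> U" for u x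
    using UA that periodic_wordsD(1)[OF p, of x] reps_length[OF As] by simp
  have \<rho>d: "\<rho> x < d" if "x < d" for x
    using imageI[of x "{..<d}" \<rho>] that unfolding permutes_fixing_0(3)[OF \<rho> d] by simp
  have \<rho>_surj: "\<exists>k<d. b = \<rho> k" if "b < d" for b
  proof -
    have "b \<in> \<rho> ` {..<d}" unfolding permutes_fixing_0(3)[OF \<rho> d] using that by simp
    then obtain k where "b = \<rho> k" "k < d" by (elim imageE) simp
    thus ?thesis by blast
  qed
  show "U = {vzero R d} \<or> U = kspace R d"
  proof (cases "U = {vzero R d}")
    case False
    then obtain u where u: "u \<in> U" "u \<noteq> vzero R d" using is_subspaceD(2)[OF U] by blast
    have uk: "u \<in> kspace R d" by (rule is_subspaceD(1)[OF U u(1)])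
    have "\<exists>b<d. u $ b \<noteq> \<zero>"
    proof (rule ccontr)
      assume "\<not> (\<exists>b<d. u $ b \<noteq> \<zero>)"
      hence "u = vzero R d" using kspace_dim[OF uk] by (intro eq_vecI) simp_all
      thus False using u(2) by simp
    qed
    then obtain k where k: "k < d" "u $ \<rho> k \<noteq> \<zero>" using \<rho>_surj by blast
    \<comment> \<open>a component survives \<open>s\<close> steps if its word agrees with that of \<open>k\<close> so far\<close>
    have "\<exists>v\<in>U. \<forall>j<d. v $ \<rho> ((j + s) mod d) \<noteq> \<zero> \<longleftrightarrow>
        u $ \<rho> j \<noteq> \<zero> \<and> (\<forall>t<s. w (k + t) = w (j + t))" for s
    proof (induction s)
      case 0
      show ?case by (rule bexI[OF _ u(1)]) simp
    next
      case (Suc s)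
      then obtain v where v: "v \<in> U" and vs: "\<forall>j<d. v $ \<rho> ((j + s) mod d) \<noteq> \<zero> \<longleftrightarrow>
        u $ \<rho> j \<noteq> \<zero> \<and> (\<forall>t<s. w (k + t) = w (j + t))" by blast
      have vk: "v \<in> kspace R d" by (rule is_subspaceD(1)[OF U v])
      have im: "w (k + s) < m" by (rule periodic_wordsD(1)[OF p])
      show ?case
      proof (rule bexI[OF _ inv[OF v, of "k + s"]], intro allI impI)
        fix j assume j: "j < d"
        define l where "l = (j + s) mod d"
        have l: "l < d" "Suc l mod d < d" using d by (simp_all add: l_def)
        have idx: "(j + Suc s) mod d = Suc l mod d" by (simp add: l_def mod_Suc_eq)
        have "mat_act R (As ! w (k + s)) v $ \<rho> ((j + Suc s) mod d) \<noteq> \<zero> \<longleftrightarrow>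
            As ! w (k + s) $$ (\<rho> (Suc l mod d), \<rho> l) \<noteq> \<zero> \<and> v $ \<rho> l \<noteq> \<zero>"
          unfolding idx cycle_act[OF As P \<rho> im l(1) vk]
          using integral_iff[OF matrices_nth[OF reps_nth[OF As im] \<rho>d[OF l(2)] \<rho>d[OF l(1)]]
              kspace_nth[OF vk \<rho>d[OF l(1)]]] by simp
        also have "\<dots> \<longleftrightarrow> w (k + s) = w l \<and> v $ \<rho> l \<noteq> \<zero>"
          unfolding cycle_entry[OF As P \<rho> im l] by simp
        also have "w l = w (j + s)" unfolding l_def by (rule periodic_words_mod[OF p])
        also have "v $ \<rho> l \<noteq> \<zero> \<longleftrightarrow> u $ \<rho> j \<noteq> \<zero> \<and> (\<forall>t<s. w (k + t) = w (j + t))"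
          using vs j by (simp add: l_def)
        also have "w (k + s) = w (j + s) \<and> u $ \<rho> j \<noteq> \<zero> \<and> (\<forall>t<s. w (k + t) = w (j + t)) \<longleftrightarrow>
            u $ \<rho> j \<noteq> \<zero> \<and> (\<forall>t<Suc s. w (k + t) = w (j + t))"
          unfolding All_less_Suc by blast
        finally show "mat_act R (As ! w (k + s)) v $ \<rho> ((j + Suc s) mod d) \<noteq> \<zero> \<longleftrightarrow>
            u $ \<rho> j \<noteq> \<zero> \<and> (\<forall>t<Suc s. w (k + t) = w (j + t))" .
      qed
    qed
    from this[of d] obtain v where v: "v \<in> U" and vd: "\<forall>j<d. v $ \<rho> ((j + d) mod d) \<noteq> \<zero> \<longleftrightarrow>
        u $ \<rho> j \<noteq> \<zero> \<and> (\<forall>t<d. w (k + t) = w (j + t))" by blast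
    have vk: "v \<in> kspace R d" by (rule is_subspaceD(1)[OF U v])
    have v_nz: "v $ \<rho> j \<noteq> \<zero> \<longleftrightarrow> j = k" if j: "j < d" for j
    proof
      assume "v $ \<rho> j \<noteq> \<zero>"
      hence "\<forall>t<d. w (k + t) = w (j + t)" using vd j by simp
      hence "k = j" by (intro primitive_words_shift[OF w k(1) j]) blast
      thus "j = k" by (rule sym)
    next
      assume "j = k"
      thus "v $ \<rho> j \<noteq> \<zero>" using vd k by simp
    qed
    define c where "c = v $ \<rho> k"
    have c: "c \<in> carrier R" "c \<noteq> \<zero>"
      unfolding c_def using kspace_nth[OF vk \<rho>d[OF k(1)]] v_nz[OF k(1)] by simp_all
    have v_axis: "v = axis_vec R d c (\<rho> k)"
    proof (rule eq_vecI)
      fix b assume "b < dim_vec (axis_vec R d c (\<rho> k))"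
      hence b: "b < d" by simp
      obtain j where j: "j < d" "b = \<rho> j" using \<rho>_surj[OF b] by blast
      show "v $ b = axis_vec R d c (\<rho> k) $ b"
      proof (cases "j = k")
        case True
        thus ?thesis using b j by (simp add: c_def)
      next
        case False
        hence "\<rho> j \<noteq> \<rho> k" by (simp only: inj_eq[OF permutes_fixing_0(2)[OF \<rho> d]] not_False_eq_True)
        moreover have "v $ \<rho> j = \<zero>" using v_nz[OF j(1)] False by simp
        ultimately show ?thesis using b unfolding j(2) by simp
      qed
    qed (simp add: kspace_dim[OF vk])
    have scale: "axis_vec R d \<one> b \<in> U" if "axis_vec R d x b \<in> U" "x \<in> carrier R" "x \<noteq> \<zero>" for x b
    proof -
      have x: "x \<in> Units R" using that by (simp add: field_Units)
      have "vscale R d (inv x) (axis_vec R d x b) \<in> U"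
        using is_subspaceD(4)[OF U _ that(1)] x by simp
      thus ?thesis using x that(2) by (simp add: axis_vec_scale)
    qed
    have axes: "axis_vec R d \<one> (\<rho> ((k + s) mod d)) \<in> U" for s
    proof (induction s)
      case 0
      show ?case using scale[OF v[unfolded v_axis] c] k(1) by simp
    next
      case (Suc s)
      define l where "l = (k + s) mod d"
      have l: "l < d" "Suc l mod d < d" using d by (simp_all add: l_def)
      have idx: "(k + Suc s) mod d = Suc l mod d" by (simp add: l_def mod_Suc_eq)
      have im: "w l < m" by (rule periodic_wordsD(1)[OF p])
      note A = reps_nth[OF As im]
      define x where "x = As ! w l $$ (\<rho> (Suc l mod d), \<rho> l)"
      have x: "x \<in> carrier R" "x \<noteq> \<zero>"
        using matrices_nth[OF A \<rho>d[OF l(2)] \<rho>d[OF l(1)]] cycle_entry[OF As P \<rho> im l] by (simp_all add: x_def)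
      have "mat_act R (As ! w l) (axis_vec R d \<one> (\<rho> l)) = axis_vec R d x (\<rho> (Suc l mod d))"
      proof (rule eq_vecI)
        fix b assume "b < dim_vec (axis_vec R d x (\<rho> (Suc l mod d)))"
        hence b: "b < d" by simp
        obtain j where j: "j < d" "b = \<rho> j" using \<rho>_surj[OF b] by blast
        have e: "mat_act R (As ! w l) (axis_vec R d \<one> (\<rho> l)) $ b = As ! w l $$ (b, \<rho> l)"
          unfolding mat_act_axis[OF A one_closed \<rho>d[OF l(1)]]
          using b matrices_nth[OF A b \<rho>d[OF l(1)]] by simp
        show "mat_act R (As ! w l) (axis_vec R d \<one> (\<rho> l)) $ b = axis_vec R d x (\<rho> (Suc l mod d)) $ b"
        proof (cases "j = Suc l mod d")
          case True
          thus ?thesis using b e j(2) by (simp add: x_def)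
        next
          case False
          hence "\<rho> j \<noteq> \<rho> (Suc l mod d)"
            by (simp only: inj_eq[OF permutes_fixing_0(2)[OF \<rho> d]] not_False_eq_True)
          moreover have "As ! w l $$ (\<rho> j, \<rho> l) = \<zero>"
            using cycle_entry[OF As P \<rho> im l(1) j(1)] False by blast
          ultimately show ?thesis using b e unfolding j(2) by simp
        qed
      qed (simp add: mat_act_dim[OF A])
      moreover have "mat_act R (As ! w l) (axis_vec R d \<one> (\<rho> l)) \<in> U"
        by (rule inv) (use Suc.IH in \<open>simp only: l_def\<close>)
      ultimately have "axis_vec R d x (\<rho> (Suc l mod d)) \<in> U" by simp
      from scale[OF this x] show ?case unfolding idx .
    qed
    have ax: "axis_vec R d \<one> b \<in> U" if b: "b < d" for b
    proof -
      obtain j where j: "j < d" "b = \<rho> j" using \<rho>_surj[OF b] by blast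
      have "(k + (j + (d - k))) mod d = j" using j k by simp
      thus ?thesis using axes[of "j + (d - k)"] j(2) by simp
    qed
    have "x \<in> U" if "x \<in> kspace R d" for x
      using that
    proof (induction x rule: kspace_induct)
      case zero
      show ?case by (rule is_subspaceD(2)[OF U])
    next
      case (single y b)
      have "vscale R d y (axis_vec R d \<one> b) \<in> U" by (rule is_subspaceD(4)[OF U single(1) ax[OF single(2)]])
      thus ?case using single(1) by (simp add: axis_vec_scale)
    next
      case (add y z)
      show ?case by (rule is_subspaceD(3)[OF U add(3,4)])
    qed
    hence "U = kspace R d" using is_subspaceD(1)[OF U] by (intro equalityI subsetI)
    thus ?thesis by (rule disjI2)
  qed (rule disjI1)
qed

end

lemma absolutely_irreducible_of_primitive_cycle:
  assumes K: "field K" and As: "As \<in> reps K m d" and P: "support K d As = cycle_pattern d \<rho> w"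
    and \<rho>: "\<rho> permutes {1..<d}" and w: "w \<in> primitive_words m d" and d: "d > 0"
  shows "absolutely_irreducible_rep K d As"
  unfolding absolutely_irreducible_rep_def
proof (intro conjI allI impI)
  show "irreducible_rep K d As" by (rule field.irreducible_of_primitive_cycle[OF K As P \<rho> w d])
  fix L h assume "finite_extension K L h"
  hence L: "field L" and h: "h \<in> ring_hom K L" by (simp_all add: finite_extension_def)
  show "irreducible_rep L d (map (map_mat h) As)"
    by (rule field.irreducible_of_primitive_cycle[OF L map_reps_closed[OF h As] _ \<rho> w d])
      (simp only: support_map[OF K L h As] P)
qed

lemma irreducible_dim_1:
  assumes K: "field K" and As: "As \<in> reps K m 1"
  shows "irreducible_rep K 1 As"
proof -
  interpret field K by (rule K)
  show ?thesis
    unfolding irreducible_iff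
  proof (intro conjI allI impI)
    fix U assume UA: "is_subspace K 1 U \<and> (\<forall>A\<in>set As. \<forall>u\<in>U. mat_act K A u \<in> U)"
    note U = UA[THEN conjunct1]
    show "U = {vzero K 1} \<or> U = kspace K 1"
    proof (cases "U = {vzero K 1}")
      case False
      then obtain u where u: "u \<in> U" "u \<noteq> vzero K 1" using is_subspaceD(2)[OF U] by blast
      have uk: "u \<in> kspace K 1" by (rule is_subspaceD(1)[OF U u(1)])
      have c: "u $ 0 \<in> carrier K" by (rule kspace_nth[OF uk]) simp
      have "u $ 0 \<noteq> \<zero>\<^bsub>K\<^esub>"
      proof
        assume "u $ 0 = \<zero>\<^bsub>K\<^esub>"
        hence "u = vzero K 1" using kspace_dim[OF uk] by (intro eq_vecI) simp_all
        thus False using u(2) by simp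
      qed
      hence un: "u $ 0 \<in> Units K" using c by (simp add: field_Units)
      have "x \<in> U" if x: "x \<in> kspace K 1" for x
      proof -
        have x0: "x $ 0 \<in> carrier K" by (rule kspace_nth[OF x]) simp
        have "vscale K 1 (x $ 0 \<otimes>\<^bsub>K\<^esub> inv\<^bsub>K\<^esub> (u $ 0)) u \<in> U"
          by (rule is_subspaceD(4)[OF U _ u(1)]) (use x0 un in simp)
        moreover have "vscale K 1 (x $ 0 \<otimes>\<^bsub>K\<^esub> inv\<^bsub>K\<^esub> (u $ 0)) u = x"
          using x0 un c kspace_dim[OF x] by (intro eq_vecI) (simp_all add: m_assoc)
        ultimately show ?thesis by simp
      qed
      hence "U = kspace K 1" using is_subspaceD(1)[OF U] by (intro equalityI subsetI)
      thus ?thesis by (rule disjI2)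
    qed (rule disjI1)
  qed simp
qed

lemma absolutely_irreducible_dim_1:
  assumes K: "field K" and As: "As \<in> reps K m 1"
  shows "absolutely_irreducible_rep K 1 As"
  unfolding absolutely_irreducible_rep_def finite_extension_def
  using irreducible_dim_1[OF K As] irreducible_dim_1[OF _ map_reps_closed[OF _ As]] by blast

text \<open>
  The entries on the support are arbitrary nonzero elements.
\<close>

lemma card_reps_with_support:
  assumes K: "field K" and fin: "finite (carrier K)" and P: "P \<subseteq> {..<m} \<times> {..<d} \<times> {..<d}"
  shows "card {As \<in> reps K m d. support K d As = P} = (card (carrier K) - 1) ^ card P"
proof -
  interpret field K by (rule K)
  define E where "E = P \<rightarrow>\<^sub>E carrier K - {\<zero>\<^bsub>K\<^esub>}"
  define G where "G = (\<lambda>f. map (\<lambda>i. mat d d (\<lambda>(a, b). if (i, a, b) \<in> P then f (i, a, b) else \<zero>\<^bsub>K\<^esub>)) [0..<m])"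
  define H where "H = (\<lambda>As :: 'a mat list. restrict (\<lambda>(i, a, b). As ! i $$ (a, b)) P)"
  have G_nth: "G f ! i $$ (a, b) = (if (i, a, b) \<in> P then f (i, a, b) else \<zero>\<^bsub>K\<^esub>)"
    if "i < m" "a < d" "b < d" for f i a b using that by (simp add: G_def)
  have G_reps: "G f \<in> reps K m d" if f: "f \<in> E" for f
  proof -
    have v: "f (i, a, b) \<in> carrier K" if "(i, a, b) \<in> P" for i a b
      using PiE_mem[OF f[unfolded E_def] that] by simp
    have "mat d d (\<lambda>(a, b). if (i, a, b) \<in> P then f (i, a, b) else \<zero>\<^bsub>K\<^esub>) \<in> matrices K d" for i
      by (intro matricesI) (simp_all add: v)
    thus ?thesis by (auto simp: reps_def G_def)
  qed
  have box: "i < m \<and> a < d \<and> b < d" if "(i, a, b) \<in> P" for i a b using P that by auto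
  have "bij_betw H {As \<in> reps K m d. support K d As = P} E"
  proof (rule bij_betw_byWitness[where f' = G])
    show "\<forall>As\<in>{As \<in> reps K m d. support K d As = P}. G (H As) = As"
    proof
      fix As assume "As \<in> {As \<in> reps K m d. support K d As = P}"
      hence As: "As \<in> reps K m d" and S: "support K d As = P" by simp_all
      have nz: "(i, a, b) \<in> P \<longleftrightarrow> As ! i $$ (a, b) \<noteq> \<zero>\<^bsub>K\<^esub>" if "i < m" "a < d" "b < d" for i a b
        unfolding S[symmetric] support_def using that reps_length[OF As] by simp
      have HE: "H As \<in> E"
        unfolding H_def E_def restrict_PiE_iff
      proof (intro ballI)
        fix q assume q: "q \<in> P"
        obtain i a b where iab: "q = (i, a, b)" by (rule prod_cases3)
        have x: "i < m" "a < d" "b < d" using box q iab by simp_all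
        show "(case q of (i, a, b) \<Rightarrow> As ! i $$ (a, b)) \<in> carrier K - {\<zero>\<^bsub>K\<^esub>}"
          using nz[OF x] q matrices_nth[OF reps_nth[OF As x(1)] x(2,3)] by (simp add: iab)
      qed
      show "G (H As) = As"
      proof (rule reps_entries_eqI[OF G_reps[OF HE] As])
        fix i a b assume i: "i < m" "a < d" "b < d"
        show "G (H As) ! i $$ (a, b) = As ! i $$ (a, b)"
          unfolding G_nth[OF i] using nz[OF i] by (simp add: H_def)
      qed
    qed
    show "\<forall>f\<in>E. H (G f) = f"
    proof (intro ballI ext)
      fix f and q :: "nat \<times> nat \<times> nat" assume f: "f \<in> E"
      obtain i a b where iab: "q = (i, a, b)" by (rule prod_cases3)
      show "H (G f) q = f q"
      proof (cases "q \<in> P")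
        case True
        have x: "i < m" "a < d" "b < d" using box True iab by simp_all
        show ?thesis using True G_nth[OF x] by (simp add: H_def iab)
      next
        case False
        thus ?thesis using PiE_arb[OF f[unfolded E_def] False] by (simp add: H_def)
      qed
    qed
    show "H ` {As \<in> reps K m d. support K d As = P} \<subseteq> E"
    proof (rule image_subsetI)
      fix As assume "As \<in> {As \<in> reps K m d. support K d As = P}"
      hence As: "As \<in> reps K m d" and S: "support K d As = P" by simp_all
      show "H As \<in> E"
        unfolding H_def E_def restrict_PiE_iff
      proof (intro ballI)
        fix q assume q: "q \<in> P"
        obtain i a b where iab: "q = (i, a, b)" by (rule prod_cases3)
        have x: "i < m" "a < d" "b < d" using box q iab by simp_all
        have "As ! i $$ (a, b) \<noteq> \<zero>\<^bsub>K\<^esub>" using q unfolding S[symmetric] support_def iab by simp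
        thus "(case q of (i, a, b) \<Rightarrow> As ! i $$ (a, b)) \<in> carrier K - {\<zero>\<^bsub>K\<^esub>}"
          using matrices_nth[OF reps_nth[OF As x(1)] x(2,3)] by (simp add: iab)
      qed
    qed
    show "G ` E \<subseteq> {As \<in> reps K m d. support K d As = P}"
    proof (rule image_subsetI)
      fix f assume f: "f \<in> E"
      have "(i, a, b) \<in> support K d (G f) \<longleftrightarrow> (i, a, b) \<in> P" for i a b
      proof
        assume "(i, a, b) \<in> support K d (G f)"
        hence "i < m" "a < d" "b < d" "G f ! i $$ (a, b) \<noteq> \<zero>\<^bsub>K\<^esub>"
          unfolding support_def using reps_length[OF G_reps[OF f]] by simp_all
        thus "(i, a, b) \<in> P" using G_nth[of i a b f] by metis
      next
        assume q: "(i, a, b) \<in> P"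
        have x: "i < m" "a < d" "b < d" using box q by simp_all
        have "f (i, a, b) \<noteq> \<zero>\<^bsub>K\<^esub>" using PiE_mem[OF f[unfolded E_def] q] by simp
        thus "(i, a, b) \<in> support K d (G f)"
          using x q G_nth[OF x] reps_length[OF G_reps[OF f]] by (intro supportI) simp_all
      qed
      note eq = this
      have "support K d (G f) = P"
      proof (rule Set.set_eqI)
        fix q :: "nat \<times> nat \<times> nat"
        obtain i a b where "q = (i, a, b)" by (rule prod_cases3)
        thus "q \<in> support K d (G f) \<longleftrightarrow> q \<in> P" by (simp only: eq)
      qed
      thus "G f \<in> {As \<in> reps K m d. support K d As = P}" using G_reps[OF f] by simp
    qed
  qed
  hence "card {As \<in> reps K m d. support K d As = P} = card E" by (rule bij_betw_same_card)
  also have "\<dots> = card (carrier K - {\<zero>\<^bsub>K\<^esub>}) ^ card P"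
    unfolding E_def using finite_subset[OF P] by (simp add: card_PiE)
  also have "card (carrier K - {\<zero>\<^bsub>K\<^esub>}) = card (carrier K) - 1" by (simp add: card_Diff_singleton)
  finally show ?thesis .
qed

section \<open>Counting absolutely irreducible tuples modulo a power\<close>

context field
begin

text \<open>
  Since the blocks are singletons on one cycle, the support is a cycle pattern. Its word is primitive: for a
  period \<open>e\<close> of the word, the positions modulo \<open>e\<close> also form a partition with one arrow per block, whose
  blocks are again singletons.
\<close>

lemma cycle_pattern_of_one_arrow:
  assumes o: "one_arrow_per_block R m d \<pi> \<iota> \<sigma> As" and irr: "irreducible_rep R d As"
    and scalar: "\<forall>\<Phi>\<in>commutant R d (set As).
      \<exists>c\<in>carrier R. \<forall>v\<in>kspace R d. mat_act R \<Phi> v = vscale R d c v"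
    and cols: "\<forall>b<d. \<exists>i a. (i, a, b) \<in> support R d As" and d: "d > 0"
  shows "\<exists>\<rho> w. \<rho> permutes {1..<d} \<and> w \<in> primitive_words m d \<and> support R d As = cycle_pattern d \<rho> w"
proof -
  note AR = one_arrow_per_blockD(1)[OF o]
  have \<pi>_inj: "inj_on \<pi> {..<d}"
  proof (rule inj_onI)
    fix a b assume "a \<in> {..<d}" "b \<in> {..<d}" and e: "\<pi> a = \<pi> b"
    hence a: "a < d" "b < d" by simp_all
    show "a = b" by (rule one_arrow_per_block_cycle(2)[OF o irr scalar cols a(2,1) e])
  qed
  define h where "h = (\<lambda>j. (\<sigma> ^^ j) (\<pi> 0))"
  obtain k where k: "k > 0" "h k = \<pi> 0" "inj_on h {..<k}" "\<pi> ` {..<d} = h ` {..<k}"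
    using one_arrow_per_block_cycle(1)[OF o irr scalar cols d, folded h_def] by (elim exE conjE) (simp add: h_def)
  have "card (\<pi> ` {..<d}) = d" using card_image[OF \<pi>_inj] by simp
  moreover have "card (\<pi> ` {..<d}) = k" unfolding k(4) using card_image[OF k(3)] by simp
  ultimately have "k = d" by simp
  hence hd: "h d = \<pi> 0" "inj_on h {..<d}" "\<pi> ` {..<d} = h ` {..<d}" using k by simp_all
  have h0: "h 0 = \<pi> 0" by (simp add: h_def)
  have h_Suc: "h (Suc j mod d) = \<sigma> (h j)" if "j < d" for j
  proof (cases "Suc j = d")
    case True
    have "h (Suc j mod d) = h (Suc j)" using True hd(1) h0 by simp
    thus ?thesis by (simp add: h_def)
  next
    case False
    thus ?thesis using that by (simp add: h_def)
  qed
  define \<rho> where "\<rho> = (\<lambda>j. if j < d then inv_into {..<d} \<pi> (h j) else j)"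
  have \<rho>: "\<rho> j < d" "\<pi> (\<rho> j) = h j" if j: "j < d" for j
  proof -
    have m: "h j \<in> \<pi> ` {..<d}" unfolding hd(3) using j by simp
    show "\<rho> j < d" using inv_into_into[OF m] j by (simp add: \<rho>_def)
    show "\<pi> (\<rho> j) = h j" using f_inv_into_f[OF m] j by (simp add: \<rho>_def)
  qed
  have \<rho>_inj: "i = j" if "i < d" "j < d" "\<rho> i = \<rho> j" for i j
  proof -
    have "h i = h j" using \<rho>(2)[OF that(1)] \<rho>(2)[OF that(2)] that(3) by simp
    thus ?thesis by (rule inj_onD[OF hd(2)]) (use that in \<open>simp_all\<close>)
  qed
  have \<pi>D: "a = b" if "a < d" "b < d" "\<pi> a = \<pi> b" for a b
    by (rule inj_onD[OF \<pi>_inj]) (use that in \<open>simp_all\<close>)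
  have \<rho>0: "\<rho> 0 = 0" by (rule \<pi>D) (use \<rho>[OF d] d h0 in simp_all)
  have per: "\<rho> permutes {1..<d}"
  proof (rule bij_imp_permutes)
    have i: "inj_on \<rho> {1..<d}"
    proof (rule inj_onI)
      fix i j assume "i \<in> {1..<d}" "j \<in> {1..<d}" and e: "\<rho> i = \<rho> j"
      hence ij: "i < d" "j < d" by simp_all
      show "i = j" by (rule \<rho>_inj[OF ij e])
    qed
    have "\<rho> ` {1..<d} \<subseteq> {1..<d}"
    proof (rule image_subsetI)
      fix j assume j: "j \<in> {1..<d}"
      have "\<rho> j \<noteq> 0" using \<rho>_inj[of j 0] \<rho>0 j by auto
      thus "\<rho> j \<in> {1..<d}" using \<rho>(1)[of j] j by simp
    qed
    from endo_inj_surj[OF _ this i] show "bij_betw \<rho> {1..<d} {1..<d}"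
      using i by (simp add: bij_betw_def)
    show "\<rho> j = j" if "j \<notin> {1..<d}" for j using that \<rho>0 by (cases "j = 0") (simp_all add: \<rho>_def)
  qed
  define w where "w = (\<lambda>j. \<iota> (h (j mod d)))"
  have p: "w \<in> periodic_words m d"
  proof -
    have "w j < m" for j
    proof -
      have j: "j mod d < d" using d by simp
      show ?thesis using one_arrow_per_blockD(2)[OF o \<rho>(1)[OF j]] unfolding \<rho>(2)[OF j] w_def .
    qed
    thus ?thesis by (simp add: periodic_words_def w_def)
  qed
  have sup: "support R d As = cycle_pattern d \<rho> w"
  proof -
    have pos: "\<exists>j<d. b = \<rho> j" if b: "b < d" for b
    proof -
      have "\<pi> b \<in> h ` {..<d}" unfolding hd(3)[symmetric] using b by simp
      then obtain j where j: "\<pi> b = h j" "j < d" by (elim imageE) simp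
      have "b = \<rho> j" by (rule \<pi>D[OF b \<rho>(1)[OF j(2)]]) (simp only: \<rho>(2)[OF j(2)] j(1))
      thus ?thesis using j(2) by blast
    qed
    have arrow: "i = w j \<and> a = \<rho> (Suc j mod d)" if s: "(i, a, \<rho> j) \<in> support R d As" and j: "j < d" for i a j
    proof -
      have a: "a < d" using s by (simp add: support_def)
      have sj: "Suc j mod d < d" using d by simp
      have "i = \<iota> (h j)" using one_arrow_per_blockD(3)[OF o s] unfolding \<rho>(2)[OF j] .
      moreover have "\<pi> a = \<pi> (\<rho> (Suc j mod d))"
        using one_arrow_per_blockD(4)[OF o s] unfolding \<rho>(2)[OF j] \<rho>(2)[OF sj] h_Suc[OF j] .
      hence "a = \<rho> (Suc j mod d)" by (rule \<pi>D[OF a \<rho>(1)[OF sj]])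
      ultimately show ?thesis using j by (simp add: w_def)
    qed
    show ?thesis
    proof (intro equalityI subsetI)
      fix q assume q: "q \<in> support R d As"
      obtain i a b where iab: "q = (i, a, b)" by (rule prod_cases3)
      have "b < d" using q by (simp add: iab support_def)
      then obtain j where j: "j < d" "b = \<rho> j" using pos by blast
      show "q \<in> cycle_pattern d \<rho> w"
        using arrow[OF _ j(1), of i a] q unfolding iab j(2) cycle_pattern_iff[OF per j(1)] by simp
    next
      fix q assume q: "q \<in> cycle_pattern d \<rho> w"
      then obtain j where j: "j < d" "q = (w j, \<rho> (Suc j mod d), \<rho> j)" by (auto simp: cycle_pattern_def)
      obtain i a where s: "(i, a, \<rho> j) \<in> support R d As" using cols[rule_format, OF \<rho>(1)[OF j(1)]] by blast
      show "q \<in> support R d As" using s arrow[OF s j(1)] j(2) by simp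
    qed
  qed
  obtain e where e: "e > 0" "e dvd d" "w \<in> primitive_words m e" using exists_primitive_period[OF p d] by blast
  have ep: "w \<in> periodic_words m e" using e(3) by (simp add: primitive_words_def)
  have inj: "inj \<rho>" by (rule permutes_inj[OF per])
  \<comment> \<open>forgetting all but the position modulo \<open>e\<close>\<close>
  have o': "one_arrow_per_block R m d (\<lambda>b. Hilbert_Choice.inv \<rho> b mod e) w (\<lambda>h. Suc h mod e) As"
    unfolding one_arrow_per_block_def sup
  proof (intro conjI AR allI impI)
    fix b show "w (Hilbert_Choice.inv \<rho> b mod e) < m" by (rule periodic_wordsD(1)[OF p])
  next
    fix i a b assume "(i, a, b) \<in> cycle_pattern d \<rho> w"
    then obtain j where j: "j < d" "i = w j" "a = \<rho> (Suc j mod d)" "b = \<rho> j" by (rule cycle_patternE)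
    show "i = w (Hilbert_Choice.inv \<rho> b mod e)"
      unfolding j(2,4) inv_f_f[OF inj] by (rule periodic_words_mod[OF ep, symmetric])
    show "Hilbert_Choice.inv \<rho> a mod e = Suc (Hilbert_Choice.inv \<rho> b mod e) mod e"
      unfolding j(3,4) inv_f_f[OF inj] mod_mod_cancel[OF e(2)] by (rule mod_Suc_eq[symmetric])
  qed
  have "e = d"
  proof (rule ccontr)
    assume "e \<noteq> d"
    hence ed: "e < d" using e(2) d by (simp add: dvd_imp_le le_neq_implies_less)
    have eq: "Hilbert_Choice.inv \<rho> (\<rho> e) mod e = Hilbert_Choice.inv \<rho> (\<rho> 0) mod e"
      by (simp only: inv_f_f[OF inj] mod_self mod_0)
    have "\<rho> e = \<rho> 0"
      by (rule one_arrow_per_block_cycle(2)[OF o' irr scalar cols \<rho>(1)[OF d] \<rho>(1)[OF ed] eq])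
    hence "e = 0" by (rule \<rho>_inj[OF ed d])
    thus False using e(1) by simp
  qed
  hence "w \<in> primitive_words m d" using e(3) by simp
  thus ?thesis using per sup by (intro exI conjI)
qed

end

definition cycle_patterns :: "nat \<Rightarrow> nat \<Rightarrow> (nat \<times> nat \<times> nat) set set" where
  "cycle_patterns m d = (\<lambda>(\<rho>, w). cycle_pattern d \<rho> w) ` ({\<rho>. \<rho> permutes {1..<d}} \<times> primitive_words m d)"

lemma cycle_patternsI:
  "\<rho> permutes {1..<d} \<Longrightarrow> w \<in> primitive_words m d \<Longrightarrow> cycle_pattern d \<rho> w \<in> cycle_patterns m d"
  unfolding cycle_patterns_def by (rule image_eqI[of _ _ "(\<rho>, w)"]) simp_all

lemma cycle_patternsE:
  assumes "P \<in> cycle_patterns m d"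
  obtains \<rho> w where "\<rho> permutes {1..<d}" "w \<in> primitive_words m d" "P = cycle_pattern d \<rho> w"
  using assms by (auto simp: cycle_patterns_def)

lemma card_cycle_patterns:
  assumes d: "d > 0"
  shows "card (cycle_patterns m d) = fact (d - 1) * card (primitive_words m d)"
proof -
  have "inj_on (\<lambda>(\<rho>, w). cycle_pattern d \<rho> w) ({\<rho>. \<rho> permutes {1..<d}} \<times> primitive_words m d)"
  proof (rule inj_onI, clarify)
    fix \<rho> w \<rho>' w' assume \<rho>: "\<rho> permutes {1..<d}" "\<rho>' permutes {1..<d}"
      and w: "w \<in> primitive_words m d" "w' \<in> primitive_words m d"
      and eq: "cycle_pattern d \<rho> w = cycle_pattern d \<rho>' w'"
    have p: "w \<in> periodic_words m d" "w' \<in> periodic_words m d"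
      using w by (simp_all add: primitive_words_def)
    show "\<rho> = \<rho>' \<and> w = w'"
      by (intro conjI cycle_pattern_inj(1)[OF \<rho> d p eq] cycle_pattern_inj(2)[OF \<rho> d p eq])
  qed
  hence "card (cycle_patterns m d) = card ({\<rho>. \<rho> permutes {1..<d}} \<times> primitive_words m d)"
    unfolding cycle_patterns_def by (rule card_image)
  moreover have "card {\<rho>. \<rho> permutes {1..<d}} = fact (d - 1)" by (rule card_permutations) simp_all
  ultimately show ?thesis by (simp only: card_cartesian_product)
qed

lemma cycle_patterns_subset:
  assumes d: "d > 0"
  shows "cycle_patterns m d \<subseteq> Pow ({..<m} \<times> {..<d} \<times> {..<d})"
proof (intro subsetI PowI)
  fix P x assume P: "P \<in> cycle_patterns m d" and x: "x \<in> P"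
  obtain \<rho> w where "\<rho> permutes {1..<d}" "w \<in> primitive_words m d" and e: "P = cycle_pattern d \<rho> w"
    using P by (rule cycle_patternsE)
  hence "cycle_pattern d \<rho> w \<subseteq> {..<m} \<times> {..<d} \<times> {..<d}"
    by (intro cycle_pattern_subset d) (simp_all add: primitive_words_def)
  thus "x \<in> {..<m} \<times> {..<d} \<times> {..<d}" using x unfolding e by (rule subsetD)
qed

context finite_field_with_root
begin

lemma card_supported_cycle:
  assumes P: "P \<in> cycle_patterns m d" and d: "d > 0"
  shows "card (supported_abs_irr K m d P) = (card (carrier K) - 1) ^ d"
proof -
  obtain \<rho> w where \<rho>: "\<rho> permutes {1..<d}" and w: "w \<in> primitive_words m d" and e: "P = cycle_pattern d \<rho> w"
    using P by (rule cycle_patternsE)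
  have box: "P \<subseteq> {..<m} \<times> {..<d} \<times> {..<d}" using cycle_patterns_subset[OF d] P by blast
  have "absolutely_irreducible_rep K d As" if "As \<in> reps K m d" "support K d As = P" for As
    by (rule absolutely_irreducible_of_primitive_cycle[OF K that[unfolded e] \<rho> w d])
  hence "supported_abs_irr K m d P = {As \<in> reps K m d. support K d As = P}"
    unfolding supported_abs_irr_def abs_irr_reps_def mem_Collect_eq by (intro Collect_cong) blast
  thus ?thesis
    using card_reps_with_support[OF K fin box] card_cycle_pattern[OF \<rho> d, of w] e by simp
qed

lemma card_supported_dim_1: "card (supported_abs_irr K m 1 {}) = 1"
proof -
  have "As \<in> abs_irr_reps K m 1 \<longleftrightarrow> As \<in> reps K m 1" for As
    unfolding abs_irr_reps_def mem_Collect_eq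
    by (rule iffI, erule conjunct1, rule conjI, assumption, erule absolutely_irreducible_dim_1[OF K])
  hence "supported_abs_irr K m 1 {} = {As \<in> reps K m 1. support K 1 As = {}}"
    by (simp only: supported_abs_irr_def)
  thus ?thesis using card_reps_with_support[OF K fin, of "{}" m 1] by simp
qed

text \<open>
  Every block is left by some arrow, so there are at least as many arrows between blocks as blocks. If there
  are more, the torus is large enough. If there are equally many, then there is one arrow per block, and the
  support is a cycle pattern.
\<close>

lemma power_dvd_card_supported_generic:
  assumes P: "P \<subseteq> {..<m} \<times> {..<d} \<times> {..<d}" and d: "d > 0"
    and B: "5 ^ d < B" and rough: "\<And>s. 0 < s \<Longrightarrow> s < B \<Longrightarrow> coprime s n"
    and gen: "P \<notin> cycle_patterns m d" "\<not> (d = 1 \<and> P = {})"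
  shows "n ^ (d + 1) dvd card (supported_abs_irr K m d P)"
proof (cases "supported_abs_irr K m d P = {}")
  case False
  then obtain As where As: "As \<in> supported_abs_irr K m d P" by blast
  hence AR: "As \<in> reps K m d" and irr: "absolutely_irreducible_rep K d As" and S: "support K d As = P"
    by (simp_all add: supported_abs_irr_def abs_irr_reps_def)
  have irrK: "irreducible_rep K d As" using irr by (simp add: absolutely_irreducible_rep_def)
  have col: "\<exists>i a. (i, a, b) \<in> support K d As" if "b < d" for b
    using K.column_nonzero_or_trivial[OF AR irrK that] gen(2) unfolding S by (elim disjE) simp_all
  hence cols: "\<forall>b<d. \<exists>i a. (i, a, b) \<in> support K d As" by blast
  have scalar: "\<forall>\<Phi>\<in>commutant K d (set As). \<exists>c\<in>carrier K. \<forall>v\<in>kspace K d. mat_act K \<Phi> v = vscale K d c v"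
    by (intro ballI absolutely_irreducible_commutant[OF K fin AR irr])
  have "\<exists>\<pi>. good_partition m d P \<pi> \<and> stable_partition d (int n) P \<pi>"
    by (rule exists_good_stable_partition[OF _ B _ P]) (use n rough in simp_all)
  then obtain \<pi> where good: "good_partition m d P \<pi>" and stable: "stable_partition d (int n) P \<pi>" by blast
  define C where "C = (\<lambda>(i, a, b). (i, \<pi> a, \<pi> b)) ` P"
  have finC: "finite C" unfolding C_def using P by (intro finite_imageI) (rule finite_subset, auto)
  have C: "(i, \<pi> a, \<pi> b) \<in> C" if "(i, a, b) \<in> P" for i a b
    unfolding C_def by (rule image_eqI[OF _ that]) simp
  have sub: "\<pi> ` {..<d} \<subseteq> (\<lambda>(i, g, h). h) ` C"
  proof (rule image_subsetI)
    fix b assume "b \<in> {..<d}"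
    hence b: "b < d" by simp
    obtain i a where "(i, a, b) \<in> P" using col[OF b] unfolding S by blast
    from C[OF this] show "\<pi> b \<in> (\<lambda>(i, g, h). h) ` C" by (rule image_eqI[rotated]) simp
  qed
  have sup: "(\<lambda>(i, g, h). h) ` C \<subseteq> \<pi> ` {..<d}"
  proof (rule image_subsetI)
    fix c assume "c \<in> C"
    then obtain q where q: "q \<in> P" "c = (\<lambda>(i, a, b). (i, \<pi> a, \<pi> b)) q" unfolding C_def by (elim imageE) simp
    obtain i a b where iab: "q = (i, a, b)" by (rule prod_cases3)
    have "b < d" using q(1) P unfolding iab by blast
    thus "(case c of (i, g, h) \<Rightarrow> h) \<in> \<pi> ` {..<d}" unfolding q(2) iab by simp
  qed
  have im: "(\<lambda>(i, g, h). h) ` C = \<pi> ` {..<d}" using sub sup by (rule equalityI[rotated])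
  have "card C \<noteq> card (\<pi> ` {..<d})"
  proof
    assume "card C = card (\<pi> ` {..<d})"
    hence inj: "inj_on (\<lambda>(i, g, h). h) C"
      by (intro eq_card_imp_inj_on finC) (simp only: im)
    \<comment> \<open>the unique arrow leaving a block\<close>
    define sec where "sec = inv_into C (\<lambda>(i, g, h). h)"
    have sec: "sec (\<pi> b) = (i, \<pi> a, \<pi> b)" if "(i, a, b) \<in> P" for i a b
      using inv_into_f_f[OF inj C[OF that]] by (simp add: sec_def)
    have o: "one_arrow_per_block K m d \<pi> (\<lambda>g. fst (sec g)) (\<lambda>g. fst (snd (sec g))) As"
      unfolding one_arrow_per_block_def S
    proof (intro conjI AR allI impI)
      fix b assume b: "b < d"
      obtain i a where ia: "(i, a, b) \<in> P" using col[OF b] unfolding S by blast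
      have "i < m" using ia P by blast
      thus "fst (sec (\<pi> b)) < m" by (simp only: sec[OF ia] fst_conv)
    next
      fix i a b assume ia: "(i, a, b) \<in> P"
      show "i = fst (sec (\<pi> b))" "\<pi> a = fst (snd (sec (\<pi> b)))"
        by (simp_all only: sec[OF ia] fst_conv snd_conv)
    qed
    have "\<exists>\<rho> w. \<rho> permutes {1..<d} \<and> w \<in> primitive_words m d \<and> support K d As = cycle_pattern d \<rho> w"
      by (rule K.cycle_pattern_of_one_arrow[OF o irrK scalar cols d])
    then obtain \<rho> w where "\<rho> permutes {1..<d}" "w \<in> primitive_words m d" "P = cycle_pattern d \<rho> w"
      using S by blast
    thus False using gen(1) cycle_patternsI by simp
  qed
  moreover have "card (\<pi> ` {..<d}) \<le> card C" unfolding im[symmetric] by (rule card_image_le[OF finC])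
  moreover have "card (\<pi> ` {..<d}) \<le> d" using card_image_le[of "{..<d}" \<pi>] by simp
  ultimately have "d + 1 \<le> d - card (\<pi> ` {..<d}) + card C" by simp
  hence "n ^ (d + 1) dvd n ^ (d - card (\<pi> ` {..<d}) + card C)" by (rule le_imp_power_dvd)
  also have "\<dots> dvd card (supported_abs_irr K m d P)"
    unfolding C_def by (rule power_dvd_card_supported[OF good stable P])
  finally show ?thesis .
qed simp

text \<open>
  Up to a multiple of \<open>n^(d + 1)\<close> only the supports on which the torus is small contribute: the cycle
  patterns of primitive words, and the zero tuple in dimension one.
\<close>

lemma card_abs_irr_reps_cong:
  assumes d: "d > 0" and B: "5 ^ d < B" and rough: "\<And>s. 0 < s \<Longrightarrow> s < B \<Longrightarrow> coprime s n"
  shows "int n ^ (d + 1) dvd int (card (abs_irr_reps K m d)) -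
    (int (card (carrier K) - 1) ^ d * (fact (d - 1) * int (card (primitive_words m d))) + (if d = 1 then 1 else 0))"
proof -
  define box where "box = {..<m} \<times> {..<d} \<times> {..<d}"
  define x where "x = int (card (carrier K) - 1) ^ d"
  have finbox: "finite (Pow box)" by (simp add: box_def)
  have XR: "abs_irr_reps K m d \<subseteq> reps K m d" by (auto simp: abs_irr_reps_def)
  have fin_sup: "finite (supported_abs_irr K m d P)" for P
    using finite_subset[OF XR finite_reps[OF fin]] by (rule rev_finite_subset) (auto simp: supported_abs_irr_def)
  have "abs_irr_reps K m d = (\<Union>P\<in>Pow box. supported_abs_irr K m d P)"
  proof (intro equalityI subsetI)
    fix As assume As: "As \<in> abs_irr_reps K m d"
    have "length As = m" using reps_length[OF subsetD[OF XR As]] .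
    hence "support K d As \<in> Pow box" by (auto simp: box_def support_def)
    thus "As \<in> (\<Union>P\<in>Pow box. supported_abs_irr K m d P)"
      by (rule UN_I) (simp add: supported_abs_irr_def As)
  next
    fix As assume "As \<in> (\<Union>P\<in>Pow box. supported_abs_irr K m d P)"
    then obtain P where "As \<in> supported_abs_irr K m d P" by (rule UN_E)
    thus "As \<in> abs_irr_reps K m d" by (simp add: supported_abs_irr_def)
  qed
  also have "card \<dots> = (\<Sum>P\<in>Pow box. card (supported_abs_irr K m d P))"
    by (rule card_UN_disjoint[OF finbox]) (use fin_sup in \<open>simp_all add: supported_abs_irr_def disjoint_iff\<close>)
  finally have N: "int (card (abs_irr_reps K m d)) = (\<Sum>P\<in>Pow box. int (card (supported_abs_irr K m d P)))"
    by simp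
  define t where "t = (\<lambda>P. (if P \<in> cycle_patterns m d then x else 0) + (if P = {} then if d = 1 then 1 else 0 else (0 :: int)))"
  have empty: "{} \<notin> cycle_patterns m d"
  proof
    assume "{} \<in> cycle_patterns m d"
    then obtain \<rho> w where \<rho>: "\<rho> permutes {1..<d}" and e: "{} = cycle_pattern d \<rho> w" by (rule cycle_patternsE)
    show False using card_cycle_pattern[OF \<rho> d, of w] d unfolding e[symmetric] by simp
  qed
  have each: "int n ^ (d + 1) dvd int (card (supported_abs_irr K m d P)) - t P" if P: "P \<in> Pow box" for P
  proof -
    consider (c) "P \<in> cycle_patterns m d" | (e) "d = 1 \<and> P = {}"
      | (g) "P \<notin> cycle_patterns m d" "\<not> (d = 1 \<and> P = {})" by blast
    thus ?thesis
    proof cases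
      case c
      have "P \<noteq> {}"
      proof
        assume "P = {}"
        thus False using c empty by simp
      qed
      thus ?thesis using c card_supported_cycle[OF c d] by (simp add: t_def x_def)
    next
      case e
      thus ?thesis using empty card_supported_dim_1 by (simp add: t_def)
    next
      case g
      have "t P = 0" using g(1) g(2) by (simp add: t_def)
      moreover have "n ^ (d + 1) dvd card (supported_abs_irr K m d P)"
        by (rule power_dvd_card_supported_generic[OF _ d B rough g]) (use P in \<open>simp_all add: box_def\<close>)
      hence "int (n ^ (d + 1)) dvd int (card (supported_abs_irr K m d P))" by (simp only: of_nat_dvd_iff)
      ultimately show ?thesis by simp
    qed
  qed
  have "int n ^ (d + 1) dvd (\<Sum>P\<in>Pow box. int (card (supported_abs_irr K m d P)) - t P)"
    by (rule dvd_sum) (rule each)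
  also have "(\<Sum>P\<in>Pow box. int (card (supported_abs_irr K m d P)) - t P) =
      int (card (abs_irr_reps K m d)) - (\<Sum>P\<in>Pow box. t P)"
    by (simp only: sum_subtractf N)
  also have "(\<Sum>P\<in>Pow box. t P) = x * int (card (cycle_patterns m d)) + (if d = 1 then 1 else 0)"
  proof -
    have "Pow box \<inter> cycle_patterns m d = cycle_patterns m d"
      using cycle_patterns_subset[OF d, of m] unfolding box_def by (rule Int_absorb1)
    hence "(\<Sum>P\<in>Pow box. if P \<in> cycle_patterns m d then x else 0) = x * int (card (cycle_patterns m d))"
      using sum.inter_restrict[OF finbox, of "\<lambda>_. x" "cycle_patterns m d"]
      by (simp add: mult.commute)
    moreover have "(\<Sum>P\<in>Pow box. if P = {} then if d = 1 then 1 else 0 else (0 :: int)) = (if d = 1 then 1 else 0)"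
      using sum.delta[OF finbox, of "{}" "\<lambda>_. if d = 1 then 1 else (0 :: int)"] by simp
    ultimately show ?thesis by (simp only: t_def sum.distrib)
  qed
  finally show ?thesis by (simp add: card_cycle_patterns[OF d] x_def)
qed

end

text \<open>
  A power of a generator of the multiplicative group.
\<close>

lemma exists_root_of_order:
  assumes K: "field K" and fin: "finite (carrier K)" and nv: "card (carrier K) - 1 = n * v" and n: "n > 0" and v: "v > 0"
  shows "\<exists>\<gamma>. finite_field_with_root K \<gamma> n"
proof -
  interpret field K by (rule K)
  interpret G: group "mult_of K" by (rule field_mult_group)
  have fm: "finite (carrier (mult_of K))" using fin by (rule finite_mult_of)
  obtain a where a: "a \<in> carrier (mult_of K)" and gen: "carrier (mult_of K) = {a [^]\<^bsub>K\<^esub> i |i :: nat. i \<in> UNIV}"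
    using finite_field_mult_group_has_gen[OF fin] by blast
  let ?o = "group.ord (mult_of K) a"
  have "card {a [^]\<^bsub>mult_of K\<^esub> i |i :: nat. i \<in> UNIV} = ?o"
  proof -
    have "{a [^]\<^bsub>mult_of K\<^esub> i |i :: nat. i \<in> UNIV} = (\<lambda>i. a [^]\<^bsub>mult_of K\<^esub> i) ` {0..?o - 1}"
      using G.ord_elems[OF fm a] by auto
    also have "card \<dots> = card {0..?o - 1}" by (rule card_image[OF G.ord_inj[OF a]])
    also have "\<dots> = ?o" using G.ord_ge_1[OF fm a] by simp
    finally show ?thesis .
  qed
  hence "?o = card (carrier (mult_of K))" by (simp only: nat_pow_mult_of gen[symmetric])
  also have "\<dots> = n * v" using nv by (simp add: card_Diff_singleton)
  finally have o: "?o = n * v" .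
  have "finite_field_with_root K (a [^]\<^bsub>K\<^esub> v) n"
  proof
    show "finite (carrier K)" by (rule fin)
    have "a [^]\<^bsub>mult_of K\<^esub> v \<in> carrier (mult_of K)" using a by (rule G.nat_pow_closed)
    thus "a [^]\<^bsub>K\<^esub> v \<in> carrier K" "a [^]\<^bsub>K\<^esub> v \<noteq> \<zero>\<^bsub>K\<^esub>" by (simp_all add: nat_pow_mult_of)
    show "n > 0" by (rule n)
    fix x y :: nat
    have aK: "a \<in> carrier K" using a by simp
    have "(a [^]\<^bsub>K\<^esub> v) [^]\<^bsub>K\<^esub> x = (a [^]\<^bsub>K\<^esub> v) [^]\<^bsub>K\<^esub> y \<longleftrightarrow>
        a [^]\<^bsub>mult_of K\<^esub> int (v * x) = a [^]\<^bsub>mult_of K\<^esub> int (v * y)"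
      unfolding int_pow_int by (simp only: nat_pow_mult_of nat_pow_pow[OF aK])
    also have "\<dots> \<longleftrightarrow> int (n * v) dvd int (v * y) - int (v * x)"
      unfolding G.int_pow_eq[OF a] o by (rule refl)
    also have "int (v * y) - int (v * x) = (int y - int x) * int v" by (simp add: algebra_simps)
    also have "int (n * v) dvd (int y - int x) * int v \<longleftrightarrow> int n dvd int y - int x" using v by simp
    also have "\<dots> \<longleftrightarrow> [int y = int x] (mod int n)" by (simp only: cong_iff_dvd_diff)
    also have "\<dots> \<longleftrightarrow> [x = y] (mod n)" unfolding cong_int_iff by (rule cong_sym_eq)
    finally show "(a [^]\<^bsub>K\<^esub> v) [^]\<^bsub>K\<^esub> x = (a [^]\<^bsub>K\<^esub> v) [^]\<^bsub>K\<^esub> y \<longleftrightarrow> [x = y] (mod n)" .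
  qed
  thus ?thesis by (rule exI)
qed

section \<open>The counting polynomials to first order at q = 1\<close>

lemma abs_irr_classes_dim_0:
  assumes K: "field K"
  shows "abs_irr_classes K m 0 = {}"
proof -
  interpret field K by (rule K)
  have "abs_irr_reps K m 0 = {}"
    by (simp add: abs_irr_reps_def absolutely_irreducible_rep_def irreducible_iff)
  thus ?thesis by (simp add: abs_irr_classes_def)
qed

text \<open>
  There are no irreducible representations of dimension zero, so the polynomial vanishes at all primes.
\<close>

lemma counting_polynomial_dim_0:
  fixes a :: "int poly"
  assumes a: "\<And>K :: nat ring. field K \<Longrightarrow> finite (carrier K) \<Longrightarrow>
    poly a (int (card (carrier K))) = int (card (abs_irr_classes K m 0))"
  shows "a = 0"
proof (rule ccontr)
  assume "a \<noteq> 0"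
  hence fin: "finite {x. poly a x = 0}" by (rule poly_roots_finite)
  have "int p \<in> {x. poly a x = 0}" if p: "prime p" for p
    using a[OF field_residue_field[OF p] finite_residue_field]
    by (simp add: card_residue_field abs_irr_classes_dim_0[OF field_residue_field[OF p]])
  hence "int ` {p. prime p} \<subseteq> {x. poly a x = 0}" by blast
  hence "finite (int ` {p :: nat. prime p})" using fin by (rule finite_subset)
  hence "finite {p :: nat. prime p}" by (rule finite_imageD) (simp add: inj_on_def)
  thus False using primes_infinite by blast
qed

text \<open>
  Dividing the count of tuples by \<open>|GL_d| / (q - 1)\<close>, which is \<open>(q - 1)^(d - 1)\<close> times a number congruent to
  \<open>d!\<close>, turns the congruence for tuples into one for the counting polynomial.
\<close>

lemma counting_polynomial_first_order:
  fixes a :: "int poly"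
  assumes a: "\<And>K :: nat ring. field K \<Longrightarrow> finite (carrier K) \<Longrightarrow>
      poly a (int (card (carrier K))) = int (card (abs_irr_classes K m d))"
    and d: "d > 0"
  shows "poly a 1 = (if d = 1 then 1 else 0)"
    and "int d * poly (pderiv a) 1 = int (card (primitive_words m d))"
proof -
  define \<delta> :: int where "\<delta> = (if d = 1 then 1 else 0)"
  define c :: int where "c = fact (d - 1) * int (card (primitive_words m d))"
  have "\<exists>n v u e :: int. B \<le> n \<and> coprime v n \<and> n dvd u - fact d \<and>
      (poly a (1 + n * v) - \<delta>) * (n * v) ^ (d - 1) * u = (n * v) ^ d * c + n ^ (d + 1) * e" for B
  proof -
    define B' where "B' = max (nat B) (5 ^ d + 1)"
    have B': "5 ^ d < B'" "B \<le> int B'" by (simp_all add: B'_def)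
    obtain p n v where p: "prime p" "p - 1 = n * v" "coprime n v" "B' \<le> n"
      and rough: "\<forall>s. 0 < s \<and> s < B' \<longrightarrow> coprime s n"
      using exists_prime_with_rough_part[of B'] by blast
    have p1: "p > 1" using p(1) by (rule prime_gt_1_nat)
    have n: "n > 0" using B' p(4) by simp
    have v: "v > 0" using p(2) p1 by (cases v) simp_all
    have pnv: "int p = 1 + int n * int v" using p(2) p1 by (simp flip: of_nat_mult)
    define K where "K = residue_field p"
    have K: "field K" and fin: "finite (carrier K)" and cK: "card (carrier K) = p"
      using p(1) by (simp_all add: K_def field_residue_field finite_residue_field card_residue_field)
    interpret K: field K by (rule K)
    obtain \<gamma> where \<gamma>: "finite_field_with_root K \<gamma> n"
      using exists_root_of_order[OF K fin _ n v] p(2) cK by auto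
    have "int n ^ (d + 1) dvd int (card (abs_irr_reps K m d)) - (int (card (carrier K) - 1) ^ d *
        (fact (d - 1) * int (card (primitive_words m d))) + (if d = 1 then 1 else 0))"
      by (rule finite_field_with_root.card_abs_irr_reps_cong[OF \<gamma> d B'(1)]) (use rough in simp)
    then obtain e where e: "int (card (abs_irr_reps K m d)) - (int (card (carrier K) - 1) ^ d *
        (fact (d - 1) * int (card (primitive_words m d))) + (if d = 1 then 1 else 0)) = int n ^ (d + 1) * e"
      by (rule dvdE)
    define N where "N = int (card (abs_irr_reps K m d))"
    define x where "x = int n * int v"
    have x: "x > 0" using n v by (simp add: x_def)
    have N: "N = \<delta> + x ^ d * c + int n ^ (d + 1) * e"
      using e unfolding cK p(2) N_def \<delta>_def c_def x_def by (simp add: algebra_simps)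
    obtain u where u: "(\<Prod>i<d. int p ^ d - int p ^ i) = (int p - 1) ^ d * u" "int p - 1 dvd u - fact d"
      using general_linear_order_expansion[where d = d and q = "int p"] by blast
    have px: "int p - 1 = x" using pnv by (simp add: x_def)
    have gl: "int (card (general_linear K d)) = x ^ d * u"
      using K.card_general_linear[OF fin, of d] u(1) by (simp add: cK px)
    have "int (card (abs_irr_reps K m d) * (card (carrier K) - 1)) =
        int (card (abs_irr_classes K m d) * card (general_linear K d))"
      by (simp only: card_abs_irr_reps[OF K fin])
    hence "N * x = poly a (int p) * (x ^ d * u)"
      unfolding of_nat_mult gl cK p(2) N_def x_def using a[OF K fin] by (simp add: cK)
    also have "x ^ d = x * x ^ (d - 1)" using d by (simp flip: power_Suc)
    finally have "x * N = x * (poly a (int p) * x ^ (d - 1) * u)" by (simp add: algebra_simps)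
    hence A: "N = poly a (int p) * x ^ (d - 1) * u" using x by simp
    \<comment> \<open>\<open>|GL_1| = q - 1\<close>, hence \<open>u = 1\<close> in the only case with \<open>\<delta> \<noteq> 0\<close>\<close>
    have \<delta>u: "\<delta> * x ^ (d - 1) * u = \<delta>"
    proof (cases "d = 1")
      case True
      have "x * u = x" using u(1) unfolding True by (simp add: px)
      hence "u = 1" using x by simp
      thus ?thesis using True by simp
    qed (simp add: \<delta>_def)
    have "(poly a (1 + int n * int v) - \<delta>) * x ^ (d - 1) * u = N - \<delta>"
      using A \<delta>u pnv by (simp add: algebra_simps)
    also have "\<dots> = x ^ d * c + int n ^ (d + 1) * e" using N by simp
    finally have main: "(poly a (1 + int n * int v) - \<delta>) * (int n * int v) ^ (d - 1) * u =
        (int n * int v) ^ d * c + int n ^ (d + 1) * e" unfolding x_def .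
    have "int n dvd u - fact d" using u(2) unfolding px x_def by (rule dvd_mult_left)
    moreover have "B \<le> int n" using B'(2) p(4) by linarith
    moreover have "coprime (int v) (int n)" using p(3) by (simp add: coprime_commute)
    ultimately show ?thesis using main by blast
  qed
  from poly_first_order_from_congruences[OF d _ this]
  have *: "poly a 1 = \<delta> \<and> fact d * poly (pderiv a) 1 = c" by simp
  thus "poly a 1 = (if d = 1 then 1 else 0)" by (simp add: \<delta>_def)
  have "fact d = fact (d - 1) * int d" using fact_reduce[OF d, where 'a = int] by (simp add: mult.commute)
  hence "fact (d - 1) * (int d * poly (pderiv a) 1) = fact (d - 1) * int (card (primitive_words m d))"
    using * by (simp add: c_def mult.assoc)
  thus "int d * poly (pderiv a) 1 = int (card (primitive_words m d))" by simp
qed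

theorem corollary6p2:
  fixes m :: nat and a :: "nat \<Rightarrow> int poly"
  assumes "\<And>(K :: nat ring) d. field K \<Longrightarrow> finite (carrier K) \<Longrightarrow>
    poly (a d) (int (card (carrier K))) = int (card (abs_irr_classes K m d))"
  shows "(\<forall>n. regular_at_1 (fps_nth (Exp ((gen_fun a - fps_X) / fps_const (1 - q_var))) n)) \<and>
    fps_eval_at_1 (Exp ((gen_fun a - fps_X) / fps_const (1 - q_var))) = 1 - of_nat m * fps_X"
proof (rule Exp_at_1_of_derivatives)
  show "a 0 = 0" by (rule counting_polynomial_dim_0) (rule assms)
next
  fix d :: nat assume "d > 0"
  thus "poly (a d) 1 = (if d = 1 then 1 else 0)" by (intro counting_polynomial_first_order(1)[where m = m] assms)
next
    fix n :: nat assume n: "n > 0"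
    have "(\<Sum>d | d dvd n. int d * poly (pderiv (a d)) 1) = (\<Sum>d | d dvd n. int (card (primitive_words m d)))"
    proof (rule sum.cong)
      fix d assume "d \<in> {d. d dvd n}"
      hence "d > 0" using n by (simp add: dvd_pos_nat)
      thus "int d * poly (pderiv (a d)) 1 = int (card (primitive_words m d))"
        by (intro counting_polynomial_first_order(2) assms)
    qed simp
    also have "\<dots> = int (\<Sum>d | d dvd n. card (primitive_words m d))" by simp
    also have "\<dots> = int m ^ n" unfolding sum_card_primitive_words[OF n] by simp
    finally show "(\<Sum>d | d dvd n. int d * poly (pderiv (a d)) 1) = int m ^ n" .
qed

end
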